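(* Let $\theta\in(0,1)$ and let $q\in\mathcal{P}(\mathbb{R})$ be log-Hölder continuous both at the origin and at infinity with $q(0)=q_\infty$. Let $p,q_0,q_1\in\mathcal{P}^{\log}(\mathbb{R}^n)$ and $\alpha_0,\alpha_1\in C^{\log}_{\mathrm{loc}}(\mathbb{R}^n)$. If $0\neq\alpha_0-\alpha_1$ is constant, then $$\big(B^{\alpha_0(\cdot)}_{p(\cdot),q_0(\cdot)},B^{\alpha_1(\cdot)}_{p(\cdot),q_1(\cdot)}\big)_{\theta,q(\cdot)}=B^{\alpha(\cdot)}_{p(\cdot),q(0)}$$ with $\alpha(\cdot)=(1-\theta)\alpha_0(\cdot)+\theta\alpha_1(\cdot)$. Moreover, $$\big(B^{\alpha_0(\cdot)}_{p(\cdot),r_0},B^{\alpha_1(\cdot)}_{p(\cdot),r_1}\big)_{\theta,q(\cdot)}=B^{\alpha(\cdot)}_{p(\cdot),q(0)},$$ whenever $r_0,r_1\in[1,\infty]$ and $$\frac{1}{q(0)}=\frac{1-\theta}{r_0}+\frac{\theta}{r_1}.$$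
   Context: Interpolation. For two (quasi-)normed spaces $A_0,A_1$ continuously embedded in a common Hausdorff topological vector space (here $\mathcal{S}'(\mathbb{R}^n)$), $K(t,f)=\inf_{f=f_0+f_1}(\|f_0\|_{A_0}+t\|f_1\|_{A_1})$ for $t>0$, $f\in A_0+A_1$ (infimum over $f_i\in A_i$). $\mathcal{P}(\mathbb{R}^n)$ is the set of measurable functions $\mathbb{R}^n\to[1,\infty)$, and similarly $\mathcal{P}(\mathbb{R})$. For $q\in\mathcal{P}(\mathbb{R})$ and measurable $g$ on $(0,\infty)$, $\|g\|_{L^{q(\cdot)}((0,\infty),\frac{dt}{t})}=\inf\{\lambda>0:\int_0^\infty|g(t)/\lambda|^{q(t)}\frac{dt}{t}\le1\}$. The space $(A_0,A_1)_{\theta,q(\cdot)}$ consists of all $f\in A_0+A_1$ with $\|f\|_{(A_0,A_1)_{\theta,q(\cdot)}}=\|t^{-\theta}K(t,f)\|_{L^{q(\cdot)}((0,\infty),\frac{dt}{t})}<\infty$. Regularity. A real function $g$ is log-Hölder continuous at the origin if $|g(x)-g(0)|\le c/\ln(e+1/|x|)$ for all $x$ and some $c>0$; it is log-Hölder continuous at infinity (satisfies the log-Hölder decay condition) if there are $g_\infty\in\mathbb{R}$, $c>0$ with $|g(x)-g_\infty|\le c/\log(e+|x|)$ for all $x$. $C^{\log}_{\mathrm{loc}}(\mathbb{R}^n)$ is the set of $g:\mathbb{R}^n\to\mathbb{R}$ for which there is $c>0$ with $|g(x)-g(y)|\le c/\log(e+1/|x-y|)$ for all $x,y$. $C^{\log}$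 is the set of $g\in C^{\log}_{\mathrm{loc}}(\mathbb{R}^n)$ which also satisfy the log-Hölder decay condition. $\mathcal{P}^{\log}(\mathbb{R}^n)=\{p\in\mathcal{P}(\mathbb{R}^n):1/p\in C^{\log}\}$. Besov spaces. For $p\in\mathcal{P}(\mathbb{R}^n)$ let $\varrho_{p(\cdot)}(f)=\int_{\mathbb{R}^n}|f(x)|^{p(x)}dx$ and $\|f\|_{p(\cdot)}=\inf\{\lambda>0:\varrho_{p(\cdot)}(f/\lambda)\le1\}$. For a sequence $(f_j)_{j\ge0}$ of functions and $r\in\mathcal{P}(\mathbb{R}^n)$ let $$\varrho_{\ell_>^{r(\cdot)}(L^{p(\cdot)})}((f_j)_j)=\sum_{j=0}^\infty\inf\Big\{\lambda_j>0:\varrho_{p(\cdot)}\Big(\frac{f_j}{\lambda_j^{1/r(\cdot)}}\Big)\le1\Big\},$$ $$\|(f_j)_j\|_{\ell_>^{r(\cdot)}(L^{p(\cdot)})}=\inf\{\mu>0:\varrho_{\ell_>^{r(\cdot)}(L^{p(\cdot)})}((f_j/\mu)_j)\le1\}.$$ For constant $r\in[1,\infty)$ this is $(\sum_j\|f_j\|_{p(\cdot)}^r)^{1/r}$, and for $r=\infty$ one uses $\sup_j\|f_j\|_{p(\cdot)}$. Let $\Psi\in\mathcal{S}(\mathbb{R}^n)$ with $\Psi(x)=1$ for $|x|\le1$ and $\Psi(x)=0$ for $|x|\ge2$; define $\varphi_j$ via the Fourier transform $\mathcal{F}$ by $\mathcal{F}\varphi_0(x)=\Psi(x)$ and $\mathcal{F}\varphi_j(x)=\Psi(2^{-j}x)-\Psi(2^{1-j}x)$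 for $j\ge1$, so that $\sum_{j\ge0}\mathcal{F}\varphi_j=1$. For $s:\mathbb{R}^n\to\mathbb{R}$, the space $B^{s(\cdot)}_{p(\cdot),r(\cdot)}$ consists of all $f\in\mathcal{S}'(\mathbb{R}^n)$ such that $\|f\|_{B^{s(\cdot)}_{p(\cdot),r(\cdot)}}=\|(2^{js(\cdot)}\varphi_j\ast f)_{j\ge0}\|_{\ell_>^{r(\cdot)}(L^{p(\cdot)})}<\infty$. *)

theory Defs
  imports "HOL-Analysis.Analysis" "HOL-Library.Function_Algebras"
begin

section \<open>Variable exponents and logarithmic regularity\<close>

definition exponents :: "('a::euclidean_space \<Rightarrow> real) set" where
  "exponents = {p \<in> borel_measurable lebesgue. \<forall>x. 1 \<le> p x}"

text \<open>At \<open>x = 0\<close> (resp. \<open>x = y\<close> below) the left-hand side vanishes, so the convention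
  \<open>1 / 0 = 0\<close> is harmless.\<close>

definition log_hoelder_at_origin :: "('a::real_normed_vector \<Rightarrow> real) \<Rightarrow> bool" where
  "log_hoelder_at_origin g \<longleftrightarrow> (\<exists>c>0. \<forall>x. \<bar>g x - g 0\<bar> \<le> c / ln (exp 1 + 1 / norm x))"

definition log_hoelder_at_infinity :: "('a::real_normed_vector \<Rightarrow> real) \<Rightarrow> real \<Rightarrow> bool" where
  "log_hoelder_at_infinity g g_inf \<longleftrightarrow> (\<exists>c>0. \<forall>x. \<bar>g x - g_inf\<bar> \<le> c / ln (exp 1 + norm x))"

definition C_log_loc :: "('a::euclidean_space \<Rightarrow> real) set" where
  "C_log_loc = {g. \<exists>c>0. \<forall>x y. \<bar>g x - g y\<bar> \<le> c / ln (exp 1 + 1 / norm (x - y))}"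

definition C_log :: "('a::euclidean_space \<Rightarrow> real) set" where
  "C_log = {g \<in> C_log_loc. \<exists>g_inf. log_hoelder_at_infinity g g_inf}"

definition log_exponents :: "('a::euclidean_space \<Rightarrow> real) set" where
  "log_exponents = {p \<in> exponents. (\<lambda>x. 1 / p x) \<in> C_log}"


section \<open>Variable exponent Lebesgue and mixed sequence spaces\<close>

text \<open>All (quasi-)norms take values in \<^typ>\<open>ennreal\<close>; since \<open>Inf {} = top\<close>, the value is
  \<open>top\<close> exactly when no admissible scaling factor exists.\<close>

definition modular :: "('a::euclidean_space \<Rightarrow> real) \<Rightarrow> ('a \<Rightarrow> complex) \<Rightarrow> ennreal" where
  "modular p f = (\<integral>\<^sup>+x. ennreal (norm (f x) powr p x) \<partial>lebesgue)"

definition Lp_norm :: "('a::euclidean_space \<Rightarrow> real) \<Rightarrow> ('a \<Rightarrow> complex) \<Rightarrow> ennreal" where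
  "Lp_norm p f = (INF l\<in>{l::real. 0 < l \<and> modular p (\<lambda>x. f x / of_real l) \<le> 1}. ennreal l)"

definition mixed_modular ::
  "('a::euclidean_space \<Rightarrow> real) \<Rightarrow> ('a \<Rightarrow> real) \<Rightarrow> (nat \<Rightarrow> 'a \<Rightarrow> complex) \<Rightarrow> ennreal" where
  "mixed_modular p r f =
    (\<Sum>j. INF l\<in>{l::real. 0 < l \<and> modular p (\<lambda>x. f j x / of_real (l powr (1 / r x))) \<le> 1}. ennreal l)"

definition mixed_norm ::
  "('a::euclidean_space \<Rightarrow> real) \<Rightarrow> ('a \<Rightarrow> real) \<Rightarrow> (nat \<Rightarrow> 'a \<Rightarrow> complex) \<Rightarrow> ennreal" where
  "mixed_norm p r f =
    (INF m\<in>{m::real. 0 < m \<and> mixed_modular p r (\<lambda>j x. f j x / of_real m) \<le> 1}. ennreal m)"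

definition mixed_norm_const ::
  "('a::euclidean_space \<Rightarrow> real) \<Rightarrow> ennreal \<Rightarrow> (nat \<Rightarrow> 'a \<Rightarrow> complex) \<Rightarrow> ennreal" where
  "mixed_norm_const p r f =
    (if r = top then (SUP j. Lp_norm p (f j)) else mixed_norm p (\<lambda>_. enn2real r) f)"


section \<open>Schwartz functions and tempered distributions\<close>

definition partial_deriv :: "'n::finite \<Rightarrow> (real^'n \<Rightarrow> complex) \<Rightarrow> real^'n \<Rightarrow> complex" where
  "partial_deriv i f x = frechet_derivative f (at x) (axis i 1)"

definition iterated_partial :: "'n::finite list \<Rightarrow> (real^'n \<Rightarrow> complex) \<Rightarrow> real^'n \<Rightarrow> complex" where
  "iterated_partial is f = foldr partial_deriv is f"

definition schwartz :: "(real^'n::finite \<Rightarrow> complex) set" where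
  "schwartz = {f. \<forall>is. (\<forall>x. iterated_partial is f differentiable (at x)) \<and>
                  (\<forall>k. \<exists>C. \<forall>x. (1 + norm x) ^ k * norm (iterated_partial is f x) \<le> C)}"

text \<open>Increasing in \<open>k\<close>; these seminorms generate the topology of \<^const>\<open>schwartz\<close>.\<close>

definition schwartz_seminorm :: "nat \<Rightarrow> (real^'n::finite \<Rightarrow> complex) \<Rightarrow> real" where
  "schwartz_seminorm k f =
    (SUP (is, x) \<in> {is. length is \<le> k} \<times> UNIV. (1 + norm x) ^ k * norm (iterated_partial is f x))"

text \<open>Distributions are functionals on all functions, set to \<open>0\<close> off \<^const>\<open>schwartz\<close>:
  then equality and pointwise addition of functionals are those of the dual space.\<close>

definition tempered_distributions :: "((real^'n::finite \<Rightarrow> complex) \<Rightarrow> complex) set" where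
  "tempered_distributions =
    {T. (\<forall>u. u \<notin> schwartz \<longrightarrow> T u = 0) \<and>
        (\<forall>u\<in>schwartz. \<forall>v\<in>schwartz. T (\<lambda>x. u x + v x) = T u + T v) \<and>
        (\<forall>c. \<forall>u\<in>schwartz. T (\<lambda>x. c * u x) = c * T u) \<and>
        (\<forall>u\<in>schwartz. \<forall>\<epsilon>>0. \<exists>k. \<exists>\<delta>>0. \<forall>v\<in>schwartz.
           schwartz_seminorm k (\<lambda>x. v x - u x) < \<delta> \<longrightarrow> norm (T v - T u) < \<epsilon>)}"

text \<open>Unnormalized convention, for which the Fourier transform turns convolutions into products.\<close>

definition fourier :: "(real^'n::finite \<Rightarrow> complex) \<Rightarrow> real^'n \<Rightarrow> complex" where
  "fourier f \<xi> = (\<integral>x. cis (- (x \<bullet> \<xi>)) * f x \<partial>lebesgue)"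

definition convolution ::
  "(real^'n::finite \<Rightarrow> complex) \<Rightarrow> ((real^'n \<Rightarrow> complex) \<Rightarrow> complex) \<Rightarrow> real^'n \<Rightarrow> complex" where
  "convolution u T x = T (\<lambda>y. u (x - y))"


section \<open>Besov spaces\<close>

definition dyadic_resolution ::
  "(real^'n::finite \<Rightarrow> complex) \<Rightarrow> (nat \<Rightarrow> real^'n \<Rightarrow> complex) \<Rightarrow> bool" where
  "dyadic_resolution \<Psi> \<phi> \<longleftrightarrow>
     \<Psi> \<in> schwartz \<and> (\<forall>x. norm x \<le> 1 \<longrightarrow> \<Psi> x = 1) \<and> (\<forall>x. 2 \<le> norm x \<longrightarrow> \<Psi> x = 0) \<and>
     (\<forall>j. \<phi> j \<in> schwartz) \<and>
     (\<forall>x. fourier (\<phi> 0) x = \<Psi> x) \<and>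
     (\<forall>j\<ge>1. \<forall>x. fourier (\<phi> j) x =
        \<Psi> ((2 powr (- real j)) *\<^sub>R x) - \<Psi> ((2 powr (1 - real j)) *\<^sub>R x))"

text \<open>A (quasi-)normed space inside an ambient vector space: its elements and its norm, the
  latter being relevant on the elements only.\<close>

type_synonym 'a qn_space = "'a set \<times> ('a \<Rightarrow> ennreal)"

definition besov_from ::
  "(nat \<Rightarrow> real^'n::finite \<Rightarrow> complex) \<Rightarrow> (real^'n \<Rightarrow> real) \<Rightarrow>
   ((nat \<Rightarrow> real^'n \<Rightarrow> complex) \<Rightarrow> ennreal) \<Rightarrow> ((real^'n \<Rightarrow> complex) \<Rightarrow> complex) qn_space" where
  "besov_from \<phi> s N =
    (let nrm = (\<lambda>f. N (\<lambda>j x. of_real (2 powr (real j * s x)) * convolution (\<phi> j) f x))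
     in ({f \<in> tempered_distributions. nrm f < top}, nrm))"

definition besov ::
  "(nat \<Rightarrow> real^'n::finite \<Rightarrow> complex) \<Rightarrow> (real^'n \<Rightarrow> real) \<Rightarrow> (real^'n \<Rightarrow> real) \<Rightarrow>
   (real^'n \<Rightarrow> real) \<Rightarrow> ((real^'n \<Rightarrow> complex) \<Rightarrow> complex) qn_space" where
  "besov \<phi> s p r = besov_from \<phi> s (mixed_norm p r)"

definition besov_const ::
  "(nat \<Rightarrow> real^'n::finite \<Rightarrow> complex) \<Rightarrow> (real^'n \<Rightarrow> real) \<Rightarrow> (real^'n \<Rightarrow> real) \<Rightarrow>
   ennreal \<Rightarrow> ((real^'n \<Rightarrow> complex) \<Rightarrow> complex) qn_space" where
  "besov_const \<phi> s p r = besov_from \<phi> s (mixed_norm_const p r)"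


section \<open>Real interpolation with a variable exponent\<close>

definition sum_carrier :: "'a::ab_group_add qn_space \<Rightarrow> 'a qn_space \<Rightarrow> 'a set" where
  "sum_carrier A0 A1 = {f0 + f1 | f0 f1. f0 \<in> fst A0 \<and> f1 \<in> fst A1}"

definition K_functional ::
  "'a::ab_group_add qn_space \<Rightarrow> 'a qn_space \<Rightarrow> real \<Rightarrow> 'a \<Rightarrow> ennreal" where
  "K_functional A0 A1 t f =
    (INF (f0, f1) \<in> {(f0, f1). f0 \<in> fst A0 \<and> f1 \<in> fst A1 \<and> f = f0 + f1}.
       snd A0 f0 + ennreal t * snd A1 f1)"

definition Lq_dt_t_norm :: "(real \<Rightarrow> real) \<Rightarrow> (real \<Rightarrow> real) \<Rightarrow> ennreal" where
  "Lq_dt_t_norm q g =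
    (INF l\<in>{l::real. 0 < l \<and>
        (\<integral>\<^sup>+t\<in>{0<..}. ennreal (\<bar>g t / l\<bar> powr q t / t) \<partial>lebesgue) \<le> 1}. ennreal l)"

text \<open>The K-functional is finite on \<^const>\<open>sum_carrier\<close>, so \<^const>\<open>enn2real\<close> loses nothing there.\<close>

definition interpolation_space ::
  "'a::ab_group_add qn_space \<Rightarrow> 'a qn_space \<Rightarrow> real \<Rightarrow> (real \<Rightarrow> real) \<Rightarrow> 'a qn_space" where
  "interpolation_space A0 A1 \<theta> q =
    (let nrm = (\<lambda>f. Lq_dt_t_norm q (\<lambda>t. t powr (- \<theta>) * enn2real (K_functional A0 A1 t f)))
     in ({f \<in> sum_carrier A0 A1. nrm f < top}, nrm))"

text \<open>Equality of spaces in the sense of interpolation theory: same elements, equivalent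
  (quasi-)norms.\<close>

definition same_space :: "'a qn_space \<Rightarrow> 'a qn_space \<Rightarrow> bool" where
  "same_space A B \<longleftrightarrow> fst A = fst B \<and>
    (\<exists>c::real. c > 0 \<and>
      (\<forall>f\<in>fst A. snd A f \<le> ennreal c * snd B f \<and> snd B f \<le> ennreal c * snd A f))"

end

theory Submission
  imports Defs
begin

text \<open>Write \<open>b\<^sub>j(f)\<close> for the \<open>L\<^sup>p\<close> norm of \<open>2 powr (j * \<alpha>1)\<close> times the \<open>j\<close>-th dyadic block of \<open>f\<close>.
  The only consequences of the regularity of \<open>p\<close> and \<open>\<alpha>1\<close> that matter are that the smooth kernels
  of the resolution act on the blocks with bounds uniform in \<open>j\<close>: for every set \<open>S\<close> of frequencies
  that is finite or cofinite, \<open>f\<close> splits as \<open>f0 + f1\<close> where \<open>b\<^sub>k(f0)\<close> and \<open>b\<^sub>k(f1)\<close> are controlled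
  by those \<open>b\<^sub>j(f)\<close> with \<open>\<bar>j - k\<bar> \<le> 1\<close> and \<open>j\<close> in \<open>S\<close>, respectively outside \<open>S\<close>.

  If \<open>d \<noteq> 0\<close>, all the norms involved lie between the supremum and the sum of the norms of the
  blocks, so cutting at the frequency where \<open>2 powr (j * d) = t\<close> shows that
  \<open>K(2 powr (j * d), f) \<ge> 2 powr (j * d) * b\<^sub>j(f)\<close> and \<open>K(t, f) \<le> \<Sum>j. min (2 powr (j * d)) t * b\<^sub>j(f)\<close>
  up to constants, whatever \<open>q\<^sub>0\<close> and \<open>q\<^sub>1\<close> are. A Hardy inequality turns this into the theorem. If \<open>d = 0\<close>
  and \<open>r0 \<noteq> r1\<close>, the same scheme runs with \<open>1 / r0 - 1 / r1\<close> in place of \<open>d\<close> and with the dyadic values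
  of the decreasing rearrangement of \<open>j \<mapsto> b\<^sub>j(f)\<close> in place of \<open>b\<^sub>j(f)\<close>; if \<open>r0 = r1\<close>, both spaces of the
  couple coincide.

  The variable exponent \<open>q\<close> of the interpolation functor may be replaced by the constant \<open>q 0\<close>, because
  \<open>\<bar>q t - q 0\<bar> * \<bar>ln t\<bar>\<close> is bounded: the two integrands then differ by a bounded factor and the
  integrable term \<open>min t (1 / t)\<close>.\<close>

section \<open>Interpolation norms with a log-Hoelder exponent\<close>

text \<open>Two obstacles shape the argument. A splitting with infinitely many frequencies on both
  sides would need convergence of infinite sums of blocks as distributions. For either sign of
  \<open>d\<close> the set of \<open>i\<close> with \<open>2 powr (i * d) \<le> t\<close> is finite
  or cofinite, so only a finite sum of blocks is ever written down; the rest is a difference. The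
  other obstacle is the variable sequence exponent. The gap between supremum and sum of the block
  norms does no harm because the weights \<open>min (2 powr (i * d)) t\<close>, compared with
  \<open>t powr \<theta>\<close> and the weights of the target, decay exponentially in the distance
  of \<open>ln t\<close> from \<open>i * d * ln 2\<close>. This decay also explains why sampling K
  at \<open>2 powr (i * d)\<close> with \<open>i \<ge> 0\<close> suffices, although these points
  reach only one end of the half-line. For \<open>d = 0\<close> the blocks have no weights to
  compare. Then \<open>2 ^ i\<close> coefficients of size \<open>c\<close> have norm
  \<open>2 powr (i / r) * c\<close> in the sequence space of exponent \<open>r\<close>, so distinct
  \<open>r0\<close>, \<open>r1\<close> supply the geometric weights.
  \<open>interpolation_space_eqI\<close> serves three sequences: block norms, weighted rearrangement
  values, and one with a single nonzero entry when the two spaces coincide.\<close>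

lemma powr_perturb_exponent:
  fixes a b c h t :: real
  assumes h: "0 \<le> h" "h \<le> 1" and a: "1 \<le> a" and b: "1 \<le> b" and t: "0 < t"
    and c: "\<bar>a - b\<bar> * \<bar>ln t\<bar> \<le> c"
  shows "h powr a \<le> exp c * h powr b + exp (- \<bar>ln t\<bar>)"
\<comment> \<open>Either \<open>h\<close> lies below the error term, and then so does
  \<open>h powr a \<le> h\<close>, or \<open>\<bar>ln h\<bar> \<le> \<bar>ln t\<bar>\<close>, and
  changing the exponent costs the factor
  \<open>exp (\<bar>a - b\<bar> * \<bar>ln h\<bar>) \<le> exp c\<close>.\<close>
proof (cases "exp (- \<bar>ln t\<bar>) \<le> h")
  case True
  then have h0: "0 < h" by (meson exp_gt_zero less_le_trans)
  have lnh: "\<bar>ln h\<bar> \<le> \<bar>ln t\<bar>"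
  proof -
    have "- \<bar>ln t\<bar> \<le> ln h" using True h0 by (simp add: ln_ge_iff)
    moreover have "ln h \<le> 0" using h h0 by simp
    ultimately show ?thesis by simp
  qed
  have "h powr a = h powr b * h powr (a - b)" by (simp add: powr_add [symmetric])
  also have "h powr (a - b) \<le> exp c"
  proof -
    have "(a - b) * ln h \<le> \<bar>a - b\<bar> * \<bar>ln h\<bar>" by (metis abs_ge_self abs_mult)
    also have "\<dots> \<le> \<bar>a - b\<bar> * \<bar>ln t\<bar>" by (intro mult_left_mono lnh) auto
    finally show ?thesis using c h0 by (simp add: powr_def)
  qed
  finally have "h powr a \<le> h powr b * exp c" by (simp add: mult_left_mono)
  then show ?thesis by (smt (verit) exp_gt_zero mult.commute)
next
  case False
  have "h powr a \<le> h"
  proof (cases "h = 0")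
    case False
    then have "h powr a \<le> h powr 1" using h a by (intro powr_mono') auto
    then show ?thesis using h by simp
  qed auto
  moreover have "0 \<le> exp c * h powr b" by simp
  ultimately show ?thesis using False by linarith
qed

text \<open>Each modulus of continuity controls \<open>\<bar>ln t\<bar>\<close> on its own range,
  the one at the origin for \<open>t < 1\<close> and the one at infinity for
  \<open>t \<ge> 1\<close>. Both compare \<open>q t\<close> with the same number because the value
  at infinity is \<open>q 0\<close>.\<close>

lemma log_hoelder_exponent_bound:
  fixes q :: "real \<Rightarrow> real"
  assumes "log_hoelder_at_origin q" and "log_hoelder_at_infinity q (q 0)"
  obtains c where "0 \<le> c" and "\<And>t. 0 < t \<Longrightarrow> \<bar>q t - q 0\<bar> * \<bar>ln t\<bar> \<le> c"
proof -
  obtain c1 where c1: "c1 > 0" "\<And>x. \<bar>q x - q 0\<bar> \<le> c1 / ln (exp 1 + 1 / norm x)"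
    using assms(1) unfolding log_hoelder_at_origin_def by auto
  obtain c2 where c2: "c2 > 0" "\<And>x. \<bar>q x - q 0\<bar> \<le> c2 / ln (exp 1 + norm x)"
    using assms(2) unfolding log_hoelder_at_infinity_def by auto
  have *: "\<bar>D\<bar> * l \<le> c" if "\<bar>D\<bar> \<le> c / L" "l \<le> L" "0 < L" "0 \<le> l" for D c l L :: real
  proof -
    have "\<bar>D\<bar> * l \<le> \<bar>D\<bar> * L" using that by (intro mult_left_mono) auto
    also have "\<dots> \<le> c" using that by (simp add: pos_le_divide_eq)
    finally show ?thesis .
  qed
  have "\<bar>q t - q 0\<bar> * \<bar>ln t\<bar> \<le> max c1 c2" if t: "0 < t" for t
  proof (cases "t < 1")
    case True
    have "\<bar>ln t\<bar> \<le> ln (exp 1 + 1 / norm t)"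
    proof -
      have "\<bar>ln t\<bar> = ln (1 / t)" using t True by (simp add: ln_div)
      also have "\<dots> \<le> ln (exp 1 + 1 / norm t)" using t by (simp add: add_pos_pos)
      finally show ?thesis .
    qed
    moreover have "0 < ln (exp 1 + 1 / norm t)"
      using t by (intro ln_gt_zero) (smt (verit) exp_gt_one zero_less_divide_1_iff zero_less_norm_iff)
    ultimately have "\<bar>q t - q 0\<bar> * \<bar>ln t\<bar> \<le> c1" using c1(2)[of t] by (intro *) auto
    then show ?thesis by linarith
  next
    case False
    have "\<bar>ln t\<bar> \<le> ln (exp 1 + norm t)" using False by (simp add: add_pos_pos)
    moreover have "0 < ln (exp 1 + norm t)"
      by (intro ln_gt_zero) (smt (verit) exp_gt_one norm_ge_zero)
    ultimately have "\<bar>q t - q 0\<bar> * \<bar>ln t\<bar> \<le> c2" using c2(2)[of t] by (intro *) auto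
    then show ?thesis by linarith
  qed
  then show ?thesis using c1 c2 by (intro that[of "max c1 c2"]) auto
qed

text \<open>In the variable \<open>u = ln t\<close> this is the integral of
  \<open>exp (- e * \<bar>u - ln T\<bar>)\<close> over the line. The integrand is a pure power of
  \<open>t\<close> on either side of \<open>T\<close>, and each side contributes
  \<open>1 / e\<close>.\<close>

lemma nn_integral_exp_abs_ln:
  fixes e T :: real
  assumes e: "0 < e" and T: "0 < T"
  shows "(\<integral>\<^sup>+t\<in>{0<..}. ennreal (exp (- e * \<bar>ln t - ln T\<bar>) / t) \<partial>lborel) \<le> ennreal (2 / e)"
proof -
  let ?f1 = "\<lambda>t. (T powr (-e)) * t powr (e - 1)" and ?f2 = "\<lambda>t. T powr e * t powr (- e - 1)"
  have i1: "(?f1 has_integral T powr (-e) * (T powr ((e-1)+1) / ((e-1)+1))) {0..T}"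
    using e T by (intro has_integral_mult_right has_integral_powr_from_0) auto
  have i2: "(?f2 has_integral T powr e * (-(T powr ((-e-1)+1)) / ((-e-1)+1))) {T..}"
    using e T by (intro has_integral_mult_right has_integral_powr_to_inf) auto
  have n1: "integral\<^sup>N lborel (\<lambda>t. ennreal (?f1 t) * indicator {0..T} t) = ennreal (1 / e)"
    using nn_integral_has_integral_lebesgue'[OF _ i1] e T
    by (simp add: powr_minus field_simps)
  have n2: "integral\<^sup>N lborel (\<lambda>t. ennreal (?f2 t) * indicator {T..} t) = ennreal (1 / e)"
    using nn_integral_has_integral_lebesgue'[OF _ i2] e T
    by (simp add: powr_minus field_simps)
  have "(\<integral>\<^sup>+t\<in>{0<..}. ennreal (exp (- e * \<bar>ln t - ln T\<bar>) / t) \<partial>lborel)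
      \<le> (\<integral>\<^sup>+t. ennreal (?f1 t) * indicator {0..T} t + ennreal (?f2 t) * indicator {T..} t \<partial>lborel)"
  proof (rule nn_integral_mono)
    fix t :: real
    show "ennreal (exp (- e * \<bar>ln t - ln T\<bar>) / t) * indicator {0<..} t
      \<le> ennreal (?f1 t) * indicator {0..T} t + ennreal (?f2 t) * indicator {T..} t"
    proof (cases "0 < t")
      case t: True
      show ?thesis
      proof (cases "t \<le> T")
        case True
        then have "\<bar>ln t - ln T\<bar> = ln T - ln t" using t by simp
        then have "exp (- e * \<bar>ln t - ln T\<bar>) / t = exp (- e * (ln T - ln t) - ln t)"
          by (simp only: exp_diff exp_ln[OF t])
        also have "\<dots> = ?f1 t"
          using t T by (simp add: powr_def exp_add[symmetric] algebra_simps)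
        finally show ?thesis using True t by simp
      next
        case False
        then have "\<bar>ln t - ln T\<bar> = ln t - ln T" using t T by simp
        then have "exp (- e * \<bar>ln t - ln T\<bar>) / t = exp (- e * (ln t - ln T) - ln t)"
          by (simp only: exp_diff exp_ln[OF t])
        also have "\<dots> = ?f2 t"
          using t T by (simp add: powr_def exp_add[symmetric] algebra_simps)
        finally show ?thesis using False t by simp
      qed
    qed auto
  qed
  also have "\<dots> = ennreal (1/e) + ennreal (1/e)"
    by (subst nn_integral_add) (auto simp: n1 n2)
  also have "\<dots> = ennreal (2/e)" using e by (simp add: ennreal_plus[symmetric] del: ennreal_plus)
  finally show ?thesis .
qed

lemma nn_integral_inverse_interval:
  fixes a w :: real
  assumes "0 \<le> w"
  shows "(\<integral>\<^sup>+t. ennreal (1 / t) * indicator {exp a..exp (a + w)} t \<partial>lborel) = ennreal w"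
proof -
  have "((\<lambda>t::real. 1 / t) has_integral ln (exp (a + w)) - ln (exp a)) {exp a..exp (a + w)}"
  proof (rule fundamental_theorem_of_calculus)
    fix x :: real assume "x \<in> {exp a..exp (a + w)}"
    then have "0 < x" by (meson atLeastAtMost_iff exp_gt_zero less_le_trans)
    then show "(ln has_vector_derivative 1 / x) (at x within {exp a..exp (a + w)})"
      by (auto intro!: derivative_eq_intros simp: has_real_derivative_iff_has_vector_derivative[symmetric])
  qed (use assms in auto)
  moreover have "0 \<le> 1 / t" if "t \<in> {exp a..exp (a + w)}" for t :: real
    using that by (meson atLeastAtMost_iff exp_gt_zero less_le_trans less_imp_le zero_le_divide_1_iff)
  ultimately have "integral\<^sup>N lborel (\<lambda>t. ennreal (1 / t) * indicator {exp a..exp (a + w)} t) =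
      ennreal (ln (exp (a + w)) - ln (exp a))"
    by (intro nn_integral_has_integral_lebesgue')
  then show ?thesis by simp
qed

text \<open>The points \<open>i * d\<close> have spacing \<open>\<bar>d\<bar>\<close>. Rounding
  \<open>x / d\<close> to an integer costs the factor \<open>exp (e * \<bar>d\<bar>)\<close> and
  leaves two geometric series, one for each side. The point is that the bound does not depend on
  \<open>x\<close>.\<close>

lemma suminf_exp_abs_le:
  fixes e d x :: real
  assumes e: "0 < e" and d: "d \<noteq> 0"
  shows "(\<Sum>i. ennreal (exp (- e * \<bar>x - real i * d\<bar>))) \<le> ennreal (2 * exp (e * \<bar>d\<bar>) / (1 - exp (- (e * \<bar>d\<bar>))))"
proof (rule suminf_le_const)
  define h where "h = e * \<bar>d\<bar>"
  define m where "m = \<lfloor>x / d\<rfloor>"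
  define r where "r = exp (- h)"
  have h: "0 < h" unfolding h_def using e d by simp
  have r: "0 < r" "r < 1" unfolding r_def using h by auto
  show "summable (\<lambda>i. ennreal (exp (- e * \<bar>x - real i * d\<bar>)))" by simp
  fix n
  have pt: "exp (- e * \<bar>x - real i * d\<bar>) \<le> exp h * r ^ nat \<bar>int i - m\<bar>" for i
  proof -
    have "real_of_int \<bar>int i - m\<bar> \<le> \<bar>x / d - real i\<bar> + 1"
      unfolding m_def by linarith
    then have "\<bar>d\<bar> * real_of_int \<bar>int i - m\<bar> \<le> \<bar>d\<bar> * (\<bar>x / d - real i\<bar> + 1)"
      by (intro mult_left_mono) auto
    also have "\<dots> = \<bar>x - real i * d\<bar> + \<bar>d\<bar>"
      using d by (simp add: algebra_simps abs_mult[symmetric])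
    finally have "e * (\<bar>d\<bar> * real_of_int \<bar>int i - m\<bar>) \<le> e * (\<bar>x - real i * d\<bar> + \<bar>d\<bar>)"
      using e by (intro mult_left_mono) auto
    then have "- e * \<bar>x - real i * d\<bar> \<le> h + real (nat \<bar>int i - m\<bar>) * (- h)"
      unfolding h_def by (simp add: algebra_simps)
    then have "exp (- e * \<bar>x - real i * d\<bar>) \<le> exp (h + real (nat \<bar>int i - m\<bar>) * (- h))" by (simp only: exp_le_cancel_iff)
    also have "\<dots> = exp h * r ^ nat \<bar>int i - m\<bar>"
      unfolding r_def by (simp only: exp_add exp_of_nat_mult)
    finally show ?thesis .
  qed
  have geo: "(\<Sum>i\<in>F. r ^ f i) \<le> 1 / (1 - r)" if "finite F" "inj_on f F" for F and f :: "nat \<Rightarrow> nat"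
  proof -
    have "(\<Sum>i\<in>F. r ^ f i) = (\<Sum>k\<in>f ` F. r ^ k)" using that by (simp add: sum.reindex)
    also have "\<dots> \<le> (\<Sum>k. r ^ k)" using that r by (intro sum_le_suminf) auto
    also have "\<dots> = 1 / (1 - r)" using r by (simp add: suminf_geometric)
    finally show ?thesis .
  qed
  have "(\<Sum>i<n. r ^ nat \<bar>int i - m\<bar>) = (\<Sum>i\<in>{i\<in>{..<n}. m \<le> int i}. r ^ nat \<bar>int i - m\<bar>)
      + (\<Sum>i\<in>{i\<in>{..<n}. \<not> m \<le> int i}. r ^ nat \<bar>int i - m\<bar>)"
    by (subst sum.union_disjoint [symmetric]) (auto intro!: sum.cong)
  also have "\<dots> \<le> 1 / (1 - r) + 1 / (1 - r)"
    by (intro add_mono geo) (auto simp: inj_on_def)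
  finally have S: "(\<Sum>i<n. r ^ nat \<bar>int i - m\<bar>) \<le> 2 / (1 - r)" by simp
  have "(\<Sum>i<n. exp (- e * \<bar>x - real i * d\<bar>)) \<le> (\<Sum>i<n. exp h * r ^ nat \<bar>int i - m\<bar>)"
    by (intro sum_mono pt)
  also have "\<dots> = exp h * (\<Sum>i<n. r ^ nat \<bar>int i - m\<bar>)" by (simp add: sum_distrib_left)
  also have "\<dots> \<le> exp h * (2 / (1 - r))" by (intro mult_left_mono S) auto
  finally show "(\<Sum>i<n. ennreal (exp (- e * \<bar>x - real i * d\<bar>))) \<le> ennreal (2 * exp (e * \<bar>d\<bar>) / (1 - exp (- (e * \<bar>d\<bar>))))"
    unfolding h_def r_def by (simp add: ennreal_leI mult.commute)
qed

text \<open>The upper Hardy inequality. The weight of rate \<open>2 * e\<close> is the square of a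
  weight \<open>w\<close> of rate \<open>e\<close>. One factor \<open>w\<close> bounds
  \<open>w * x i\<close> by the number \<open>M\<close> whose power \<open>q 0\<close> is the
  \<open>w\<close>-weighted sum of the \<open>x i powr q 0\<close>; the other makes the sum over
  \<open>i\<close> converge uniformly in \<open>t\<close>. After normalisation \<open>g\<close> is
  at most \<open>M \<le> 1\<close>, so \<open>powr_perturb_exponent\<close> applies, and integrating
  \<open>M powr q 0\<close> against dt/t reduces to the integrals of the single weights. The
  constant is fixed before \<open>x\<close>, \<open>g\<close> and \<open>L\<close>, as needed for
  equivalence of norms.\<close>

lemma Lq_dt_t_norm_le_of_exp_sum:
  fixes q :: "real \<Rightarrow> real" and e d c :: real
  assumes q1: "\<And>t. 1 \<le> q t" and c: "\<And>t. 0 < t \<Longrightarrow> \<bar>q t - q 0\<bar> * \<bar>ln t\<bar> \<le> c"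
    and e: "0 < e" and d: "d \<noteq> 0"
  obtains C where "0 < C"
    and "\<And>x g L. \<lbrakk>0 < L; \<And>i::nat. 0 \<le> x i; (\<Sum>i. ennreal (x i powr q 0)) \<le> 1; \<And>t. 0 < t \<Longrightarrow> 0 \<le> g t;
      \<And>t. 0 < t \<Longrightarrow> ennreal (g t) \<le> ennreal L * (\<Sum>i. ennreal (exp (- (2 * e) * \<bar>ln t - real i * d\<bar>) * x i))\<rbrakk>
      \<Longrightarrow> Lq_dt_t_norm q g \<le> ennreal (C * L)"
proof -
  \<comment> \<open>\<open>A\<close> bounds the sum of the weights at one point. \<open>D\<close>
    bounds the modular after the passage from \<open>q t\<close> to \<open>q 0\<close>:
    \<open>2 / e\<close> is the dt/t-integral of one weight, and \<open>2\<close> that of the error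
    term \<open>exp (- \<bar>ln t\<bar>)\<close>.\<close>
  define A where "A = 2 * exp (e * \<bar>d\<bar>) / (1 - exp (- (e * \<bar>d\<bar>)))"
  define D where "D = exp c * (2 / e) + 2"
  have A: "0 < A" unfolding A_def using e d by simp
  have D: "1 \<le> D" unfolding D_def using e by (simp add: add_increasing)
  show ?thesis
  proof (rule that[of "A * D"])
    show "0 < A * D" using A D by simp
    fix x :: "nat \<Rightarrow> real" and g :: "real \<Rightarrow> real" and L :: real
    assume L: "0 < L" and x: "\<And>i. 0 \<le> x i" and sx: "(\<Sum>i. ennreal (x i powr q 0)) \<le> 1"
      and g0: "\<And>t. 0 < t \<Longrightarrow> 0 \<le> g t"
      and g: "\<And>t. 0 < t \<Longrightarrow> ennreal (g t) \<le> ennreal L * (\<Sum>i. ennreal (exp (- (2 * e) * \<bar>ln t - real i * d\<bar>) * x i))"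
    define w where "w = (\<lambda>i t. exp (- e * \<bar>ln t - real i * d\<bar>))"
    define S where "S = (\<lambda>t. \<Sum>i. ennreal (w i t * x i powr q 0))"
    have w_sq: "exp (- (2 * e) * \<bar>ln t - real i * d\<bar>) = w i t * w i t" for i t
      unfolding w_def by (simp add: exp_add[symmetric])
    have [measurable]: "w i \<in> borel_measurable borel" for i unfolding w_def by measurable
    have q0: "1 \<le> q 0" by (rule q1)
    have w01: "0 < w i t" "w i t \<le> 1" for i t unfolding w_def using e by auto
    have S1: "S t \<le> 1" for t
    proof -
      have "S t \<le> (\<Sum>i. ennreal (x i powr q 0))" unfolding S_def
        using w01 by (intro suminf_le ennreal_leI) (auto intro!: mult_left_le_one_le simp: less_imp_le)
      then show ?thesis using sx by simp
    qed
    have pt: "ennreal ((g t / (L * A)) powr q t) \<le> ennreal (exp c) * S t + ennreal (exp (- \<bar>ln t\<bar>))"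
      if t: "0 < t" for t
    proof -
      have "\<exists>s. X = ennreal s \<and> 0 \<le> s \<and> s \<le> 1" if "X \<le> 1" for X
        using that by (cases X) (auto simp: top_unique)
      from this[OF S1[of t]] obtain s where s: "S t = ennreal s" "0 \<le> s" "s \<le> 1" by blast
      define M where "M = s powr (1 / q 0)"
      have M0: "0 \<le> M" unfolding M_def by simp
      have M1: "M \<le> 1" unfolding M_def using s(2,3) q0 by (intro powr_le1) auto
      have Mq: "M powr q 0 = s" unfolding M_def powr_powr using s(2) q0 by simp
      note M = M0 M1 Mq
      \<comment> \<open>Taking the root of order \<open>q 0\<close> of
        \<open>w * x powr q 0 \<le> s\<close> leaves \<open>w powr (1 / q 0)\<close> in front of
        \<open>x\<close>, which is at least \<open>w\<close> because
        \<open>w \<le> 1 \<le> q 0\<close>.\<close>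
      have wM: "w i t * x i \<le> M" for i
      proof -
        have "ennreal (w i t * x i powr q 0) \<le> S t"
          using sum_le_suminf[of "\<lambda>i. ennreal (w i t * x i powr q 0)" "{i}"] unfolding S_def by simp
        then have "w i t * x i powr q 0 \<le> s" using s by simp
        then have "(w i t * x i powr q 0) powr (1 / q 0) \<le> M"
          unfolding M_def using q0 w01(1)[of i t] by (intro powr_mono2) auto
        moreover have "(w i t * x i powr q 0) powr (1 / q 0) = w i t powr (1 / q 0) * x i"
          using x[of i] q0 by (simp add: powr_mult powr_powr)
        moreover have "w i t powr 1 \<le> w i t powr (1 / q 0)"
          using w01[of i t] q0 by (intro powr_mono') auto
        then have "w i t \<le> w i t powr (1 / q 0)" using w01(1)[of i t] by simp
        ultimately show ?thesis using x[of i] by (smt (verit) mult_right_mono)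
      qed
      have "(\<Sum>i. ennreal (exp (- (2 * e) * \<bar>ln t - real i * d\<bar>) * x i)) \<le> (\<Sum>i. ennreal M * ennreal (w i t))"
      proof (intro suminf_le)
        fix i
        have "exp (- (2 * e) * \<bar>ln t - real i * d\<bar>) * x i = (w i t * x i) * w i t"
          unfolding w_sq by (simp only: mult_ac)
        also have "\<dots> \<le> M * w i t" using wM[of i] w01(1)[of i t] by (intro mult_right_mono) auto
        finally show "ennreal (exp (- (2 * e) * \<bar>ln t - real i * d\<bar>) * x i) \<le> ennreal M * ennreal (w i t)"
          using M(1) less_imp_le[OF w01(1)] by (simp add: ennreal_mult[symmetric] ennreal_leI)
      qed auto
      also have "\<dots> = ennreal M * (\<Sum>i. ennreal (w i t))" by simp
      also have "\<dots> \<le> ennreal M * ennreal A"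
        unfolding A_def w_def using suminf_exp_abs_le[OF e d, of "ln t"] by (intro mult_left_mono) auto
      finally have "ennreal (g t) \<le> ennreal L * (ennreal M * ennreal A)"
        using g[OF t] by (meson mult_left_mono order_trans zero_le)
      also have "\<dots> = ennreal (L * A * M)" using L A M by (simp add: ennreal_mult[symmetric] mult_ac)
      finally have "g t \<le> L * A * M" using L A M by (simp add: ennreal_le_iff)
      then have hM: "g t / (L * A) \<le> M" using L A by (simp add: field_simps)
      have h0: "0 \<le> g t / (L * A)" using g0[OF t] L A by simp
      have "(g t / (L * A)) powr q t \<le> exp c * (g t / (L * A)) powr q 0 + exp (- \<bar>ln t\<bar>)"
        using h0 hM M t q1 c by (intro powr_perturb_exponent) auto
      also have "\<dots> \<le> exp c * s + exp (- \<bar>ln t\<bar>)"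
        using powr_mono2[of "q 0", OF _ h0 hM] q0 M by (intro add_right_mono mult_left_mono) auto
      finally show ?thesis
        unfolding s(1) using s by (simp add: ennreal_mult[symmetric] ennreal_plus[symmetric] del: ennreal_plus)
    qed
    have I1: "(\<integral>\<^sup>+t\<in>{0<..}. ennreal (exp (- \<bar>ln t\<bar>) / t) \<partial>lborel) \<le> ennreal 2"
      using nn_integral_exp_abs_ln[of 1 1] by simp
    have I2: "(\<integral>\<^sup>+t\<in>{0<..}. ennreal (w i t / t) \<partial>lborel) \<le> ennreal (2 / e)" for i
      using nn_integral_exp_abs_ln[of e "exp (real i * d)"] e unfolding w_def by simp
    define F where "F = (\<lambda>t. (\<Sum>i. ennreal (exp c) * ennreal (x i powr q 0) * (ennreal (w i t / t) * indicator {0<..} t))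
            + ennreal (exp (- \<bar>ln t\<bar>) / t) * indicator {0<..} t)"
    have [measurable]: "F \<in> borel_measurable lborel" unfolding F_def by measurable
    have gF: "ennreal ((g t / (L * A)) powr q t / t) * indicator {0<..} t \<le> F t" for t
      proof (cases "0 < t")
        case t: True
        have "ennreal ((g t / (L * A)) powr q t / t) = ennreal ((g t / (L * A)) powr q t) * ennreal (1 / t)"
          using t by (simp add: ennreal_mult[symmetric])
        also have "\<dots> \<le> (ennreal (exp c) * S t + ennreal (exp (- \<bar>ln t\<bar>))) * ennreal (1 / t)"
          by (intro mult_right_mono pt t) auto
        also have "\<dots> = (\<Sum>i. ennreal (exp c) * ennreal (w i t * x i powr q 0) * ennreal (1 / t)) + ennreal (exp (- \<bar>ln t\<bar>) / t)"
          using t unfolding S_def ennreal_suminf_multc ennreal_suminf_cmult distrib_right by (simp add: ennreal_mult[symmetric])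
        also have "(\<lambda>i. ennreal (exp c) * ennreal (w i t * x i powr q 0) * ennreal (1 / t))
            = (\<lambda>i. ennreal (exp c) * ennreal (x i powr q 0) * ennreal (w i t / t))"
          using t less_imp_le[OF w01(1)] by (auto simp: ennreal_mult[symmetric] mult_ac intro!: ext)
        finally show ?thesis unfolding F_def using t by simp
      qed simp
    have "integral\<^sup>N lborel F = (\<integral>\<^sup>+t. (\<Sum>i. ennreal (exp c) * ennreal (x i powr q 0) * (ennreal (w i t / t) * indicator {0<..} t)) \<partial>lborel)
       + (\<integral>\<^sup>+t\<in>{0<..}. ennreal (exp (- \<bar>ln t\<bar>) / t) \<partial>lborel)"
      unfolding F_def by (rule nn_integral_add) measurable
    also have "(\<integral>\<^sup>+t. (\<Sum>i. ennreal (exp c) * ennreal (x i powr q 0) * (ennreal (w i t / t) * indicator {0<..} t)) \<partial>lborel)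
      = (\<Sum>i. (\<integral>\<^sup>+t. ennreal (exp c) * ennreal (x i powr q 0) * (ennreal (w i t / t) * indicator {0<..} t) \<partial>lborel))"
      by (rule nn_integral_suminf) measurable
    also have "\<dots> = (\<Sum>i. ennreal (exp c) * ennreal (x i powr q 0) * (\<integral>\<^sup>+t\<in>{0<..}. ennreal (w i t / t) \<partial>lborel))"
    proof (rule arg_cong[where f=suminf], rule ext)
      fix i
      show "(\<integral>\<^sup>+t. ennreal (exp c) * ennreal (x i powr q 0) * (ennreal (w i t / t) * indicator {0<..} t) \<partial>lborel)
        = ennreal (exp c) * ennreal (x i powr q 0) * (\<integral>\<^sup>+t\<in>{0<..}. ennreal (w i t / t) \<partial>lborel)"
        by (rule nn_integral_cmult) measurable
    qed
    finally have "integral\<^sup>N lborel F = (\<Sum>i. ennreal (exp c) * ennreal (x i powr q 0) * (\<integral>\<^sup>+t\<in>{0<..}. ennreal (w i t / t) \<partial>lborel))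
       + (\<integral>\<^sup>+t\<in>{0<..}. ennreal (exp (- \<bar>ln t\<bar>) / t) \<partial>lborel)" .
    also have "\<dots> \<le> (\<Sum>i. ennreal (exp c) * ennreal (x i powr q 0) * ennreal (2 / e)) + ennreal 2"
      using I1 I2 by (intro add_mono suminf_le mult_left_mono) auto
    also have "(\<Sum>i. ennreal (exp c) * ennreal (x i powr q 0) * ennreal (2 / e)) =
        ennreal (exp c) * (\<Sum>i. ennreal (x i powr q 0)) * ennreal (2 / e)"
      by simp
    also have "\<dots> + ennreal 2 \<le> ennreal (exp c) * 1 * ennreal (2 / e) + ennreal 2"
      by (intro add_right_mono mult_left_mono mult_right_mono sx) auto
    also have "ennreal (exp c) * 1 * ennreal (2 / e) + ennreal 2 = ennreal D"
      unfolding D_def using e ennreal_plus[of "exp c * (2 / e)" 2] by (simp add: ennreal_mult[symmetric])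
    finally have I: "integral\<^sup>N lborel F \<le> ennreal D" by (simp add: add_mono)
    \<comment> \<open>Enlarging the scale by \<open>D\<close> brings the modular below 1, since
      \<open>(1 / D) powr q t \<le> 1 / D\<close> for \<open>D \<ge> 1\<close> and
      \<open>q t \<ge> 1\<close>.\<close>
    have "(\<integral>\<^sup>+t\<in>{0<..}. ennreal (\<bar>g t / (A * D * L)\<bar> powr q t / t) \<partial>lborel)
      \<le> (\<integral>\<^sup>+t. ennreal (1 / D) * F t \<partial>lborel)"
    proof (intro nn_integral_mono)
      fix t :: real
      have "ennreal (\<bar>g t / (A * D * L)\<bar> powr q t / t) * indicator {0<..} t
        \<le> ennreal (1 / D) * (ennreal ((g t / (L * A)) powr q t / t) * indicator {0<..} t)"
      proof (cases "0 < t")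
        case t: True
        have h0: "0 \<le> g t / (L * A)" using g0[OF t] L A by simp
        have "\<bar>g t / (A * D * L)\<bar> = (1 / D) * (g t / (L * A))" using g0[OF t] L A D by (simp add: field_simps)
        then have "\<bar>g t / (A * D * L)\<bar> powr q t = (1 / D) powr q t * (g t / (L * A)) powr q t"
          using h0 D by (simp only: powr_mult zero_le_divide_1_iff)
        also have "\<dots> \<le> (1 / D) * (g t / (L * A)) powr q t"
          using powr_mono'[of 1 "q t" "1 / D"] D q1[of t] by (intro mult_right_mono) auto
        finally have z: "\<bar>g t / (A * D * L)\<bar> powr q t \<le> (1 / D) * (g t / (L * A)) powr q t" .
        have "\<bar>g t / (A * D * L)\<bar> powr q t / t \<le> (1 / D) * ((g t / (L * A)) powr q t / t)"
          using divide_right_mono[OF z, of t] t by simp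
        then show ?thesis using t D by (simp add: ennreal_mult[symmetric])
      qed simp
      also have "\<dots> \<le> ennreal (1 / D) * F t" by (intro mult_left_mono gF) auto
      finally show "ennreal (\<bar>g t / (A * D * L)\<bar> powr q t / t) * indicator {0<..} t \<le> ennreal (1 / D) * F t" .
    qed
    also have "\<dots> = ennreal (1 / D) * integral\<^sup>N lborel F" by (rule nn_integral_cmult) measurable
    also have "\<dots> \<le> ennreal (1 / D) * ennreal D" by (intro mult_left_mono I) auto
    also have "\<dots> = 1" using D by (simp add: ennreal_mult[symmetric])
    finally have "(\<integral>\<^sup>+t\<in>{0<..}. ennreal (\<bar>g t / (A * D * L)\<bar> powr q t / t) \<partial>lebesgue) \<le> 1"
      by (simp add: nn_integral_completion)
    then show "Lq_dt_t_norm q g \<le> ennreal (A * D * L)"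
      unfolding Lq_dt_t_norm_def using L A D by (intro INF_lower2[of "A * D * L"]) auto
  qed
qed

text \<open>The converse Hardy inequality. Each \<open>x i\<close> is a minorant of \<open>g\<close>
  on an interval of dt/t-length \<open>\<bar>d\<bar> / 2\<close>. This is half the spacing of the
  intervals, so they are disjoint and the integrals over them add up to at most the whole
  modular.\<close>

lemma suminf_le_of_Lq_dt_t_norm:
  fixes q :: "real \<Rightarrow> real" and d c :: real
  assumes q1: "\<And>t. 1 \<le> q t" and c: "\<And>t. 0 < t \<Longrightarrow> \<bar>q t - q 0\<bar> * \<bar>ln t\<bar> \<le> c"
    and qm[measurable]: "q \<in> borel_measurable lebesgue" and d: "d \<noteq> 0"
  obtains C where "0 < C"
    and "\<And>x g l. \<lbrakk>0 < l; \<And>i::nat. 0 \<le> x i;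
        \<And>i t. t \<in> {exp (real i * d)..exp (real i * d + \<bar>d\<bar> / 2)} \<Longrightarrow> x i \<le> g t;
        (\<integral>\<^sup>+t\<in>{0<..}. ennreal (\<bar>g t / l\<bar> powr q t / t) \<partial>lebesgue) \<le> 1\<rbrakk>
      \<Longrightarrow> (\<Sum>i. ennreal ((x i / (C * l)) powr q 0)) \<le> 1"
proof -
  define w where "w = \<bar>d\<bar> / 2"
  \<comment> \<open>\<open>D\<close> is an a priori bound for \<open>x i / l\<close>.
    \<open>E\<close> compensates the total \<open>exp c + 2\<close> collected when
    \<open>q t\<close> is replaced by \<open>q 0\<close>, relative to the interval length
    \<open>w\<close>.\<close>
  define D where "D = max 1 (1 / w)"
  define E where "E = max 1 ((exp c + 2) / w)"
  have w: "0 < w" unfolding w_def using d by simp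
  have D: "1 \<le> D" "1 \<le> D * w" unfolding D_def using w by (auto simp: max_def field_simps)
  have E: "1 \<le> E" "exp c + 2 \<le> E * w" unfolding E_def using w by (auto simp: max_def field_simps)
  define J where "J = (\<lambda>i::nat. {exp (real i * d)..exp (real i * d + w)})"
  have Jpos: "0 < t" if "t \<in> J i" for t i
    using that unfolding J_def by (meson atLeastAtMost_iff exp_gt_zero less_le_trans)
  have Jdisj: "i = j" if "t \<in> J i" "t \<in> J j" for t i j
  proof (rule ccontr)
    assume ij: "i \<noteq> j"
    have t: "0 < t" using Jpos that(1) .
    have "real k * d \<le> ln t \<and> ln t \<le> real k * d + w" if "t \<in> J k" for k
      using that t exp_le_cancel_iff[of "ln t" "real k * d + w"] unfolding J_def by (auto simp: ln_ge_iff)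
    from this[OF that(1)] this[OF that(2)]
    have "\<bar>real i * d - real j * d\<bar> \<le> w" by linarith
    then have "\<bar>real i - real j\<bar> * \<bar>d\<bar> \<le> \<bar>d\<bar> / 2"
      unfolding w_def by (simp add: abs_mult[symmetric] algebra_simps)
    moreover have "1 \<le> \<bar>real i - real j\<bar>" using ij by linarith
    then have "1 * \<bar>d\<bar> \<le> \<bar>real i - real j\<bar> * \<bar>d\<bar>" by (intro mult_right_mono) auto
    ultimately show False using d by auto
  qed
  have Jm: "(\<integral>\<^sup>+t. ennreal (1 / t) * indicator (J i) t \<partial>lebesgue) = ennreal w" for i
    using nn_integral_inverse_interval[of w "real i * d"] w unfolding J_def by (simp add: nn_integral_completion)
  have [measurable]: "J i \<in> sets lebesgue" for i unfolding J_def by auto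
  have [measurable]: "(\<lambda>t::real. t) \<in> borel_measurable lebesgue" "(\<lambda>t::real. ln t) \<in> borel_measurable lebesgue"
    by (auto intro!: measurable_completion)
  have at_most: "(\<Sum>i. f i * indicator (J i) t) \<le> F" if "\<And>i. t \<in> J i \<Longrightarrow> f i \<le> F" for f :: "nat \<Rightarrow> ennreal" and F t
  proof (cases "\<exists>i. t \<in> J i")
    case True
    then obtain i where i: "t \<in> J i" by auto
    have "(\<Sum>j. f j * indicator (J j) t) = (\<Sum>j\<in>{i}. f j * indicator (J j) t)"
      by (rule suminf_finite) (use i Jdisj in \<open>auto simp: indicator_def\<close>)
    then show ?thesis using that[OF i] i by simp
  qed simp
  show ?thesis
  proof (rule that[of "D * E"])
    show "0 < D * E" using D E by simp
    fix x :: "nat \<Rightarrow> real" and g :: "real \<Rightarrow> real" and l :: real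
    assume l: "0 < l" and x: "\<And>i. 0 \<le> x i"
      and xg: "\<And>i t. t \<in> {exp (real i * d)..exp (real i * d + \<bar>d\<bar> / 2)} \<Longrightarrow> x i \<le> g t"
      and I: "(\<integral>\<^sup>+t\<in>{0<..}. ennreal (\<bar>g t / l\<bar> powr q t / t) \<partial>lebesgue) \<le> 1"
    have xg': "x i \<le> g t" if "t \<in> J i" for i t using xg that unfolding J_def w_def by blast
    \<comment> \<open>The exponent can only be perturbed for values in [0, 1], so a crude bound
      comes first: if \<open>x i / l\<close> exceeded \<open>D \<ge> 1\<close>, the interval
      \<open>J i\<close> alone would contribute more than \<open>D * w \<ge> 1\<close> to the
      modular.\<close>
    have xl: "x i / l \<le> D" for i
    proof (rule ccontr)
      assume "\<not> x i / l \<le> D"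
      then have xi: "D < x i / l" by simp
      have "ennreal (x i / l * w) = (\<integral>\<^sup>+t. ennreal (x i / l) * (ennreal (1 / t) * indicator (J i) t) \<partial>lebesgue)"
        using x[of i] l w Jm[of i] by (subst nn_integral_cmult) (measurable, simp add: ennreal_mult[symmetric])
      also have "\<dots> \<le> (\<integral>\<^sup>+t\<in>{0<..}. ennreal (\<bar>g t / l\<bar> powr q t / t) \<partial>lebesgue)"
      proof (rule nn_integral_mono)
        fix t
        show "ennreal (x i / l) * (ennreal (1 / t) * indicator (J i) t) \<le> ennreal (\<bar>g t / l\<bar> powr q t / t) * indicator {0<..} t"
        proof (cases "t \<in> J i")
          case True
          have t: "0 < t" using Jpos[OF True] .
          have "(x i / l) powr 1 \<le> (x i / l) powr q t" using q1[of t] xi D by (intro powr_mono) auto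
          also have "\<dots> \<le> \<bar>g t / l\<bar> powr q t"
            using xg'[OF True] x[of i] l q1[of t] by (intro powr_mono2) (auto simp: divide_right_mono)
          finally have "x i / l \<le> \<bar>g t / l\<bar> powr q t" using x[of i] l by simp
          then have "x i / l * (1 / t) \<le> \<bar>g t / l\<bar> powr q t * (1 / t)" using t by (intro mult_right_mono) auto
          then show ?thesis using True t x[of i] l by (simp add: ennreal_mult[symmetric])
        qed simp
      qed
      also have "\<dots> \<le> 1" by (rule I)
      finally have "x i / l * w \<le> 1" by simp
      moreover have "D * w < x i / l * w" using xi w by (intro mult_strict_right_mono)
      ultimately show False using D(2) by linarith
    qed
    define h where "h = (\<lambda>i. x i / l / D)"
    have hD: "0 \<le> y / D \<and> y / D \<le> 1 \<and> y / D \<le> y" if "0 \<le> y" "y \<le> D" for y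
      using D(1) that mult_left_mono[of 1 D y] by (auto simp: divide_le_eq)
    have h: "0 \<le> h i" "h i \<le> 1" "h i \<le> x i / l" for i
      using hD[of "x i / l"] x[of i] l xl[of i] unfolding h_def by auto
    let ?G = "\<lambda>i t. ennreal (h i powr q t / t) * indicator (J i) t"
    let ?m = "\<lambda>i t. ennreal (exp (- \<bar>ln t\<bar>) / t) * indicator (J i) t"
    have summand: "ennreal w * ennreal (h i powr q 0) \<le> ennreal (exp c) * integral\<^sup>N lebesgue (?G i) + integral\<^sup>N lebesgue (?m i)" for i
    proof -
      have "ennreal w * ennreal (h i powr q 0) = (\<integral>\<^sup>+t. ennreal (h i powr q 0) * (ennreal (1 / t) * indicator (J i) t) \<partial>lebesgue)"
        using Jm[of i] by (subst nn_integral_cmult) (measurable, simp add: mult.commute)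
      also have "\<dots> \<le> (\<integral>\<^sup>+t. ennreal (exp c) * ?G i t + ?m i t \<partial>lebesgue)"
      proof (rule nn_integral_mono)
        fix t
        show "ennreal (h i powr q 0) * (ennreal (1 / t) * indicator (J i) t) \<le> ennreal (exp c) * ?G i t + ?m i t"
        proof (cases "t \<in> J i")
          case True
          have t: "0 < t" using Jpos[OF True] .
          have "h i powr q 0 \<le> exp c * h i powr q t + exp (- \<bar>ln t\<bar>)"
            using h q1 t c[OF t] by (intro powr_perturb_exponent) (auto simp: abs_minus_commute)
          then have "h i powr q 0 * (1 / t) \<le> (exp c * h i powr q t + exp (- \<bar>ln t\<bar>)) * (1 / t)"
            using t by (intro mult_right_mono) auto
          also have "\<dots> = exp c * (h i powr q t / t) + exp (- \<bar>ln t\<bar>) / t" by (simp add: add_divide_distrib)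
          finally show ?thesis using True t
            by (simp add: ennreal_mult[symmetric] ennreal_plus[symmetric] del: ennreal_plus)
        qed simp
      qed
      also have "\<dots> = ennreal (exp c) * integral\<^sup>N lebesgue (?G i) + integral\<^sup>N lebesgue (?m i)"
        by (subst nn_integral_add, measurable, subst nn_integral_cmult, measurable)
      finally show ?thesis .
    qed
    have SG: "(\<Sum>i. integral\<^sup>N lebesgue (?G i)) \<le> 1"
    proof -
      have "(\<Sum>i. integral\<^sup>N lebesgue (?G i)) = (\<integral>\<^sup>+t. (\<Sum>i. ?G i t) \<partial>lebesgue)"
        by (rule nn_integral_suminf[symmetric]) measurable
      also have "\<dots> \<le> (\<integral>\<^sup>+t\<in>{0<..}. ennreal (\<bar>g t / l\<bar> powr q t / t) \<partial>lebesgue)"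
      proof (intro nn_integral_mono at_most)
        fix t i assume t: "t \<in> J i"
        have "h i powr q t \<le> \<bar>g t / l\<bar> powr q t"
          using h[of i] xg'[OF t] q1[of t] l x[of i] by (intro powr_mono2) (auto simp: divide_right_mono intro: order_trans)
        then show "ennreal (h i powr q t / t) \<le> ennreal (\<bar>g t / l\<bar> powr q t / t) * indicator {0<..} t"
          using Jpos[OF t] by (simp add: divide_right_mono)
      qed
      finally show ?thesis using I by simp
    qed
    have Sm: "(\<Sum>i. integral\<^sup>N lebesgue (?m i)) \<le> ennreal 2"
    proof -
      have "(\<Sum>i. integral\<^sup>N lebesgue (?m i)) = (\<integral>\<^sup>+t. (\<Sum>i. ?m i t) \<partial>lebesgue)"
        by (rule nn_integral_suminf[symmetric]) measurable
      also have "\<dots> \<le> (\<integral>\<^sup>+t\<in>{0<..}. ennreal (exp (- \<bar>ln t\<bar>) / t) \<partial>lebesgue)"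
        using Jpos by (intro nn_integral_mono at_most) auto
      also have "\<dots> \<le> ennreal 2" using nn_integral_exp_abs_ln[of 1 1] by (simp add: nn_integral_completion)
      finally show ?thesis .
    qed
    have "ennreal w * (\<Sum>i. ennreal (h i powr q 0)) = (\<Sum>i. ennreal w * ennreal (h i powr q 0))" by simp
    also have "\<dots> \<le> (\<Sum>i. ennreal (exp c) * integral\<^sup>N lebesgue (?G i) + integral\<^sup>N lebesgue (?m i))"
      by (intro suminf_le summand) auto
    also have "\<dots> = ennreal (exp c) * (\<Sum>i. integral\<^sup>N lebesgue (?G i)) + (\<Sum>i. integral\<^sup>N lebesgue (?m i))"
      by (subst suminf_add[symmetric]) auto
    also have "\<dots> \<le> ennreal (exp c) * 1 + ennreal 2"
      by (intro add_mono mult_left_mono SG Sm) auto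
    also have "\<dots> = ennreal (exp c + 2)"
      using ennreal_plus[of "exp c" 2] by simp
    also have "\<dots> \<le> ennreal (E * w)" using E by (intro ennreal_leI)
    finally have S: "ennreal w * (\<Sum>i. ennreal (h i powr q 0)) \<le> ennreal (E * w)" .
    have "(\<Sum>i. ennreal ((x i / (D * E * l)) powr q 0)) \<le> (\<Sum>i. ennreal (1 / (E * w)) * (ennreal w * ennreal (h i powr q 0)))"
    proof (intro suminf_le)
      fix i
      have "(x i / (D * E * l)) powr q 0 = (1 / E) powr q 0 * h i powr q 0"
        unfolding h_def using x[of i] D E l by (subst powr_mult[symmetric]) (auto simp: field_simps)
      also have "\<dots> \<le> (1 / E) * h i powr q 0"
        using powr_mono'[of 1 "q 0" "1 / E"] E q1[of 0] by (intro mult_right_mono) auto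
      also have "\<dots> = (1 / (E * w)) * (w * h i powr q 0)" using w E by simp
      finally show "ennreal ((x i / (D * E * l)) powr q 0) \<le> ennreal (1 / (E * w)) * (ennreal w * ennreal (h i powr q 0))"
        using w E by (simp add: ennreal_mult[symmetric])
    qed auto
    also have "\<dots> = ennreal (1 / (E * w)) * (ennreal w * (\<Sum>i. ennreal (h i powr q 0)))" by simp
    also have "\<dots> \<le> ennreal (1 / (E * w)) * ennreal (E * w)" by (intro mult_left_mono S) auto
    also have "\<dots> = 1" using E w by (simp add: ennreal_mult[symmetric])
    finally show "(\<Sum>i. ennreal ((x i / (D * E * l)) powr q 0)) \<le> 1" .
  qed
qed

section \<open>Mixed sequence norms\<close>

lemma ennreal_le_if_le_greater:
  assumes "\<And>l. x < l \<Longrightarrow> I \<le> ennreal l"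
  shows "I \<le> ennreal x"
proof (rule ennreal_le_epsilon)
  fix e :: real assume e: "0 < e"
  show "I \<le> ennreal x + ennreal e"
  proof (cases "0 \<le> x")
    case True then show ?thesis using assms[of "x + e"] e by simp
  next
    case False
    then show ?thesis using assms[of 0] e by (simp add: ennreal_neg)
  qed
qed

lemma ennreal_le_suminf: "f k \<le> (\<Sum>k. f k :: ennreal)"
  using sum_le_suminf[of f "{k}"] by simp

lemma modular_mono:
  assumes "\<And>x. 0 \<le> p x" and "\<And>x. norm (f x) \<le> norm (g x)"
  shows "modular p f \<le> modular p g"
  unfolding modular_def using assms by (intro nn_integral_mono ennreal_leI powr_mono2) auto

lemma Lp_norm_le:
  assumes "0 < l" and "modular p (\<lambda>x. f x / of_real l) \<le> 1"
  shows "Lp_norm p f \<le> ennreal l"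
  unfolding Lp_norm_def using assms by (intro INF_lower2[of l]) auto

lemma modular_le_1_of_Lp_norm_less:
  assumes "\<And>x. 0 \<le> p x" and "Lp_norm p f < ennreal l"
  shows "modular p (\<lambda>x. f x / of_real l) \<le> 1"
proof -
  obtain k where k: "0 < k" "modular p (\<lambda>x. f x / of_real k) \<le> 1" "ennreal k < ennreal l"
    using assms(2) unfolding Lp_norm_def by (auto simp: INF_less_iff)
  then have "k < l" by (simp add: ennreal_less_iff)
  then have "modular p (\<lambda>x. f x / of_real l) \<le> modular p (\<lambda>x. f x / of_real k)"
    using assms(1) k by (intro modular_mono) (auto simp: norm_divide intro!: divide_left_mono)
  then show ?thesis using k by simp
qed

lemma Lp_norm_cmult_le:
  assumes p: "\<And>x. 0 \<le> p x" and c: "0 < c" and fg: "\<And>x. norm (f x) \<le> c * norm (g x)"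
  shows "Lp_norm p f \<le> ennreal c * Lp_norm p g"
proof -
  have "ennreal (1 / c) * Lp_norm p f \<le> Lp_norm p g"
    unfolding Lp_norm_def[of p g]
  proof (rule INF_greatest, safe)
    fix l :: real assume l: "0 < l" "modular p (\<lambda>x. g x / of_real l) \<le> 1"
    have "modular p (\<lambda>x. f x / of_real (c * l)) \<le> modular p (\<lambda>x. g x / of_real l)"
    proof (intro modular_mono p)
      fix x
      have "norm (f x) / (c * l) \<le> c * norm (g x) / (c * l)" using fg c l by (intro divide_right_mono) auto
      then show "norm (f x / of_real (c * l)) \<le> norm (g x / of_real l)"
        using c l by (simp add: norm_divide norm_mult)
    qed
    then have "Lp_norm p f \<le> ennreal (c * l)" using c l by (intro Lp_norm_le) auto
    then have "ennreal (1 / c) * Lp_norm p f \<le> ennreal (1 / c) * ennreal (c * l)" by (intro mult_left_mono) auto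
    also have "\<dots> = ennreal l" using c l by (simp add: ennreal_mult[symmetric])
    finally show "ennreal (1 / c) * Lp_norm p f \<le> ennreal l" .
  qed
  then have "ennreal c * (ennreal (1 / c) * Lp_norm p f) \<le> ennreal c * Lp_norm p g" by (intro mult_left_mono) auto
  moreover have "ennreal c * (ennreal (1 / c) * Lp_norm p f) = Lp_norm p f"
    using c by (simp add: mult.assoc[symmetric] ennreal_mult[symmetric])
  ultimately show ?thesis by simp
qed

lemma powr_convex_combination:
  fixes u v a b q :: real
  assumes q: "1 \<le> q" and uv: "0 \<le> u" "0 \<le> v" and ab: "0 \<le> a" "0 \<le> b" "a + b = 1"
  shows "(a * u + b * v) powr q \<le> a * u powr q + b * v powr q"
proof -
  have *: "(c * w) powr q \<le> c * w powr q" if "0 \<le> c" "c \<le> 1" for c w :: real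
  proof -
    have "c powr q \<le> c"
      using powr_mono'[of 1 q c] that q by (cases "c = 0") auto
    then show ?thesis by (simp add: powr_mult mult_right_mono)
  qed
  show ?thesis
  proof (cases "u = 0 \<or> v = 0")
    case True then show ?thesis using *[of a u] *[of b v] ab q by auto
  next
    case False
    then have "0 < u" "0 < v" using uv by auto
    then show ?thesis
      using convex_onD[OF powr_convex[OF q], of b u v] ab by (simp add: eq_diff_eq[THEN iffD2, OF ab(3)])
  qed
qed

text \<open>The usual argument for Luxemburg norms: if \<open>a\<close> and \<open>b\<close> are
  admissible for \<open>f\<close> and \<open>g\<close>, then \<open>(f + g) / (a + b)\<close> is the
  convex combination of \<open>f / a\<close> and \<open>g / b\<close> with weights
  \<open>a / (a + b)\<close> and \<open>b / (a + b)\<close>, and the modular is convex because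
  \<open>p \<ge> 1\<close>.\<close>

lemma Lp_norm_triangle:
  fixes f g :: "'a::euclidean_space \<Rightarrow> complex"
  assumes p: "\<And>x. 1 \<le> p x"
    and [measurable]: "p \<in> borel_measurable lebesgue" "f \<in> borel_measurable lebesgue" "g \<in> borel_measurable lebesgue"
  shows "Lp_norm p (\<lambda>x. f x + g x) \<le> Lp_norm p f + Lp_norm p g"
proof -
  have key: "Lp_norm p (\<lambda>x. f x + g x) \<le> ennreal (a + b)"
    if a: "0 < a" "modular p (\<lambda>x. f x / of_real a) \<le> 1" and b: "0 < b" "modular p (\<lambda>x. g x / of_real b) \<le> 1" for a b :: real
  proof (rule Lp_norm_le)
    let ?a = "a / (a + b)" and ?b = "b / (a + b)"
    have ab: "0 \<le> ?a" "0 \<le> ?b" "?a + ?b = 1" using a b by (auto simp: add_divide_distrib[symmetric])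
    have pt: "norm ((f x + g x) / of_real (a + b)) powr p x
      \<le> ?a * norm (f x / of_real a) powr p x + ?b * norm (g x / of_real b) powr p x" for x
    proof -
      have "norm ((f x + g x) / of_real (a + b)) \<le> (norm (f x) + norm (g x)) / (a + b)"
        unfolding norm_divide norm_of_real using a b norm_triangle_ineq[of "f x" "g x"]
        by (simp add: divide_right_mono)
      also have "\<dots> = ?a * norm (f x / of_real a) + ?b * norm (g x / of_real b)"
        using a b by (simp add: norm_divide add_divide_distrib)
      finally have "norm ((f x + g x) / of_real (a + b)) powr p x
        \<le> (?a * norm (f x / of_real a) + ?b * norm (g x / of_real b)) powr p x"
        using p[of x] by (intro powr_mono2) auto
      also have "\<dots> \<le> ?a * norm (f x / of_real a) powr p x + ?b * norm (g x / of_real b) powr p x"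
        using p ab by (intro powr_convex_combination) auto
      finally show ?thesis .
    qed
    have "modular p (\<lambda>x. (f x + g x) / of_real (a + b))
      \<le> (\<integral>\<^sup>+x. ennreal ?a * ennreal (norm (f x / of_real a) powr p x) + ennreal ?b * ennreal (norm (g x / of_real b) powr p x) \<partial>lebesgue)"
      unfolding modular_def
    proof (intro nn_integral_mono)
      fix x
      have "ennreal (norm ((f x + g x) / of_real (a + b)) powr p x)
        \<le> ennreal (?a * norm (f x / of_real a) powr p x + ?b * norm (g x / of_real b) powr p x)"
        by (intro ennreal_leI pt)
      also have "\<dots> = ennreal (?a * norm (f x / of_real a) powr p x) + ennreal (?b * norm (g x / of_real b) powr p x)"
        by (rule ennreal_plus; intro mult_nonneg_nonneg powr_ge_zero ab)
      also have "\<dots> = ennreal ?a * ennreal (norm (f x / of_real a) powr p x) + ennreal ?b * ennreal (norm (g x / of_real b) powr p x)"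
        using ab by (simp only: ennreal_mult powr_ge_zero)
      finally show "ennreal (norm ((f x + g x) / of_real (a + b)) powr p x)
        \<le> ennreal ?a * ennreal (norm (f x / of_real a) powr p x) + ennreal ?b * ennreal (norm (g x / of_real b) powr p x)" .
    qed
    also have "\<dots> = ennreal ?a * modular p (\<lambda>x. f x / of_real a) + ennreal ?b * modular p (\<lambda>x. g x / of_real b)"
      unfolding modular_def
      by (subst nn_integral_add, measurable, subst nn_integral_cmult, measurable, subst nn_integral_cmult, measurable)
    also have "\<dots> \<le> ennreal ?a * 1 + ennreal ?b * 1"
      using a b by (intro add_mono mult_left_mono) auto
    also have "\<dots> = 1" using ab ennreal_plus[of ?a ?b] by simp
    finally show "modular p (\<lambda>x. (f x + g x) / of_real (a + b)) \<le> 1" .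
  qed (use a b in auto)
  show ?thesis
  proof (cases "Lp_norm p f = top \<or> Lp_norm p g = top")
    case False
    show ?thesis
    proof (rule ennreal_le_epsilon)
      fix e :: real assume e: "0 < e"
      have *: "\<exists>l>0. modular p (\<lambda>x. h x / of_real l) \<le> 1 \<and> ennreal l \<le> Lp_norm p h + ennreal (e / 2)"
        if "Lp_norm p h \<noteq> top" for h
      proof -
        have "Lp_norm p h < Lp_norm p h + ennreal (e / 2)" using that e
          by (cases "Lp_norm p h") (auto simp: ennreal_plus[symmetric] ennreal_less_iff simp del: ennreal_plus)
        then show ?thesis unfolding Lp_norm_def[of p h] by (subst (asm) INF_less_iff) (auto intro: less_imp_le)
      qed
      obtain a where a: "0 < a" "modular p (\<lambda>x. f x / of_real a) \<le> 1" "ennreal a \<le> Lp_norm p f + ennreal (e / 2)"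
        using *[of f] False by auto
      obtain b where b: "0 < b" "modular p (\<lambda>x. g x / of_real b) \<le> 1" "ennreal b \<le> Lp_norm p g + ennreal (e / 2)"
        using *[of g] False by auto
      have "Lp_norm p (\<lambda>x. f x + g x) \<le> ennreal a + ennreal b" using key[OF a(1,2) b(1,2)] a b by simp
      also have "\<dots> \<le> (Lp_norm p f + ennreal (e / 2)) + (Lp_norm p g + ennreal (e / 2))" by (intro add_mono a b)
      also have "\<dots> = Lp_norm p f + Lp_norm p g + (ennreal (e / 2) + ennreal (e / 2))" by (simp add: add_ac)
      also have "ennreal (e / 2) + ennreal (e / 2) = ennreal e" using e ennreal_plus[of "e/2" "e/2"] by simp
      finally show "Lp_norm p (\<lambda>x. f x + g x) \<le> Lp_norm p f + Lp_norm p g + ennreal e" .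
    qed
  qed auto
qed

lemma Lp_norm_zero [simp]: "Lp_norm p (\<lambda>_. 0) = 0"
proof -
  have "Lp_norm p (\<lambda>_. 0) \<le> ennreal 0"
  proof (rule ennreal_le_if_le_greater)
    fix l :: real assume "0 < l"
    then show "Lp_norm p (\<lambda>_. 0) \<le> ennreal l" by (intro Lp_norm_le) (auto simp: modular_def)
  qed
  then show ?thesis by simp
qed

lemma Lp_norm_sum_le:
  fixes f :: "'i \<Rightarrow> 'a::euclidean_space \<Rightarrow> complex"
  assumes p: "\<And>x. 1 \<le> p x" and pm: "p \<in> borel_measurable lebesgue"
    and fm: "\<And>i. i \<in> I \<Longrightarrow> f i \<in> borel_measurable lebesgue"
  shows "Lp_norm p (\<lambda>x. \<Sum>i\<in>I. f i x) \<le> (\<Sum>i\<in>I. Lp_norm p (f i))"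
  using fm
proof (induction I rule: infinite_finite_induct)
  case (insert i I)
  have "Lp_norm p (\<lambda>x. f i x + (\<Sum>i\<in>I. f i x)) \<le> Lp_norm p (f i) + Lp_norm p (\<lambda>x. \<Sum>i\<in>I. f i x)"
    using insert by (intro Lp_norm_triangle p pm borel_measurable_sum) auto
  also have "\<dots> \<le> Lp_norm p (f i) + (\<Sum>i\<in>I. Lp_norm p (f i))"
    using insert by (intro add_left_mono) auto
  finally show ?case using insert by simp
qed auto

text \<open>A single summand of the mixed modular is at most 1, and for a scale
  \<open>k / m > 1\<close> above an admissible \<open>l\<close> one has
  \<open>l powr (1 / r x) \<le> k / m\<close> for every \<open>r x \<ge> 1\<close>. So the variable
  sequence exponent disappears.\<close>

lemma Lp_norm_le_mixed_norm:
  assumes p: "\<And>x. 0 \<le> p x" and r: "\<And>x. 1 \<le> r x"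
  shows "Lp_norm p (f j) \<le> mixed_norm p r f"
  unfolding mixed_norm_def
proof (rule INF_greatest, safe)
  fix m :: real assume m: "0 < m" and le: "mixed_modular p r (\<lambda>j x. f j x / of_real m) \<le> 1"
  let ?I = "\<lambda>j. INF l\<in>{l::real. 0 < l \<and> modular p (\<lambda>x. f j x / of_real m / of_real (l powr (1 / r x))) \<le> 1}. ennreal l"
  have "?I j \<le> (\<Sum>j. ?I j)" using sum_le_suminf[of ?I "{j}"] by simp
  then have I: "?I j \<le> 1" using le unfolding mixed_modular_def by (rule order_trans)
  show "Lp_norm p (f j) \<le> ennreal m"
  proof (rule ennreal_le_if_le_greater)
    fix k assume k: "m < k"
    have "?I j < ennreal (k / m)"
      using I k m by (intro le_less_trans[OF I]) (simp add: ennreal_1[symmetric] ennreal_less_iff del: ennreal_1)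
    then obtain l where l: "0 < l" "modular p (\<lambda>x. f j x / of_real m / of_real (l powr (1 / r x))) \<le> 1" "l < k / m"
      using k m by (auto simp: INF_less_iff ennreal_less_iff)
    have "modular p (\<lambda>x. f j x / of_real k) \<le> modular p (\<lambda>x. f j x / of_real m / of_real (l powr (1 / r x)))"
    proof (intro modular_mono p)
      fix x
      have "l powr (1 / r x) \<le> (k / m) powr (1 / r x)" using l r[of x] by (intro powr_mono2) auto
      also have "\<dots> \<le> (k / m) powr 1" using k m r[of x] by (intro powr_mono) auto
      finally have "m * l powr (1 / r x) \<le> k" using k m by (simp add: field_simps)
      then have "norm (f j x) / k \<le> norm (f j x) / (m * l powr (1 / r x))"
        using k m l by (intro divide_left_mono) auto
      then show "norm (f j x / of_real k) \<le> norm (f j x / of_real m / of_real (l powr (1 / r x)))"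
        using k m l by (simp add: norm_divide norm_mult)
    qed
    then show "Lp_norm p (f j) \<le> ennreal k" using l k m by (intro Lp_norm_le) auto
  qed
qed

text \<open>The opposite end of the sandwich around the mixed norm: for \<open>l \<le> 1\<close> one
  has \<open>l \<le> l powr (1 / r x)\<close>, so once \<open>m\<close> exceeds the sum, each inner
  infimum is at most the \<open>L\<^sup>p\<close> norm of the block divided by
  \<open>m\<close>.\<close>

lemma mixed_norm_le_suminf:
  assumes p: "\<And>x. 0 \<le> p x" and r: "\<And>x. 1 \<le> r x"
  shows "mixed_norm p r f \<le> (\<Sum>j. Lp_norm p (f j))"
proof (cases "(\<Sum>j. Lp_norm p (f j)) = top")
  case False
  then obtain S where S: "(\<Sum>j. Lp_norm p (f j)) = ennreal S" "0 \<le> S" by (cases "\<Sum>j. Lp_norm p (f j)") auto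
  show ?thesis unfolding S(1)
  proof (rule ennreal_le_if_le_greater)
    fix m assume m: "S < m"
    have m0: "0 < m" using m S by simp
    have fj: "Lp_norm p (f j) \<le> ennreal S" for j
      using sum_le_suminf[of "\<lambda>j. Lp_norm p (f j)" "{j}"] S by simp
    have "mixed_modular p r (\<lambda>j x. f j x / of_real m) \<le> (\<Sum>j. ennreal (1 / m) * Lp_norm p (f j))"
      unfolding mixed_modular_def
    proof (intro suminf_le)
      fix j
      obtain b where b: "Lp_norm p (f j) = ennreal b" "0 \<le> b" "b \<le> S"
        using fj[of j] S by (cases "Lp_norm p (f j)") (auto simp: top_unique)
      have "(INF l\<in>{l::real. 0 < l \<and> modular p (\<lambda>x. f j x / of_real m / of_real (l powr (1 / r x))) \<le> 1}. ennreal l) \<le> ennreal (b / m)"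
      proof (rule ennreal_le_if_le_greater)
        fix l0 assume l0: "b / m < l0"
        \<comment> \<open>The cap at 1 makes \<open>l \<le> l powr (1 / r x)\<close> available; it
          keeps \<open>b / m < l\<close> because \<open>b / m < 1\<close>.\<close>
        define l where "l = min l0 1"
        have "0 \<le> b / m" "b / m < 1" using b m m0 by auto
        then have l: "b / m < l" "l \<le> 1" "0 < l" "l \<le> l0" unfolding l_def using l0 by auto
        have "modular p (\<lambda>x. f j x / of_real m / of_real (l powr (1 / r x))) \<le> modular p (\<lambda>x. f j x / of_real (m * l))"
        proof (intro modular_mono p)
          fix x
          have "l powr 1 \<le> l powr (1 / r x)" using l r[of x] by (intro powr_mono') auto
          then have "norm (f j x) / (m * l powr (1 / r x)) \<le> norm (f j x) / (m * l)"
            using m0 l by (intro divide_left_mono) auto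
          then show "norm (f j x / of_real m / of_real (l powr (1 / r x))) \<le> norm (f j x / of_real (m * l))"
            using m0 l by (simp add: norm_divide norm_mult)
        qed
        also have "\<dots> \<le> 1"
          using b l m0 by (intro modular_le_1_of_Lp_norm_less p) (simp add: ennreal_less_iff field_simps)
        finally have "(INF l\<in>{l::real. 0 < l \<and> modular p (\<lambda>x. f j x / of_real m / of_real (l powr (1 / r x))) \<le> 1}. ennreal l) \<le> ennreal l"
          using l by (intro INF_lower) auto
        also have "\<dots> \<le> ennreal l0" using l by (intro ennreal_leI)
        finally show "(INF l\<in>{l::real. 0 < l \<and> modular p (\<lambda>x. f j x / of_real m / of_real (l powr (1 / r x))) \<le> 1}. ennreal l) \<le> ennreal l0" .
      qed
      then show "(INF l\<in>{l::real. 0 < l \<and> modular p (\<lambda>x. f j x / of_real m / of_real (l powr (1 / r x))) \<le> 1}. ennreal l)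
          \<le> ennreal (1 / m) * Lp_norm p (f j)"
        unfolding b(1) using b m0 by (simp add: ennreal_mult[symmetric])
    qed auto
    also have "\<dots> = ennreal (1 / m) * ennreal S" using S by simp
    also have "\<dots> \<le> 1" using m0 m S by (simp add: ennreal_mult[symmetric])
    finally show "mixed_norm p r f \<le> ennreal m"
      unfolding mixed_norm_def using m0 by (intro INF_lower) auto
  qed
qed auto

text \<open>For a constant exponent the inner infimum is the power \<open>r\<close> of the
  \<open>L\<^sup>p\<close> norm. This lemma and the next express the resulting formula for the norm
  as two implications about the normalised sum, which also suits norms that may be infinite.\<close>

lemma mixed_norm_const_exponent_le:
  assumes p: "\<And>x. 0 \<le> p x" and r: "1 \<le> r" and m: "0 < m"
    and b: "\<And>j. Lp_norm p (f j) \<le> ennreal (b j)" "\<And>j. 0 \<le> b j"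
    and S: "(\<Sum>j. ennreal ((b j / m) powr r)) \<le> 1"
  shows "mixed_norm p (\<lambda>_. r) f \<le> ennreal m"
proof -
  have "mixed_modular p (\<lambda>_. r) (\<lambda>j x. f j x / of_real m) \<le> (\<Sum>j. ennreal ((b j / m) powr r))"
    unfolding mixed_modular_def
  proof (intro suminf_le)
    fix j
    show "(INF l\<in>{l::real. 0 < l \<and> modular p (\<lambda>x. f j x / of_real m / of_real (l powr (1 / r))) \<le> 1}. ennreal l) \<le> ennreal ((b j / m) powr r)"
    proof (rule ennreal_le_if_le_greater)
      fix l assume l: "(b j / m) powr r < l"
      have l0: "0 < l" using l by (meson le_less_trans powr_ge_zero)
      have "((b j / m) powr r) powr (1 / r) < l powr (1 / r)"
        using l r by (intro powr_less_mono2) auto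
      then have "b j / m < l powr (1 / r)" using b(2)[of j] m r by (simp add: powr_powr)
      then have "b j < m * l powr (1 / r)" using m by (simp add: field_simps)
      then have "Lp_norm p (f j) < ennreal (m * l powr (1 / r))"
        using b(2)[of j] by (intro le_less_trans[OF b(1)]) (simp add: ennreal_less_iff)
      then have "modular p (\<lambda>x. f j x / of_real (m * l powr (1 / r))) \<le> 1"
        by (intro modular_le_1_of_Lp_norm_less p)
      then show "(INF l\<in>{l::real. 0 < l \<and> modular p (\<lambda>x. f j x / of_real m / of_real (l powr (1 / r))) \<le> 1}. ennreal l) \<le> ennreal l"
        using l0 by (intro INF_lower) auto
    qed
  qed auto
  then show ?thesis unfolding mixed_norm_def using m S by (intro INF_lower) auto
qed

text \<open>The strict inequality provides an admissible scale \<open>k\<close> below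
  \<open>m\<close>, since the infimum defining the norm need not be attained.\<close>

lemma suminf_le_of_mixed_norm_less:
  assumes p: "\<And>x. 0 \<le> p x" and r: "1 \<le> r"
    and m: "mixed_norm p (\<lambda>_. r) f < ennreal m"
  shows "(\<Sum>j. ennreal ((enn2real (Lp_norm p (f j)) / m) powr r)) \<le> 1"
proof -
  obtain k where k: "0 < k" "mixed_modular p (\<lambda>_. r) (\<lambda>j x. f j x / of_real k) \<le> 1" "ennreal k < ennreal m"
    using m unfolding mixed_norm_def by (auto simp: INF_less_iff)
  have km: "k < m" using k by (simp add: ennreal_less_iff)
  have "(\<Sum>j. ennreal ((enn2real (Lp_norm p (f j)) / m) powr r)) \<le> mixed_modular p (\<lambda>_. r) (\<lambda>j x. f j x / of_real k)"
    unfolding mixed_modular_def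
  proof (intro suminf_le INF_greatest, safe)
    fix j and l :: real assume l: "0 < l" "modular p (\<lambda>x. f j x / of_real k / of_real (l powr (1 / r))) \<le> 1"
    have "Lp_norm p (f j) \<le> ennreal (k * l powr (1 / r))"
      using l k by (intro Lp_norm_le) auto
    then have "enn2real (Lp_norm p (f j)) \<le> k * l powr (1 / r)" using k by (intro enn2real_leI) auto
    also have "\<dots> \<le> m * l powr (1 / r)" using km by (intro mult_right_mono) auto
    finally have "enn2real (Lp_norm p (f j)) / m \<le> l powr (1 / r)" using k km by (simp add: field_simps)
    then have "(enn2real (Lp_norm p (f j)) / m) powr r \<le> (l powr (1 / r)) powr r"
      using k km r by (intro powr_mono2) auto
    then show "ennreal ((enn2real (Lp_norm p (f j)) / m) powr r) \<le> ennreal l"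
      using l r by (simp add: powr_powr ennreal_leI)
  qed auto
  then show ?thesis using k by simp
qed

section \<open>Kernels acting on variable exponent Lebesgue spaces\<close>

lemma lborel_nn_integral_affine:
  fixes t :: "'a::euclidean_space" and f :: "'a \<Rightarrow> ennreal"
  assumes c: "c \<noteq> 0" and [measurable]: "f \<in> borel_measurable borel"
  shows "(\<integral>\<^sup>+x. ennreal (\<bar>c\<bar> ^ DIM('a)) * f (t + c *\<^sub>R x) \<partial>lborel) = (\<integral>\<^sup>+x. f x \<partial>lborel)"
proof -
  have "(\<integral>\<^sup>+x. f x \<partial>lborel) = (\<integral>\<^sup>+x. f x \<partial>density (distr lborel borel (\<lambda>x. t + c *\<^sub>R x)) (\<lambda>_. \<bar>c\<bar> ^ DIM('a)))"
    using lborel_affine[OF c, of t] by simp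
  also have "\<dots> = (\<integral>\<^sup>+x. ennreal (\<bar>c\<bar> ^ DIM('a)) * f x \<partial>distr lborel borel (\<lambda>x. t + c *\<^sub>R x))"
    by (subst nn_integral_density) auto
  also have "\<dots> = (\<integral>\<^sup>+x. ennreal (\<bar>c\<bar> ^ DIM('a)) * f (t + c *\<^sub>R x) \<partial>lborel)"
    by (subst nn_integral_distr) auto
  finally show ?thesis by simp
qed

text \<open>The integrand is dominated by a sum of multiples of indicators of the balls of radius
  \<open>k + 1\<close>. The volume takes \<open>n\<close> of the \<open>n + 2\<close> powers of
  \<open>k + 1\<close>, so the convergent series of inverse squares remains.\<close>

lemma nn_integral_decay_finite:
  "(\<integral>\<^sup>+(x::'a::euclidean_space). ennreal ((1 + norm x) powr (- (real DIM('a) + 2))) \<partial>lborel) < top"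
proof -
  let ?n = "DIM('a)" and ?V = "unit_ball_vol (real DIM('a))"
  have V: "0 \<le> ?V" by simp
  have "(\<integral>\<^sup>+(x::'a). ennreal ((1 + norm x) powr (- (real ?n + 2))) \<partial>lborel)
    \<le> (\<integral>\<^sup>+(x::'a). (\<Sum>k. ennreal (inverse (real (Suc k) ^ (?n + 2))) * indicator (cball 0 (real (Suc k))) x) \<partial>lborel)"
  proof (rule nn_integral_mono)
    fix x :: 'a
    define k where "k = nat \<lfloor>norm x\<rfloor>"
    have "real k = of_int \<lfloor>norm x\<rfloor>" unfolding k_def by simp
    then have k: "real k \<le> norm x" "norm x \<le> real (Suc k)" by linarith+
    have "(1 + norm x) powr (- (real ?n + 2)) \<le> real (Suc k) powr (- (real ?n + 2))"
      using k by (intro powr_mono2') auto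
    also have "\<dots> = inverse (real (Suc k) powr (real ?n + 2))" by (rule powr_minus)
    also have "real (Suc k) powr (real ?n + 2) = real (Suc k) ^ (?n + 2)"
      using powr_realpow[of "real (Suc k)" "?n + 2"] unfolding of_nat_add of_nat_numeral by simp
    finally have "ennreal ((1 + norm x) powr (- (real ?n + 2)))
      \<le> ennreal (inverse (real (Suc k) ^ (?n + 2))) * indicator (cball 0 (real (Suc k))) x"
      using k by (simp add: ennreal_leI)
    also have "\<dots> \<le> (\<Sum>k. ennreal (inverse (real (Suc k) ^ (?n + 2))) * indicator (cball 0 (real (Suc k))) x)"
      by (rule ennreal_le_suminf)
    finally show "ennreal ((1 + norm x) powr (- (real ?n + 2)))
      \<le> (\<Sum>k. ennreal (inverse (real (Suc k) ^ (?n + 2))) * indicator (cball 0 (real (Suc k))) x)" .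
  qed
  also have "\<dots> = (\<Sum>k. (\<integral>\<^sup>+(x::'a). ennreal (inverse (real (Suc k) ^ (?n + 2))) * indicator (cball 0 (real (Suc k))) x \<partial>lborel))"
  proof (rule nn_integral_suminf)
    fix k
    have [measurable]: "cball (0::'a) (real (Suc k)) \<in> sets borel" by simp
    show "(\<lambda>x::'a. ennreal (inverse (real (Suc k) ^ (?n + 2))) * indicator (cball 0 (real (Suc k))) x) \<in> borel_measurable lborel"
      by measurable
  qed
  also have "\<dots> = (\<Sum>k. ennreal (?V * inverse (real (Suc k) ^ 2)))"
  proof (rule arg_cong[where f = suminf], rule ext)
    fix k
    have "(\<integral>\<^sup>+(x::'a). ennreal (inverse (real (Suc k) ^ (?n + 2))) * indicator (cball 0 (real (Suc k))) x \<partial>lborel)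
      = ennreal (inverse (real (Suc k) ^ (?n + 2))) * emeasure lborel (cball (0::'a) (real (Suc k)))"
      by (rule nn_integral_cmult_indicator) auto
    also have "\<dots> = ennreal (inverse (real (Suc k) ^ (?n + 2))) * ennreal (?V * real (Suc k) ^ ?n)"
      by (subst emeasure_cball) auto
    also have "\<dots> = ennreal (inverse (real (Suc k) ^ (?n + 2)) * (?V * real (Suc k) ^ ?n))"
      by (rule ennreal_mult[symmetric]) auto
    also have "inverse (real (Suc k) ^ (?n + 2)) * (?V * real (Suc k) ^ ?n) = ?V * inverse (real (Suc k) ^ 2)"
      by (simp add: power_add power2_eq_square field_simps del: of_nat_Suc)
    finally show "(\<integral>\<^sup>+(x::'a). ennreal (inverse (real (Suc k) ^ (?n + 2))) * indicator (cball 0 (real (Suc k))) x \<partial>lborel)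
      = ennreal (?V * inverse (real (Suc k) ^ 2))" .
  qed
  also have "\<dots> < top"
  proof -
    have "summable (\<lambda>k. ?V * inverse (real (Suc k) ^ 2))"
      using iffD2[OF summable_Suc_iff inverse_power_summable[of 2, where ?'a = real]] by (intro summable_mult) simp
    then show ?thesis using V by (subst suminf_ennreal2) auto
  qed
  finally show ?thesis .
qed

lemma nn_integral_scaled_decay:
  fixes x :: "'a::euclidean_space"
  assumes s: "0 < s"
  shows "(\<integral>\<^sup>+y. ennreal (s ^ DIM('a) * (1 + s * norm (x - y)) powr m) \<partial>lborel)
    = (\<integral>\<^sup>+(y::'a). ennreal ((1 + norm y) powr m) \<partial>lborel)"
proof -
  have "(\<integral>\<^sup>+(y::'a). ennreal ((1 + norm y) powr m) \<partial>lborel)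
    = (\<integral>\<^sup>+y. ennreal (\<bar>- s\<bar> ^ DIM('a)) * ennreal ((1 + norm (s *\<^sub>R x + (- s) *\<^sub>R y)) powr m) \<partial>lborel)"
    using s by (intro lborel_nn_integral_affine[symmetric]) auto
  also have "(\<lambda>y. ennreal (\<bar>- s\<bar> ^ DIM('a)) * ennreal ((1 + norm (s *\<^sub>R x + (- s) *\<^sub>R y)) powr m))
    = (\<lambda>y. ennreal (s ^ DIM('a) * (1 + s * norm (x - y)) powr m))"
  proof
    fix y
    have "norm (s *\<^sub>R x + (- s) *\<^sub>R y) = s * norm (x - y)"
      using s by (simp add: scaleR_diff_right[symmetric])
    then show "ennreal (\<bar>- s\<bar> ^ DIM('a)) * ennreal ((1 + norm (s *\<^sub>R x + (- s) *\<^sub>R y)) powr m)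
      = ennreal (s ^ DIM('a) * (1 + s * norm (x - y)) powr m)"
      using s by (simp only: abs_minus_cancel abs_of_pos) (simp add: ennreal_mult)
  qed
  finally show ?thesis by simp
qed

lemma C_log_loc_continuous:
  fixes g :: "'a::euclidean_space \<Rightarrow> real"
  assumes "g \<in> C_log_loc"
  shows "continuous_on UNIV g"
proof -
  obtain c where c: "c > 0" "\<And>x y. \<bar>g x - g y\<bar> \<le> c / ln (exp 1 + 1 / norm (x - y))"
    using assms unfolding C_log_loc_def by auto
  have "\<exists>d>0. \<forall>y. dist y x < d \<longrightarrow> dist (g y) (g x) < e" if e: "0 < e" for x e
  proof (intro exI[of _ "1 / exp (c / e)"] conjI allI impI)
    fix y assume "dist y x < 1 / exp (c / e)"
    show "dist (g y) (g x) < e"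
    proof (cases "y = x")
      case False
      then have n: "0 < norm (y - x)" by simp
      have "norm (y - x) < 1 / exp (c / e)" using \<open>dist y x < _\<close> by (simp add: dist_norm)
      then have "exp (c / e) < 1 / norm (y - x)" using n by (simp add: field_simps)
      also have "\<dots> < exp 1 + 1 / norm (y - x)" by simp
      finally have "c / e < ln (exp 1 + 1 / norm (y - x))"
        by (metis exp_gt_zero exp_less_cancel_iff exp_ln less_trans)
      moreover have "0 < c / e" using c e by simp
      ultimately have "0 < ln (exp 1 + 1 / norm (y - x))" "c < e * ln (exp 1 + 1 / norm (y - x))"
        using e by (linarith, simp add: field_simps)
      then have "c / ln (exp 1 + 1 / norm (y - x)) < e"
        by (simp add: divide_less_eq)
      then show ?thesis using c(2)[of y x] by (simp add: dist_real_def)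
    qed (use e in simp)
  qed simp
  then show ?thesis by (auto simp: continuous_on_iff)
qed

text \<open>With \<open>r\<close> the distance of the points and \<open>L = ln (e + 1 / r)\<close>,
  the inequality \<open>s \<le> (1 + s * r) * (e + 1 / r)\<close> gives
  \<open>ln s \<le> ln (1 + s * r) + L\<close>. Multiplication by \<open>D \<le> c / L\<close>
  leaves at most \<open>c * ln (1 + s * r) + c\<close>. With \<open>s = 2 ^ k\<close> this moves a
  variable weight from one point to another at the price of a power of
  \<open>1 + s * r\<close>.\<close>

lemma log_Hoelder_weight_bound:
  fixes a b :: "'a::real_normed_vector"
  assumes c: "0 < c" and D: "0 \<le> D" "D \<le> c / ln (exp 1 + 1 / norm (a - b))" and s: "1 \<le> s"
    and D0: "a = b \<Longrightarrow> D = 0"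
  shows "s powr D \<le> exp c * (1 + s * norm (a - b)) powr c"
proof (cases "a = b")
  case True then show ?thesis using D0 s c by simp
next
  case False
  define r where "r = norm (a - b)"
  have r: "0 < r" using False unfolding r_def by simp
  define L where "L = ln (exp 1 + 1 / r)"
  have L: "1 \<le> L" unfolding L_def using r by (subst ln_ge_iff) (auto intro: add_pos_pos)
  have sr: "0 < s * r" using r s by simp
  have "s = (s * r) * (1 / r)" using r by simp
  also have "\<dots> \<le> (1 + s * r) * (exp 1 + 1 / r)" using r s by (intro mult_mono) auto
  finally have "ln s \<le> ln ((1 + s * r) * (exp 1 + 1 / r))"
    using r s by (subst ln_le_cancel_iff) (auto intro!: mult_pos_pos add_pos_pos add_pos_nonneg)
  also have "\<dots> = ln (1 + s * r) + L" unfolding L_def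
    using sr r by (intro ln_mult_pos) (auto intro!: add_pos_pos)
  finally have ls: "ln s \<le> ln (1 + s * r) + L" .
  have l0: "0 \<le> ln (1 + s * r)" using r s by simp
  have "D * ln s \<le> c / L * (ln (1 + s * r) + L)"
    using D ls s L l0 c unfolding L_def r_def by (intro mult_mono) auto
  also have "\<dots> = c * (ln (1 + s * r) / L) + c" using L by (simp add: field_simps)
  also have "\<dots> \<le> c * ln (1 + s * r) + c"
    using c L l0 by (intro add_right_mono mult_left_mono) (auto simp: divide_le_eq mult_left_mono[of 1 L, simplified])
  finally have "exp (D * ln s) \<le> exp (c * ln (1 + s * r) + c)" by simp
  also have "\<dots> = exp c * (1 + s * r) powr c" using sr by (simp add: powr_def exp_add)
  also have "exp (D * ln s) = s powr D" using s by (simp add: powr_def)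
  finally show ?thesis unfolding r_def .
qed

text \<open>Boundedness, uniform in the scale \<open>s\<close>, of convolution with kernels of high
  polynomial decay. For \<open>f\<close> of modular at most 1, \<open>G x\<close> is compared
  pointwise with \<open>J x powr (1 / p x)\<close>, where \<open>J\<close> is essentially the
  convolution of \<open>norm f powr p\<close> with an integrable kernel, so that the integral of
  \<open>J\<close> is bounded. The exponent \<open>1 / p y\<close> that arises under the integral is
  exchanged for \<open>1 / p x\<close> by log-Hoelder continuity; this costs powers of
  \<open>1 + s * norm (x - y)\<close>, which the decay has to supply.\<close>

lemma kernel_Lp_norm_bound:
  fixes p :: "'a::euclidean_space \<Rightarrow> real"
  assumes p: "p \<in> log_exponents"
  obtains C M :: real where "0 < C" and "0 \<le> M"
    and "\<And>s f G. \<lbrakk>1 \<le> s; f \<in> borel_measurable borel;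
      \<And>x. ennreal (norm (G x)) \<le> (\<integral>\<^sup>+y. ennreal (s ^ DIM('a) * (1 + s * norm (x - y)) powr (- M) * norm (f y)) \<partial>lborel)\<rbrakk>
      \<Longrightarrow> Lp_norm p G \<le> ennreal C * Lp_norm p f"
proof -
  define n where "n = real DIM('a)"
  have n1: "1 \<le> n" unfolding n_def using DIM_positive[where 'a = 'a] by linarith
  have p1: "1 \<le> p x" for x using p unfolding log_exponents_def exponents_def by auto
  have p0: "0 \<le> p x" "0 < p x" for x using p1[of x] by linarith+
  have ploc: "(\<lambda>x. 1 / p x) \<in> C_log_loc" using p unfolding log_exponents_def C_log_def by auto
  have "continuous_on UNIV (\<lambda>x. inverse (1 / p x))"
    using p0(2) by (intro continuous_on_inverse C_log_loc_continuous[OF ploc]) (auto simp: less_imp_neq[symmetric])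
  then have "continuous_on UNIV p" by simp
  then have [measurable]: "p \<in> borel_measurable borel" by (rule borel_measurable_continuous_onI)
  obtain c1 where c1: "0 < c1" "\<And>x y. \<bar>1 / p x - 1 / p y\<bar> \<le> c1 / ln (exp 1 + 1 / norm (x - y))"
    using ploc unfolding C_log_loc_def by auto
  obtain c2 P where c2: "0 < c2" "\<And>x. \<bar>1 / p x - P\<bar> \<le> c2 / ln (exp 1 + norm x)"
    using p unfolding log_exponents_def C_log_def log_hoelder_at_infinity_def by auto
  \<comment> \<open>The two losses in \<open>Ebound\<close>: \<open>n * c1\<close> from local
    continuity, because \<open>J \<le> 2 * s powr n\<close>, and \<open>(n + 2) * c2\<close> from
    the decay condition, because \<open>J\<close> is at least the power \<open>- (n + 2)\<close> of
    \<open>e + norm x\<close>.\<close>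
  define M where "M = n * c1 + (n + 2) * c2"
  define E where "E = 2 * exp (n * c1 + 2 * (n + 2) * c2)"
  have M0: "0 \<le> M" unfolding M_def using n1 c1 c2 by simp
  have E0: "0 < E" unfolding E_def by simp
  define K where "K = enn2real (\<integral>\<^sup>+(x::'a). ennreal ((1 + norm x) powr (- (n + 2))) \<partial>lborel)"
  have K: "(\<integral>\<^sup>+(x::'a). ennreal ((1 + norm x) powr (- (n + 2))) \<partial>lborel) = ennreal K" "0 \<le> K"
    unfolding K_def n_def using nn_integral_decay_finite[where 'a = 'a] by auto
  \<comment> \<open>A bound for the integral of \<open>J\<close>: one \<open>K\<close> from the
    convolution and one from its added floor. The 1 ensures \<open>D \<ge> 1\<close>, hence
    \<open>(1 / D) powr p x \<le> 1 / D\<close>.\<close>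
  define D where "D = 2 * K + 1"
  have D: "1 \<le> D" unfolding D_def using K by simp
  define C where "C = E * (K + 1) * D"
  have C: "0 < C" unfolding C_def using E0 K D by simp

  \<comment> \<open>The exchange of exponents. For \<open>J \<ge> 1\<close> only the upper bound of
    \<open>J\<close> and local continuity at scale \<open>s\<close> matter; for \<open>J < 1\<close>
    only the lower bound of \<open>J\<close> and the condition at infinity.\<close>
  have Ebound: "J powr (1 / p y - 1 / p x) \<le> E * (1 + s * norm (x - y)) powr M"
    if s: "1 \<le> s" and J: "(exp 1 + norm x) powr (- (n + 2)) \<le> J" "J \<le> 2 * s powr n" for J s x y
  proof -
    define d where "d = \<bar>1 / p y - 1 / p x\<bar>"
    have d1: "0 \<le> d" "d \<le> 1"
    proof -
      have "0 < 1 / p y" "1 / p y \<le> 1" "0 < 1 / p x" "1 / p x \<le> 1" using p1[of x] p1[of y] p0(2) by auto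
      then show "0 \<le> d" "d \<le> 1" unfolding d_def by linarith+
    qed
    have ex: "0 < exp 1 + norm x" by (simp add: add_pos_nonneg)
    have "0 < (exp 1 + norm x) powr (- (n + 2))" using ex by simp
    then have J0: "0 < J" using J(1) by linarith
    have sr1: "1 \<le> 1 + s * norm (x - y)" using s by simp
    have pmono: "(1 + s * norm (x - y)) powr k \<le> (1 + s * norm (x - y)) powr M" if "k \<le> M" for k
      using sr1 that by (intro powr_mono) auto
    show ?thesis
    proof (cases "1 \<le> J")
      case True
      have "J powr (1 / p y - 1 / p x) \<le> J powr d" unfolding d_def using True by (intro powr_mono) auto
      also have "\<dots> \<le> (2 * s powr n) powr d" using J J0 d1 by (intro powr_mono2) auto
      also have "\<dots> = 2 powr d * (s powr d) powr n" by (simp add: powr_mult powr_powr mult.commute)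
      also have "\<dots> \<le> 2 * (exp c1 * (1 + s * norm (x - y)) powr c1) powr n"
      proof (intro mult_mono)
        show "2 powr d \<le> 2" using powr_mono[of d 1 2] d1 by simp
        have "s powr d \<le> exp c1 * (1 + s * norm (x - y)) powr c1"
        proof (rule log_Hoelder_weight_bound)
          show "d \<le> c1 / ln (exp 1 + 1 / norm (x - y))" unfolding d_def using c1(2)[of x y] by (simp add: abs_minus_commute)
        qed (use d1 c1 s in \<open>auto simp: d_def\<close>)
        then show "(s powr d) powr n \<le> (exp c1 * (1 + s * norm (x - y)) powr c1) powr n"
          using n1 by (intro powr_mono2) auto
      qed auto
      also have "\<dots> = 2 * exp (n * c1) * (1 + s * norm (x - y)) powr (n * c1)"
        by (simp add: powr_mult powr_powr exp_powr_real mult.commute)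
      also have "\<dots> \<le> E * (1 + s * norm (x - y)) powr M"
        unfolding E_def using n1 c1 c2 by (intro mult_mono pmono) (auto simp: M_def)
      finally show ?thesis .
    next
      case False
      define X where "X = exp 1 + norm x"
      define Y where "Y = exp 1 + norm y"
      have X1: "1 \<le> ln X" "0 < X" "1 \<le> ln Y" "0 < Y" unfolding X_def Y_def by (auto simp: ln_ge_iff add_pos_nonneg)
      have "J powr (1 / p y - 1 / p x) \<le> J powr (- d)" unfolding d_def using False J0 by (intro powr_mono') auto
      also have "\<dots> \<le> (X powr (- (n + 2))) powr (- d)"
        using J(1) d1 X1 unfolding X_def by (intro powr_mono2') auto
      also have "\<dots> = exp ((n + 2) * (d * ln X))" using X1 unfolding powr_powr by (simp add: powr_def algebra_simps)
      \<comment> \<open>\<open>d\<close> is at most \<open>c2 / ln X + c2 / ln Y\<close>. The first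
        part cancels \<open>ln X\<close>; for the second,
        \<open>X \<le> Y * (1 + s * norm (x - y))\<close> compares \<open>ln X\<close> with
        \<open>ln Y\<close>.\<close>
      also have "d * ln X \<le> 2 * c2 + c2 * ln (1 + s * norm (x - y))"
      proof -
        have alg1: "(c / a + c / b) * a = c + c / b * a" if "1 \<le> a" for a b c :: real
          using that by (simp add: field_simps)
        have alg2: "c + c / b * (b + m) = 2 * c + c * (m / b)" if "1 \<le> b" for m b c :: real
          using that by (simp add: field_simps)
        define l where "l = ln (1 + s * norm (x - y))"
        have l0: "0 \<le> l" unfolding l_def using s by simp
        have "X \<le> Y + norm (x - y)" unfolding X_def Y_def using norm_triangle_ineq[of "x - y" y] by simp
        also have "\<dots> \<le> Y * (1 + norm (x - y))"
        proof -
          have "1 \<le> Y" unfolding Y_def by (smt (verit) exp_ge_add_one_self norm_ge_zero)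
          then have "1 * norm (x - y) \<le> Y * norm (x - y)" by (intro mult_right_mono) auto
          then show ?thesis by (simp add: algebra_simps)
        qed
        also have "\<dots> \<le> Y * (1 + s * norm (x - y))"
        proof -
          have "1 * norm (x - y) \<le> s * norm (x - y)" using s by (intro mult_right_mono) auto
          then show ?thesis using X1 by (intro mult_left_mono) auto
        qed
        finally have "ln X \<le> ln (Y * (1 + s * norm (x - y)))"
          using X1 sr1 by (subst ln_le_cancel_iff) auto
        also have "\<dots> = ln Y + l" unfolding l_def using X1 sr1 by (intro ln_mult_pos) auto
        finally have lX: "ln X \<le> ln Y + l" .
        have "d \<le> \<bar>1 / p x - P\<bar> + \<bar>1 / p y - P\<bar>" unfolding d_def by linarith
        also have "\<dots> \<le> c2 / ln X + c2 / ln Y" unfolding X_def Y_def by (intro add_mono c2)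
        finally have "d * ln X \<le> (c2 / ln X + c2 / ln Y) * ln X" by (rule mult_right_mono) (use X1 in linarith)
        also have "\<dots> = c2 + c2 / ln Y * ln X" by (rule alg1[OF X1(1)])
        also have "\<dots> \<le> c2 + c2 / ln Y * (ln Y + l)" using c2 by (intro add_left_mono mult_left_mono lX divide_nonneg_nonneg) (use X1 in linarith)+
        also have "\<dots> = 2 * c2 + c2 * (l / ln Y)" by (rule alg2[OF X1(3)])
        also have "\<dots> \<le> 2 * c2 + c2 * l"
        proof -
          have "l * 1 \<le> l * ln Y" by (intro mult_left_mono X1 l0)
          then have "l / ln Y \<le> l" using X1(3) by (subst pos_divide_le_eq) linarith+
          then show ?thesis using c2 by (intro add_left_mono mult_left_mono) auto
        qed
        finally show ?thesis unfolding l_def .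
      qed
      finally have "J powr (1 / p y - 1 / p x) \<le> exp ((n + 2) * (2 * c2 + c2 * ln (1 + s * norm (x - y))))"
        using n1 by (simp add: mult_left_mono)
      also have "\<dots> = exp (2 * (n + 2) * c2) * (1 + s * norm (x - y)) powr ((n + 2) * c2)"
        using sr1 by (simp add: powr_def exp_add[symmetric] algebra_simps)
      also have "\<dots> \<le> E * (1 + s * norm (x - y)) powr M"
      proof (intro mult_mono pmono)
        have "exp (2 * (n + 2) * c2) \<le> exp (n * c1 + 2 * (n + 2) * c2)" using n1 c1 by simp
        also have "\<dots> \<le> E" unfolding E_def by simp
        finally show "exp (2 * (n + 2) * c2) \<le> E" .
      qed (use n1 c1 E0 in \<open>auto simp: M_def\<close>)
      finally show ?thesis .
    qed
  qed

  \<comment> \<open>Of the decay of order \<open>M + n + 2\<close>, the \<open>M\<close> powers pay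
    for \<open>Ebound\<close> and the remaining \<open>n + 2\<close> keep the kernel integrable with
    mass \<open>K\<close> independent of \<open>s\<close>.\<close>
  have core: "Lp_norm p G \<le> ennreal C"
    if s: "1 \<le> s" and fm[measurable]: "f \<in> borel_measurable borel" and f1: "modular p f \<le> 1"
      and G: "\<And>x. ennreal (norm (G x)) \<le> (\<integral>\<^sup>+y. ennreal (s ^ DIM('a) * (1 + s * norm (x - y)) powr (- (M + n + 2)) * norm (f y)) \<partial>lborel)"
    for s and f G :: "'a \<Rightarrow> complex"
  proof -
    let ?k = "\<lambda>x y::'a. s ^ DIM('a) * (1 + s * norm (x - y)) powr (- (n + 2))"
    have sn: "s ^ DIM('a) = s powr n" unfolding n_def using s by (simp add: powr_realpow)
    have k0: "0 \<le> ?k x y" for x y using s by simp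
    have kK: "(\<integral>\<^sup>+y. ennreal (?k x y) \<partial>lborel) = ennreal K" for x
      using nn_integral_scaled_decay[of s x "- (n + 2)"] s K(1) by simp
    have f1': "(\<integral>\<^sup>+y. ennreal (norm (f y) powr p y) \<partial>lborel) \<le> 1"
      using f1 unfolding modular_def by (simp add: nn_integral_completion)
    define I where "I = (\<lambda>x. \<integral>\<^sup>+y. ennreal (?k x y) * ennreal (norm (f y) powr p y) \<partial>lborel)"
    have Im[measurable]: "I \<in> borel_measurable borel" unfolding I_def by measurable
    have Is: "I x \<le> ennreal (s powr n)" for x
    proof -
      have "I x \<le> (\<integral>\<^sup>+y. ennreal (s powr n) * ennreal (norm (f y) powr p y) \<partial>lborel)"
        unfolding I_def
      proof (intro nn_integral_mono mult_right_mono ennreal_leI)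
        fix y
        have "(1 + s * norm (x - y)) powr (- (n + 2)) \<le> (1 + s * norm (x - y)) powr 0"
          using s n1 by (intro powr_mono) auto
        moreover have "(1 + s * norm (x - y)) powr 0 = 1" using s by (smt (verit) mult_nonneg_nonneg norm_ge_zero powr_zero_eq_one)
        ultimately have "(1 + s * norm (x - y)) powr (- (n + 2)) \<le> 1" by linarith
        then show "?k x y \<le> s powr n" unfolding sn by (rule mult_left_le) simp
      qed auto
      also have "\<dots> = ennreal (s powr n) * (\<integral>\<^sup>+y. ennreal (norm (f y) powr p y) \<partial>lborel)"
        by (rule nn_integral_cmult) measurable
      also have "\<dots> \<le> ennreal (s powr n) * 1" by (intro mult_left_mono f1') auto
      finally show ?thesis by simp
    qed
    \<comment> \<open>The added term is an integrable floor. It makes \<open>J\<close> positive and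
      not too small at infinity, where the decay condition of \<open>p\<close> only tolerates
      polynomial smallness.\<close>
    define J where "J = (\<lambda>x. enn2real (I x) + (exp 1 + norm x) powr (- (n + 2)))"
    have IJ: "I x \<le> ennreal (J x)" for x
    proof -
      have "I x = ennreal (enn2real (I x))" using Is[of x] by (cases "I x") (auto simp: top_unique)
      also have "\<dots> \<le> ennreal (J x)" unfolding J_def by (intro ennreal_leI) simp
      finally show ?thesis .
    qed
    have J1: "(exp 1 + norm x) powr (- (n + 2)) \<le> J x" for x unfolding J_def by simp
    have e1: "1 \<le> exp 1 + norm x" for x :: 'a by (smt (verit) exp_ge_add_one_self norm_ge_zero)
    have J2: "J x \<le> 2 * s powr n" for x
    proof -
      have "enn2real (I x) \<le> s powr n" using Is by (intro enn2real_leI) auto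
      moreover have "(exp 1 + norm x) powr (- (n + 2)) \<le> (exp 1 + norm x) powr 0"
        using e1[of x] n1 by (intro powr_mono) auto
      moreover have "(exp 1 + norm x) powr 0 = 1" using e1[of x] by simp
      moreover have "1 \<le> s powr n" using s n1 by (simp add: ge_one_powr_ge_zero)
      ultimately show ?thesis unfolding J_def by linarith
    qed
    have J0: "0 < J x" for x
    proof -
      have "0 < (exp 1 + norm x) powr (- (n + 2))" using e1[of x] by simp
      then show ?thesis using J1[of x] by linarith
    qed
    \<comment> \<open>By Fubini the kernel mass \<open>K\<close> and the modular of \<open>f\<close>
      factor; the kernel has the same mass in either variable because it depends on
      \<open>norm (x - y)\<close> only.\<close>
    have Jint: "(\<integral>\<^sup>+x. ennreal (J x) \<partial>lborel) \<le> ennreal D"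
    proof -
      have "(\<integral>\<^sup>+x. ennreal (J x) \<partial>lborel) \<le> (\<integral>\<^sup>+x. I x + ennreal ((1 + norm x) powr (- (n + 2))) \<partial>lborel)"
      proof (rule nn_integral_mono)
        fix x :: 'a
        have "(exp 1 + norm x) powr (- (n + 2)) \<le> (1 + norm x) powr (- (n + 2))"
          using n1 by (intro powr_mono2') (auto simp: add_pos_nonneg)
        then have "ennreal (J x) \<le> ennreal (enn2real (I x)) + ennreal ((1 + norm x) powr (- (n + 2)))"
          unfolding J_def by (simp add: ennreal_plus[symmetric] ennreal_leI del: ennreal_plus)
        also have "ennreal (enn2real (I x)) \<le> I x" by (simp add: ennreal_enn2real_if)
        finally show "ennreal (J x) \<le> I x + ennreal ((1 + norm x) powr (- (n + 2)))" by (simp add: add_right_mono)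
      qed
      also have "\<dots> = (\<integral>\<^sup>+x. I x \<partial>lborel) + ennreal K"
        unfolding K(1)[symmetric] by (rule nn_integral_add) measurable
      also have "(\<integral>\<^sup>+x. I x \<partial>lborel) = (\<integral>\<^sup>+y. (\<integral>\<^sup>+x. ennreal (?k x y) * ennreal (norm (f y) powr p y) \<partial>lborel) \<partial>lborel)"
        unfolding I_def by (rule lborel_pair.Fubini') measurable
      also have "\<dots> = (\<integral>\<^sup>+y. ennreal K * ennreal (norm (f y) powr p y) \<partial>lborel)"
      proof (rule nn_integral_cong)
        fix y
        have "(\<integral>\<^sup>+x. ennreal (?k x y) * ennreal (norm (f y) powr p y) \<partial>lborel)
          = (\<integral>\<^sup>+x. ennreal (?k y x) \<partial>lborel) * ennreal (norm (f y) powr p y)"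
          by (subst nn_integral_multc) (simp_all add: norm_minus_commute)
        then show "(\<integral>\<^sup>+x. ennreal (?k x y) * ennreal (norm (f y) powr p y) \<partial>lborel) = ennreal K * ennreal (norm (f y) powr p y)"
          unfolding kK .
      qed
      also have "\<dots> = ennreal K * (\<integral>\<^sup>+y. ennreal (norm (f y) powr p y) \<partial>lborel)"
        by (rule nn_integral_cmult) measurable
      also have "\<dots> + ennreal K \<le> ennreal K * 1 + ennreal K" by (intro add_right_mono mult_left_mono f1') auto
      also have "\<dots> = ennreal (K + K)" using K by (simp only: ennreal_plus mult_1_right)
      also have "\<dots> \<le> ennreal D" unfolding D_def by (intro ennreal_leI) simp
      finally show ?thesis .
    qed
    have Gpt: "norm (G x) \<le> E * (K + 1) * J x powr (1 / p x)" for x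
    proof -
      define lam where "lam = J x powr (1 / p x)"
      have lam: "0 < lam" unfolding lam_def using J0[of x] by simp
      \<comment> \<open>A threshold argument in place of Young's inequality. By
        \<open>Ebound\<close> the threshold \<open>e * lam\<close> satisfies
        \<open>J x \<le> (e * lam) powr p y\<close>. A value \<open>t\<close> below the threshold is
        bounded by it; above, \<open>t / (e * lam)\<close> is at most its own power
        \<open>p y \<ge> 1\<close>, hence at most \<open>t powr p y / J x\<close>. The factor
        \<open>r powr M\<close> inside \<open>e\<close> is cancelled by the spare decay.\<close>
      have pt: "(1 + s * norm (x - y)) powr (- M) * norm (f y) \<le> E * lam * (1 + norm (f y) powr p y / J x)" for y
      proof -
        define t where "t = norm (f y)"
        define r where "r = 1 + s * norm (x - y)"
        define e where "e = E * r powr M"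
        have r: "1 \<le> r" unfolding r_def using s by simp
        have t: "0 \<le> t" unfolding t_def by simp
        have e0: "0 < e" unfolding e_def using E0 r by simp
        have eJ: "J x powr (1 / p y - 1 / p x) \<le> e" unfolding e_def r_def by (rule Ebound[OF s J1 J2])
        have "J x powr (1 / p y) = J x powr (1 / p y - 1 / p x) * lam" unfolding lam_def by (simp add: powr_add[symmetric])
        also have "\<dots> \<le> e * lam" using lam eJ by (intro mult_right_mono) auto
        finally have "(J x powr (1 / p y)) powr p y \<le> (e * lam) powr p y" using p0 by (intro powr_mono2) auto
        then have Je: "J x \<le> (e * lam) powr p y" using J0[of x] p0(2)[of y] by (simp add: powr_powr less_imp_neq[symmetric])
        have "t \<le> e * lam * (1 + t powr p y / J x)"
        proof (cases "t \<le> e * lam")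
          case True
          also have "e * lam * 1 \<le> e * lam * (1 + t powr p y / J x)"
            using e0 lam J0[of x] by (intro mult_left_mono) auto
          finally show ?thesis by simp
        next
          case False
          then have q: "1 \<le> t / (e * lam)" using e0 lam by (simp add: le_divide_eq)
          have "0 \<le> t / (e * lam)" using q by linarith
          then have "t / (e * lam) = (t / (e * lam)) powr 1" by (rule powr_one[symmetric])
          also have "\<dots> \<le> (t / (e * lam)) powr p y" using q p1 by (intro powr_mono) auto
          also have "\<dots> = t powr p y / (e * lam) powr p y" by (rule powr_divide)
          also have "\<dots> \<le> t powr p y / J x" using Je J0[of x] less_le_trans[OF J0[of x] Je] by (intro divide_left_mono mult_pos_pos) auto
          finally have "t / (e * lam) \<le> 1 + t powr p y / J x" by simp
          then show ?thesis using e0 lam by (simp add: divide_le_eq mult.commute)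
        qed
        then have "r powr (- M) * t \<le> r powr (- M) * (e * lam * (1 + t powr p y / J x))"
          by (intro mult_left_mono) auto
        also have "\<dots> = (r powr (- M) * r powr M) * (E * lam * (1 + t powr p y / J x))"
          unfolding e_def by (simp add: mult_ac)
        also have "r powr (- M) * r powr M = 1" using r by (simp add: powr_minus)
        finally show ?thesis unfolding t_def r_def by simp
      qed
      have "ennreal (norm (G x)) \<le> (\<integral>\<^sup>+y. ennreal (s ^ DIM('a) * (1 + s * norm (x - y)) powr (- (M + n + 2)) * norm (f y)) \<partial>lborel)"
        by (rule G)
      also have "\<dots> \<le> (\<integral>\<^sup>+y. ennreal (E * lam) * (ennreal (?k x y) + ennreal (1 / J x) * (ennreal (?k x y) * ennreal (norm (f y) powr p y))) \<partial>lborel)"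
      proof (rule nn_integral_mono)
        fix y
        have "(1 + s * norm (x - y)) powr (- (M + n + 2)) = (1 + s * norm (x - y)) powr (- M) * (1 + s * norm (x - y)) powr (- (n + 2))"
          by (simp add: powr_add[symmetric] algebra_simps)
        then have "s ^ DIM('a) * (1 + s * norm (x - y)) powr (- (M + n + 2)) * norm (f y)
          = ?k x y * ((1 + s * norm (x - y)) powr (- M) * norm (f y))" by (simp only: mult_ac)
        also have "\<dots> \<le> ?k x y * (E * lam * (1 + norm (f y) powr p y / J x))"
          by (intro mult_left_mono pt k0)
        also have "\<dots> = (E * lam) * (?k x y + (1 / J x) * (?k x y * norm (f y) powr p y))"
          by (simp add: algebra_simps)
        finally have "ennreal (s ^ DIM('a) * (1 + s * norm (x - y)) powr (- (M + n + 2)) * norm (f y))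
          \<le> ennreal ((E * lam) * (?k x y + (1 / J x) * (?k x y * norm (f y) powr p y)))" by (rule ennreal_leI)
        also have "\<dots> = ennreal (E * lam) * (ennreal (?k x y) + ennreal (1 / J x) * (ennreal (?k x y) * ennreal (norm (f y) powr p y)))"
        proof -
          have h: "0 \<le> 1 / J x" "0 \<le> E * lam" "0 \<le> norm (f y) powr p y" using J0[of x] E0 lam by auto
          show ?thesis
            by (simp only: ennreal_mult[OF k0 h(3), symmetric] ennreal_mult[OF h(1) mult_nonneg_nonneg[OF k0 h(3)], symmetric]
              ennreal_plus[OF k0 mult_nonneg_nonneg[OF h(1) mult_nonneg_nonneg[OF k0 h(3)]], symmetric]
              ennreal_mult[OF h(2) add_nonneg_nonneg[OF k0 mult_nonneg_nonneg[OF h(1) mult_nonneg_nonneg[OF k0 h(3)]]], symmetric])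
        qed
        finally show "ennreal (s ^ DIM('a) * (1 + s * norm (x - y)) powr (- (M + n + 2)) * norm (f y))
          \<le> ennreal (E * lam) * (ennreal (?k x y) + ennreal (1 / J x) * (ennreal (?k x y) * ennreal (norm (f y) powr p y)))" .
      qed
      also have "\<dots> = ennreal (E * lam) * (\<integral>\<^sup>+y. ennreal (?k x y) + ennreal (1 / J x) * (ennreal (?k x y) * ennreal (norm (f y) powr p y)) \<partial>lborel)"
        by (rule nn_integral_cmult) measurable
      also have "(\<integral>\<^sup>+y. ennreal (?k x y) + ennreal (1 / J x) * (ennreal (?k x y) * ennreal (norm (f y) powr p y)) \<partial>lborel)
        = (\<integral>\<^sup>+y. ennreal (?k x y) \<partial>lborel) + (\<integral>\<^sup>+y. ennreal (1 / J x) * (ennreal (?k x y) * ennreal (norm (f y) powr p y)) \<partial>lborel)"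
        by (rule nn_integral_add) measurable
      also have "(\<integral>\<^sup>+y. ennreal (1 / J x) * (ennreal (?k x y) * ennreal (norm (f y) powr p y)) \<partial>lborel) = ennreal (1 / J x) * I x"
        unfolding I_def by (rule nn_integral_cmult) measurable
      also have "(\<integral>\<^sup>+y. ennreal (?k x y) \<partial>lborel) = ennreal K" by (rule kK)
      also have "ennreal (E * lam) * (ennreal K + ennreal (1 / J x) * I x) \<le> ennreal (E * lam) * (ennreal K + ennreal (1 / J x) * ennreal (J x))"
        by (intro mult_left_mono add_left_mono IJ) auto
      also have "\<dots> = ennreal (E * lam * (K + 1))"
      proof -
        have "ennreal (1 / J x) * ennreal (J x) = 1" using J0[of x] by (simp add: ennreal_mult[symmetric])
        then show ?thesis using K E0 lam ennreal_plus[of K 1] by (simp add: ennreal_mult)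
      qed
      finally show ?thesis unfolding lam_def using E0 K by (simp add: ennreal_le_iff mult_ac)
    qed
    show ?thesis
    proof (rule Lp_norm_le[OF C])
      have "modular p (\<lambda>x. G x / of_real C) \<le> (\<integral>\<^sup>+x. ennreal (1 / D) * ennreal (J x) \<partial>lebesgue)"
        unfolding modular_def
      proof (intro nn_integral_mono)
        fix x
        have "norm (G x / of_real C) \<le> E * (K + 1) * J x powr (1 / p x) / C"
          using Gpt[of x] C by (simp add: norm_divide divide_right_mono)
        also have "\<dots> = (1 / D) * J x powr (1 / p x)" unfolding C_def using E0 K D by simp
        finally have "norm (G x / of_real C) powr p x \<le> ((1 / D) * J x powr (1 / p x)) powr p x"
          using p0 by (intro powr_mono2) auto
        also have "\<dots> = (1 / D) powr p x * J x"
          using J0[of x] p0(2)[of x] by (simp only: powr_mult powr_powr) simp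
        also have "\<dots> \<le> (1 / D) * J x"
          using powr_mono'[of 1 "p x" "1 / D"] D p1[of x] J0[of x] by (intro mult_right_mono) auto
        finally show "ennreal (norm (G x / of_real C) powr p x) \<le> ennreal (1 / D) * ennreal (J x)"
          using D J0[of x] by (simp add: ennreal_mult[symmetric] ennreal_leI)
      qed
      also have "\<dots> = ennreal (1 / D) * (\<integral>\<^sup>+x. ennreal (J x) \<partial>lborel)"
        unfolding nn_integral_completion J_def by (rule nn_integral_cmult) measurable
      also have "\<dots> \<le> ennreal (1 / D) * ennreal D" by (intro mult_left_mono Jint) auto
      also have "\<dots> = 1" using D by (simp add: ennreal_mult[symmetric])
      finally show "modular p (\<lambda>x. G x / of_real C) \<le> 1" .
    qed
  qed

  show ?thesis
  proof (rule that[of C "M + n + 2"])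
    show "0 < C" by (rule C)
    show "0 \<le> M + n + 2" using M0 n1 by simp
    fix s :: real and f G :: "'a \<Rightarrow> complex"
    assume s: "1 \<le> s" and fm[measurable]: "f \<in> borel_measurable borel"
      and G: "\<And>x. ennreal (norm (G x)) \<le> (\<integral>\<^sup>+y. ennreal (s ^ DIM('a) * (1 + s * norm (x - y)) powr (- (M + n + 2)) * norm (f y)) \<partial>lborel)"
    have "ennreal (1 / C) * Lp_norm p G \<le> Lp_norm p f"
      unfolding Lp_norm_def[of p f]
    proof (rule INF_greatest, safe)
      fix l :: real assume l: "0 < l" "modular p (\<lambda>x. f x / of_real l) \<le> 1"
      have "Lp_norm p (\<lambda>x. G x / of_real l) \<le> ennreal C"
      proof (rule core[OF s _ l(2)])
        fix x
        have "ennreal (norm (G x / of_real l)) = ennreal (1 / l) * ennreal (norm (G x))"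
          using l by (simp add: norm_divide ennreal_mult[symmetric])
        also have "\<dots> \<le> ennreal (1 / l) * (\<integral>\<^sup>+y. ennreal (s ^ DIM('a) * (1 + s * norm (x - y)) powr (- (M + n + 2)) * norm (f y)) \<partial>lborel)"
          by (intro mult_left_mono G) auto
        also have "\<dots> = (\<integral>\<^sup>+y. ennreal (1 / l) * ennreal (s ^ DIM('a) * (1 + s * norm (x - y)) powr (- (M + n + 2)) * norm (f y)) \<partial>lborel)"
          by (rule nn_integral_cmult[symmetric]) measurable
        also have "\<dots> = (\<integral>\<^sup>+y. ennreal (s ^ DIM('a) * (1 + s * norm (x - y)) powr (- (M + n + 2)) * norm (f y / of_real l)) \<partial>lborel)"
          using l s by (intro nn_integral_cong) (simp add: norm_divide ennreal_mult[symmetric])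
        finally show "ennreal (norm (G x / of_real l)) \<le> \<dots>" .
      qed measurable
      moreover have "Lp_norm p G \<le> ennreal l * Lp_norm p (\<lambda>x. G x / of_real l)"
        using l p0 by (intro Lp_norm_cmult_le) (auto simp: norm_divide)
      ultimately have "Lp_norm p G \<le> ennreal l * ennreal C" by (meson mult_left_mono order_trans zero_le)
      then have "ennreal (1 / C) * Lp_norm p G \<le> ennreal (1 / C) * (ennreal l * ennreal C)" by (intro mult_left_mono) auto
      also have "\<dots> = ennreal l" using C l by (simp add: ennreal_mult[symmetric])
      finally show "ennreal (1 / C) * Lp_norm p G \<le> ennreal l" .
    qed
    then have "ennreal C * (ennreal (1 / C) * Lp_norm p G) \<le> ennreal C * Lp_norm p f" by (intro mult_left_mono) auto
    moreover have "ennreal C * (ennreal (1 / C) * Lp_norm p G) = Lp_norm p G"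
      using C by (simp add: mult.assoc[symmetric] ennreal_mult[symmetric])
    ultimately show "Lp_norm p G \<le> ennreal C * Lp_norm p f" by simp
  qed
qed

section \<open>Schwartz functions and tempered distributions\<close>

lemma iterated_partial_Nil [simp]: "iterated_partial [] u = u"
  by (simp add: iterated_partial_def)

lemma iterated_partial_Cons: "iterated_partial (i # is) u = partial_deriv i (iterated_partial is u)"
  by (simp add: iterated_partial_def)

lemma iterated_partial_append: "iterated_partial (is @ js) u = iterated_partial is (iterated_partial js u)"
  by (simp add: iterated_partial_def)

lemma schwartz_iterated_partial:
  assumes "u \<in> schwartz"
  shows "iterated_partial is u \<in> schwartz"
  using assms unfolding schwartz_def by (auto simp flip: iterated_partial_append)

lemma schwartz_partial_deriv: "u \<in> schwartz \<Longrightarrow> partial_deriv i u \<in> schwartz"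
  using schwartz_iterated_partial[of u "[i]"] by (simp add: iterated_partial_Cons)

lemma schwartz_decay:
  assumes "u \<in> schwartz"
  obtains C where "0 < C" and "\<And>x. (1 + norm x) ^ k * norm (u x) \<le> C"
proof -
  from assms obtain C where C: "\<And>x. (1 + norm x) ^ k * norm (u x) \<le> C"
    unfolding schwartz_def by simp (metis iterated_partial_Nil)
  show ?thesis
    by (rule that[of "max C 1"]) (use C in \<open>auto simp: le_max_iff_disj\<close>)
qed

lemma schwartz_differentiable: "u \<in> schwartz \<Longrightarrow> u differentiable (at x)"
  unfolding schwartz_def by simp (metis iterated_partial_Nil)

lemma schwartz_has_derivative:
  fixes u :: "real^'n::finite \<Rightarrow> complex"
  assumes "u \<in> schwartz"
  shows "(u has_derivative (\<lambda>h. \<Sum>i\<in>UNIV. (h $ i) *\<^sub>R partial_deriv i u x)) (at x)"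
proof -
  have D: "(u has_derivative frechet_derivative u (at x)) (at x)"
    using schwartz_differentiable[OF assms] by (simp add: frechet_derivative_works)
  then interpret bounded_linear "frechet_derivative u (at x)" by (rule has_derivative_bounded_linear)
  have "frechet_derivative u (at x) h = (\<Sum>i\<in>UNIV. (h $ i) *\<^sub>R partial_deriv i u x)" for h
  proof -
    have "h = (\<Sum>i\<in>UNIV. (h $ i) *\<^sub>R axis i 1)"
      using basis_expansion[of h] by (simp add: scalar_mult_eq_scaleR)
    then have "frechet_derivative u (at x) h = frechet_derivative u (at x) (\<Sum>i\<in>UNIV. (h $ i) *\<^sub>R axis i 1)" by simp
    then show ?thesis by (simp add: sum scaleR partial_deriv_def)
  qed
  then have "frechet_derivative u (at x) = (\<lambda>h. \<Sum>i\<in>UNIV. (h $ i) *\<^sub>R partial_deriv i u x)" by auto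
  then show ?thesis using D by simp
qed

lemma schwartz_continuous_on: "u \<in> schwartz \<Longrightarrow> continuous_on S u"
  by (meson differentiable_imp_continuous_within continuous_at_imp_continuous_on schwartz_differentiable)

lemma schwartz_borel_measurable: "u \<in> schwartz \<Longrightarrow> u \<in> borel_measurable borel"
  by (intro borel_measurable_continuous_onI schwartz_continuous_on)

lemma partial_deriv_eqI:
  fixes u :: "real^'n::finite \<Rightarrow> complex"
  assumes "(u has_derivative (\<lambda>h. \<Sum>i\<in>UNIV. (h $ i) *\<^sub>R D i)) (at x)"
  shows "partial_deriv i u x = D i"
proof -
  have "frechet_derivative u (at x) = (\<lambda>h. \<Sum>i\<in>UNIV. (h $ i) *\<^sub>R D i)"
    using frechet_derivative_at[OF assms] by simp
  then have "partial_deriv i u x = (\<Sum>j\<in>UNIV. (axis i 1 $ j) *\<^sub>R D j)" by (simp add: partial_deriv_def)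
  also have "\<dots> = (\<Sum>j\<in>UNIV. if j = i then D j else 0)"
    by (intro sum.cong) (auto simp: axis_def)
  finally show ?thesis by simp
qed

section \<open>Uniform estimates for Schwartz functions and superpositions of their
  translates\<close>

lemma norm_sum_scaleR_coord_le:
  fixes D :: "'n::finite \<Rightarrow> complex"
  assumes "\<And>i. norm (D i) \<le> B"
  shows "norm (\<Sum>i\<in>UNIV. (h $ i) *\<^sub>R D i) \<le> real CARD('n) * B * norm (h :: real^'n)"
proof -
  have "norm (\<Sum>i\<in>UNIV. (h $ i) *\<^sub>R D i) \<le> (\<Sum>i\<in>(UNIV :: 'n set). norm h * B)"
  proof (intro order_trans[OF norm_sum] sum_mono)
    fix i
    have "norm ((h $ i) *\<^sub>R D i) = \<bar>h $ i\<bar> * norm (D i)" by simp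
    also have "\<dots> \<le> norm h * B" by (intro mult_mono assms component_le_norm_cart) auto
    finally show "norm ((h $ i) *\<^sub>R D i) \<le> norm h * B" .
  qed
  then show ?thesis by (simp add: mult_ac)
qed

text \<open>Mean value theorem on the segment from \<open>a - y\<close> to \<open>b - y\<close>. Its
  points have the form \<open>z - y\<close> with \<open>norm z \<le> norm a + norm b\<close>, so
  \<open>1 + norm y\<close> is at most \<open>(1 + norm \<xi>) * (1 + norm a + norm b)\<close> and
  the decay of the gradient at \<open>\<xi>\<close> pays for the weight. This is continuity of
  translation in the Schwartz seminorms, with a quantitative modulus.\<close>

lemma schwartz_Lipschitz_weighted:
  fixes u :: "real^'n::finite \<Rightarrow> complex"
  assumes u: "u \<in> schwartz"
  obtains C where "0 < C"
    and "\<And>a b y. (1 + norm y) ^ k * norm (u (a - y) - u (b - y)) \<le> C * (1 + norm a + norm b) ^ k * norm (a - b)"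
proof -
  have "\<forall>i. \<exists>C>0. \<forall>x. (1 + norm x) ^ k * norm (partial_deriv i u x) \<le> C"
    using schwartz_decay[OF schwartz_partial_deriv[OF u]] by metis
  then obtain c where c: "\<And>i. 0 < c i" "\<And>i x. (1 + norm x) ^ k * norm (partial_deriv i u x) \<le> c i" by metis
  define C where "C = (\<Sum>i\<in>UNIV. c i)"
  have cC: "c i \<le> C" for i unfolding C_def using c(1) by (intro member_le_sum) (auto simp: less_imp_le)
  have C0: "0 < C" using cC c(1) less_le_trans by blast
  define N where "N = real CARD('n)"
  have N: "0 < N" unfolding N_def by simp
  show ?thesis
  proof (rule that[of "N * C"])
    show "0 < N * C" using N C0 by simp
    fix a b y :: "real^'n"
    define R where "R = 1 + norm a + norm b"
    have R: "0 < R" unfolding R_def by (simp add: add_pos_nonneg)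
    define y1 where "y1 = 1 + norm y"
    have y1: "0 < y1" unfolding y1_def by (simp add: add_pos_nonneg)
    define B where "B = N * (C * R ^ k / y1 ^ k)"
    have B0: "0 \<le> B" unfolding B_def using N C0 R y1 by simp
    have "norm (u (a - y) - u (b - y)) \<le> B * norm ((a - y) - (b - y))"
    proof (rule differentiable_bound[where S = "closed_segment (a - y) (b - y)"])
      fix \<xi> assume \<xi>: "\<xi> \<in> closed_segment (a - y) (b - y)"
      show "(u has_derivative (\<lambda>h. \<Sum>i\<in>UNIV. (h $ i) *\<^sub>R partial_deriv i u \<xi>)) (at \<xi> within closed_segment (a - y) (b - y))"
        using schwartz_has_derivative[OF u] by (rule has_derivative_at_withinI)
      obtain t where t: "0 \<le> t" "t \<le> 1" "\<xi> = (1 - t) *\<^sub>R (a - y) + t *\<^sub>R (b - y)"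
        using \<xi> by (auto simp: in_segment)
      define z where "z = (1 - t) *\<^sub>R a + t *\<^sub>R b"
      have z: "\<xi> = z - y" unfolding t(3) z_def by (simp add: algebra_simps)
      have nz: "norm z \<le> norm a + norm b"
      proof -
        have "norm z \<le> (1 - t) * norm a + t * norm b"
          unfolding z_def by (rule order_trans[OF norm_triangle_ineq]) (use t in simp)
        also have "\<dots> \<le> 1 * norm a + 1 * norm b" using t by (intro add_mono mult_right_mono) auto
        finally show ?thesis by simp
      qed
      have "y1 \<le> (1 + norm \<xi>) * R"
      proof -
        have "norm y \<le> norm z + norm \<xi>" unfolding z by (metis norm_minus_commute norm_triangle_sub)
        also have "\<dots> \<le> norm a + norm b + norm \<xi>" using nz by simp
        finally have "y1 \<le> R + norm \<xi> * 1" unfolding y1_def R_def by simp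
        also have "\<dots> \<le> R + norm \<xi> * R" unfolding R_def by (intro add_left_mono mult_left_mono) auto
        finally show ?thesis by (simp add: algebra_simps)
      qed
      then have "y1 ^ k \<le> ((1 + norm \<xi>) * R) ^ k" using y1 by (intro power_mono) auto
      then have y1k: "y1 ^ k \<le> (1 + norm \<xi>) ^ k * R ^ k" by (simp add: power_mult_distrib)
      have "norm (partial_deriv i u \<xi>) \<le> C * R ^ k / y1 ^ k" for i
      proof -
        have "norm (partial_deriv i u \<xi>) * y1 ^ k \<le> norm (partial_deriv i u \<xi>) * ((1 + norm \<xi>) ^ k * R ^ k)"
          by (intro mult_left_mono y1k) auto
        also have "\<dots> = ((1 + norm \<xi>) ^ k * norm (partial_deriv i u \<xi>)) * R ^ k" by simp
        also have "\<dots> \<le> C * R ^ k"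
          using R by (intro mult_right_mono order_trans[OF c(2) cC]) auto
        finally show ?thesis using y1 by (simp add: le_divide_eq)
      qed
      then have "norm (\<Sum>i\<in>UNIV. (h $ i) *\<^sub>R partial_deriv i u \<xi>) \<le> B * norm h" for h :: "real^'n"
        unfolding B_def N_def by (rule norm_sum_scaleR_coord_le)
      then show "onorm (\<lambda>h. \<Sum>i\<in>UNIV. (h $ i) *\<^sub>R partial_deriv i u \<xi>) \<le> B"
        using B0 by (intro onorm_bound) auto
    qed auto
    then have "(1 + norm y) ^ k * norm (u (a - y) - u (b - y)) \<le> y1 ^ k * (B * norm (a - b))"
      unfolding y1_def by (intro mult_left_mono) auto
    also have "\<dots> = N * C * (1 + norm a + norm b) ^ k * norm (a - b)"
      unfolding B_def R_def using y1 by simp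
    finally show "(1 + norm y) ^ k * norm (u (a - y) - u (b - y)) \<le> N * C * (1 + norm a + norm b) ^ k * norm (a - b)" .
  qed
qed

text \<open>Mean value theorem for \<open>u\<close> minus its differential at \<open>x\<close>, with
  Lipschitz partial derivatives. As the constant does not depend on \<open>x\<close>, the remainder
  can be integrated, which gives differentiation under the integral sign with no limit
  interchange.\<close>

lemma schwartz_Taylor_bound:
  fixes u :: "real^'n::finite \<Rightarrow> complex"
  assumes u: "u \<in> schwartz"
  obtains C where "0 < C"
    and "\<And>x h. norm (u (x + h) - u x - (\<Sum>i\<in>UNIV. (h $ i) *\<^sub>R partial_deriv i u x)) \<le> C * norm h ^ 2"
proof -
  have "\<exists>C>0. \<forall>a b. norm (partial_deriv i u a - partial_deriv i u b) \<le> C * norm (a - b)" for i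
    by (rule schwartz_Lipschitz_weighted[OF schwartz_partial_deriv[OF u, of i], of 0]) (metis diff_zero power_0 mult_1 mult.right_neutral)
  then obtain c where c: "\<And>i. 0 < c i" "\<And>i a b. norm (partial_deriv i u a - partial_deriv i u b) \<le> c i * norm (a - b)" by metis
  define C where "C = (\<Sum>i\<in>UNIV. c i)"
  have cC: "c i \<le> C" for i unfolding C_def using c(1) by (intro member_le_sum) (auto simp: less_imp_le)
  have C0: "0 < C" using cC c(1) less_le_trans by blast
  define N where "N = real CARD('n)"
  have N: "0 < N" unfolding N_def by simp
  show ?thesis
  proof (rule that[of "N * C"])
    show "0 < N * C" using N C0 by simp
    fix x h :: "real^'n"
    define B where "B = N * (C * norm h)"
    let ?D = "\<lambda>x h. \<Sum>i\<in>UNIV. (h $ i) *\<^sub>R partial_deriv i u x"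
    have bl: "bounded_linear (?D x)" for x
      using schwartz_has_derivative[OF u] has_derivative_bounded_linear by blast
    have "norm ((\<lambda>\<xi>. u \<xi> - ?D x \<xi>) (x + h) - (\<lambda>\<xi>. u \<xi> - ?D x \<xi>) x) \<le> B * norm ((x + h) - x)"
    proof (rule differentiable_bound[where S = "closed_segment (x + h) x"])
      fix \<xi> assume \<xi>: "\<xi> \<in> closed_segment (x + h) x"
      have "((\<lambda>\<xi>. u \<xi> - ?D x \<xi>) has_derivative (\<lambda>k. ?D \<xi> k - ?D x k)) (at \<xi>)"
        by (intro has_derivative_diff schwartz_has_derivative u bounded_linear_imp_has_derivative bl)
      then show "((\<lambda>\<xi>. u \<xi> - ?D x \<xi>) has_derivative (\<lambda>k. ?D \<xi> k - ?D x k)) (at \<xi> within closed_segment (x + h) x)"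
        by (rule has_derivative_at_withinI)
      have "norm (\<xi> - x) \<le> norm h"
        using segment_bound(2)[OF \<xi>] by (simp add: norm_minus_commute)
      then have "norm (partial_deriv i u \<xi> - partial_deriv i u x) \<le> C * norm h" for i
        using c(2)[of i \<xi> x] cC[of i] c(1)[of i] C0 by (meson mult_mono norm_ge_zero order_trans less_imp_le)
      then have "norm (\<Sum>i\<in>UNIV. (k $ i) *\<^sub>R (partial_deriv i u \<xi> - partial_deriv i u x)) \<le> B * norm k" for k :: "real^'n"
        unfolding B_def N_def by (rule norm_sum_scaleR_coord_le)
      then have "norm (?D \<xi> k - ?D x k) \<le> B * norm k" for k :: "real^'n"
        by (simp add: scaleR_diff_right sum_subtractf)
      then show "onorm (\<lambda>k. ?D \<xi> k - ?D x k) \<le> B"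
        unfolding B_def using C0 N by (intro onorm_bound) auto
    qed auto
    moreover have "?D x (x + h) - ?D x x = ?D x h"
      by (simp add: scaleR_add_left sum.distrib)
    ultimately show "norm (u (x + h) - u x - ?D x h) \<le> N * C * norm h ^ 2"
      unfolding B_def by (simp add: algebra_simps power2_eq_square)
  qed
qed

lemma has_derivative_at_quadraticI:
  fixes f :: "'a::real_normed_vector \<Rightarrow> 'b::real_normed_vector"
  assumes D: "bounded_linear D" and C: "\<And>h. norm (f (x + h) - f x - D h) \<le> C * norm h ^ 2"
  shows "(f has_derivative D) (at x)"
  unfolding has_derivative_at
proof (intro conjI D)
  have "((\<lambda>h. C * norm h) \<longlongrightarrow> C * norm (0::'a)) (at (0::'a))"
    by (rule tendsto_mult[OF tendsto_const tendsto_norm[OF tendsto_ident_at]])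
  then have lim: "((\<lambda>h. C * norm h) \<longlongrightarrow> 0) (at (0::'a))" by simp
  show "(\<lambda>h. norm (f (x + h) - f x - D h) / norm h) \<midarrow>0\<rightarrow> 0"
  proof (rule Lim_null_comparison[OF _ lim])
    show "\<forall>\<^sub>F h in at 0. norm (norm (f (x + h) - f x - D h) / norm h) \<le> C * norm h"
    proof (rule always_eventually, rule allI)
      fix h
      have "norm (f (x + h) - f x - D h) / norm h \<le> C * norm h ^ 2 / norm h"
        by (intro divide_right_mono C) auto
      then show "norm (norm (f (x + h) - f x - D h) / norm h) \<le> C * norm h"
        by (cases "h = 0") (auto simp: power2_eq_square)
    qed
  qed
qed

lemma norm_integral_le_of_AE:
  fixes f :: "'b \<Rightarrow> 'c::{banach, second_countable_topology}"
  assumes "integrable M g" and "AE x in M. norm (f x) \<le> g x"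
  shows "norm (\<integral>x. f x \<partial>M) \<le> (\<integral>x. g x \<partial>M)"
proof -
  have "norm (\<integral>x. f x \<partial>M) \<le> (\<integral>x. norm (f x) \<partial>M)" by (rule integral_norm_bound)
  also have "\<dots> \<le> (\<integral>x. g x \<partial>M)"     by (intro integral_mono_AE') (use assms in \<open>auto elim!: eventually_mono intro: order_trans[OF norm_ge_zero]\<close>)
  finally show ?thesis .
qed

lemma integrable_times_bounded:
  fixes w f :: "'b \<Rightarrow> complex"
  assumes "integrable M w" and "f \<in> borel_measurable M" and "\<And>z. norm (f z) \<le> B"
  shows "integrable M (\<lambda>z. w z * f z)"
proof (rule Bochner_Integration.integrable_bound)
  show "integrable M (\<lambda>z. B * norm (w z))" using assms by simp
  show "(\<lambda>z. w z * f z) \<in> borel_measurable M" using assms by simp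
  show "AE z in M. norm (w z * f z) \<le> norm (B * norm (w z))"
  proof (rule AE_I2)
    fix z
    have "norm (w z * f z) \<le> norm (w z) * B" unfolding norm_mult by (intro mult_left_mono assms) auto
    also have "\<dots> \<le> norm (B * norm (w z))" by (simp add: mult.commute)
    finally show "norm (w z * f z) \<le> norm (B * norm (w z))" .
  qed
qed

text \<open>Superpositions of translated and reflected copies of \<open>u\<close>: a measure on a single point gives
  \<open>\<lambda>y. u (a - y)\<close>, a finitely supported \<open>s\<close> gives Riemann sums and \<open>s = id\<close> gives convolutions.\<close>

lemma superposition_has_derivative:
  fixes u :: "real^'n::finite \<Rightarrow> complex" and s :: "'b \<Rightarrow> real^'n" and w :: "'b \<Rightarrow> complex"
  assumes u: "u \<in> schwartz" and s[measurable]: "s \<in> borel_measurable M" and w: "integrable M w"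
  shows "((\<lambda>y. \<integral>z. w z * u (s z - y) \<partial>M) has_derivative
    (\<lambda>h. \<Sum>i\<in>UNIV. (h $ i) *\<^sub>R (- (\<integral>z. w z * partial_deriv i u (s z - y) \<partial>M)))) (at y)"
proof -
  have int: "integrable M (\<lambda>z. w z * v (s z - y))" if v: "v \<in> schwartz" for v y
  proof -
    obtain B where "\<And>x. (1 + norm x) ^ 0 * norm (v x) \<le> B" using schwartz_decay[OF v, of 0] by blast
    moreover have [measurable]: "v \<in> borel_measurable borel" by (rule schwartz_borel_measurable[OF v])
    ultimately show ?thesis by (intro integrable_times_bounded[OF w]) auto
  qed
  obtain C where C: "0 < C" "\<And>x h. norm (u (x + h) - u x - (\<Sum>i\<in>UNIV. (h $ i) *\<^sub>R partial_deriv i u x)) \<le> C * norm h ^ 2"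
    using schwartz_Taylor_bound[OF u] by blast
  show ?thesis
  proof (rule has_derivative_at_quadraticI)
    show "bounded_linear (\<lambda>h. \<Sum>i\<in>UNIV. (h $ i) *\<^sub>R (- (\<integral>z. w z * partial_deriv i u (s z - y) \<partial>M)))"
      by (intro bounded_linear_sum bounded_linear_scaleR_const bounded_linear_vec_nth)
    fix h :: "real^'n"
    have ip: "integrable M (\<lambda>z. w z * partial_deriv i u (s z - y))" for i
      by (intro int schwartz_partial_deriv u)
    \<comment> \<open>The error of the candidate derivative is the integral of \<open>w z\<close>
      against the Taylor remainder of \<open>u\<close> at \<open>s z - y\<close> for the increment
      \<open>- h\<close>; that remainder is quadratic in \<open>h\<close> uniformly in
      \<open>z\<close>.\<close>
    let ?R = "\<lambda>z. u ((s z - y) + (- h)) - u (s z - y) - (\<Sum>i\<in>UNIV. ((- h) $ i) *\<^sub>R partial_deriv i u (s z - y))"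
    have "(\<integral>z. w z * u (s z - (y + h)) \<partial>M) - (\<integral>z. w z * u (s z - y) \<partial>M)
        - (\<Sum>i\<in>UNIV. (h $ i) *\<^sub>R (- (\<integral>z. w z * partial_deriv i u (s z - y) \<partial>M)))
      = (\<integral>z. w z * u (s z - (y + h)) \<partial>M) - (\<integral>z. w z * u (s z - y) \<partial>M)
        - (\<integral>z. (\<Sum>i\<in>UNIV. (- (h $ i)) *\<^sub>R (w z * partial_deriv i u (s z - y))) \<partial>M)"
      by (subst Bochner_Integration.integral_sum) (use ip in \<open>auto simp: sum_negf\<close>)
    also have "\<dots> = (\<integral>z. w z * u (s z - (y + h)) - w z * u (s z - y)
        - (\<Sum>i\<in>UNIV. (- (h $ i)) *\<^sub>R (w z * partial_deriv i u (s z - y))) \<partial>M)"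
      using int[OF u, of y] int[OF u, of "y + h"] ip
      by (subst Bochner_Integration.integral_diff, intro Bochner_Integration.integrable_diff, simp, simp,
          intro Bochner_Integration.integrable_sum integrable_scaleR_right, simp, simp)
    also have "\<dots> = (\<integral>z. w z * ?R z \<partial>M)"
      by (intro Bochner_Integration.integral_cong) (auto simp: algebra_simps sum_distrib_left sum_negf)
    finally have eq: "(\<integral>z. w z * u (s z - (y + h)) \<partial>M) - (\<integral>z. w z * u (s z - y) \<partial>M)
        - (\<Sum>i\<in>UNIV. (h $ i) *\<^sub>R (- (\<integral>z. w z * partial_deriv i u (s z - y) \<partial>M))) = (\<integral>z. w z * ?R z \<partial>M)" .
    have "norm (\<integral>z. w z * ?R z \<partial>M) \<le> (\<integral>z. norm (w z) * (C * norm h ^ 2) \<partial>M)"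
    proof (rule norm_integral_le_of_AE)
      show "integrable M (\<lambda>z. norm (w z) * (C * norm h ^ 2))" using w by simp
      show "AE z in M. norm (w z * ?R z) \<le> norm (w z) * (C * norm h ^ 2)"
        using C(2)[of _ "- h"] by (auto simp: norm_mult intro!: mult_left_mono)
    qed
    then show "norm ((\<integral>z. w z * u (s z - (y + h)) \<partial>M) - (\<integral>z. w z * u (s z - y) \<partial>M)
        - (\<Sum>i\<in>UNIV. (h $ i) *\<^sub>R (- (\<integral>z. w z * partial_deriv i u (s z - y) \<partial>M))))
      \<le> (C * (\<integral>z. norm (w z) \<partial>M)) * norm h ^ 2"
      unfolding eq by (simp add: mult_ac)
  qed
qed

lemma iterated_partial_superposition:
  fixes u :: "real^'n::finite \<Rightarrow> complex" and s :: "'b \<Rightarrow> real^'n" and w :: "'b \<Rightarrow> complex"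
  assumes u: "u \<in> schwartz" and s: "s \<in> borel_measurable M" and w: "integrable M w"
  shows "iterated_partial is (\<lambda>y. \<integral>z. w z * u (s z - y) \<partial>M)
    = (\<lambda>y. (- 1) ^ length is * (\<integral>z. w z * iterated_partial is u (s z - y) \<partial>M))"
proof (induction "is")
  case (Cons i "is")
  let ?v = "iterated_partial is u"
  have v: "?v \<in> schwartz" using u by (rule schwartz_iterated_partial)
  show ?case
  proof
    fix y
    have d: "((\<lambda>y. (- 1) ^ length is * (\<integral>z. w z * ?v (s z - y) \<partial>M)) has_derivative
      (\<lambda>h. (- 1) ^ length is * (\<Sum>j\<in>UNIV. (h $ j) *\<^sub>R (- (\<integral>z. w z * partial_deriv j ?v (s z - y) \<partial>M))))) (at y)"
      by (intro has_derivative_mult_right superposition_has_derivative v s w)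
    have "partial_deriv i (\<lambda>y. (- 1) ^ length is * (\<integral>z. w z * ?v (s z - y) \<partial>M)) y
      = (- 1) ^ length is * (- (\<integral>z. w z * partial_deriv i ?v (s z - y) \<partial>M))"
      by (rule partial_deriv_eqI) (use d in \<open>simp add: sum_distrib_left mult_scaleR_right\<close>)
    then show "iterated_partial (i # is) (\<lambda>y. \<integral>z. w z * u (s z - y) \<partial>M) y
      = (- 1) ^ length (i # is) * (\<integral>z. w z * iterated_partial (i # is) u (s z - y) \<partial>M)"
      unfolding iterated_partial_Cons Cons.IH by simp
  qed
qed simp

text \<open>The inequality \<open>1 + norm y \<le> (1 + norm (s z - y)) * (1 + norm (s z))\<close>
  shares a polynomial weight in \<open>y\<close> between the decay of \<open>u\<close> and the
  moments of \<open>w\<close>.\<close>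

lemma schwartz_superposition:
  fixes u :: "real^'n::finite \<Rightarrow> complex" and s :: "'b \<Rightarrow> real^'n" and w :: "'b \<Rightarrow> complex"
  assumes u: "u \<in> schwartz" and s[measurable]: "s \<in> borel_measurable M" and wm[measurable]: "w \<in> borel_measurable M"
    and w: "\<And>k. integrable M (\<lambda>z. norm (w z) * (1 + norm (s z)) ^ k)"
  shows "(\<lambda>y. \<integral>z. w z * u (s z - y) \<partial>M) \<in> schwartz"
  unfolding schwartz_def
proof (intro CollectI allI conjI)
  have w0: "integrable M w" using w[of 0] by (simp add: integrable_norm_iff)
  fix "is" :: "'n list"
  let ?v = "iterated_partial is u"
  have v: "?v \<in> schwartz" using u by (rule schwartz_iterated_partial)
  note eq = iterated_partial_superposition[OF u s w0, of "is"]
  show "iterated_partial is (\<lambda>y. \<integral>z. w z * u (s z - y) \<partial>M) differentiable (at y)" for y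
    unfolding eq
    by (rule differentiableI[OF has_derivative_mult_right[OF superposition_has_derivative[OF v s w0]]])
  fix k
  obtain C where C: "0 < C" "\<And>x. (1 + norm x) ^ k * norm (?v x) \<le> C" using schwartz_decay[OF v, of k] by blast
  have "(1 + norm y) ^ k * norm (iterated_partial is (\<lambda>y. \<integral>z. w z * u (s z - y) \<partial>M) y)
    \<le> (\<integral>z. C * (norm (w z) * (1 + norm (s z)) ^ k) \<partial>M)" for y
  proof -
    have "norm (\<integral>z. of_real ((1 + norm y) ^ k) * (w z * ?v (s z - y)) \<partial>M)
      \<le> (\<integral>z. C * (norm (w z) * (1 + norm (s z)) ^ k) \<partial>M)"
    proof (rule norm_integral_le_of_AE)
      show "integrable M (\<lambda>z. C * (norm (w z) * (1 + norm (s z)) ^ k))" using w by simp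
      show "AE z in M. norm (of_real ((1 + norm y) ^ k) * (w z * ?v (s z - y))) \<le> C * (norm (w z) * (1 + norm (s z)) ^ k)"
      proof (rule AE_I2)
        fix z
        have "1 + norm y \<le> (1 + norm (s z - y)) * (1 + norm (s z))"
        proof -
          have "norm y \<le> norm (s z - y) + norm (s z)" by (metis norm_minus_commute norm_triangle_sub add.commute)
          moreover have "0 \<le> norm (s z - y) * norm (s z)" by simp
          moreover have "(1 + norm (s z - y)) * (1 + norm (s z)) = 1 + norm (s z) + norm (s z - y) + norm (s z - y) * norm (s z)"
            by (simp add: algebra_simps)
          ultimately show ?thesis by linarith
        qed
        then have "(1 + norm y) ^ k \<le> ((1 + norm (s z - y)) * (1 + norm (s z))) ^ k" by (intro power_mono) auto
        then have "(1 + norm y) ^ k * (norm (w z) * norm (?v (s z - y)))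
          \<le> ((1 + norm (s z - y)) * (1 + norm (s z))) ^ k * (norm (w z) * norm (?v (s z - y)))"
          by (intro mult_right_mono) auto
        also have "\<dots> = ((1 + norm (s z - y)) ^ k * norm (?v (s z - y))) * (norm (w z) * (1 + norm (s z)) ^ k)"
          by (simp add: power_mult_distrib)
        also have "\<dots> \<le> C * (norm (w z) * (1 + norm (s z)) ^ k)" by (intro mult_right_mono C) auto
        finally show "norm (of_real ((1 + norm y) ^ k) * (w z * ?v (s z - y))) \<le> C * (norm (w z) * (1 + norm (s z)) ^ k)"
          by (simp add: norm_mult norm_power abs_of_nonneg add_nonneg_nonneg del: of_real_power)
      qed
    qed
    moreover have "norm (complex_of_real ((1 + norm y) ^ k)) = (1 + norm y) ^ k"
      unfolding norm_of_real by (intro abs_of_nonneg zero_le_power add_nonneg_nonneg) auto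
    ultimately show ?thesis unfolding eq by (simp add: norm_mult norm_power del: of_real_power of_real_add)
  qed
  then show "\<exists>C. \<forall>y. (1 + norm y) ^ k * norm (iterated_partial is (\<lambda>y. \<integral>z. w z * u (s z - y) \<partial>M) y) \<le> C" by blast
qed

section \<open>Linear structure, reflections and seminorms of the Schwartz space\<close>

lemma partial_deriv_lincomb:
  assumes u: "u \<in> schwartz" and v: "v \<in> schwartz"
  shows "partial_deriv i (\<lambda>x. a * u x + b * v x) = (\<lambda>x. a * partial_deriv i u x + b * partial_deriv i v x)"
proof
  fix x
  have "((\<lambda>x. a * u x + b * v x) has_derivative
    (\<lambda>h. a * (\<Sum>i\<in>UNIV. (h $ i) *\<^sub>R partial_deriv i u x) + b * (\<Sum>i\<in>UNIV. (h $ i) *\<^sub>R partial_deriv i v x))) (at x)"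
    by (intro has_derivative_add has_derivative_mult_right schwartz_has_derivative u v)
  then show "partial_deriv i (\<lambda>x. a * u x + b * v x) x = a * partial_deriv i u x + b * partial_deriv i v x"
    by (intro partial_deriv_eqI) (simp add: sum_distrib_left mult_scaleR_right sum.distrib scaleR_add_right)
qed

lemma iterated_partial_lincomb:
  assumes u: "u \<in> schwartz" and v: "v \<in> schwartz"
  shows "iterated_partial is (\<lambda>x. a * u x + b * v x) = (\<lambda>x. a * iterated_partial is u x + b * iterated_partial is v x)"
  by (induction "is") (auto simp: iterated_partial_Cons partial_deriv_lincomb schwartz_iterated_partial u v)

lemma schwartz_lincomb:
  assumes u: "u \<in> schwartz" and v: "v \<in> schwartz"
  shows "(\<lambda>x. a * u x + b * v x) \<in> schwartz"
  unfolding schwartz_def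
proof (intro CollectI allI conjI)
  fix "is" :: "'a list"
  let ?u = "iterated_partial is u" and ?v = "iterated_partial is v"
  have uv: "?u \<in> schwartz" "?v \<in> schwartz" using u v by (auto intro: schwartz_iterated_partial)
  note eq = iterated_partial_lincomb[OF u v, of "is" a b]
  show "iterated_partial is (\<lambda>x. a * u x + b * v x) differentiable (at x)" for x
    unfolding eq using schwartz_differentiable[OF uv(1)] schwartz_differentiable[OF uv(2)]
    by (intro differentiable_add differentiable_mult differentiable_const) auto
  fix k
  obtain C where C: "\<And>x. (1 + norm x) ^ k * norm (?u x) \<le> C" using schwartz_decay[OF uv(1), of k] by blast
  obtain D where D: "\<And>x. (1 + norm x) ^ k * norm (?v x) \<le> D" using schwartz_decay[OF uv(2), of k] by blast
  have "(1 + norm x) ^ k * norm (a * ?u x + b * ?v x) \<le> norm a * C + norm b * D" for x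
  proof -
    have "(1 + norm x) ^ k * norm (a * ?u x + b * ?v x) \<le> (1 + norm x) ^ k * (norm a * norm (?u x) + norm b * norm (?v x))"
      using norm_triangle_ineq[of "a * ?u x" "b * ?v x"] by (intro mult_left_mono) (auto simp: norm_mult)
    also have "\<dots> = norm a * ((1 + norm x) ^ k * norm (?u x)) + norm b * ((1 + norm x) ^ k * norm (?v x))"
      by (simp add: algebra_simps)
    also have "\<dots> \<le> norm a * C + norm b * D" by (intro add_mono mult_left_mono C D) auto
    finally show ?thesis .
  qed
  then show "\<exists>C. \<forall>x. (1 + norm x) ^ k * norm (iterated_partial is (\<lambda>x. a * u x + b * v x) x) \<le> C"
    unfolding eq by blast
qed

lemma schwartz_zero: "(\<lambda>_::real^'n::finite. 0) \<in> schwartz"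
proof -
  have "iterated_partial is (\<lambda>_::real^'n. 0) = (\<lambda>_. 0 :: complex)" for "is" :: "'n list"
    by (induction "is") (auto simp: iterated_partial_Cons partial_deriv_def)
  then show ?thesis unfolding schwartz_def by auto
qed

lemma schwartz_cmult: "u \<in> schwartz \<Longrightarrow> (\<lambda>x. c * u x) \<in> schwartz"
  using schwartz_lincomb[of u u c 0] by simp

lemma schwartz_diff: "u \<in> schwartz \<Longrightarrow> v \<in> schwartz \<Longrightarrow> (\<lambda>x. u x - v x) \<in> schwartz"
  using schwartz_lincomb[of u v 1 "-1"] by simp

lemma schwartz_add: "u \<in> schwartz \<Longrightarrow> v \<in> schwartz \<Longrightarrow> (\<lambda>x. u x + v x) \<in> schwartz"
  using schwartz_lincomb[of u v 1 1] by simp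

lemma schwartz_sum:
  "(\<And>i. i \<in> I \<Longrightarrow> u i \<in> schwartz) \<Longrightarrow> (\<lambda>x. \<Sum>i\<in>I. u i x) \<in> schwartz"
  by (induction I rule: infinite_finite_induct) (auto intro: schwartz_zero schwartz_add)

lemma schwartz_reflect:
  fixes u :: "real^'n::finite \<Rightarrow> complex"
  assumes "u \<in> schwartz"
  shows "(\<lambda>y. u (a - y)) \<in> schwartz"
    and "iterated_partial is (\<lambda>y. u (a - y)) = (\<lambda>y. (- 1) ^ length is * iterated_partial is u (a - y))"
proof -
  let ?M = "count_space (UNIV :: unit set)"
  have eq: "(\<integral>z. (1::complex) * v (a - y) \<partial>?M) = v (a - y)" for v :: "real^'n \<Rightarrow> complex" and y
    by (subst lebesgue_integral_count_space_finite) auto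
  have int: "integrable ?M f" for f :: "unit \<Rightarrow> 'b::{banach,second_countable_topology}"
    by (rule integrable_count_space) auto
  show "(\<lambda>y. u (a - y)) \<in> schwartz"
    using schwartz_superposition[OF assms, of "\<lambda>_. a" ?M "\<lambda>_. 1"] unfolding eq by (simp add: int)
  show "iterated_partial is (\<lambda>y. u (a - y)) = (\<lambda>y. (- 1) ^ length is * iterated_partial is u (a - y))"
    using iterated_partial_superposition[OF assms, of "\<lambda>_. a" ?M "\<lambda>_. 1" "is"] unfolding eq by (simp add: int)
qed

lemma finite_short_lists: "finite {is :: 'n::finite list. length is \<le> k}"
  using finite_lists_length_le[of "UNIV :: 'n set" k] by simp

text \<open>A seminorm of order \<open>k\<close> involves only finitely many iterated derivatives,
  so constants found for each of them separately can be replaced by their sum.\<close>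

lemma uniform_constant_short_lists:
  fixes P :: "'n::finite list \<Rightarrow> real \<Rightarrow> bool"
  assumes ex: "\<And>is. \<exists>C>0. P is C" and mono: "\<And>is C D. C \<le> D \<Longrightarrow> P is C \<Longrightarrow> P is D"
  obtains C where "0 < C" and "\<And>is. length is \<le> k \<Longrightarrow> P is C"
proof -
  obtain c where c: "\<And>is. 0 < c is" "\<And>is. P is (c is)" using ex by metis
  have le: "c js \<le> (\<Sum>is\<in>{is. length is \<le> k}. c is)" if "length js \<le> k" for js
    using that c(1) by (intro member_le_sum) (auto simp: finite_short_lists less_imp_le)
  show ?thesis
  proof (rule that)
    show "0 < (\<Sum>is\<in>{is. length is \<le> k}. c is)" using less_le_trans[OF c(1)[of "[]"] le[of "[]"]] by simp
    show "P js (\<Sum>is\<in>{is. length is \<le> k}. c is)" if "length js \<le> k" for js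
      by (rule mono[OF le[OF that] c(2)])
  qed
qed

lemma schwartz_seminorm_leI:
  assumes "\<And>is x. length is \<le> k \<Longrightarrow> (1 + norm x) ^ k * norm (iterated_partial is f x) \<le> B"
  shows "schwartz_seminorm k f \<le> B"
  unfolding schwartz_seminorm_def using assms by (intro cSUP_least) (auto intro: exI[of _ "[]"])

text \<open>The seminorm is a real supremum and is meaningful only for a bounded set; boundedness
  comes from the decay of each derivative and the finiteness of the set of short lists.\<close>

lemma le_schwartz_seminorm:
  fixes f :: "real^'n::finite \<Rightarrow> complex"
  assumes f: "f \<in> schwartz" and "length is \<le> k"
  shows "(1 + norm x) ^ k * norm (iterated_partial is f x) \<le> schwartz_seminorm k f"
proof -
  have "\<exists>C>0. \<forall>x. (1 + norm x) ^ k * norm (iterated_partial is f x) \<le> C" for "is"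
    using schwartz_decay[OF schwartz_iterated_partial[OF f]] by metis
  then obtain C where C: "\<And>is. length is \<le> k \<Longrightarrow> \<forall>x. (1 + norm x) ^ k * norm (iterated_partial is f x) \<le> C"
    by (rule uniform_constant_short_lists[where P = "\<lambda>is C. \<forall>x. (1 + norm x) ^ k * norm (iterated_partial is f x) \<le> C"])
      (auto intro: order_trans)
  have "(\<lambda>(is, x). (1 + norm x) ^ k * norm (iterated_partial is f x)) (is, x) \<le> schwartz_seminorm k f"
    unfolding schwartz_seminorm_def using C assms(2)
    by (intro cSUP_upper) (auto intro!: bdd_aboveI[where M = C])
  then show ?thesis by simp
qed

lemma schwartz_seminorm_nonneg: "f \<in> schwartz \<Longrightarrow> 0 \<le> schwartz_seminorm k f"
  using le_schwartz_seminorm[of f "[]" k 0] by (auto intro: order_trans[rotated])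

lemma schwartz_seminorm_cmult_le:
  assumes f: "f \<in> schwartz"
  shows "schwartz_seminorm k (\<lambda>x. c * f x) \<le> norm c * schwartz_seminorm k f"
proof (rule schwartz_seminorm_leI)
  fix "is" :: "'a list" and x :: "real^'a" assume l: "length is \<le> k"
  have "iterated_partial is (\<lambda>x. c * f x) x = c * iterated_partial is f x"
    using iterated_partial_lincomb[OF f f, of "is" c 0] by (simp add: fun_eq_iff)
  then have "(1 + norm x) ^ k * norm (iterated_partial is (\<lambda>x. c * f x) x) = norm c * ((1 + norm x) ^ k * norm (iterated_partial is f x))"
    by (simp add: norm_mult)
  also have "\<dots> \<le> norm c * schwartz_seminorm k f" by (intro mult_left_mono le_schwartz_seminorm f l) auto
  finally show "(1 + norm x) ^ k * norm (iterated_partial is (\<lambda>x. c * f x) x) \<le> norm c * schwartz_seminorm k f" .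
qed

section \<open>Tempered distributions, their convolutions and their action under integrals\<close>

lemma tempered_add:
  "T \<in> tempered_distributions \<Longrightarrow> u \<in> schwartz \<Longrightarrow> v \<in> schwartz \<Longrightarrow> T (\<lambda>x. u x + v x) = T u + T v"
  unfolding tempered_distributions_def by blast

lemma tempered_cmult:
  "T \<in> tempered_distributions \<Longrightarrow> u \<in> schwartz \<Longrightarrow> T (\<lambda>x. c * u x) = c * T u"
  unfolding tempered_distributions_def by blast

lemma tempered_zero: "T \<in> tempered_distributions \<Longrightarrow> T (\<lambda>_. 0) = 0"
  using tempered_cmult[of T "\<lambda>_. 0" 0] schwartz_zero by simp

lemma tempered_diff:
  assumes "T \<in> tempered_distributions" "u \<in> schwartz" "v \<in> schwartz"
  shows "T (\<lambda>x. u x - v x) = T u - T v"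
  using tempered_add[OF assms(1,2) schwartz_cmult[OF assms(3), of "-1"]] tempered_cmult[OF assms(1,3), of "-1"] by simp

lemma tempered_sum:
  assumes T: "T \<in> tempered_distributions"
  shows "(\<And>i. i \<in> I \<Longrightarrow> u i \<in> schwartz) \<Longrightarrow> T (\<lambda>x. \<Sum>i\<in>I. c i * u i x) = (\<Sum>i\<in>I. c i * T (u i))"
proof (induction I rule: infinite_finite_induct)
  case (insert i I)
  have "T (\<lambda>x. c i * u i x + (\<Sum>i\<in>I. c i * u i x)) = T (\<lambda>x. c i * u i x) + T (\<lambda>x. \<Sum>i\<in>I. c i * u i x)"
    using insert.prems by (intro tempered_add T schwartz_cmult schwartz_sum) auto
  then show ?case using insert by (simp add: tempered_cmult[OF T])
qed (auto simp: tempered_zero[OF T])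

text \<open>Continuity at zero yields a ball of some seminorm on which \<open>T\<close> is bounded
  by 1, and homogeneity extends this to a global inequality.\<close>

lemma tempered_seminorm_bound:
  assumes T: "T \<in> tempered_distributions"
  obtains k C where "0 < C" and "\<And>u. u \<in> schwartz \<Longrightarrow> norm (T u) \<le> C * schwartz_seminorm k u"
proof -
  have "\<forall>u\<in>schwartz. \<forall>\<epsilon>>0. \<exists>k. \<exists>\<delta>>0. \<forall>v\<in>schwartz.
      schwartz_seminorm k (\<lambda>x. v x - u x) < \<delta> \<longrightarrow> norm (T v - T u) < \<epsilon>"
    using T unfolding tempered_distributions_def by simp
  from this[rule_format, OF schwartz_zero zero_less_one] obtain k d where d: "0 < d" "\<And>v. v \<in> schwartz \<Longrightarrow> schwartz_seminorm k v < d \<Longrightarrow> norm (T v) < 1"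
    by (auto simp: tempered_zero[OF T])
  show ?thesis
  proof (rule that[of "2 / d" k])
    show "0 < 2 / d" using d by simp
    fix u :: "real^'a \<Rightarrow> complex" assume u: "u \<in> schwartz"
    define S where "S = schwartz_seminorm k u"
    have S: "0 \<le> S" unfolding S_def using u by (rule schwartz_seminorm_nonneg)
    show "norm (T u) \<le> 2 / d * schwartz_seminorm k u"
    proof (rule field_le_epsilon)
      fix e :: real assume e: "0 < e"
      \<comment> \<open>Chosen such that \<open>c * S < d\<close> while
        \<open>1 / c = 2 / d * S + e\<close>. The summand with \<open>e\<close> keeps the
        denominator positive when the seminorm of \<open>u\<close> vanishes.\<close>
      define c where "c = d / (2 * S + d * e)"
      have den: "0 < 2 * S + d * e" using S d e by (simp add: add_nonneg_pos)
      have c: "0 < c" unfolding c_def using d den by simp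
      have "schwartz_seminorm k (\<lambda>x. of_real c * u x) \<le> c * S"
        using schwartz_seminorm_cmult_le[OF u, of k "of_real c"] c unfolding S_def by simp
      also have "c * S < d"
      proof -
        have "S < 2 * S + d * e" using S d e by (simp add: add_nonneg_pos)
        then have "d * S < d * (2 * S + d * e)" using d by (intro mult_strict_left_mono)
        then show ?thesis unfolding c_def using den by (simp add: divide_less_eq)
      qed
      finally have "norm (T (\<lambda>x. of_real c * u x)) < 1" using u by (intro d schwartz_cmult)
      then have "c * norm (T u) < 1" using c u by (simp add: tempered_cmult[OF T] norm_mult)
      then have "norm (T u) < 1 / c" using c by (simp add: field_simps)
      also have "1 / c = 2 / d * S + e" unfolding c_def using d by (simp add: field_simps)
      finally show "norm (T u) \<le> 2 / d * schwartz_seminorm k u + e" unfolding S_def by simp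
    qed
  qed
qed

text \<open>The seminorm bound of \<open>T\<close> applied to translates of the reflected
  \<open>\<Phi>\<close>, whose seminorms grow polynomially in the translation, and to differences of
  such translates, which are Lipschitz with polynomially growing constant. Both estimates concern
  the same seminorm order \<open>k\<close>.\<close>

lemma convolution_growth:
  fixes \<Phi> :: "real^'n::finite \<Rightarrow> complex"
  assumes T: "T \<in> tempered_distributions" and \<Phi>: "\<Phi> \<in> schwartz"
  obtains k C where "0 < C" and "\<And>z. norm (convolution \<Phi> T z) \<le> C * (1 + norm z) ^ k"
    and "\<And>a b. norm (convolution \<Phi> T a - convolution \<Phi> T b) \<le> C * (1 + norm a + norm b) ^ k * norm (a - b)"
proof -
  obtain k C0 where C0: "0 < C0" "\<And>u. u \<in> schwartz \<Longrightarrow> norm (T u) \<le> C0 * schwartz_seminorm k u"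
    using tempered_seminorm_bound[OF T] by blast
  have "\<exists>C>0. \<forall>x. (1 + norm x) ^ k * norm (iterated_partial is \<Phi> x) \<le> C" for "is"
    using schwartz_decay[OF schwartz_iterated_partial[OF \<Phi>]] by metis
  then obtain C1 where C1: "0 < C1" "\<And>is. length is \<le> k \<Longrightarrow> \<forall>x. (1 + norm x) ^ k * norm (iterated_partial is \<Phi> x) \<le> C1"
    by (rule uniform_constant_short_lists[where P = "\<lambda>is C. \<forall>x. (1 + norm x) ^ k * norm (iterated_partial is \<Phi> x) \<le> C"])
      (auto intro: order_trans)
  let ?P = "\<lambda>is C. \<forall>a b y. (1 + norm y) ^ k * norm (iterated_partial is \<Phi> (a - y) - iterated_partial is \<Phi> (b - y))
      \<le> C * (1 + norm a + norm b) ^ k * norm (a - b)"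
  have ex: "\<exists>C>0. ?P is C" for "is"
    using schwartz_Lipschitz_weighted[OF schwartz_iterated_partial[OF \<Phi>], of k "is"] by metis
  have mono: "?P is D" if "C \<le> D" "?P is C" for "is" C D
  proof (intro allI)
    fix a b y :: "real^'n"
    have "C * (1 + norm a + norm b) ^ k * norm (a - b) \<le> D * (1 + norm a + norm b) ^ k * norm (a - b)"
      using that(1) by (intro mult_right_mono) auto
    then show "(1 + norm y) ^ k * norm (iterated_partial is \<Phi> (a - y) - iterated_partial is \<Phi> (b - y))
      \<le> D * (1 + norm a + norm b) ^ k * norm (a - b)" using that(2) by (meson order_trans)
  qed
  obtain C2 where C2: "0 < C2" "\<And>is. length is \<le> k \<Longrightarrow> ?P is C2"
    by (rule uniform_constant_short_lists[where P = ?P and k = k, OF ex]) (use mono in blast)+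
  have r: "(\<lambda>y. \<Phi> (z - y)) \<in> schwartz" for z by (rule schwartz_reflect(1)[OF \<Phi>])
  show ?thesis
  proof (rule that[of "C0 * max C1 C2" k])
    show "0 < C0 * max C1 C2" using C0 C1 by simp
    fix z
    have "schwartz_seminorm k (\<lambda>y. \<Phi> (z - y)) \<le> max C1 C2 * (1 + norm z) ^ k"
    proof (rule schwartz_seminorm_leI)
      fix "is" :: "'n list" and y assume l: "length is \<le> k"
      have "1 + norm y \<le> (1 + norm (z - y)) * (1 + norm z)"
      proof -
        have "norm y \<le> norm (z - y) + norm z" by (metis norm_minus_commute norm_triangle_sub add.commute)
        moreover have "0 \<le> norm (z - y) * norm z" by simp
        moreover have "(1 + norm (z - y)) * (1 + norm z) = 1 + norm z + norm (z - y) + norm (z - y) * norm z"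
          by (simp add: algebra_simps)
        ultimately show ?thesis by linarith
      qed
      then have "(1 + norm y) ^ k \<le> ((1 + norm (z - y)) * (1 + norm z)) ^ k" by (intro power_mono) auto
      then have "(1 + norm y) ^ k * norm (iterated_partial is \<Phi> (z - y))
        \<le> ((1 + norm (z - y)) * (1 + norm z)) ^ k * norm (iterated_partial is \<Phi> (z - y))" by (intro mult_right_mono) auto
      also have "\<dots> = ((1 + norm (z - y)) ^ k * norm (iterated_partial is \<Phi> (z - y))) * (1 + norm z) ^ k"
        by (simp add: power_mult_distrib)
      also have "\<dots> \<le> max C1 C2 * (1 + norm z) ^ k"
        using C1(2)[OF l] by (intro mult_right_mono) (auto simp: le_max_iff_disj)
      finally show "(1 + norm y) ^ k * norm (iterated_partial is (\<lambda>y. \<Phi> (z - y)) y) \<le> max C1 C2 * (1 + norm z) ^ k"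
        by (simp add: schwartz_reflect(2)[OF \<Phi>] norm_mult norm_power)
    qed
    then have "C0 * schwartz_seminorm k (\<lambda>y. \<Phi> (z - y)) \<le> C0 * (max C1 C2 * (1 + norm z) ^ k)"
      using C0 by (intro mult_left_mono) auto
    then show "norm (convolution \<Phi> T z) \<le> C0 * max C1 C2 * (1 + norm z) ^ k"
      unfolding convolution_def using C0(2)[OF r[of z]] by (simp add: mult.assoc)
  next
    fix a b
    have "schwartz_seminorm k (\<lambda>y. \<Phi> (a - y) - \<Phi> (b - y)) \<le> max C1 C2 * ((1 + norm a + norm b) ^ k * norm (a - b))"
    proof (rule schwartz_seminorm_leI)
      fix "is" :: "'n list" and y assume l: "length is \<le> k"
      have "iterated_partial is (\<lambda>y. \<Phi> (a - y) - \<Phi> (b - y)) y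
        = (- 1) ^ length is * (iterated_partial is \<Phi> (a - y) - iterated_partial is \<Phi> (b - y))"
        using iterated_partial_lincomb[OF r r, of "is" 1 a "-1" b]
        by (simp add: schwartz_reflect(2)[OF \<Phi>] fun_eq_iff algebra_simps)
      then have "(1 + norm y) ^ k * norm (iterated_partial is (\<lambda>y. \<Phi> (a - y) - \<Phi> (b - y)) y)
        = (1 + norm y) ^ k * norm (iterated_partial is \<Phi> (a - y) - iterated_partial is \<Phi> (b - y))"
        by (simp add: norm_mult norm_power)
      also have "\<dots> \<le> C2 * (1 + norm a + norm b) ^ k * norm (a - b)" using C2(2)[OF l] by blast
      also have "\<dots> \<le> max C1 C2 * (1 + norm a + norm b) ^ k * norm (a - b)" by (intro mult_right_mono) auto
      finally show "(1 + norm y) ^ k * norm (iterated_partial is (\<lambda>y. \<Phi> (a - y) - \<Phi> (b - y)) y)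
        \<le> max C1 C2 * ((1 + norm a + norm b) ^ k * norm (a - b))" by (simp add: mult.assoc)
    qed
    then have "C0 * schwartz_seminorm k (\<lambda>y. \<Phi> (a - y) - \<Phi> (b - y)) \<le> C0 * (max C1 C2 * ((1 + norm a + norm b) ^ k * norm (a - b)))"
      using C0 by (intro mult_left_mono) auto
    moreover have "norm (T (\<lambda>y. \<Phi> (a - y)) - T (\<lambda>y. \<Phi> (b - y))) \<le> C0 * schwartz_seminorm k (\<lambda>y. \<Phi> (a - y) - \<Phi> (b - y))"
      using C0(2)[OF schwartz_diff[OF r r, of a b]] by (simp add: tempered_diff[OF T r r])
    ultimately show "norm (convolution \<Phi> T a - convolution \<Phi> T b) \<le> C0 * max C1 C2 * (1 + norm a + norm b) ^ k * norm (a - b)"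
      unfolding convolution_def by (simp add: mult.assoc)
  qed
qed

text \<open>For a simple function \<open>s\<close> a superposition is a finite linear combination of
  translates, to which plain linearity of a distribution applies.\<close>

lemma integral_simple_composition:
  fixes F :: "'b \<Rightarrow> complex" and w :: "'a \<Rightarrow> complex"
  assumes s: "simple_function M s" and w: "integrable M w"
  shows "(\<integral>z. w z * F (s z) \<partial>M) = (\<Sum>a\<in>s ` space M. F a * (\<integral>z. w z * indicator (s -` {a} \<inter> space M) z \<partial>M))"
proof -
  have fin: "finite (s ` space M)" using s by (rule simple_functionD)
  have [measurable]: "s -` {a} \<inter> space M \<in> sets M" for a using s by (rule simple_functionD)
  have int: "integrable M (\<lambda>z. w z * indicator (s -` {a} \<inter> space M) z)" for a
    by (rule integrable_times_bounded[OF w, of _ 1]) (measurable, simp add: indicator_def)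
  have "(\<integral>z. w z * F (s z) \<partial>M) = (\<integral>z. (\<Sum>a\<in>s ` space M. F a * (w z * indicator (s -` {a} \<inter> space M) z)) \<partial>M)"
  proof (rule Bochner_Integration.integral_cong[OF refl])
    fix z assume z: "z \<in> space M"
    have "(\<Sum>a\<in>s ` space M. F a * (w z * indicator (s -` {a} \<inter> space M) z)) = (\<Sum>a\<in>s ` space M. if a = s z then F a * w z else 0)"
      using z by (intro sum.cong) (auto simp: indicator_def)
    also have "\<dots> = F (s z) * w z" using fin z by simp
    finally show "w z * F (s z) = (\<Sum>a\<in>s ` space M. F a * (w z * indicator (s -` {a} \<inter> space M) z))" by (simp add: mult.commute)
  qed
  also have "\<dots> = (\<Sum>a\<in>s ` space M. F a * (\<integral>z. w z * indicator (s -` {a} \<inter> space M) z \<partial>M))"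
    using int by (subst Bochner_Integration.integral_sum) auto
  finally show ?thesis .
qed

lemma continuous_on_polynomial_Lipschitz:
  fixes g :: "'a::real_normed_vector \<Rightarrow> complex"
  assumes L: "\<And>a b. norm (g a - g b) \<le> C * (1 + norm a + norm b) ^ k * norm (a - b)"
  shows "continuous_on UNIV g"
proof (rule continuous_at_imp_continuous_on, rule ballI)
  fix x :: 'a
  have "((\<lambda>y. C * (1 + norm y + norm x) ^ k * norm (y - x)) \<longlongrightarrow> C * (1 + norm x + norm x) ^ k * norm (x - x)) (at x)"
    by (intro tendsto_intros)
  then have lim: "((\<lambda>y. C * (1 + norm y + norm x) ^ k * norm (y - x)) \<longlongrightarrow> 0) (at x)" by simp
  have "((\<lambda>y. g y - g x) \<longlongrightarrow> 0) (at x)"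
    by (rule Lim_null_comparison[OF _ lim]) (use L in auto)
  then show "isCont g x" unfolding isCont_def by (simp add: LIM_zero_iff)
qed

lemma convolution_continuous:
  assumes "T \<in> tempered_distributions" and "\<Phi> \<in> schwartz"
  shows "continuous_on UNIV (convolution \<Phi> T)"
  using convolution_growth[OF assms] continuous_on_polynomial_Lipschitz by metis

text \<open>A tempered distribution commutes with integrals of translates: replace \<open>z\<close> by simple functions
  \<open>s m\<close> tending to the identity; the Riemann sums converge in every Schwartz seminorm.\<close>

lemma tempered_integral:
  fixes \<Phi> w :: "real^'n::finite \<Rightarrow> complex"
  assumes T: "T \<in> tempered_distributions" and \<Phi>: "\<Phi> \<in> schwartz"
    and wm[measurable]: "w \<in> borel_measurable borel"
    and wi: "\<And>k. integrable lborel (\<lambda>z. norm (w z) * (1 + norm z) ^ k)"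
  shows "T (\<lambda>y. \<integral>z. w z * \<Phi> (z - y) \<partial>lborel) = (\<integral>z. w z * convolution \<Phi> T z \<partial>lborel)"
proof -
  define g where "g = convolution \<Phi> T"
  have w0: "integrable lborel w" using wi[of 0] by (simp add: integrable_norm_iff)
  \<comment> \<open>The bound of \<open>s m z\<close> by twice \<open>z\<close> provides majorants
    that are integrable and independent of \<open>m\<close> for all dominated convergence arguments
    below.\<close>
  obtain s where s: "\<And>m. simple_function lborel (s m :: real^'n \<Rightarrow> real^'n)" "\<And>z. (\<lambda>m. s m z) \<longlonglongrightarrow> z"
    "\<And>m z. dist (s m z) 0 \<le> 2 * dist z 0"
    using borel_measurable_implies_sequence_metric[of "\<lambda>x::real^'n. x" lborel 0] by auto
  have ns: "norm (s m z) \<le> 2 * norm z" for m z using s(3)[of m z] by simp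
  have sm[measurable]: "s m \<in> borel_measurable lborel" for m using s(1) by (rule borel_measurable_simple_function)
  have gc: "continuous_on UNIV g" unfolding g_def by (rule convolution_continuous[OF T \<Phi>])
  then have gm[measurable]: "g \<in> borel_measurable borel" by (rule borel_measurable_continuous_onI)
  obtain l Cg where Cg: "0 < Cg" "\<And>z. norm (g z) \<le> Cg * (1 + norm z) ^ l"
    using convolution_growth[OF T \<Phi>] unfolding g_def by metis
  obtain k C0 where C0: "0 < C0" "\<And>u. u \<in> schwartz \<Longrightarrow> norm (T u) \<le> C0 * schwartz_seminorm k u"
    using tempered_seminorm_bound[OF T] by blast
  let ?P = "\<lambda>is C. \<forall>a b y. (1 + norm y) ^ k * norm (iterated_partial is \<Phi> (a - y) - iterated_partial is \<Phi> (b - y))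
      \<le> C * (1 + norm a + norm b) ^ k * norm (a - b)"
  have ex: "\<exists>C>0. ?P is C" for "is"
    using schwartz_Lipschitz_weighted[OF schwartz_iterated_partial[OF \<Phi>], of k "is"] by metis
  have mono: "?P is D" if "C \<le> D" "?P is C" for "is" C D
  proof (intro allI)
    fix a b y :: "real^'n"
    have "C * (1 + norm a + norm b) ^ k * norm (a - b) \<le> D * (1 + norm a + norm b) ^ k * norm (a - b)"
      using that(1) by (intro mult_right_mono) auto
    then show "(1 + norm y) ^ k * norm (iterated_partial is \<Phi> (a - y) - iterated_partial is \<Phi> (b - y))
      \<le> D * (1 + norm a + norm b) ^ k * norm (a - b)" using that(2) by (meson order_trans)
  qed
  obtain C2 where C2: "0 < C2" "\<And>is. length is \<le> k \<Longrightarrow> ?P is C2"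
    by (rule uniform_constant_short_lists[where P = ?P and k = k, OF ex]) (use mono in blast)+
  define v where "v = (\<lambda>y. \<integral>z. w z * \<Phi> (z - y) \<partial>lborel)"
  define V where "V = (\<lambda>m y. \<integral>z. w z * \<Phi> (s m z - y) \<partial>lborel)"
  have pw: "(1 + c * norm z) ^ j \<le> c ^ j * (1 + norm z) ^ j" if "1 \<le> c" for c :: real and z :: "real^'n" and j
  proof -
    have "(1 + c * norm z) ^ j \<le> (c * (1 + norm z)) ^ j" using that by (intro power_mono) (auto simp: algebra_simps)
    then show ?thesis by (simp add: power_mult_distrib)
  qed
  have wsi: "integrable lborel (\<lambda>z. norm (w z) * (1 + norm (s m z)) ^ j)" for m j
  proof (rule Bochner_Integration.integrable_bound)
    show "integrable lborel (\<lambda>z. 2 ^ j * (norm (w z) * (1 + norm z) ^ j))" using wi by simp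
    show "AE z in lborel. norm (norm (w z) * (1 + norm (s m z)) ^ j) \<le> norm (2 ^ j * (norm (w z) * (1 + norm z) ^ j))"
    proof (rule AE_I2)
      fix z
      have "(1 + norm (s m z)) ^ j \<le> (1 + 2 * norm z) ^ j" using ns by (intro power_mono) auto
      also have "\<dots> \<le> 2 ^ j * (1 + norm z) ^ j" by (rule pw) simp
      finally have "norm (w z) * (1 + norm (s m z)) ^ j \<le> norm (w z) * (2 ^ j * (1 + norm z) ^ j)" by (intro mult_left_mono) auto
      then show "norm (norm (w z) * (1 + norm (s m z)) ^ j) \<le> norm (2 ^ j * (norm (w z) * (1 + norm z) ^ j))"
        by (simp add: abs_mult mult_ac)
    qed
  qed measurable
  have vS: "v \<in> schwartz" unfolding v_def by (rule schwartz_superposition[OF \<Phi>]) (use wi in auto)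
  have VS: "V m \<in> schwartz" for m unfolding V_def by (rule schwartz_superposition[OF \<Phi>]) (use wsi in auto)
  have r: "(\<lambda>y. \<Phi> (z - y)) \<in> schwartz" for z by (rule schwartz_reflect(1)[OF \<Phi>])
  have TV: "T (V m) = (\<integral>z. w z * g (s m z) \<partial>lborel)" for m
  proof -
    have "V m = (\<lambda>y. \<Sum>a\<in>s m ` space lborel. (\<integral>z. w z * indicator (s m -` {a} \<inter> space lborel) z \<partial>lborel) * \<Phi> (a - y))"
      unfolding V_def using integral_simple_composition[OF s(1)[of m] w0, of "\<lambda>a. \<Phi> (a - _)"]
      by (simp add: mult.commute)
    then have "T (V m) = (\<Sum>a\<in>s m ` space lborel. (\<integral>z. w z * indicator (s m -` {a} \<inter> space lborel) z \<partial>lborel) * g a)"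
      unfolding g_def convolution_def by (simp only:) (rule tempered_sum[OF T r])
    also have "\<dots> = (\<integral>z. w z * g (s m z) \<partial>lborel)"
      using integral_simple_composition[OF s(1)[of m] w0, of g] by (simp add: mult.commute)
    finally show ?thesis .
  qed
  have lim1: "(\<lambda>m. T (V m)) \<longlonglongrightarrow> (\<integral>z. w z * g z \<partial>lborel)"
    unfolding TV
  proof (rule integral_dominated_convergence)
    show "integrable lborel (\<lambda>z. Cg * 2 ^ l * (norm (w z) * (1 + norm z) ^ l))" using wi by simp
    show "AE z in lborel. (\<lambda>m. w z * g (s m z)) \<longlonglongrightarrow> w z * g z"
      using gc s(2) by (intro AE_I2 tendsto_mult tendsto_const isCont_tendsto_compose[of _ g]) (auto simp: continuous_on_eq_continuous_at)
    show "AE z in lborel. norm (w z * g (s m z)) \<le> Cg * 2 ^ l * (norm (w z) * (1 + norm z) ^ l)" for m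
    proof (rule AE_I2)
      fix z
      have "norm (g (s m z)) \<le> Cg * (1 + norm (s m z)) ^ l" by (rule Cg)
      also have "\<dots> \<le> Cg * (1 + 2 * norm z) ^ l" using Cg ns by (intro mult_left_mono power_mono) auto
      also have "\<dots> \<le> Cg * (2 ^ l * (1 + norm z) ^ l)" using Cg by (intro mult_left_mono pw) auto
      finally have "norm (w z) * norm (g (s m z)) \<le> norm (w z) * (Cg * (2 ^ l * (1 + norm z) ^ l))" by (intro mult_left_mono) auto
      then show "norm (w z * g (s m z)) \<le> Cg * 2 ^ l * (norm (w z) * (1 + norm z) ^ l)" by (simp add: norm_mult mult_ac)
    qed
  qed measurable
  \<comment> \<open>This number dominates the seminorm of \<open>V m - v\<close>, because
    \<open>norm (s m z) + norm z \<le> 3 * norm z\<close> in the weighted Lipschitz estimate. It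
    tends to 0 by dominated convergence, so \<open>T (V m)\<close> tends to \<open>T v\<close> as
    well as to the integral in \<open>lim1\<close>.\<close>
  define e where "e = (\<lambda>m. \<integral>z. norm (w z) * (C2 * (1 + 3 * norm z) ^ k * norm (s m z - z)) \<partial>lborel)"
  have ei: "norm (w z) * (C2 * (1 + 3 * norm z) ^ k * norm (s m z - z)) \<le> C2 * 3 ^ Suc k * (norm (w z) * (1 + norm z) ^ Suc k)" for m z
  proof -
    have "norm (s m z - z) \<le> 3 * (1 + norm z)" using norm_triangle_ineq4[of "s m z" z] ns[of m z] by simp
    then have "C2 * (1 + 3 * norm z) ^ k * norm (s m z - z) \<le> C2 * (3 ^ k * (1 + norm z) ^ k) * (3 * (1 + norm z))"
      using C2(1) by (intro mult_mono mult_left_mono pw) auto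
    then have "norm (w z) * (C2 * (1 + 3 * norm z) ^ k * norm (s m z - z)) \<le> norm (w z) * (C2 * (3 ^ k * (1 + norm z) ^ k) * (3 * (1 + norm z)))"
      by (intro mult_left_mono) auto
    also have "\<dots> = C2 * 3 ^ Suc k * (norm (w z) * (1 + norm z) ^ Suc k)" by (simp only: power_Suc mult_ac)
    finally show ?thesis .
  qed
  have dom: "integrable lborel (\<lambda>z. C2 * 3 ^ Suc k * (norm (w z) * (1 + norm z) ^ Suc k))"
    using wi[of "Suc k"] by (intro integrable_mult_right)
  have eint: "integrable lborel (\<lambda>z. norm (w z) * (C2 * (1 + 3 * norm z) ^ k * norm (s m z - z)))" for m
    by (rule Bochner_Integration.integrable_bound[OF dom])
      (measurable, intro AE_I2, use ei C2(1) in \<open>auto simp: abs_mult intro!: order_trans[OF ei]\<close>)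
  have elim: "e \<longlonglongrightarrow> (\<integral>z. 0 \<partial>(lborel :: (real^'n) measure))"
    unfolding e_def
  proof (rule integral_dominated_convergence)
    show "integrable lborel (\<lambda>z. C2 * 3 ^ Suc k * (norm (w z) * (1 + norm z) ^ Suc k))" by (rule dom)
    show "AE z in lborel. (\<lambda>m. norm (w z) * (C2 * (1 + 3 * norm z) ^ k * norm (s m z - z))) \<longlonglongrightarrow> 0"
    proof (rule AE_I2)
      fix z
      have "(\<lambda>m. norm (w z) * (C2 * (1 + 3 * norm z) ^ k * norm (s m z - z))) \<longlonglongrightarrow> norm (w z) * (C2 * (1 + 3 * norm z) ^ k * norm (z - z))"
        by (intro tendsto_intros s(2))
      then show "(\<lambda>m. norm (w z) * (C2 * (1 + 3 * norm z) ^ k * norm (s m z - z))) \<longlonglongrightarrow> 0" by simp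
    qed
    show "AE z in lborel. norm (norm (w z) * (C2 * (1 + 3 * norm z) ^ k * norm (s m z - z))) \<le> C2 * 3 ^ Suc k * (norm (w z) * (1 + norm z) ^ Suc k)" for m
    proof (rule AE_I2)
      fix z
      have "0 \<le> norm (w z) * (C2 * (1 + 3 * norm z) ^ k * norm (s m z - z))" using C2(1) by (intro mult_nonneg_nonneg zero_le_power) auto
      then show "norm (norm (w z) * (C2 * (1 + 3 * norm z) ^ k * norm (s m z - z))) \<le> C2 * 3 ^ Suc k * (norm (w z) * (1 + norm z) ^ Suc k)"
        using ei[of z m] unfolding real_norm_def by (subst abs_of_nonneg)
    qed
  qed measurable
  have sem: "schwartz_seminorm k (\<lambda>y. V m y - v y) \<le> e m" for m
  proof (rule schwartz_seminorm_leI)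
    fix "is" :: "'n list" and y assume l: "length is \<le> k"
    let ?u = "iterated_partial is \<Phi>"
    have u: "?u \<in> schwartz" using \<Phi> by (rule schwartz_iterated_partial)
    have [measurable]: "?u \<in> borel_measurable borel" using u by (rule schwartz_borel_measurable)
    obtain B where B: "\<And>x. norm (?u x) \<le> B" using schwartz_decay[OF u, of 0] by auto
    have i1: "integrable lborel (\<lambda>z. w z * ?u (s m z - y))"
      by (rule integrable_times_bounded[OF w0 _ B]) measurable
    have i2: "integrable lborel (\<lambda>z. w z * ?u (z - y))"
      by (rule integrable_times_bounded[OF w0 _ B]) measurable
    have "iterated_partial is (\<lambda>y. V m y - v y) y = (- 1) ^ length is * (\<integral>z. w z * ?u (s m z - y) \<partial>lborel) - (- 1) ^ length is * (\<integral>z. w z * ?u (z - y) \<partial>lborel)"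
      using iterated_partial_lincomb[OF VS vS, of "is" 1 m "-1"] iterated_partial_superposition[OF \<Phi> sm[of m] w0, of "is"]
        iterated_partial_superposition[OF \<Phi> _ w0, of "\<lambda>z. z" "is"]
      by (simp add: fun_eq_iff V_def v_def)
    also have "\<dots> = (- 1) ^ length is * (\<integral>z. w z * (?u (s m z - y) - ?u (z - y)) \<partial>lborel)"
      using i1 i2 by (simp add: right_diff_distrib)
    finally have "(1 + norm y) ^ k * norm (iterated_partial is (\<lambda>y. V m y - v y) y)
      = norm (\<integral>z. of_real ((1 + norm y) ^ k) * (w z * (?u (s m z - y) - ?u (z - y))) \<partial>lborel)"
      by (simp add: norm_mult norm_power abs_of_nonneg del: of_real_power of_real_add)
    also have "\<dots> \<le> e m"
      unfolding e_def
    proof (rule norm_integral_le_of_AE[OF eint], rule AE_I2)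
      fix z
      have "(1 + norm y) ^ k * norm (?u (s m z - y) - ?u (z - y)) \<le> C2 * (1 + norm (s m z) + norm z) ^ k * norm (s m z - z)"
        using C2(2)[OF l] by blast
      also have "\<dots> \<le> C2 * (1 + 3 * norm z) ^ k * norm (s m z - z)"
        using C2(1) ns[of m z] by (intro mult_right_mono mult_left_mono power_mono) auto
      finally have "norm (w z) * ((1 + norm y) ^ k * norm (?u (s m z - y) - ?u (z - y))) \<le> norm (w z) * (C2 * (1 + 3 * norm z) ^ k * norm (s m z - z))"
        by (intro mult_left_mono) auto
      then show "norm (of_real ((1 + norm y) ^ k) * (w z * (?u (s m z - y) - ?u (z - y)))) \<le> norm (w z) * (C2 * (1 + 3 * norm z) ^ k * norm (s m z - z))"
        by (simp add: norm_mult mult_ac abs_of_nonneg del: of_real_power of_real_add)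
    qed
    finally show "(1 + norm y) ^ k * norm (iterated_partial is (\<lambda>y. V m y - v y) y) \<le> e m" .
  qed
  have "(\<lambda>m. T (V m) - T v) \<longlonglongrightarrow> 0"
  proof (rule Lim_null_comparison)
    show "\<forall>\<^sub>F m in sequentially. norm (T (V m) - T v) \<le> C0 * e m"
    proof (rule always_eventually, rule allI)
      fix m
      have "norm (T (V m) - T v) \<le> C0 * schwartz_seminorm k (\<lambda>y. V m y - v y)"
        using C0(2)[OF schwartz_diff[OF VS vS]] by (simp add: tempered_diff[OF T VS vS])
      also have "\<dots> \<le> C0 * e m" using C0(1) sem by (intro mult_left_mono) auto
      finally show "norm (T (V m) - T v) \<le> C0 * e m" .
    qed
    show "(\<lambda>m. C0 * e m) \<longlonglongrightarrow> 0" using tendsto_mult[OF tendsto_const[of C0] elim] by simp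
  qed
  then have "(\<lambda>m. T (V m)) \<longlonglongrightarrow> T v" by (simp add: LIM_zero_iff)
  then have "T v = (\<integral>z. w z * g z \<partial>lborel)" using lim1 by (rule LIMSEQ_unique)
  then show ?thesis unfolding v_def g_def .
qed

section \<open>The Fourier transform and the dyadic resolution\<close>

lemma schwartz_weighted_integrable:
  fixes u :: "real^'n::finite \<Rightarrow> complex"
  assumes u: "u \<in> schwartz"
  shows "integrable lborel (\<lambda>z. norm (u z) * (1 + norm z) ^ k)"
proof -
  let ?m = "CARD('n) + 2"
  obtain C where C: "0 < C" "\<And>x. (1 + norm x) ^ (k + ?m) * norm (u x) \<le> C"
    using schwartz_decay[OF u, of "k + ?m"] by blast
  have [measurable]: "u \<in> borel_measurable borel" by (rule schwartz_borel_measurable[OF u])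
  have fin: "(\<integral>\<^sup>+(x::real^'n). ennreal ((1 + norm x) powr (- (real CARD('n) + 2))) \<partial>lborel) < top"
    using nn_integral_decay_finite[where 'a = "real^'n"] by simp
  have dom: "integrable lborel (\<lambda>z::real^'n. C * (1 + norm z) powr (- (real CARD('n) + 2)))"
    by (intro integrable_mult_right integrableI_bounded) (use fin in \<open>auto\<close>)
  show ?thesis
  proof (rule Bochner_Integration.integrable_bound[OF dom])
    show "AE z in lborel. norm (norm (u z) * (1 + norm z) ^ k) \<le> norm (C * (1 + norm z) powr (- (real CARD('n) + 2)))"
    proof (rule AE_I2)
      fix z :: "real^'n"
      define N where "N = 1 + norm z"
      have N: "0 < N" unfolding N_def by (simp add: add_pos_nonneg)
      have "N ^ ?m * (norm (u z) * N ^ k) \<le> C" using C(2)[of z] unfolding N_def by (simp add: power_add mult_ac)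
      then have "norm (u z) * N ^ k \<le> C * inverse (N ^ ?m)" using N by (simp add: field_simps)
      also have "inverse (N ^ ?m) = N powr (- (real CARD('n) + 2))"
        using N powr_realpow[OF N, of ?m] by (simp only: powr_minus of_nat_add of_nat_numeral)
      finally show "norm (norm (u z) * (1 + norm z) ^ k) \<le> norm (C * (1 + norm z) powr (- (real CARD('n) + 2)))"
        using C(1) unfolding N_def by (simp add: abs_mult)
    qed
  qed measurable
qed

lemma schwartz_integrable:
  fixes u :: "real^'n::finite \<Rightarrow> complex"
  assumes "u \<in> schwartz"
  shows "integrable lborel u"
proof -
  have "u \<in> borel_measurable lborel" using schwartz_borel_measurable[OF assms] by simp
  then show ?thesis using schwartz_weighted_integrable[OF assms, of 0] by (simp add: integrable_norm_iff)
qed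

lemma lborel_integral_affine:
  fixes t :: "'a::euclidean_space" and f :: "'a \<Rightarrow> 'b::{banach, second_countable_topology}"
  assumes c: "c \<noteq> 0" and [measurable]: "f \<in> borel_measurable borel"
  shows "(\<integral>x. f x \<partial>lborel) = (\<bar>c\<bar> ^ DIM('a)) *\<^sub>R (\<integral>x. f (t + c *\<^sub>R x) \<partial>lborel)"
proof -
  have "(\<integral>x. f x \<partial>lborel) = (\<integral>x. f x \<partial>density (distr lborel borel (\<lambda>x. t + c *\<^sub>R x)) (\<lambda>_. ennreal (\<bar>c\<bar> ^ DIM('a))))"
    using lborel_affine[OF c, of t] by (simp add: ennreal_power)
  also have "\<dots> = (\<integral>x. (\<bar>c\<bar> ^ DIM('a)) *\<^sub>R f x \<partial>distr lborel borel (\<lambda>x. t + c *\<^sub>R x))"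
    by (subst integral_density) auto
  also have "\<dots> = (\<integral>x. (\<bar>c\<bar> ^ DIM('a)) *\<^sub>R f (t + c *\<^sub>R x) \<partial>lborel)"
    by (subst integral_distr) auto
  finally show ?thesis by simp
qed

lemma lborel_integrable_affine:
  fixes t :: "'a::euclidean_space" and f :: "'a \<Rightarrow> 'b::{banach, second_countable_topology}"
  assumes c: "c \<noteq> 0" and f: "integrable lborel f"
  shows "integrable lborel (\<lambda>x. f (t + c *\<^sub>R x))"
proof -
  have [measurable]: "f \<in> borel_measurable borel" using f by auto
  have "integrable (density (distr lborel borel (\<lambda>x. t + c *\<^sub>R x)) (\<lambda>_. ennreal (\<bar>c\<bar> ^ DIM('a)))) f"
    using lborel_affine[OF c, of t] f by (simp add: ennreal_power)
  then have "integrable (distr lborel borel (\<lambda>x. t + c *\<^sub>R x)) (\<lambda>x. (\<bar>c\<bar> ^ DIM('a)) *\<^sub>R f x)"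
    by (subst (asm) integrable_density) auto
  then have "integrable lborel (\<lambda>x. (\<bar>c\<bar> ^ DIM('a)) *\<^sub>R f (t + c *\<^sub>R x))"
    by (subst (asm) integrable_distr_eq) auto
  then have "integrable lborel (\<lambda>x. inverse (\<bar>c\<bar> ^ DIM('a)) *\<^sub>R (\<bar>c\<bar> ^ DIM('a)) *\<^sub>R f (t + c *\<^sub>R x))"
    by (rule integrable_scaleR_right)
  then show ?thesis using c by simp
qed

lemma lborel_integrable_product:
  fixes f :: "'a::euclidean_space \<Rightarrow> complex" and g :: "'b::euclidean_space \<Rightarrow> complex"
  assumes f: "integrable lborel f" and g: "integrable lborel g"
  shows "integrable (lborel \<Otimes>\<^sub>M lborel) (\<lambda>p. f (fst p) * g (snd p))"
proof -
  have [measurable]: "f \<in> borel_measurable borel" "g \<in> borel_measurable borel" using f g by auto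
  show ?thesis
    by (rule lborel_pair.Fubini_integrable) (use f g in \<open>auto simp: norm_mult\<close>)
qed

section \<open>Fourier integrals, their uniqueness theorem and the convolution theorem\<close>

lemma fourier_lborel:
  fixes f :: "real^'n::finite \<Rightarrow> complex"
  assumes [measurable]: "f \<in> borel_measurable borel"
  shows "fourier f \<xi> = (\<integral>x. cis (- (x \<bullet> \<xi>)) * f x \<partial>lborel)"
proof -
  have [measurable]: "(\<lambda>x::real^'n. cis (- (x \<bullet> \<xi>))) \<in> borel_measurable borel"
    by (intro borel_measurable_continuous_onI continuous_intros)
  show ?thesis unfolding fourier_def by (rule integral_completion) measurable
qed

lemma integrable_cis_mult:
  fixes f :: "'a \<Rightarrow> complex"
  assumes f: "integrable M f" and g: "g \<in> borel_measurable M"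
  shows "integrable M (\<lambda>x. cis (g x) * f x)"
proof -
  have "(\<lambda>x. cis (g x)) \<in> borel_measurable M"
    using g by (rule borel_measurable_continuous_on[OF _ _, of cis, rotated]) (intro continuous_intros)
  then show ?thesis using integrable_times_bounded[OF f, of "\<lambda>x. cis (g x)" 1] by (simp add: mult.commute)
qed

lemma fourier_scale:
  fixes f :: "real^'n::finite \<Rightarrow> complex"
  assumes s: "0 < s" and [measurable]: "f \<in> borel_measurable borel"
  shows "fourier (\<lambda>x. of_real (s ^ CARD('n)) * f (s *\<^sub>R x)) \<xi> = fourier f (\<xi> /\<^sub>R s)"
proof -
  have [measurable]: "(\<lambda>x::real^'n. cis (- (x \<bullet> a))) \<in> borel_measurable borel" for a
    by (intro borel_measurable_continuous_onI continuous_intros)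
  have "fourier f (\<xi> /\<^sub>R s) = (\<integral>x. cis (- (x \<bullet> (\<xi> /\<^sub>R s))) * f x \<partial>lborel)" by (rule fourier_lborel) measurable
  also have "\<dots> = (\<bar>s\<bar> ^ DIM(real^'n)) *\<^sub>R (\<integral>x. cis (- ((0 + s *\<^sub>R x) \<bullet> (\<xi> /\<^sub>R s))) * f (0 + s *\<^sub>R x) \<partial>lborel)"
    using s by (intro lborel_integral_affine) (simp, measurable)
  also have "\<dots> = (\<integral>x. cis (- (x \<bullet> \<xi>)) * (of_real (s ^ CARD('n)) * f (s *\<^sub>R x)) \<partial>lborel)"
  proof (unfold integral_scaleR_right[symmetric], rule Bochner_Integration.integral_cong[OF refl])
    fix x :: "real^'n"
    have ip: "(0 + s *\<^sub>R x) \<bullet> (\<xi> /\<^sub>R s) = x \<bullet> \<xi>" using s by simp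
    show "(\<bar>s\<bar> ^ DIM(real^'n)) *\<^sub>R (cis (- ((0 + s *\<^sub>R x) \<bullet> (\<xi> /\<^sub>R s))) * f (0 + s *\<^sub>R x))
      = cis (- (x \<bullet> \<xi>)) * (of_real (s ^ CARD('n)) * f (s *\<^sub>R x))"
      unfolding ip using s scaleR_conv_of_real[of "s ^ CARD('n)" "cis (- (x \<bullet> \<xi>)) * f (s *\<^sub>R x)"] by (simp add: mult_ac)
  qed
  also have "\<dots> = fourier (\<lambda>x. of_real (s ^ CARD('n)) * f (s *\<^sub>R x)) \<xi>" by (rule fourier_lborel[symmetric]) measurable
  finally show ?thesis by simp
qed

text \<open>After interchanging the integrals the inner one is, up to a factor, the transform of
  \<open>g\<close> at \<open>\<zeta> - c * \<xi>\<close>, hence zero. Thus a vanishing transform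
  survives multiplication by any function that is itself a Fourier integral of an integrable
  function; the uniqueness theorem rests on this alone.\<close>

lemma fourier_zero_mult:
  fixes g a :: "real^'n::finite \<Rightarrow> complex"
  assumes g: "integrable lborel g" and a: "integrable lborel a"
    and z: "\<And>\<xi>. (\<integral>y. cis (- (y \<bullet> \<xi>)) * g y \<partial>lborel) = 0"
  shows "(\<integral>y. cis (- (y \<bullet> \<zeta>)) * (g y * (\<integral>\<xi>. cis (c * ((y - x) \<bullet> \<xi>)) * a \<xi> \<partial>lborel)) \<partial>lborel) = 0"
proof -
  have [measurable]: "g \<in> borel_measurable borel" "a \<in> borel_measurable borel" using g a by auto
  have gc[measurable]: "integrable lborel (\<lambda>y. cis (- (y \<bullet> \<zeta>)) * g y)" by (rule integrable_cis_mult[OF g]) measurable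
  let ?f = "\<lambda>y \<xi>. (cis (- (y \<bullet> \<zeta>)) * g y * a \<xi>) * cis (c * ((y - x) \<bullet> \<xi>))"
  have i: "integrable (lborel \<Otimes>\<^sub>M lborel) (\<lambda>p. (cis (- (fst p \<bullet> \<zeta>)) * g (fst p)) * a (snd p))"
    by (rule lborel_integrable_product[OF gc a])
  have "integrable (lborel \<Otimes>\<^sub>M lborel) (\<lambda>p. cis (c * ((fst p - x) \<bullet> snd p)) * ((cis (- (fst p \<bullet> \<zeta>)) * g (fst p)) * a (snd p)))"
    by (rule integrable_cis_mult[OF i]) measurable
  then have int: "integrable (lborel \<Otimes>\<^sub>M lborel) (case_prod ?f)"
    by (simp add: case_prod_beta' mult_ac)
  have "(\<integral>y. cis (- (y \<bullet> \<zeta>)) * (g y * (\<integral>\<xi>. cis (c * ((y - x) \<bullet> \<xi>)) * a \<xi> \<partial>lborel)) \<partial>lborel)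
    = (\<integral>y. (\<integral>\<xi>. ?f y \<xi> \<partial>lborel) \<partial>lborel)"
    by (simp add: mult_ac flip: integral_mult_right_zero)
  also have "\<dots> = (\<integral>\<xi>. (\<integral>y. ?f y \<xi> \<partial>lborel) \<partial>lborel)"
    by (rule lborel_pair.Fubini_integral[OF int, symmetric])
  also have "\<dots> = (\<integral>\<xi>. 0 \<partial>(lborel :: (real^'n) measure))"
  proof (rule Bochner_Integration.integral_cong[OF refl])
    fix \<xi> :: "real^'n"
    have "(\<integral>y. ?f y \<xi> \<partial>lborel) = (\<integral>y. (a \<xi> * cis (- (c * (x \<bullet> \<xi>)))) * (cis (- (y \<bullet> (\<zeta> - c *\<^sub>R \<xi>))) * g y) \<partial>lborel)"
    proof (rule Bochner_Integration.integral_cong[OF refl])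
      fix y
      have "cis (- (y \<bullet> \<zeta>)) * cis (c * ((y - x) \<bullet> \<xi>)) = cis (- (c * (x \<bullet> \<xi>))) * cis (- (y \<bullet> (\<zeta> - c *\<^sub>R \<xi>)))"
        unfolding cis_mult by (simp add: inner_diff_left inner_diff_right algebra_simps)
      then show "?f y \<xi> = (a \<xi> * cis (- (c * (x \<bullet> \<xi>)))) * (cis (- (y \<bullet> (\<zeta> - c *\<^sub>R \<xi>))) * g y)"
        by (simp add: algebra_simps)
    qed
    also have "\<dots> = 0" by (simp add: z)
    finally show "(\<integral>y. ?f y \<xi> \<partial>lborel) = 0" .
  qed
  finally show ?thesis by simp
qed

text \<open>Uniqueness without an inversion formula. Since \<open>\<Psi>\<close> is the transform of
  \<open>\<phi>0\<close>, the bump \<open>W\<close> obtained by rescaling it around \<open>x\<close>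
  is a Fourier integral, and so is its conjugate. Multiplying \<open>g\<close> by both keeps the
  transform zero, so the integral of \<open>g * W * cnj W\<close> vanishes. The conjugate is needed
  because \<open>\<Psi>\<close> is complex-valued, whereas \<open>W * cnj W\<close> is nonnegative;
  near \<open>x\<close> the function \<open>cnj (g x) * g\<close> has positive real part, a
  contradiction.\<close>

lemma fourier_injective:
  fixes g \<phi>0 \<Psi> :: "real^'n::finite \<Rightarrow> complex"
  assumes gi: "integrable lborel g" and gc: "continuous_on UNIV g" and z: "\<And>\<xi>. fourier g \<xi> = 0"
    and \<phi>0: "\<phi>0 \<in> schwartz" and F: "\<And>\<xi>. fourier \<phi>0 \<xi> = \<Psi> \<xi>" and \<Psi>: "\<Psi> \<in> schwartz"
    and \<Psi>1: "\<And>x. norm x \<le> 1 \<Longrightarrow> \<Psi> x = 1" and \<Psi>0: "\<And>x. 2 \<le> norm x \<Longrightarrow> \<Psi> x = 0"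
  shows "g x = 0"
proof (rule ccontr)
  assume nz: "g x \<noteq> 0"
  have gm[measurable]: "g \<in> borel_measurable borel" using gi by auto
  have fm[measurable]: "\<phi>0 \<in> borel_measurable borel" by (rule schwartz_borel_measurable[OF \<phi>0])
  have \<Psi>m[measurable]: "\<Psi> \<in> borel_measurable borel" by (rule schwartz_borel_measurable[OF \<Psi>])
  have i0: "integrable lborel \<phi>0" by (rule schwartz_integrable[OF \<phi>0])
  have z': "(\<integral>y. cis (- (y \<bullet> \<xi>)) * g y \<partial>lborel) = 0" for \<xi> using z fourier_lborel[OF gm] by simp
  define v where "v = norm (g x) ^ 2 / 2"
  have v: "0 < v" unfolding v_def using nz by simp
  have "\<exists>r>0. \<forall>y. dist y x < r \<longrightarrow> v < Re (cnj (g x) * g y)"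
  proof -
    have "continuous_on UNIV (\<lambda>y. Re (cnj (g x) * g y))" using gc by (intro continuous_intros) auto
    then have "isCont (\<lambda>y. Re (cnj (g x) * g y)) x" by (simp add: continuous_on_eq_continuous_at)
    then have "((\<lambda>y. Re (cnj (g x) * g y)) \<longlongrightarrow> Re (cnj (g x) * g x)) (nhds x)"
      unfolding isCont_def by (rule iffD1[OF tendsto_at_iff_tendsto_nhds[of "\<lambda>y. Re (cnj (g x) * g y)" x]])
    moreover have "v < Re (cnj (g x) * g x)"
      using nz by (simp add: v_def complex_mult_cnj mult.commute[of "cnj _"] cmod_power2 complex_eq_iff) (auto simp: sum_power2_gt_zero_iff)
    ultimately have "\<forall>\<^sub>F y in nhds x. v < Re (cnj (g x) * g y)" by (rule order_tendstoD)
    then show ?thesis unfolding eventually_nhds_metric by blast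
  qed
  then obtain r where r: "0 < r" "\<And>y. dist y x < r \<Longrightarrow> v < Re (cnj (g x) * g y)" by blast
  \<comment> \<open>With this scale \<open>W\<close> vanishes where
    \<open>norm (y - x) \<ge> r\<close> and equals 1 where \<open>norm (y - x) \<le> r / 2\<close>,
    since \<open>\<Psi>\<close> vanishes from radius 2 on and is 1 up to radius 1.\<close>
  define e where "e = 2 / r"
  have e: "0 < e" unfolding e_def using r by simp
  define W where "W = (\<lambda>y. \<Psi> (e *\<^sub>R (y - x)))"
  have [measurable]: "W \<in> borel_measurable borel" unfolding W_def by measurable
  have W1: "(\<integral>\<xi>. cis (- e * ((y - x) \<bullet> \<xi>)) * \<phi>0 \<xi> \<partial>lborel) = W y" for y
  proof -
    have "W y = (\<integral>\<xi>. cis (- (\<xi> \<bullet> (e *\<^sub>R (y - x)))) * \<phi>0 \<xi> \<partial>lborel)"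
      unfolding W_def F[symmetric] by (rule fourier_lborel[OF fm])
    then show ?thesis by (simp add: inner_commute)
  qed
  have W2: "(\<integral>\<xi>. cis (e * ((y - x) \<bullet> \<xi>)) * cnj (\<phi>0 \<xi>) \<partial>lborel) = cnj (W y)" for y
  proof -
    have "cnj (W y) = (\<integral>\<xi>. cnj (cis (- e * ((y - x) \<bullet> \<xi>)) * \<phi>0 \<xi>) \<partial>lborel)"
      unfolding W1[symmetric] by (rule Bochner_Integration.integral_cnj[symmetric])
    then show ?thesis by (simp add: cis_cnj del: Bochner_Integration.integral_cnj)
  qed
  have Wb: "\<exists>B. \<forall>y. norm (W y) \<le> B"
  proof -
    obtain B where "\<And>y. (1 + norm y) ^ 0 * norm (\<Psi> y) \<le> B" using schwartz_decay[OF \<Psi>, of 0] by blast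
    then show ?thesis unfolding W_def by auto
  qed
  then obtain B where B: "\<And>y. norm (W y) \<le> B" by blast
  have h1: "(\<integral>y. cis (- (y \<bullet> \<zeta>)) * (g y * W y) \<partial>lborel) = 0" for \<zeta>
    using fourier_zero_mult[OF gi i0 z', of \<zeta> "- e" x] unfolding W1 .
  have gW: "integrable lborel (\<lambda>y. g y * W y)" by (rule integrable_times_bounded[OF gi _ B]) measurable
  have ic: "integrable lborel (\<lambda>\<xi>. cnj (\<phi>0 \<xi>))" using i0 by simp
  have h2: "(\<integral>y. cis (- (y \<bullet> 0)) * ((g y * W y) * cnj (W y)) \<partial>lborel) = 0"
    using fourier_zero_mult[OF gW ic h1, of 0 e x] unfolding W2 .
  have gWW: "integrable lborel (\<lambda>y. (g y * W y) * cnj (W y))"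
  proof (rule integrable_times_bounded[OF gW, where B = B])
    show "(\<lambda>y. cnj (W y)) \<in> borel_measurable lborel"
      by (rule borel_measurable_continuous_on[of cnj]) (auto intro!: continuous_intros)
  qed (use B in simp)
  have h3: "(\<integral>y. cnj (g x) * ((g y * W y) * cnj (W y)) \<partial>lborel) = 0" using h2 by simp
  have i3: "integrable lborel (\<lambda>y. cnj (g x) * ((g y * W y) * cnj (W y)))" using gWW by simp
  have h4: "(\<integral>y. Re (cnj (g x) * ((g y * W y) * cnj (W y))) \<partial>lborel) = 0"
    unfolding integral_Re[OF i3] h3 by simp
  have i4: "integrable lborel (\<lambda>y. Re (cnj (g x) * ((g y * W y) * cnj (W y))))" using i3 by (rule integrable_Re)
  have pt: "v * indicator (cball x (1 / e)) y \<le> Re (cnj (g x) * ((g y * W y) * cnj (W y)))" for y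
  proof -
    have "W y * cnj (W y) = of_real (norm (W y) ^ 2)" by (simp add: complex_mult_cnj cmod_power2)
    then have eq: "Re (cnj (g x) * ((g y * W y) * cnj (W y))) = Re (cnj (g x) * g y) * norm (W y) ^ 2"
      by (simp add: mult.assoc) (simp add: algebra_simps)
    have ne: "norm (e *\<^sub>R (y - x)) = e * norm (y - x)" using e by (simp only: norm_scaleR abs_of_pos)
    show ?thesis
    proof (cases "dist y x < r")
      case True
      have "v * indicator (cball x (1 / e)) y \<le> v * norm (W y) ^ 2"
      proof (cases "y \<in> cball x (1 / e)")
        case True
        then have "norm (y - x) \<le> 1 / e" by (simp add: dist_norm norm_minus_commute)
        then have "norm (e *\<^sub>R (y - x)) \<le> 1" unfolding ne using e by (simp add: field_simps)
        then show ?thesis unfolding W_def using \<Psi>1 v by simp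
      qed (use v in simp)
      also have "\<dots> \<le> Re (cnj (g x) * g y) * norm (W y) ^ 2"
        using r(2)[OF True] by (intro mult_right_mono) auto
      finally show ?thesis unfolding eq .
    next
      case False
      then have "r \<le> norm (y - x)" by (simp add: dist_norm)
      then have "2 \<le> norm (e *\<^sub>R (y - x))" unfolding ne unfolding e_def using r(1) by (simp add: field_simps)
      then have "W y = 0" unfolding W_def by (rule \<Psi>0)
      moreover have "y \<notin> cball x (1 / e)" using False r(1) unfolding e_def by (simp add: dist_commute)
      ultimately show ?thesis by simp
    qed
  qed
  have "(\<integral>y. v * indicator (cball x (1 / e)) y \<partial>lborel) \<le> (\<integral>y. Re (cnj (g x) * ((g y * W y) * cnj (W y))) \<partial>lborel)"
    by (rule integral_mono[OF _ i4 pt])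
      (intro integrable_mult_right integrable_real_indicator; simp add: emeasure_lborel_cball_finite[unfolded infinity_ennreal_def])
  then have "v * measure lborel (cball x (1 / e)) \<le> 0" unfolding h4 by simp
  moreover have "0 < measure lborel (cball x (1 / e))" using e content_cball_pos[of "1 / e" x] by simp
  ultimately show False using v by (simp add: mult_le_0_iff)
qed

lemma
  fixes a b :: "real^'n::finite \<Rightarrow> complex"
  assumes a: "integrable lborel a" and b: "integrable lborel b"
  shows integrable_convolve: "integrable lborel (\<lambda>x. \<integral>z. a z * b (x - z) \<partial>lborel)"
    and fourier_convolve: "fourier (\<lambda>x. \<integral>z. a z * b (x - z) \<partial>lborel) \<xi> = fourier a \<xi> * fourier b \<xi>"
proof -
  have [measurable]: "a \<in> borel_measurable borel" "b \<in> borel_measurable borel" using a b by auto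
  have bt: "integrable lborel (\<lambda>x. b (x - z))" for z
    using lborel_integrable_affine[OF _ b, of 1 "- z"] by simp
  have tr: "(\<integral>x. f (x - z) \<partial>lborel) = (\<integral>x. f x \<partial>lborel)"
    if "f \<in> borel_measurable borel" for f :: "real^'n \<Rightarrow> 'b::{banach, second_countable_topology}" and z
    using lborel_integral_affine[OF _ that, of 1 "- z"] by simp
  have intF: "integrable (lborel \<Otimes>\<^sub>M lborel) (\<lambda>p. a (fst p) * b (snd p - fst p))"
  proof (rule lborel_pair.Fubini_integrable)
    show "integrable lborel (\<lambda>z. \<integral>x. norm (a (fst (z, x)) * b (snd (z, x) - fst (z, x))) \<partial>lborel)"
      using a tr[of "\<lambda>x. norm (b x)"] by (simp add: norm_mult)
    show "AE z in lborel. integrable lborel (\<lambda>x. a (fst (z, x)) * b (snd (z, x) - fst (z, x)))"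
      using bt by simp
  qed measurable
  have intS: "integrable (lborel \<Otimes>\<^sub>M lborel) (\<lambda>(x, z). a z * b (x - z))"
    using lborel_pair.integrable_product_swap[OF intF] by simp
  show i: "integrable lborel (\<lambda>x. \<integral>z. a z * b (x - z) \<partial>lborel)"
    using lborel_pair.integrable_fst'[OF intS] by simp
  have cm: "(\<lambda>x. \<integral>z. a z * b (x - z) \<partial>lborel) \<in> borel_measurable borel" using i by auto
  let ?f = "\<lambda>z x. cis (- (x \<bullet> \<xi>)) * (a z * b (x - z))"
  have int: "integrable (lborel \<Otimes>\<^sub>M lborel) (case_prod ?f)"
    using integrable_cis_mult[OF intF, of "\<lambda>p. - (snd p \<bullet> \<xi>)"] by (simp add: case_prod_beta')
  have "fourier (\<lambda>x. \<integral>z. a z * b (x - z) \<partial>lborel) \<xi> = (\<integral>x. (\<integral>z. ?f z x \<partial>lborel) \<partial>lborel)"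
    by (simp add: fourier_lborel[OF cm])
  also have "\<dots> = (\<integral>z. (\<integral>x. ?f z x \<partial>lborel) \<partial>lborel)"
    by (rule lborel_pair.Fubini_integral[OF int])
  also have "\<dots> = (\<integral>z. (cis (- (z \<bullet> \<xi>)) * a z) * fourier b \<xi> \<partial>lborel)"
  proof (rule Bochner_Integration.integral_cong[OF refl])
    fix z
    have "(\<integral>x. ?f z x \<partial>lborel) = (\<integral>x. (cis (- (z \<bullet> \<xi>)) * a z) * (cis (- ((x - z) \<bullet> \<xi>)) * b (x - z)) \<partial>lborel)"
    proof (rule Bochner_Integration.integral_cong[OF refl])
      fix x
      have "cis (- (x \<bullet> \<xi>)) = cis (- (z \<bullet> \<xi>)) * cis (- ((x - z) \<bullet> \<xi>))"
        unfolding cis_mult by (simp add: inner_diff_left)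
      then show "?f z x = (cis (- (z \<bullet> \<xi>)) * a z) * (cis (- ((x - z) \<bullet> \<xi>)) * b (x - z))" by (simp only: mult_ac)
    qed
    also have "\<dots> = (cis (- (z \<bullet> \<xi>)) * a z) * (\<integral>x. cis (- ((x - z) \<bullet> \<xi>)) * b (x - z) \<partial>lborel)" by simp
    also have "(\<integral>x. cis (- ((x - z) \<bullet> \<xi>)) * b (x - z) \<partial>lborel) = (\<integral>x. cis (- (x \<bullet> \<xi>)) * b x \<partial>lborel)"
    proof (rule tr)
      have [measurable]: "(\<lambda>x::real^'n. cis (- (x \<bullet> \<xi>))) \<in> borel_measurable borel"
        by (intro borel_measurable_continuous_onI continuous_intros)
      show "(\<lambda>x. cis (- (x \<bullet> \<xi>)) * b x) \<in> borel_measurable borel" by measurable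
    qed
    finally show "(\<integral>x. ?f z x \<partial>lborel) = (cis (- (z \<bullet> \<xi>)) * a z) * fourier b \<xi>"
      by (simp add: fourier_lborel)
  qed
  also have "\<dots> = fourier a \<xi> * fourier b \<xi>" by (simp add: fourier_lborel)
  finally show "fourier (\<lambda>x. \<integral>z. a z * b (x - z) \<partial>lborel) \<xi> = fourier a \<xi> * fourier b \<xi>" .
qed

text \<open>Supplies the continuity by which \<open>fourier_injective\<close> yields identities of
  convolutions at every point, not only almost everywhere.\<close>

lemma continuous_convolve:
  fixes a b :: "real^'n::finite \<Rightarrow> complex"
  assumes a: "integrable lborel a" and b: "b \<in> schwartz"
  shows "continuous_on UNIV (\<lambda>x. \<integral>z. a z * b (x - z) \<partial>lborel)"
proof -
  obtain C where C: "0 < C" "\<And>x y z. (1 + norm z) ^ 0 * norm (b (x - z) - b (y - z)) \<le> C * (1 + norm x + norm y) ^ 0 * norm (x - y)"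
    using schwartz_Lipschitz_weighted[OF b, of 0] by blast
  have [measurable]: "b \<in> borel_measurable borel" by (rule schwartz_borel_measurable[OF b])
  obtain B where B: "\<And>x. norm (b x) \<le> B" using schwartz_decay[OF b, of 0] by auto
  have i: "integrable lborel (\<lambda>z. a z * b (x - z))" for x
    by (rule integrable_times_bounded[OF a _ B]) measurable
  have "norm ((\<integral>z. a z * b (x - z) \<partial>lborel) - (\<integral>z. a z * b (y - z) \<partial>lborel))
    \<le> (C * (\<integral>z. norm (a z) \<partial>lborel)) * (1 + norm x + norm y) ^ 0 * norm (x - y)" for x y
  proof -
    have "(\<integral>z. a z * b (x - z) \<partial>lborel) - (\<integral>z. a z * b (y - z) \<partial>lborel) = (\<integral>z. a z * (b (x - z) - b (y - z)) \<partial>lborel)"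
      using i[of x] i[of y] by (simp add: right_diff_distrib)
    moreover have "norm (\<integral>z. a z * (b (x - z) - b (y - z)) \<partial>lborel) \<le> (\<integral>z. norm (a z) * (C * norm (x - y)) \<partial>lborel)"
      using a C(2)[where z = "_ :: real^'n"] by (intro norm_integral_le_of_AE AE_I2) (auto simp: norm_mult intro!: mult_left_mono)
    ultimately show ?thesis by (simp add: mult_ac)
  qed
  then show ?thesis by (rule continuous_on_polynomial_Lipschitz)
qed

section \<open>The dyadic resolution: supports, reproducing identity, scaling\<close>

context
  fixes \<Psi> :: "real^'n::finite \<Rightarrow> complex" and \<phi> :: "nat \<Rightarrow> real^'n \<Rightarrow> complex"
  assumes D: "dyadic_resolution \<Psi> \<phi>"
begin

lemma dyadic_schwartz: "\<phi> j \<in> schwartz" "\<Psi> \<in> schwartz"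
  using D unfolding dyadic_resolution_def by auto

lemma dyadic_integrable: "integrable lborel (\<phi> j)"
  by (rule schwartz_integrable[OF dyadic_schwartz(1)])

lemma dyadic_measurable [measurable]: "\<phi> j \<in> borel_measurable borel"
  by (rule schwartz_borel_measurable[OF dyadic_schwartz(1)])

text \<open>The transform of the partial sum \<open>\<phi> 0 + ... + \<phi> j\<close>, so that the
  blocks are its increments and sums of consecutive blocks telescope.\<close>

definition cutoff :: "nat \<Rightarrow> real^'n \<Rightarrow> complex" where
  "cutoff j \<xi> = \<Psi> ((2 powr (- real j)) *\<^sub>R \<xi>)"

lemma cutoff_eq_1: "norm \<xi> \<le> 2 ^ j \<Longrightarrow> cutoff j \<xi> = 1"
  using D unfolding dyadic_resolution_def cutoff_def
  by (simp add: powr_minus powr_realpow field_simps)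

lemma cutoff_eq_0: "2 ^ Suc j \<le> norm \<xi> \<Longrightarrow> cutoff j \<xi> = 0"
  using D unfolding dyadic_resolution_def cutoff_def
  by (simp add: powr_minus powr_realpow field_simps)

lemma fourier_dyadic_0: "fourier (\<phi> 0) \<xi> = cutoff 0 \<xi>"
  using D unfolding dyadic_resolution_def cutoff_def by simp

lemma fourier_dyadic_Suc: "fourier (\<phi> (Suc j)) \<xi> = cutoff (Suc j) \<xi> - cutoff j \<xi>"
  using D unfolding dyadic_resolution_def cutoff_def by simp

lemma dyadic_fourier_injective:
  fixes g :: "real^'n \<Rightarrow> complex"
  assumes "integrable lborel g" "continuous_on UNIV g" "\<And>\<xi>. fourier g \<xi> = 0"
  shows "g x = 0"
  using D unfolding dyadic_resolution_def by (intro fourier_injective[OF assms, of "\<phi> 0" \<Psi>]) auto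

text \<open>The transform of \<open>\<phi> j\<close> vanishes for
  \<open>norm \<xi> \<ge> 2 ^ (j + 1)\<close>. For \<open>k \<ge> j + 2\<close> both cutoffs
  defining the transform of \<open>\<phi> k\<close> equal 1 for
  \<open>norm \<xi> \<le> 2 ^ (k - 1)\<close>, which covers the ball of radius
  \<open>2 ^ (j + 1)\<close>.\<close>

lemma fourier_dyadic_disjoint:
  assumes "j + 2 \<le> k"
  shows "fourier (\<phi> j) \<xi> * fourier (\<phi> k) \<xi> = 0"
proof -
  obtain k' where k: "k = Suc k'" "j + 1 \<le> k'" using assms by (cases k) auto
  show ?thesis
  proof (cases "norm \<xi> \<le> 2 ^ Suc j")
    case True
    have "(2::real) ^ Suc j \<le> 2 ^ k'" "(2::real) ^ Suc j \<le> 2 ^ Suc k'" using k by (intro power_increasing; simp)+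
    then have "norm \<xi> \<le> 2 ^ k'" "norm \<xi> \<le> 2 ^ Suc k'" using True by linarith+
    then have "cutoff k' \<xi> = 1" "cutoff (Suc k') \<xi> = 1" by (auto intro!: cutoff_eq_1)
    then show ?thesis unfolding k fourier_dyadic_Suc by simp
  next
    case False
    then have "cutoff j \<xi> = 0" by (intro cutoff_eq_0) auto
    moreover have "cutoff i \<xi> = 0" if "j = Suc i" for i
    proof (rule cutoff_eq_0)
      have "(2::real) ^ Suc i \<le> 2 ^ Suc j" using that by (intro power_increasing) auto
      then show "2 ^ Suc i \<le> norm \<xi>" using False by linarith
    qed
    ultimately have "fourier (\<phi> j) \<xi> = 0" by (cases j) (auto simp: fourier_dyadic_0 fourier_dyadic_Suc)
    then show ?thesis by simp
  qed
qed

text \<open>The neighbouring sum telescopes to \<open>cutoff (k + 1)\<close> minus, for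
  \<open>k \<ge> 2\<close>, \<open>cutoff (k - 2)\<close>. On the annulus where the transform of
  \<open>\<phi> k\<close> can be nonzero the first is 1 and the second 0. For \<open>k = 0\<close>
  truncated subtraction lets the range start at 0.\<close>

lemma fourier_dyadic_neighbours:
  "fourier (\<phi> k) \<xi> * (\<Sum>j\<in>{k - 1..Suc k}. fourier (\<phi> j) \<xi>) = fourier (\<phi> k) \<xi>"
proof (cases "norm \<xi> \<le> 2 ^ Suc k")
  case True
  then have c1: "cutoff (Suc k) \<xi> = 1" by (intro cutoff_eq_1)
  show ?thesis
  proof (cases k)
    case 0
    have "{k - 1..Suc k} = {0, 1}" unfolding 0 by auto
    then show ?thesis using c1 unfolding 0 by (simp add: fourier_dyadic_0 fourier_dyadic_Suc)
  next
    case (Suc i)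
    have "{k - 1..Suc k} = {i, Suc i, Suc (Suc i)}" unfolding Suc by auto
    then have S: "(\<Sum>j\<in>{k - 1..Suc k}. fourier (\<phi> j) \<xi>) = fourier (\<phi> i) \<xi> + (cutoff (Suc i) \<xi> - cutoff i \<xi>) + (1 - cutoff (Suc i) \<xi>)"
      using c1 unfolding Suc by (simp add: fourier_dyadic_Suc)
    show ?thesis
    proof (cases i)
      case 0 then show ?thesis unfolding S by (simp add: fourier_dyadic_0)
    next
      case (Suc l)
      have "fourier (\<phi> k) \<xi> = 0 \<or> cutoff l \<xi> = 0"
      proof (cases "norm \<xi> \<le> 2 ^ Suc l")
        case True
        moreover have "(2::real) ^ Suc l \<le> 2 ^ k" using \<open>k = Suc i\<close> Suc by (intro power_increasing) auto
        ultimately have "norm \<xi> \<le> 2 ^ k" "norm \<xi> \<le> 2 ^ i" unfolding \<open>i = Suc l\<close> by linarith+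
        then have "cutoff k \<xi> = 1" "cutoff i \<xi> = 1" by (auto intro!: cutoff_eq_1)
        then show ?thesis using \<open>k = Suc i\<close> by (simp add: fourier_dyadic_Suc)
      next
        case False then show ?thesis by (intro disjI2 cutoff_eq_0) auto
      qed
      then show ?thesis unfolding S using Suc by (auto simp: fourier_dyadic_Suc)
    qed
  qed
next
  case False
  then have "cutoff k \<xi> = 0" by (intro cutoff_eq_0) auto
  moreover have "cutoff i \<xi> = 0" if "k = Suc i" for i
  proof (rule cutoff_eq_0)
    have "(2::real) ^ Suc i \<le> 2 ^ Suc k" using that by (intro power_increasing) auto
    then show "2 ^ Suc i \<le> norm \<xi>" using False by linarith
  qed
  ultimately have "fourier (\<phi> k) \<xi> = 0" by (cases k) (auto simp: fourier_dyadic_0 fourier_dyadic_Suc)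
  then show ?thesis by simp
qed

lemma dyadic_convolve_disjoint:
  assumes "j + 2 \<le> k \<or> k + 2 \<le> j"
  shows "(\<integral>z. \<phi> k z * \<phi> j (x - z) \<partial>lborel) = 0"
proof (rule dyadic_fourier_injective)
  show "integrable lborel (\<lambda>x. \<integral>z. \<phi> k z * \<phi> j (x - z) \<partial>lborel)"
    by (intro integrable_convolve dyadic_integrable)
  show "continuous_on UNIV (\<lambda>x. \<integral>z. \<phi> k z * \<phi> j (x - z) \<partial>lborel)"
    by (intro continuous_convolve dyadic_integrable dyadic_schwartz)
  fix \<xi>
  show "fourier (\<lambda>x. \<integral>z. \<phi> k z * \<phi> j (x - z) \<partial>lborel) \<xi> = 0"
    using assms fourier_dyadic_disjoint[of j k] fourier_dyadic_disjoint[of k j]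
    by (subst fourier_convolve) (auto intro: dyadic_integrable simp: mult.commute)
qed

lemma fourier_sum_diff:
  fixes f :: "'i \<Rightarrow> real^'n \<Rightarrow> complex"
  assumes f: "\<And>i. i \<in> I \<Longrightarrow> integrable lborel (f i)" and h: "integrable lborel h"
  shows "fourier (\<lambda>x. (\<Sum>i\<in>I. f i x) - h x) \<xi> = (\<Sum>i\<in>I. fourier (f i) \<xi>) - fourier h \<xi>"
proof -
  have m: "f i \<in> borel_measurable borel" if "i \<in> I" for i using f[OF that] by auto
  have mh[measurable]: "h \<in> borel_measurable borel" using h by auto
  have ms[measurable]: "(\<lambda>x. \<Sum>i\<in>I. f i x) \<in> borel_measurable borel" using m by (rule borel_measurable_sum)
  have ci: "integrable lborel (\<lambda>x. cis (- (x \<bullet> \<xi>)) * u x)" if "integrable lborel u" for u :: "real^'n \<Rightarrow> complex"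
    by (rule integrable_cis_mult[OF that]) measurable
  have "fourier (\<lambda>x. (\<Sum>i\<in>I. f i x) - h x) \<xi> = (\<integral>x. (\<Sum>i\<in>I. cis (- (x \<bullet> \<xi>)) * f i x) - cis (- (x \<bullet> \<xi>)) * h x \<partial>lborel)"
    by (subst fourier_lborel) (auto simp: right_diff_distrib sum_distrib_left)
  also have "\<dots> = (\<integral>x. (\<Sum>i\<in>I. cis (- (x \<bullet> \<xi>)) * f i x) \<partial>lborel) - (\<integral>x. cis (- (x \<bullet> \<xi>)) * h x \<partial>lborel)"
    using f h by (intro Bochner_Integration.integral_diff Bochner_Integration.integrable_sum ci) auto
  also have "(\<integral>x. (\<Sum>i\<in>I. cis (- (x \<bullet> \<xi>)) * f i x) \<partial>lborel) = (\<Sum>i\<in>I. \<integral>x. cis (- (x \<bullet> \<xi>)) * f i x \<partial>lborel)"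
    using f by (intro Bochner_Integration.integral_sum ci)
  also have "\<dots> = (\<Sum>i\<in>I. fourier (f i) \<xi>)" using m by (intro sum.cong) (auto simp: fourier_lborel)
  finally show ?thesis by (simp add: fourier_lborel)
qed

lemma dyadic_convolve_neighbours:
  "(\<Sum>j\<in>{k - 1..Suc k}. \<integral>z. \<phi> k z * \<phi> j (x - z) \<partial>lborel) = \<phi> k x"
proof -
  let ?c = "\<lambda>j x. \<integral>z. \<phi> k z * \<phi> j (x - z) \<partial>lborel"
  have ci: "integrable lborel (?c j)" for j by (intro integrable_convolve dyadic_integrable)
  have "(\<lambda>x. (\<Sum>j\<in>{k - 1..Suc k}. ?c j x) - \<phi> k x) x = 0"
  proof (rule dyadic_fourier_injective)
    show "integrable lborel (\<lambda>x. (\<Sum>j\<in>{k - 1..Suc k}. ?c j x) - \<phi> k x)"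
      by (intro Bochner_Integration.integrable_diff Bochner_Integration.integrable_sum ci dyadic_integrable)
    show "continuous_on UNIV (\<lambda>x. (\<Sum>j\<in>{k - 1..Suc k}. ?c j x) - \<phi> k x)"
      by (intro continuous_on_diff continuous_on_sum continuous_convolve dyadic_integrable dyadic_schwartz schwartz_continuous_on)
    fix \<xi>
    have "fourier (\<lambda>x. (\<Sum>j\<in>{k - 1..Suc k}. ?c j x) - \<phi> k x) \<xi> = (\<Sum>j\<in>{k - 1..Suc k}. fourier (?c j) \<xi>) - fourier (\<phi> k) \<xi>"
      by (rule fourier_sum_diff[OF ci dyadic_integrable])
    also have "(\<Sum>j\<in>{k - 1..Suc k}. fourier (?c j) \<xi>) = fourier (\<phi> k) \<xi> * (\<Sum>j\<in>{k - 1..Suc k}. fourier (\<phi> j) \<xi>)"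
      by (simp add: fourier_convolve dyadic_integrable sum_distrib_left del: sum.cl_ivl_Suc)
    also have "\<dots> = fourier (\<phi> k) \<xi>" by (rule fourier_dyadic_neighbours)
    finally show "fourier (\<lambda>x. (\<Sum>j\<in>{k - 1..Suc k}. ?c j x) - \<phi> k x) \<xi> = 0" by simp
  qed
  then show ?thesis by (simp del: sum.cl_ivl_Suc)
qed

text \<open>All blocks but the zeroth have transforms that are dilations of one function on an
  annulus; by uniqueness the kernels themselves are dilations of \<open>\<phi> 1\<close>. This makes
  the decay constants below independent of \<open>k\<close>.\<close>

lemma dyadic_scaling:
  "\<phi> (Suc k) x = of_real ((2 ^ k) ^ CARD('n)) * \<phi> 1 ((2 ^ k) *\<^sub>R x)"
proof -
  let ?s = "\<lambda>x. of_real ((2 ^ k) ^ CARD('n)) * \<phi> 1 ((2 ^ k) *\<^sub>R x)"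
  have si: "integrable lborel ?s"
    using lborel_integrable_affine[where c = "2 ^ k" and t = 0, OF _ dyadic_integrable[of 1]]
    by (intro integrable_mult_right) simp
  \<comment> \<open>The sum over a singleton merely brings the difference into the form treated by
    \<open>fourier_sum_diff\<close>.\<close>
  define g where "g = (\<lambda>x. (\<Sum>j\<in>{Suc k}. \<phi> j x) - ?s x)"
  have "g x = 0"
  proof (rule dyadic_fourier_injective, unfold g_def)
    show "integrable lborel (\<lambda>x. (\<Sum>j\<in>{Suc k}. \<phi> j x) - ?s x)"
      by (intro Bochner_Integration.integrable_diff Bochner_Integration.integrable_sum si dyadic_integrable)
    have "continuous_on UNIV (\<lambda>x. \<phi> 1 ((2 ^ k) *\<^sub>R x))"
      by (rule continuous_on_compose2[OF schwartz_continuous_on[OF dyadic_schwartz(1), of UNIV]]) (auto intro!: continuous_intros)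
    then show "continuous_on UNIV (\<lambda>x. (\<Sum>j\<in>{Suc k}. \<phi> j x) - ?s x)"
      by (intro continuous_on_diff continuous_on_sum continuous_on_mult continuous_on_const)
        (auto intro: schwartz_continuous_on dyadic_schwartz)
    fix \<xi>
    have cs: "cutoff i (\<xi> /\<^sub>R 2 ^ k) = cutoff (i + k) \<xi>" for i
    proof -
      have "2 powr (- real (i + k)) = 2 powr (- real i) * 2 powr (- real k)" by (simp add: powr_add[symmetric])
      moreover have "inverse (2 ^ k) = (2 :: real) powr (- real k)" by (simp add: powr_minus powr_realpow)
      ultimately show ?thesis unfolding cutoff_def by simp
    qed
    have "fourier ?s \<xi> = fourier (\<phi> 1) (\<xi> /\<^sub>R 2 ^ k)" by (rule fourier_scale) auto
    also have "\<dots> = fourier (\<phi> (Suc k)) \<xi>"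
      using cs[of 0] cs[of 1] fourier_dyadic_Suc[of 0] by (simp add: fourier_dyadic_Suc)
    finally show "fourier (\<lambda>x. (\<Sum>j\<in>{Suc k}. \<phi> j x) - ?s x) \<xi> = 0"
      using fourier_sum_diff[where I = "{Suc k}" and f = \<phi>, OF dyadic_integrable si] by simp
  qed
  then show ?thesis by (simp add: g_def)
qed

lemma dyadic_decay:
  obtains C where "0 < C" and "\<And>k x. (1 + 2 ^ k * norm x) ^ m * norm (\<phi> k x) \<le> C * (2 ^ k) ^ CARD('n)"
proof -
  obtain C0 where C0: "0 < C0" "\<And>x. (1 + norm x) ^ m * norm (\<phi> 0 x) \<le> C0"
    using schwartz_decay[OF dyadic_schwartz(1), of m 0] by blast
  obtain C1 where C1: "0 < C1" "\<And>x. (1 + norm x) ^ m * norm (\<phi> 1 x) \<le> C1"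
    using schwartz_decay[OF dyadic_schwartz(1), of m 1] by blast
  \<comment> \<open>The factor \<open>2 ^ m\<close> stems from the shift between the index
    \<open>i + 1\<close> of the block and its dilation \<open>2 ^ i\<close>:
    \<open>1 + 2 ^ (i + 1) * norm x\<close> is at most twice
    \<open>1 + 2 ^ i * norm x\<close>.\<close>
  define C where "C = max C0 (2 ^ m * C1)"
  have "(1 + 2 ^ k * norm x) ^ m * norm (\<phi> k x) \<le> C * (2 ^ k) ^ CARD('n)" for k x
  proof (cases k)
    case 0 then show ?thesis using C0(2)[of x] unfolding C_def by simp
  next
    case (Suc i)
    define y where "y = (2 ^ i :: real) *\<^sub>R x"
    have ny: "norm y = 2 ^ i * norm x" unfolding y_def by simp
    have "(1 + 2 ^ k * norm x) ^ m \<le> (2 * (1 + norm y)) ^ m"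
      unfolding ny Suc by (intro power_mono) auto
    then have "(1 + 2 ^ k * norm x) ^ m * norm (\<phi> 1 y) \<le> (2 * (1 + norm y)) ^ m * norm (\<phi> 1 y)" by (intro mult_right_mono) auto
    also have "\<dots> = 2 ^ m * ((1 + norm y) ^ m * norm (\<phi> 1 y))" by (simp only: power_mult_distrib mult.assoc)
    also have "\<dots> \<le> 2 ^ m * C1" using C1(2)[of y] by (intro mult_left_mono) auto
    also have "\<dots> \<le> C" unfolding C_def by simp
    finally have *: "(1 + 2 ^ k * norm x) ^ m * norm (\<phi> 1 y) \<le> C" .
    have "(1 + 2 ^ k * norm x) ^ m * norm (\<phi> k x) = (2 ^ i) ^ CARD('n) * ((1 + 2 ^ k * norm x) ^ m * norm (\<phi> 1 y))"
      unfolding Suc dyadic_scaling y_def by (simp add: norm_mult norm_power)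
    also have "\<dots> \<le> (2 ^ i) ^ CARD('n) * C" by (intro mult_left_mono *) auto
    also have "\<dots> \<le> (2 ^ k) ^ CARD('n) * C"
      using C0(1) unfolding Suc C_def by (intro mult_right_mono power_mono) auto
    finally show ?thesis by (simp add: mult.commute)
  qed
  then show ?thesis using C0(1) by (intro that[of C]) (auto simp: C_def)
qed

end

section \<open>Splitting of a distribution by frequencies\<close>

text \<open>The logarithm in the local condition is at least 1 at every distance, so the condition
  bounds the oscillation over the whole space by \<open>c\<close>.\<close>

lemma C_log_loc_bounded:
  fixes g :: "'a::euclidean_space \<Rightarrow> real"
  assumes "g \<in> C_log_loc"
  obtains B where "0 < B" and "\<And>x. \<bar>g x\<bar> \<le> B"
proof -
  obtain c where c: "c > 0" "\<And>x y. \<bar>g x - g y\<bar> \<le> c / ln (exp 1 + 1 / norm (x - y))"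
    using assms unfolding C_log_loc_def by auto
  have "\<bar>g x\<bar> \<le> \<bar>g 0\<bar> + c" for x
  proof -
    have "1 \<le> ln (exp 1 + 1 / norm (x - 0))" by (subst ln_ge_iff) (auto intro: add_pos_nonneg)
    then have "c / ln (exp 1 + 1 / norm (x - 0)) \<le> c / 1" using c(1) by (intro divide_left_mono) auto
    then show ?thesis using c(2)[of x 0] by linarith
  qed
  then show ?thesis using c(1) by (intro that[of "\<bar>g 0\<bar> + c"]) auto
qed

section \<open>Distributions given by functions of polynomial growth, and sums of
  distributions\<close>

definition regular_distribution :: "(real^'n::finite \<Rightarrow> complex) \<Rightarrow> (real^'n \<Rightarrow> complex) \<Rightarrow> complex" where
  "regular_distribution G u = (if u \<in> schwartz then \<integral>z. u z * G z \<partial>lborel else 0)"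

lemma schwartz_mult_growth_integrable:
  fixes u G :: "real^'n::finite \<Rightarrow> complex"
  assumes u: "u \<in> schwartz" and G[measurable]: "G \<in> borel_measurable borel" and C: "\<And>z. norm (G z) \<le> C * (1 + norm z) ^ k"
  shows "integrable lborel (\<lambda>z. u z * G z)"
proof (rule Bochner_Integration.integrable_bound)
  show "integrable lborel (\<lambda>z. C * (norm (u z) * (1 + norm z) ^ k))"
    using schwartz_weighted_integrable[OF u] by simp
  have [measurable]: "u \<in> borel_measurable borel" using u by (rule schwartz_borel_measurable)
  show "(\<lambda>z. u z * G z) \<in> borel_measurable lborel" by measurable
  show "AE z in lborel. norm (u z * G z) \<le> norm (C * (norm (u z) * (1 + norm z) ^ k))"
  proof (rule AE_I2)
    fix z
    have "norm (u z * G z) \<le> norm (u z) * (C * (1 + norm z) ^ k)"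
      unfolding norm_mult by (intro mult_left_mono C) auto
    also have "\<dots> \<le> norm (C * (norm (u z) * (1 + norm z) ^ k))" by (simp add: mult_ac)
    finally show "norm (u z * G z) \<le> norm (C * (norm (u z) * (1 + norm z) ^ k))" .
  qed
qed

lemma regular_distribution_tempered:
  fixes G :: "real^'n::finite \<Rightarrow> complex"
  assumes Gm: "G \<in> borel_measurable borel" and C: "\<And>z. norm (G z) \<le> C * (1 + norm z) ^ k"
  shows "regular_distribution G \<in> tempered_distributions"
proof -
  have int: "integrable lborel (\<lambda>z. u z * G z)" if "u \<in> schwartz" for u
    by (rule schwartz_mult_growth_integrable[OF that Gm C])
  have C0: "0 \<le> C" using order_trans[OF norm_ge_zero C[of 0]] by simp
  let ?R = "regular_distribution G"
  have z: "?R u = 0" if "u \<notin> schwartz" for u using that by (simp add: regular_distribution_def)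
  have add: "?R (\<lambda>x. u x + v x) = ?R u + ?R v" if "u \<in> schwartz" "v \<in> schwartz" for u v
    using that int[of u] int[of v] schwartz_add[OF that] by (simp add: regular_distribution_def distrib_right)
  have cm: "?R (\<lambda>x. c * u x) = c * ?R u" if "u \<in> schwartz" for c u
    using that schwartz_cmult[OF that, of c] by (simp add: regular_distribution_def mult.assoc)
  have cont: "\<exists>k. \<exists>\<delta>>0. \<forall>v\<in>schwartz. schwartz_seminorm k (\<lambda>x. v x - u x) < \<delta> \<longrightarrow> norm (?R v - ?R u) < \<epsilon>"
    if u: "u \<in> schwartz" and e: "0 < \<epsilon>" for u and \<epsilon> :: real
  proof -
    \<comment> \<open>\<open>k\<close> powers of \<open>1 + norm z\<close> absorb the growth of
      \<open>G\<close>, and \<open>n + 2\<close> more leave an integrable function with integral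
      \<open>K\<close>. The 1 in \<open>C * K + 1\<close> keeps the quotient defining
      \<open>\<delta>\<close> positive even if \<open>C * K\<close> is 0.\<close>
    let ?m = "CARD('n) + 2"
    have fin: "(\<integral>\<^sup>+(x::real^'n). ennreal ((1 + norm x) powr (- (real CARD('n) + 2))) \<partial>lborel) < top"
      using nn_integral_decay_finite[where 'a = "real^'n"] by simp
    have dom: "integrable lborel (\<lambda>z::real^'n. (1 + norm z) powr (- (real CARD('n) + 2)))"
      by (intro integrableI_bounded) (use fin in \<open>auto\<close>)
    define K where "K = (\<integral>(z::real^'n). (1 + norm z) powr (- (real CARD('n) + 2)) \<partial>lborel)"
    have K: "0 \<le> K" unfolding K_def by (rule integral_nonneg_AE) auto
    define \<delta> where "\<delta> = \<epsilon> / (C * K + 1)"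
    have CK: "0 < C * K + 1" using C0 K by (simp add: add_nonneg_pos)
    have d: "0 < \<delta>" unfolding \<delta>_def using e CK by simp
    have "norm (?R v - ?R u) < \<epsilon>" if v: "v \<in> schwartz" and s: "schwartz_seminorm (k + ?m) (\<lambda>x. v x - u x) < \<delta>" for v
    proof -
      define S where "S = schwartz_seminorm (k + ?m) (\<lambda>x. v x - u x)"
      have vu: "(\<lambda>x. v x - u x) \<in> schwartz" by (rule schwartz_diff[OF v u])
      have S0: "0 \<le> S" unfolding S_def using vu by (rule schwartz_seminorm_nonneg)
      have "?R v - ?R u = (\<integral>z. (v z - u z) * G z \<partial>lborel)"
        using u v int[OF u] int[OF v] by (simp add: regular_distribution_def left_diff_distrib)
      moreover have "norm (\<integral>z. (v z - u z) * G z \<partial>lborel) \<le> (\<integral>z. (C * S) * (1 + norm (z::real^'n)) powr (- (real CARD('n) + 2)) \<partial>lborel)"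
      proof (rule norm_integral_le_of_AE)
        show "integrable lborel (\<lambda>z::real^'n. (C * S) * (1 + norm z) powr (- (real CARD('n) + 2)))" using dom by simp
        show "AE z in lborel. norm ((v z - u z) * G z) \<le> (C * S) * (1 + norm z) powr (- (real CARD('n) + 2))"
        proof (rule AE_I2)
          fix z :: "real^'n"
          define N where "N = 1 + norm z"
          have N: "0 < N" unfolding N_def by (simp add: add_pos_nonneg)
          have "N ^ (k + ?m) * norm (v z - u z) \<le> S"
            using le_schwartz_seminorm[OF vu, of "[]" "k + ?m" z] unfolding S_def N_def by simp
          then have "norm (v z - u z) * N ^ k * N ^ ?m \<le> S" by (simp only: power_add mult_ac)
          then have "norm (v z - u z) * N ^ k \<le> S * inverse (N ^ ?m)" using N by (simp add: field_simps)
          also have "inverse (N ^ ?m) = N powr (- (real CARD('n) + 2))"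
            using N powr_realpow[OF N, of ?m] by (simp only: powr_minus of_nat_add of_nat_numeral)
          finally have *: "norm (v z - u z) * N ^ k \<le> S * N powr (- (real CARD('n) + 2))" .
          have "norm ((v z - u z) * G z) \<le> norm (v z - u z) * (C * N ^ k)"
            unfolding norm_mult N_def by (intro mult_left_mono C) auto
          also have "\<dots> = C * (norm (v z - u z) * N ^ k)" by simp
          also have "\<dots> \<le> C * (S * N powr (- (real CARD('n) + 2)))" by (intro mult_left_mono * C0)
          finally show "norm ((v z - u z) * G z) \<le> (C * S) * (1 + norm z) powr (- (real CARD('n) + 2))"
            unfolding N_def by (simp add: mult.assoc)
        qed
      qed
      ultimately have "norm (?R v - ?R u) \<le> C * S * K" unfolding K_def by simp
      also have "\<dots> \<le> (C * K + 1) * S" using S0 by (simp add: algebra_simps)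
      also have "\<dots> < (C * K + 1) * \<delta>" using s CK unfolding S_def by (intro mult_strict_left_mono)
      also have "\<dots> = \<epsilon>" unfolding \<delta>_def using CK by simp
      finally show ?thesis .
    qed
    then show ?thesis using d by blast
  qed
  show ?thesis unfolding tempered_distributions_def
  proof (intro CollectI conjI)
    show "\<forall>c. \<forall>u\<in>schwartz. ?R (\<lambda>x. c * u x) = c * ?R u" using cm by blast
    show "\<forall>u\<in>schwartz. \<forall>\<epsilon>>0. \<exists>k. \<exists>\<delta>>0. \<forall>v\<in>schwartz. schwartz_seminorm k (\<lambda>x. v x - u x) < \<delta> \<longrightarrow> norm (?R v - ?R u) < \<epsilon>"
      using cont by blast
  qed (use z add in blast)+
qed

lemma tempered_distributions_add:
  assumes S: "S \<in> tempered_distributions" and T: "T \<in> tempered_distributions"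
  shows "S + T \<in> tempered_distributions"
proof -
  have cont: "\<exists>k. \<exists>\<delta>>0. \<forall>v\<in>schwartz. schwartz_seminorm k (\<lambda>x. v x - u x) < \<delta> \<longrightarrow> norm ((S + T) v - (S + T) u) < \<epsilon>"
    if u: "u \<in> schwartz" and e: "0 < \<epsilon>" for u and \<epsilon> :: real
  proof -
    obtain k C where C: "0 < C" "\<And>u. u \<in> schwartz \<Longrightarrow> norm (S u) \<le> C * schwartz_seminorm k u"
      using tempered_seminorm_bound[OF S] by blast
    obtain l D where D: "0 < D" "\<And>u. u \<in> schwartz \<Longrightarrow> norm (T u) \<le> D * schwartz_seminorm l u"
      using tempered_seminorm_bound[OF T] by blast
    have mono: "schwartz_seminorm k w \<le> schwartz_seminorm m w" if "w \<in> schwartz" "k \<le> m" for k m and w :: "real^'a \<Rightarrow> complex"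
    proof (rule schwartz_seminorm_leI)
      fix "is" :: "'a list" and x assume "length is \<le> k"
      have "(1 + norm x) ^ k * norm (iterated_partial is w x) \<le> (1 + norm x) ^ m * norm (iterated_partial is w x)"
        using that by (intro mult_right_mono power_increasing) auto
      also have "\<dots> \<le> schwartz_seminorm m w" using \<open>length is \<le> k\<close> that by (intro le_schwartz_seminorm) auto
      finally show "(1 + norm x) ^ k * norm (iterated_partial is w x) \<le> schwartz_seminorm m w" .
    qed
    define \<delta> where "\<delta> = \<epsilon> / (C + D)"
    have "norm ((S + T) v - (S + T) u) < \<epsilon>" if v: "v \<in> schwartz" and s: "schwartz_seminorm (max k l) (\<lambda>x. v x - u x) < \<delta>" for v
    proof -
      let ?w = "\<lambda>x. v x - u x"
      have w: "?w \<in> schwartz" by (rule schwartz_diff[OF v u])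
      have "(S + T) v - (S + T) u = S ?w + T ?w"
        by (simp add: tempered_diff[OF S v u] tempered_diff[OF T v u])
      then have "norm ((S + T) v - (S + T) u) \<le> norm (S ?w) + norm (T ?w)" using norm_triangle_ineq by metis
      also have "\<dots> \<le> C * schwartz_seminorm k ?w + D * schwartz_seminorm l ?w" by (intro add_mono C D w)
      also have "\<dots> \<le> C * schwartz_seminorm (max k l) ?w + D * schwartz_seminorm (max k l) ?w"
        using C(1) D(1) by (intro add_mono mult_left_mono mono w) auto
      also have "\<dots> = (C + D) * schwartz_seminorm (max k l) ?w" by (simp add: algebra_simps)
      also have "\<dots> < (C + D) * \<delta>" using s C(1) D(1) by (intro mult_strict_left_mono) auto
      also have "\<dots> = \<epsilon>" unfolding \<delta>_def using C(1) D(1) by simp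
      finally show ?thesis .
    qed
    moreover have "0 < \<delta>" unfolding \<delta>_def using e C(1) D(1) by simp
    ultimately show ?thesis by blast
  qed
  show ?thesis unfolding tempered_distributions_def
  proof (intro CollectI conjI)
    show "\<forall>u. u \<notin> schwartz \<longrightarrow> (S + T) u = 0" using S T unfolding tempered_distributions_def by auto
    show "\<forall>u\<in>schwartz. \<forall>v\<in>schwartz. (S + T) (\<lambda>x. u x + v x) = (S + T) u + (S + T) v"
      by (simp add: tempered_add[OF S] tempered_add[OF T])
    show "\<forall>c. \<forall>u\<in>schwartz. (S + T) (\<lambda>x. c * u x) = c * (S + T) u"
      by (simp add: tempered_cmult[OF S] tempered_cmult[OF T] distrib_left)
    show "\<forall>u\<in>schwartz. \<forall>\<epsilon>>0. \<exists>k. \<exists>\<delta>>0. \<forall>v\<in>schwartz. schwartz_seminorm k (\<lambda>x. v x - u x) < \<delta> \<longrightarrow> norm ((S + T) v - (S + T) u) < \<epsilon>"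
      using cont by blast
  qed
qed

lemma tempered_distributions_cmult:
  assumes T: "T \<in> tempered_distributions"
  shows "(\<lambda>u. c * T u) \<in> tempered_distributions"
proof -
  have cont: "\<exists>k. \<exists>\<delta>>0. \<forall>v\<in>schwartz. schwartz_seminorm k (\<lambda>x. v x - u x) < \<delta> \<longrightarrow> norm (c * T v - c * T u) < \<epsilon>"
    if u: "u \<in> schwartz" and e: "0 < \<epsilon>" for u and \<epsilon> :: real
  proof -
    have "0 < \<epsilon> / (norm c + 1)" using e by (simp add: add_nonneg_pos)
    moreover have "\<forall>u\<in>schwartz. \<forall>\<epsilon>>0. \<exists>k. \<exists>\<delta>>0. \<forall>v\<in>schwartz. schwartz_seminorm k (\<lambda>x. v x - u x) < \<delta> \<longrightarrow> norm (T v - T u) < \<epsilon>"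
      using T unfolding tempered_distributions_def by simp
    ultimately obtain k \<delta> where d: "0 < \<delta>" "\<And>v. v \<in> schwartz \<Longrightarrow> schwartz_seminorm k (\<lambda>x. v x - u x) < \<delta> \<Longrightarrow> norm (T v - T u) < \<epsilon> / (norm c + 1)"
      using u by blast
    have "norm (c * T v - c * T u) < \<epsilon>" if "norm (T v - T u) < \<epsilon> / (norm c + 1)" for v
    proof -
      have "norm (c * T v - c * T u) = norm c * norm (T v - T u)" by (simp add: norm_mult flip: right_diff_distrib)
      also have "\<dots> \<le> (norm c + 1) * norm (T v - T u)" by (intro mult_right_mono) auto
      also have "\<dots> < \<epsilon>" using that by (simp add: less_divide_eq add_nonneg_pos mult.commute)
      finally show ?thesis .
    qed
    then show ?thesis using d by blast
  qed
  show ?thesis unfolding tempered_distributions_def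
  proof (intro CollectI conjI)
    show "\<forall>u. u \<notin> schwartz \<longrightarrow> c * T u = 0" using T unfolding tempered_distributions_def by auto
    show "\<forall>u\<in>schwartz. \<forall>v\<in>schwartz. c * T (\<lambda>x. u x + v x) = c * T u + c * T v"
      by (simp add: tempered_add[OF T] distrib_left)
    show "\<forall>a. \<forall>u\<in>schwartz. c * T (\<lambda>x. a * u x) = a * (c * T u)"
      by (simp add: tempered_cmult[OF T])
    show "\<forall>u\<in>schwartz. \<forall>\<epsilon>>0. \<exists>k. \<exists>\<delta>>0. \<forall>v\<in>schwartz. schwartz_seminorm k (\<lambda>x. v x - u x) < \<delta> \<longrightarrow> norm (c * T v - c * T u) < \<epsilon>"
      using cont by blast
  qed
qed

lemma tempered_distributions_diff:
  assumes S: "S \<in> tempered_distributions" and T: "T \<in> tempered_distributions"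
  shows "S - T \<in> tempered_distributions"
proof -
  have "S + (\<lambda>u. - 1 * T u) \<in> tempered_distributions"
    by (rule tempered_distributions_add[OF S tempered_distributions_cmult[OF T]])
  moreover have "S + (\<lambda>u. - 1 * T u) = S - T" by (rule ext) simp
  ultimately show ?thesis by simp
qed

lemma continuous_lebesgue_measurable:
  fixes f :: "'a::euclidean_space \<Rightarrow> complex"
  assumes "continuous_on UNIV f"
  shows "f \<in> borel_measurable lebesgue"
  using borel_measurable_continuous_onI[OF assms] by (intro measurable_completion) simp

section \<open>Weighted norms of dyadic blocks and the frequency splitting\<close>

context
  fixes \<Psi> :: "real^'n::finite \<Rightarrow> complex" and \<phi> :: "nat \<Rightarrow> real^'n \<Rightarrow> complex"
    and p :: "real^'n \<Rightarrow> real"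
  assumes D: "dyadic_resolution \<Psi> \<phi>" and p: "p \<in> log_exponents"
begin

definition besov_coeff :: "(real^'n \<Rightarrow> real) \<Rightarrow> ((real^'n \<Rightarrow> complex) \<Rightarrow> complex) \<Rightarrow> nat \<Rightarrow> ennreal" where
  "besov_coeff s T j = Lp_norm p (\<lambda>x. of_real (2 powr (real j * s x)) * convolution (\<phi> j) T x)"

lemma exponent_ge_1: "1 \<le> p x" and exponent_ge_0: "0 \<le> p x" and exponent_measurable: "p \<in> borel_measurable lebesgue"
proof -
  have *: "p \<in> borel_measurable lebesgue" "\<And>x. 1 \<le> p x"
    using p unfolding log_exponents_def exponents_def by auto
  show "1 \<le> p x" "p \<in> borel_measurable lebesgue" using * by auto
  show "0 \<le> p x" using *(2)[of x] by linarith
qed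

lemma continuous_weight:
  assumes "s \<in> C_log_loc"
  shows "continuous_on UNIV (\<lambda>x. complex_of_real (2 powr (c * s x)))"
  using C_log_loc_continuous[OF assms] by (intro continuous_intros) auto

text \<open>\<open>k * s x\<close> is decomposed as
  \<open>k * (s x - s z) + (k - j) * s z + j * s z\<close>. The first term costs a power of
  \<open>1 + 2 ^ k * norm (x - z)\<close> by log-Hoelder continuity, the second a constant since
  \<open>s\<close> is bounded and the indices differ by at most one, and the third is the weight of
  the input. What remains is a kernel of scale \<open>2 ^ k\<close> as in
  \<open>kernel_Lp_norm_bound\<close>.\<close>

lemma kernel_weighted_bound:
  assumes s: "s \<in> C_log_loc"
  obtains C where "0 < C" and "\<And>j k g. \<lbrakk>j \<le> Suc k; k \<le> Suc j; continuous_on UNIV g\<rbrakk> \<Longrightarrow>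
    Lp_norm p (\<lambda>x. of_real (2 powr (real k * s x)) * (\<integral>z. \<phi> k (x - z) * g z \<partial>lborel))
      \<le> ennreal C * Lp_norm p (\<lambda>x. of_real (2 powr (real j * s x)) * g x)"
proof -
  show ?thesis
  proof (rule kernel_Lp_norm_bound[OF p])
    fix C1 M :: real
    assume M: "0 < C1" "0 \<le> M"
    "\<And>s f G. \<lbrakk>1 \<le> s; f \<in> borel_measurable borel;
      \<And>x. ennreal (norm (G x)) \<le> (\<integral>\<^sup>+y. ennreal (s ^ DIM(real^'n) * (1 + s * norm (x - y)) powr (- M) * norm (f y)) \<partial>lborel)\<rbrakk>
      \<Longrightarrow> Lp_norm p G \<le> ennreal C1 * Lp_norm p f"
  obtain A where A: "0 < A" "\<And>x. \<bar>s x\<bar> \<le> A" using C_log_loc_bounded[OF s] by blast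
  obtain c where c: "c > 0" "\<And>x y. \<bar>s x - s y\<bar> \<le> c / ln (exp 1 + 1 / norm (x - y))"
    using s unfolding C_log_loc_def by auto
  \<comment> \<open>The decay of \<open>\<phi> k\<close> must cover the power \<open>c\<close> lost
    in shifting the weight and the order \<open>M\<close> that the \<open>L\<^sup>p\<close> bound
    demands.\<close>
  define m where "m = nat \<lceil>c + M\<rceil>"
  have m: "c + M \<le> real m" unfolding m_def using c M by linarith
  obtain C2 where C2: "0 < C2" "\<And>k x. (1 + 2 ^ k * norm x) ^ m * norm (\<phi> k x) \<le> C2 * (2 ^ k) ^ CARD('n)"
    using dyadic_decay[OF D] by blast
  define E where "E = C2 * exp c * 2 powr A"
  have E: "0 < E" unfolding E_def using C2 by simp
  have pt: "2 powr (real k * s x) * norm (\<phi> k (x - z)) \<le> E * ((2 ^ k) ^ CARD('n) * (1 + 2 ^ k * norm (x - z)) powr (- M) * 2 powr (real j * s z))"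
    if jk: "j \<le> Suc k" "k \<le> Suc j" for j k x z
  proof -
    define N where "N = 1 + 2 ^ k * norm (x - z)"
    have N: "1 \<le> N" unfolding N_def by simp
    have "real k * s x = real k * (s x - s z) + (real k - real j) * s z + real j * s z" by (simp add: algebra_simps)
    then have "2 powr (real k * s x) = 2 powr (real k * (s x - s z)) * 2 powr ((real k - real j) * s z) * 2 powr (real j * s z)"
      by (simp add: powr_add[symmetric])
    also have "\<dots> \<le> (exp c * N powr c) * 2 powr A * 2 powr (real j * s z)"
    proof (intro mult_right_mono mult_mono)
      have "2 powr (real k * (s x - s z)) \<le> 2 powr (real k * \<bar>s x - s z\<bar>)"
        by (intro powr_mono mult_left_mono) auto
      also have "\<dots> = (2 ^ k) powr \<bar>s x - s z\<bar>" by (simp add: powr_powr flip: powr_realpow)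
      also have "\<dots> \<le> exp c * N powr c" unfolding N_def
        by (rule log_Hoelder_weight_bound[OF c(1)]) (use c(2) in auto)
      finally show "2 powr (real k * (s x - s z)) \<le> exp c * N powr c" .
      have "(real k - real j) * s z \<le> \<bar>real k - real j\<bar> * \<bar>s z\<bar>" by (metis abs_ge_self abs_mult)
      also have "\<dots> \<le> 1 * A" using jk A by (intro mult_mono) auto
      finally show "2 powr ((real k - real j) * s z) \<le> 2 powr A" by simp
    qed auto
    finally have w: "2 powr (real k * s x) \<le> (exp c * N powr c) * 2 powr A * 2 powr (real j * s z)" .
    have "norm (\<phi> k (x - z)) \<le> C2 * (2 ^ k) ^ CARD('n) * N powr (- real m)"
    proof -
      have "N ^ m * norm (\<phi> k (x - z)) \<le> C2 * (2 ^ k) ^ CARD('n)" using C2(2) unfolding N_def by simp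
      then have "norm (\<phi> k (x - z)) \<le> C2 * (2 ^ k) ^ CARD('n) / N ^ m" using N by (simp add: field_simps)
      then show ?thesis using N by (simp add: powr_minus powr_realpow divide_inverse)
    qed
    also have "\<dots> \<le> C2 * (2 ^ k) ^ CARD('n) * N powr (- (c + M))"
      using C2(1) m N by (intro mult_left_mono powr_mono) auto
    finally have ph: "norm (\<phi> k (x - z)) \<le> C2 * (2 ^ k) ^ CARD('n) * N powr (- (c + M))" .
    have "2 powr (real k * s x) * norm (\<phi> k (x - z))
      \<le> ((exp c * N powr c) * 2 powr A * 2 powr (real j * s z)) * (C2 * (2 ^ k) ^ CARD('n) * N powr (- (c + M)))"
      using N by (intro mult_mono w ph) auto
    also have "\<dots> = E * ((2 ^ k) ^ CARD('n) * (N powr c * N powr (- (c + M))) * 2 powr (real j * s z))"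
      unfolding E_def by (simp only: mult_ac)
    also have "N powr c * N powr (- (c + M)) = N powr (- M)" by (simp add: powr_add[symmetric])
    finally show ?thesis unfolding N_def .
  qed
  show ?thesis
  proof (rule that[of "E * C1"])
    show "0 < E * C1" using E M by simp
    fix j k and g :: "real^'n \<Rightarrow> complex" assume jk: "j \<le> Suc k" "k \<le> Suc j" and g: "continuous_on UNIV g"
    define f where "f = (\<lambda>x. of_real (2 powr (real j * s x)) * g x)"
    define h where "h = (\<lambda>x. of_real (2 powr (real k * s x)) * (\<integral>z. \<phi> k (x - z) * g z \<partial>lborel))"
    have fm: "f \<in> borel_measurable borel" unfolding f_def
      by (intro borel_measurable_continuous_onI continuous_on_mult continuous_weight s g)
    have "Lp_norm p (\<lambda>x. h x / of_real E) \<le> ennreal C1 * Lp_norm p f"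
    proof (rule M(3)[OF _ fm, of "2 ^ k"])
      fix x
      have "ennreal (norm (\<integral>z. \<phi> k (x - z) * g z \<partial>lborel)) \<le> (\<integral>\<^sup>+z. ennreal (norm (\<phi> k (x - z) * g z)) \<partial>lborel)"
        by (cases "integrable lborel (\<lambda>z. \<phi> k (x - z) * g z)")
          (auto intro: integral_norm_bound_ennreal simp: not_integrable_integral_eq)
      then have "ennreal (2 powr (real k * s x) / E) * ennreal (norm (\<integral>z. \<phi> k (x - z) * g z \<partial>lborel))
        \<le> ennreal (2 powr (real k * s x) / E) * (\<integral>\<^sup>+z. ennreal (norm (\<phi> k (x - z) * g z)) \<partial>lborel)"
        by (intro mult_left_mono) auto
      also have "\<dots> = (\<integral>\<^sup>+z. ennreal (2 powr (real k * s x) / E) * ennreal (norm (\<phi> k (x - z) * g z)) \<partial>lborel)"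
      proof (rule nn_integral_cmult[symmetric])
        have [measurable]: "\<phi> k \<in> borel_measurable borel" "g \<in> borel_measurable borel"
          using dyadic_measurable[OF D] borel_measurable_continuous_onI[OF g] by auto
        show "(\<lambda>z. ennreal (norm (\<phi> k (x - z) * g z))) \<in> borel_measurable lborel" by measurable
      qed
      also have "\<dots> \<le> (\<integral>\<^sup>+z. ennreal ((2 ^ k) ^ DIM(real^'n) * (1 + 2 ^ k * norm (x - z)) powr (- M) * norm (f z)) \<partial>lborel)"
      proof (rule nn_integral_mono)
        fix z
        have "2 powr (real k * s x) / E * norm (\<phi> k (x - z) * g z) = (2 powr (real k * s x) * norm (\<phi> k (x - z))) / E * norm (g z)"
          by (simp add: norm_mult)
        also have "\<dots> \<le> (E * ((2 ^ k) ^ CARD('n) * (1 + 2 ^ k * norm (x - z)) powr (- M) * 2 powr (real j * s z))) / E * norm (g z)"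
          using E by (intro mult_right_mono divide_right_mono pt[OF jk]) auto
        also have "\<dots> = (2 ^ k) ^ DIM(real^'n) * (1 + 2 ^ k * norm (x - z)) powr (- M) * norm (f z)"
          using E unfolding f_def by (simp add: norm_mult)
        finally show "ennreal (2 powr (real k * s x) / E) * ennreal (norm (\<phi> k (x - z) * g z))
          \<le> ennreal ((2 ^ k) ^ DIM(real^'n) * (1 + 2 ^ k * norm (x - z)) powr (- M) * norm (f z))"
          using E by (simp add: ennreal_leI flip: ennreal_mult)
      qed
      finally show "ennreal (norm (h x / of_real E))
        \<le> (\<integral>\<^sup>+y. ennreal ((2 ^ k) ^ DIM(real^'n) * (1 + 2 ^ k * norm (x - y)) powr (- M) * norm (f y)) \<partial>lborel)"
        unfolding h_def using E by (simp add: norm_mult norm_divide flip: ennreal_mult)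
    qed simp
    moreover have "Lp_norm p h \<le> ennreal E * Lp_norm p (\<lambda>x. h x / of_real E)"
      using E exponent_ge_0 by (intro Lp_norm_cmult_le) (auto simp: norm_divide)
    ultimately have "Lp_norm p h \<le> ennreal E * (ennreal C1 * Lp_norm p f)" by (meson mult_left_mono order_trans zero_le)
    then show "Lp_norm p h \<le> ennreal (E * C1) * Lp_norm p f"
      using E M by (simp add: ennreal_mult mult.assoc)
  qed
qed
qed

text \<open>Associativity: convolving \<open>\<phi> k\<close> with a block of \<open>T\<close> is
  convolving \<open>T\<close> with the Schwartz function obtained from \<open>\<phi> k\<close> and
  \<open>\<phi> j\<close>. Orthogonality of distant blocks and the reproducing formula for
  \<open>T\<close> thereby reduce to identities between kernels.\<close>

lemma dyadic_block_eq:
  assumes T: "T \<in> tempered_distributions"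
  shows "(\<integral>z. \<phi> k (x - z) * convolution (\<phi> j) T z \<partial>lborel) = T (\<lambda>y. \<integral>z. \<phi> k z * \<phi> j (x - y - z) \<partial>lborel)"
    and "(\<lambda>y. \<integral>z. \<phi> k z * \<phi> j (x - y - z) \<partial>lborel) \<in> schwartz"
proof -
  have \<phi>: "\<phi> i \<in> schwartz" for i by (rule dyadic_schwartz(1)[OF D])
  have wS: "(\<lambda>z. \<phi> k (x - z)) \<in> schwartz" by (rule schwartz_reflect(1)[OF \<phi>])
  note wm[measurable] = schwartz_borel_measurable[OF wS]
  have [measurable]: "\<phi> i \<in> borel_measurable borel" for i by (rule schwartz_borel_measurable[OF \<phi>])
  have eq: "(\<lambda>y. \<integral>z. \<phi> k z * \<phi> j (x - y - z) \<partial>lborel) = (\<lambda>y. \<integral>z. \<phi> k (x - z) * \<phi> j (z - y) \<partial>lborel)"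
  proof
    fix y
    have "(\<integral>z. \<phi> k z * \<phi> j (x - y - z) \<partial>lborel) = (\<bar>- 1\<bar> ^ DIM(real^'n)) *\<^sub>R
      (\<integral>z. \<phi> k (x + (- 1) *\<^sub>R z) * \<phi> j (x - y - (x + (- 1) *\<^sub>R z)) \<partial>lborel)"
      by (rule lborel_integral_affine) (simp, measurable)
    then show "(\<integral>z. \<phi> k z * \<phi> j (x - y - z) \<partial>lborel) = (\<integral>z. \<phi> k (x - z) * \<phi> j (z - y) \<partial>lborel)" by simp
  qed
  show "(\<integral>z. \<phi> k (x - z) * convolution (\<phi> j) T z \<partial>lborel) = T (\<lambda>y. \<integral>z. \<phi> k z * \<phi> j (x - y - z) \<partial>lborel)"
    unfolding eq by (rule tempered_integral[OF T \<phi> wm, symmetric]) (rule schwartz_weighted_integrable[OF wS])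
  show "(\<lambda>y. \<integral>z. \<phi> k z * \<phi> j (x - y - z) \<partial>lborel) \<in> schwartz"
    unfolding eq by (rule schwartz_superposition[OF \<phi>]) (auto intro: schwartz_weighted_integrable[OF wS])
qed

lemma dyadic_block_disjoint:
  assumes T: "T \<in> tempered_distributions" and "j + 2 \<le> k \<or> k + 2 \<le> j"
  shows "(\<integral>z. \<phi> k (x - z) * convolution (\<phi> j) T z \<partial>lborel) = 0"
  unfolding dyadic_block_eq[OF T] dyadic_convolve_disjoint[OF D assms(2)] by (rule tempered_zero[OF T])

lemma dyadic_block_neighbours:
  assumes T: "T \<in> tempered_distributions"
  shows "(\<Sum>j\<in>{k - 1..Suc k}. \<integral>z. \<phi> k (x - z) * convolution (\<phi> j) T z \<partial>lborel) = convolution (\<phi> k) T x"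
proof -
  have "(\<Sum>j\<in>{k - 1..Suc k}. \<integral>z. \<phi> k (x - z) * convolution (\<phi> j) T z \<partial>lborel)
    = (\<Sum>j\<in>{k - 1..Suc k}. 1 * T (\<lambda>y. \<integral>z. \<phi> k z * \<phi> j (x - y - z) \<partial>lborel))"
    by (simp only: dyadic_block_eq(1)[OF T] mult_1)
  also have "\<dots> = T (\<lambda>y. \<Sum>j\<in>{k - 1..Suc k}. 1 * (\<integral>z. \<phi> k z * \<phi> j (x - y - z) \<partial>lborel))"
    by (rule tempered_sum[OF T dyadic_block_eq(2)[OF T], symmetric])
  also have "\<dots> = T (\<lambda>y. \<phi> k (x - y))"
    by (simp only: mult_1 dyadic_convolve_neighbours[OF D])
  finally show ?thesis unfolding convolution_def .
qed

lemma besov_coeff_add: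
  assumes s: "s \<in> C_log_loc" and S: "S \<in> tempered_distributions" and T: "T \<in> tempered_distributions"
  shows "besov_coeff s (S + T) j \<le> besov_coeff s S j + besov_coeff s T j"
proof -
  have m: "(\<lambda>x. of_real (2 powr (real j * s x)) * convolution (\<phi> j) U x) \<in> borel_measurable lebesgue"
    if "U \<in> tempered_distributions" for U
    by (intro continuous_lebesgue_measurable continuous_on_mult continuous_weight s
        convolution_continuous that dyadic_schwartz(1)[OF D])
  have "besov_coeff s (S + T) j = Lp_norm p (\<lambda>x. of_real (2 powr (real j * s x)) * convolution (\<phi> j) S x
      + of_real (2 powr (real j * s x)) * convolution (\<phi> j) T x)"
    unfolding besov_coeff_def convolution_def by (simp add: distrib_left)
  also have "\<dots> \<le> besov_coeff s S j + besov_coeff s T j"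
    unfolding besov_coeff_def by (intro Lp_norm_triangle exponent_ge_1 exponent_measurable m S T)
  finally show ?thesis .
qed

text \<open>Splitting \<open>T\<close> along a set \<open>S\<close> of frequencies. The part belonging to the finite one of \<open>S\<close>
  and \<open>- S\<close> is given by a function, hence a distribution without further ado; the other part is the rest.\<close>

lemma dyadic_splitting:
  assumes s: "s0 \<in> C_log_loc" "s1 \<in> C_log_loc"
  obtains C where "0 < C" and "\<And>T S. \<lbrakk>T \<in> tempered_distributions; finite S \<or> finite (- S)\<rbrakk> \<Longrightarrow>
    \<exists>T0\<in>tempered_distributions. \<exists>T1\<in>tempered_distributions. T = T0 + T1 \<and>
      (\<forall>k. besov_coeff s0 T0 k \<le> ennreal C * (\<Sum>j\<in>{k - 1..Suc k} \<inter> S. besov_coeff s0 T j)) \<and>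
      (\<forall>k. besov_coeff s1 T1 k \<le> ennreal C * (\<Sum>j\<in>{k - 1..Suc k} - S. besov_coeff s1 T j))"
proof -
  obtain C0 where C0: "0 < C0" "\<And>j k g. \<lbrakk>j \<le> Suc k; k \<le> Suc j; continuous_on UNIV g\<rbrakk> \<Longrightarrow>
    Lp_norm p (\<lambda>x. of_real (2 powr (real k * s0 x)) * (\<integral>z. \<phi> k (x - z) * g z \<partial>lborel))
      \<le> ennreal C0 * Lp_norm p (\<lambda>x. of_real (2 powr (real j * s0 x)) * g x)"
    using kernel_weighted_bound[OF s(1)] by blast
  obtain C1 where C1: "0 < C1" "\<And>j k g. \<lbrakk>j \<le> Suc k; k \<le> Suc j; continuous_on UNIV g\<rbrakk> \<Longrightarrow>
    Lp_norm p (\<lambda>x. of_real (2 powr (real k * s1 x)) * (\<integral>z. \<phi> k (x - z) * g z \<partial>lborel))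
      \<le> ennreal C1 * Lp_norm p (\<lambda>x. of_real (2 powr (real j * s1 x)) * g x)"
    using kernel_weighted_bound[OF s(2)] by blast
  define h where "h = (\<lambda>T k j x. \<integral>z. \<phi> k (x - z) * convolution (\<phi> j) T z \<partial>lborel)"
  have \<phi>: "\<phi> i \<in> schwartz" for i by (rule dyadic_schwartz(1)[OF D])
  \<comment> \<open>One estimate serves both parts of the splitting: any \<open>U\<close> whose
    \<open>k\<close>-th block is a partial sum of the at most three terms \<open>h T k j\<close>
    inherits their bounds. Continuity of these terms provides the measurability for the triangle
    inequality.\<close>
  have hb: "besov_coeff si U k \<le> ennreal Ci * (\<Sum>j\<in>{k - 1..Suc k} \<inter> S. besov_coeff si T j)"
    if T: "T \<in> tempered_distributions" and U: "\<And>x. convolution (\<phi> k) U x = (\<Sum>j\<in>{k - 1..Suc k} \<inter> S. h T k j x)"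
      and si: "si \<in> C_log_loc"
      and Ci: "\<And>j k g. \<lbrakk>j \<le> Suc k; k \<le> Suc j; continuous_on UNIV g\<rbrakk> \<Longrightarrow>
        Lp_norm p (\<lambda>x. of_real (2 powr (real k * si x)) * (\<integral>z. \<phi> k (x - z) * g z \<partial>lborel))
        \<le> ennreal Ci * Lp_norm p (\<lambda>x. of_real (2 powr (real j * si x)) * g x)"
    for T U k S si Ci
  proof -
    have hc: "continuous_on UNIV (h T k j)" for j
    proof -
      have "h T k j = (\<lambda>x. T (\<lambda>y. \<integral>z. \<phi> k z * \<phi> j (x - y - z) \<partial>lborel))"
        unfolding h_def by (rule ext) (rule dyadic_block_eq(1)[OF T])
      also have "\<dots> = convolution (\<lambda>y. \<integral>z. \<phi> k z * \<phi> j (y - z) \<partial>lborel) T" unfolding convolution_def ..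
      finally have eq: "h T k j = convolution (\<lambda>y. \<integral>z. \<phi> k z * \<phi> j (y - z) \<partial>lborel) T" .
      have "(\<lambda>y. \<integral>z. \<phi> k z * \<phi> j (y - z) \<partial>lborel) \<in> schwartz"
        using schwartz_reflect(1)[OF dyadic_block_eq(2)[OF T, of k j 0], of 0] by simp
      then show ?thesis unfolding eq by (rule convolution_continuous[OF T])
    qed
    have "besov_coeff si U k = Lp_norm p (\<lambda>x. \<Sum>j\<in>{k - 1..Suc k} \<inter> S. of_real (2 powr (real k * si x)) * h T k j x)"
      unfolding besov_coeff_def U by (simp add: sum_distrib_left)
    also have "\<dots> \<le> (\<Sum>j\<in>{k - 1..Suc k} \<inter> S. Lp_norm p (\<lambda>x. of_real (2 powr (real k * si x)) * h T k j x))"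
      by (intro Lp_norm_sum_le exponent_ge_1 exponent_measurable continuous_lebesgue_measurable
          continuous_on_mult continuous_weight si hc)
    also have "\<dots> \<le> (\<Sum>j\<in>{k - 1..Suc k} \<inter> S. ennreal Ci * besov_coeff si T j)"
      unfolding h_def besov_coeff_def by (intro sum_mono Ci convolution_continuous T \<phi>) auto
    finally show ?thesis by (simp add: sum_distrib_left)
  qed
  \<comment> \<open>For finite \<open>S\<close> the sum \<open>G\<close> of the blocks in
    \<open>S\<close> is a function of polynomial growth and defines \<open>U\<close>. In the
    \<open>k\<close>-th block of \<open>U\<close> only neighbours of \<open>k\<close> survive, and
    subtracting them from the reproducing formula of \<open>T\<close> leaves exactly the neighbours
    outside \<open>S\<close>.\<close>
  have split: "\<exists>U\<in>tempered_distributions. (\<forall>k x. convolution (\<phi> k) U x = (\<Sum>j\<in>{k - 1..Suc k} \<inter> S. h T k j x)) \<and>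
      (\<forall>k x. convolution (\<phi> k) (T - U) x = (\<Sum>j\<in>{k - 1..Suc k} \<inter> - S. h T k j x))"
    if T: "T \<in> tempered_distributions" and S: "finite S" for T S
  proof -
    define G where "G = (\<lambda>z. \<Sum>j\<in>S. convolution (\<phi> j) T z)"
    have "\<forall>j. \<exists>l C. 0 < C \<and> (\<forall>z. norm (convolution (\<phi> j) T z) \<le> C * (1 + norm z) ^ l)"
      using convolution_growth[OF T \<phi>] by metis
    then obtain l C where lC: "\<And>j. 0 < C j" "\<And>j z. norm (convolution (\<phi> j) T z) \<le> C j * (1 + norm z) ^ l j" by metis
    define L where "L = (\<Sum>j\<in>S. l j)"
    have cm: "convolution (\<phi> j) T \<in> borel_measurable borel" for j
      by (intro borel_measurable_continuous_onI convolution_continuous T \<phi>)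
    have Gm: "G \<in> borel_measurable borel" unfolding G_def by (intro borel_measurable_sum cm)
    have "norm (G z) \<le> (\<Sum>j\<in>S. C j) * (1 + norm z) ^ L" for z
    proof -
      have "norm (G z) \<le> (\<Sum>j\<in>S. C j * (1 + norm z) ^ L)"
        unfolding G_def
      proof (intro order_trans[OF norm_sum] sum_mono)
        fix j assume j: "j \<in> S"
        have "l j \<le> L" unfolding L_def using S j by (intro member_le_sum) auto
        then have "C j * (1 + norm z) ^ l j \<le> C j * (1 + norm z) ^ L"
          using lC(1)[of j] by (intro mult_left_mono power_increasing) auto
        then show "norm (convolution (\<phi> j) T z) \<le> C j * (1 + norm z) ^ L" using lC(2) order_trans by blast
      qed
      then show ?thesis by (simp add: sum_distrib_right)
    qed
    then have U: "regular_distribution G \<in> tempered_distributions" by (rule regular_distribution_tempered[OF Gm])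
    let ?U = "regular_distribution G"
    have cU: "convolution (\<phi> k) ?U x = (\<Sum>j\<in>{k - 1..Suc k} \<inter> S. h T k j x)" for k x
    proof -
      have w: "(\<lambda>y. \<phi> k (x - y)) \<in> schwartz" by (rule schwartz_reflect(1)[OF \<phi>])
      have "convolution (\<phi> k) ?U x = (\<integral>z. (\<Sum>j\<in>S. \<phi> k (x - z) * convolution (\<phi> j) T z) \<partial>lborel)"
        unfolding convolution_def[of "\<phi> k"] regular_distribution_def G_def using w by (simp add: sum_distrib_left)
      also have "\<dots> = (\<Sum>j\<in>S. h T k j x)"
        unfolding h_def by (intro Bochner_Integration.integral_sum schwartz_mult_growth_integrable[OF w cm lC(2)])
      also have "\<dots> = (\<Sum>j\<in>{k - 1..Suc k} \<inter> S. h T k j x)"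
      proof (rule sum.mono_neutral_right[OF S])
        show "\<forall>j\<in>S - {k - 1..Suc k} \<inter> S. h T k j x = 0"
          unfolding h_def by (intro ballI dyadic_block_disjoint[OF T]) auto
      qed auto
      finally show ?thesis .
    qed
    have "convolution (\<phi> k) (T - ?U) x = (\<Sum>j\<in>{k - 1..Suc k} \<inter> - S. h T k j x)" for k x
    proof -
      have "convolution (\<phi> k) (T - ?U) x = convolution (\<phi> k) T x - convolution (\<phi> k) ?U x" by (simp add: convolution_def)
      also have "convolution (\<phi> k) T x = (\<Sum>j\<in>{k - 1..Suc k}. h T k j x)"
        unfolding h_def by (rule dyadic_block_neighbours[OF T, symmetric])
      also have "\<dots> = (\<Sum>j\<in>{k - 1..Suc k} \<inter> S. h T k j x) + (\<Sum>j\<in>{k - 1..Suc k} \<inter> - S. h T k j x)"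
        by (subst sum.union_disjoint[symmetric]) (auto intro!: sum.cong simp del: sum.cl_ivl_Suc)
      finally show ?thesis unfolding cU by (simp only: add_diff_cancel_left')
    qed
    then show ?thesis using U cU by blast
  qed
  define C where "C = max C0 C1"
  have CC: "0 < C" unfolding C_def using C0 by simp
  have up: "ennreal C0 * X \<le> ennreal C * X" "ennreal C1 * X \<le> ennreal C * X" for X
    unfolding C_def by (intro mult_right_mono ennreal_leI; simp)+
  have diff: "A - S = A \<inter> - S" for A S :: "nat set" by auto
  show ?thesis
  proof (rule that[OF CC])
    fix T :: "(real^'n \<Rightarrow> complex) \<Rightarrow> complex" and S :: "nat set"
    assume T: "T \<in> tempered_distributions" and fin: "finite S \<or> finite (- S)"
    obtain T0 T1 where T01: "T0 \<in> tempered_distributions" "T1 \<in> tempered_distributions" "T = T0 + T1"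
      "\<And>k x. convolution (\<phi> k) T0 x = (\<Sum>j\<in>{k - 1..Suc k} \<inter> S. h T k j x)"
      "\<And>k x. convolution (\<phi> k) T1 x = (\<Sum>j\<in>{k - 1..Suc k} \<inter> - S. h T k j x)"
      using fin
    proof
      assume "finite S"
      then obtain U where "U \<in> tempered_distributions" "\<forall>k x. convolution (\<phi> k) U x = (\<Sum>j\<in>{k - 1..Suc k} \<inter> S. h T k j x)"
        "\<forall>k x. convolution (\<phi> k) (T - U) x = (\<Sum>j\<in>{k - 1..Suc k} \<inter> - S. h T k j x)" using split[OF T] by blast
      then show thesis by (intro that[of U "T - U"] tempered_distributions_diff T) auto
    next
      assume "finite (- S)"
      then obtain U where "U \<in> tempered_distributions" "\<forall>k x. convolution (\<phi> k) U x = (\<Sum>j\<in>{k - 1..Suc k} \<inter> - S. h T k j x)"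
        "\<forall>k x. convolution (\<phi> k) (T - U) x = (\<Sum>j\<in>{k - 1..Suc k} \<inter> - (- S). h T k j x)" using split[OF T] by blast
      then show thesis by (intro that[of "T - U" U] tempered_distributions_diff T) auto
    qed
    show "\<exists>T0\<in>tempered_distributions. \<exists>T1\<in>tempered_distributions. T = T0 + T1 \<and>
      (\<forall>k. besov_coeff s0 T0 k \<le> ennreal C * (\<Sum>j\<in>{k - 1..Suc k} \<inter> S. besov_coeff s0 T j)) \<and>
      (\<forall>k. besov_coeff s1 T1 k \<le> ennreal C * (\<Sum>j\<in>{k - 1..Suc k} - S. besov_coeff s1 T j))"
    proof (rule bexI[OF bexI[OF _ T01(2)] T01(1)], intro conjI allI T01(3))
      fix k
      show "besov_coeff s0 T0 k \<le> ennreal C * (\<Sum>j\<in>{k - 1..Suc k} \<inter> S. besov_coeff s0 T j)"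
        by (rule order_trans[OF hb[OF T T01(4) s(1) C0(2)] up(1)])
      show "besov_coeff s1 T1 k \<le> ennreal C * (\<Sum>j\<in>{k - 1..Suc k} - S. besov_coeff s1 T j)"
        unfolding diff by (rule order_trans[OF hb[OF T T01(5) s(2) C1(2)] up(2)])
    qed
  qed
qed

end

section \<open>Bounds of the K-functional and interpolation\<close>

lemma K_functional_mono: "t \<le> s \<Longrightarrow> K_functional A0 A1 t f \<le> K_functional A0 A1 s f"
  unfolding K_functional_def
  by (intro INF_mono') (auto split: prod.split intro!: add_left_mono mult_right_mono ennreal_leI)

lemma K_functional_lower:
  "f0 \<in> fst A0 \<Longrightarrow> f1 \<in> fst A1 \<Longrightarrow> K_functional A0 A1 t (f0 + f1) \<le> snd A0 f0 + ennreal t * snd A1 f1"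
  unfolding K_functional_def by (rule INF_lower2[of "(f0, f1)"]) auto

lemma K_functional_finite:
  assumes "f \<in> sum_carrier A0 A1"
    and "\<And>f. f \<in> fst A0 \<Longrightarrow> snd A0 f < top" and "\<And>f. f \<in> fst A1 \<Longrightarrow> snd A1 f < top"
  shows "K_functional A0 A1 t f < top"
proof -
  obtain f0 f1 where f: "f = f0 + f1" "f0 \<in> fst A0" "f1 \<in> fst A1" using assms(1) unfolding sum_carrier_def by auto
  have "snd A0 f0 + ennreal t * snd A1 f1 < top" using assms f by (simp add: ennreal_mult_less_top)
  then show ?thesis using K_functional_lower[OF f(2,3), of t] unfolding f(1) by (rule le_less_trans[rotated])
qed

text \<open>With \<open>a\<close> the logarithm of \<open>2 powr (i * d)\<close>, the quotient of
  the two power terms is \<open>exp (- \<theta> * (ln t - a))\<close> if \<open>a \<le> ln t\<close>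
  and \<open>exp (- (1 - \<theta>) * (a - ln t))\<close> otherwise. The smaller of the two rates is
  \<open>2 * e\<close>; its positivity is the strictness of both bounds on
  \<open>\<theta>\<close>.\<close>

lemma min_weight_bound:
  fixes t d \<theta> :: real and i :: nat
  assumes t: "0 < t" and \<theta>: "0 < \<theta>" "\<theta> < 1"
  defines "e \<equiv> min \<theta> (1 - \<theta>) / 2"
  shows "min (2 powr (real i * d)) t
    \<le> t powr \<theta> * (exp (- (2 * e) * \<bar>ln t - real i * (d * ln 2)\<bar>) * 2 powr (real i * (1 - \<theta>) * d))"
proof -
  define a where "a = real i * (d * ln 2)"
  have p: "2 powr (real i * d) = exp a" "2 powr (real i * (1 - \<theta>) * d) = exp ((1 - \<theta>) * a)"
    unfolding a_def by (auto simp: powr_def algebra_simps)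
  have tt: "t = exp (ln t)" "t powr \<theta> = exp (\<theta> * ln t)" using t by (auto simp: powr_def)
  have e: "2 * e \<le> \<theta>" "2 * e \<le> 1 - \<theta>" unfolding e_def by auto
  show ?thesis
  proof (cases "a \<le> ln t")
    case True
    have "2 * e * (ln t - a) \<le> \<theta> * (ln t - a)" using e True by (intro mult_right_mono) auto
    then have "a \<le> \<theta> * ln t + (- (2 * e) * \<bar>ln t - a\<bar> + (1 - \<theta>) * a)" using True by (simp add: algebra_simps)
    then have "exp a \<le> exp (\<theta> * ln t + (- (2 * e) * \<bar>ln t - a\<bar> + (1 - \<theta>) * a))" by (simp only: exp_le_cancel_iff)
    then have "exp a \<le> t powr \<theta> * (exp (- (2 * e) * \<bar>ln t - a\<bar>) * exp ((1 - \<theta>) * a))"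
      unfolding tt(2) by (simp only: exp_add)
    then show ?thesis unfolding p a_def[symmetric] by linarith
  next
    case False
    have "2 * e * (a - ln t) \<le> (1 - \<theta>) * (a - ln t)" using e False by (intro mult_right_mono) auto
    then have "ln t \<le> \<theta> * ln t + (- (2 * e) * \<bar>ln t - a\<bar> + (1 - \<theta>) * a)" using False by (simp add: algebra_simps)
    then have "exp (ln t) \<le> exp (\<theta> * ln t + (- (2 * e) * \<bar>ln t - a\<bar> + (1 - \<theta>) * a))" by (simp only: exp_le_cancel_iff)
    then have "t \<le> t powr \<theta> * (exp (- (2 * e) * \<bar>ln t - a\<bar>) * exp ((1 - \<theta>) * a))"
      unfolding tt(2) tt(1)[symmetric] by (simp only: exp_add)
    then show ?thesis unfolding p a_def[symmetric] by linarith
  qed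
qed

text \<open>Reduction of an interpolation identity to bounds of the K-functional by
  \<open>\<Sum>i. min (2 powr (i * d)) t * B f i\<close> from above and by a single term from below.\<close>

lemma interpolation_space_eqI:
  fixes A0 A1 E :: "'a::ab_group_add qn_space" and B :: "'a \<Rightarrow> nat \<Rightarrow> ennreal"
    and q :: "real \<Rightarrow> real" and \<theta> d C1 C2 C3 :: real
  assumes \<theta>: "0 < \<theta>" "\<theta> < 1"
    and q: "q \<in> exponents" "log_hoelder_at_origin q" "log_hoelder_at_infinity q (q 0)"
    and d: "d \<noteq> 0" and C: "0 < C1" "0 < C2" "0 < C3"
    and E: "fst E = {f \<in> X. snd E f < top}" and sub: "sum_carrier A0 A1 \<subseteq> X"
    and fin: "\<And>f. f \<in> fst A0 \<Longrightarrow> snd A0 f < top" "\<And>f. f \<in> fst A1 \<Longrightarrow> snd A1 f < top"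
    and low: "\<And>f i. f \<in> sum_carrier A0 A1 \<Longrightarrow>
      ennreal (2 powr (real i * d)) * B f i \<le> ennreal C1 * K_functional A0 A1 (2 powr (real i * d)) f"
    and up: "\<And>f t. \<lbrakk>f \<in> X; 0 < t; (\<Sum>i. ennreal (min (2 powr (real i * d)) t) * B f i) < top\<rbrakk> \<Longrightarrow>
      f \<in> sum_carrier A0 A1 \<and> K_functional A0 A1 t f \<le> ennreal C2 * (\<Sum>i. ennreal (min (2 powr (real i * d)) t) * B f i)"
    and n1: "\<And>f m. \<lbrakk>f \<in> X; 0 < m; \<And>i. B f i < top;
      (\<Sum>i. ennreal ((2 powr (real i * (1 - \<theta>) * d) * enn2real (B f i) / m) powr q 0)) \<le> 1\<rbrakk> \<Longrightarrow> snd E f \<le> ennreal (C3 * m)"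
    and n2: "\<And>f m. \<lbrakk>f \<in> X; snd E f < ennreal m\<rbrakk> \<Longrightarrow> (\<forall>i. B f i < top) \<and>
      (\<Sum>i. ennreal ((2 powr (real i * (1 - \<theta>) * d) * enn2real (B f i) / (C3 * m)) powr q 0)) \<le> 1"
  shows "same_space (interpolation_space A0 A1 \<theta> q) E"
proof -
  \<comment> \<open>Half of the available decay rate, since
    \<open>Lq_dt_t_norm_le_of_exp_sum\<close> spends its rate \<open>2 * e\<close> in two equal
    portions.\<close>
  define e where "e = min \<theta> (1 - \<theta>) / 2"
  have e: "0 < e" unfolding e_def using \<theta> by simp
  define \<delta> where "\<delta> = d * ln 2"
  have \<delta>: "\<delta> \<noteq> 0" unfolding \<delta>_def using d by simp
  have q1: "1 \<le> q t" for t using q(1) unfolding exponents_def by auto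
  have qm: "q \<in> borel_measurable lebesgue" using q(1) unfolding exponents_def by auto
  obtain c where c: "0 \<le> c" "\<And>t. 0 < t \<Longrightarrow> \<bar>q t - q 0\<bar> * \<bar>ln t\<bar> \<le> c"
    using log_hoelder_exponent_bound[OF q(2,3)] by blast
  obtain D1 where D1: "0 < D1"
    "\<And>x g L. \<lbrakk>0 < L; \<And>i::nat. 0 \<le> x i; (\<Sum>i. ennreal (x i powr q 0)) \<le> 1; \<And>t. 0 < t \<Longrightarrow> 0 \<le> g t;
      \<And>t. 0 < t \<Longrightarrow> ennreal (g t) \<le> ennreal L * (\<Sum>i. ennreal (exp (- (2 * e) * \<bar>ln t - real i * \<delta>\<bar>) * x i))\<rbrakk>
      \<Longrightarrow> Lq_dt_t_norm q g \<le> ennreal (D1 * L)"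
    using Lq_dt_t_norm_le_of_exp_sum[OF q1 c(2) e \<delta>] by blast
  obtain D2 where D2: "0 < D2"
    "\<And>x g l. \<lbrakk>0 < l; \<And>i::nat. 0 \<le> x i;
        \<And>i t. t \<in> {exp (real i * \<delta>)..exp (real i * \<delta> + \<bar>\<delta>\<bar> / 2)} \<Longrightarrow> x i \<le> g t;
        (\<integral>\<^sup>+t\<in>{0<..}. ennreal (\<bar>g t / l\<bar> powr q t / t) \<partial>lebesgue) \<le> 1\<rbrakk>
      \<Longrightarrow> (\<Sum>i. ennreal ((x i / (D2 * l)) powr q 0)) \<le> 1"
    using suminf_le_of_Lq_dt_t_norm[OF q1 c(2) qm \<delta>] by blast
  define N where "N = (\<lambda>f. Lq_dt_t_norm q (\<lambda>t. t powr (- \<theta>) * enn2real (K_functional A0 A1 t f)))"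
  have I: "fst (interpolation_space A0 A1 \<theta> q) = {f \<in> sum_carrier A0 A1. N f < top}"
    "snd (interpolation_space A0 A1 \<theta> q) = N"
    unfolding interpolation_space_def N_def Let_def by auto
  have Kfin: "K_functional A0 A1 t f < top" if "f \<in> sum_carrier A0 A1" for f t
    by (rule K_functional_finite[OF that fin])
  have pid: "2 powr (real i * d) = exp (real i * \<delta>)" for i :: nat unfolding \<delta>_def by (simp add: powr_def algebra_simps)
  \<comment> \<open>On an interval starting at \<open>exp (i * \<delta>)\<close> and of logarithmic
    length \<open>\<bar>\<delta>\<bar> / 2\<close> the factor \<open>t powr (- \<theta>)\<close>
    drops at most by \<open>w\<close>, while K can only grow. So one sampled value of K controls the
    integrand on the whole interval.\<close>
  define w where "w = exp (- (\<theta> * (\<bar>\<delta>\<bar> / 2)))"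
  have w: "0 < w" unfolding w_def by simp
  define G where "G = C3 * (C1 * D2 / w)"
  have G: "0 < G" unfolding G_def using C D2 w by simp
  have lower: "snd E f \<le> ennreal G * N f" if f: "f \<in> sum_carrier A0 A1" for f
  proof -
    have fX: "f \<in> X" using f sub by blast
    have Bfin: "B f i < top" for i
    proof -
      have "ennreal (2 powr (real i * d)) * B f i < top"
        using low[OF f, of i] Kfin[OF f] by (meson ennreal_less_top ennreal_mult_less_top le_less_trans)
      then show ?thesis by (auto simp: ennreal_mult_less_top)
    qed
    define b where "b = (\<lambda>i. enn2real (B f i))"
    have b: "B f i = ennreal (b i)" "0 \<le> b i" for i unfolding b_def using Bfin[of i] by auto
    define K where "K = (\<lambda>t. enn2real (K_functional A0 A1 t f))"
    have K: "K_functional A0 A1 t f = ennreal (K t)" "0 \<le> K t" for t unfolding K_def using Kfin[OF f, of t] by auto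
    have bK: "2 powr (real i * d) * b i \<le> C1 * K (2 powr (real i * d))" for i
      using low[OF f, of i] b[of i] K[of "2 powr (real i * d)"] C by (simp add: ennreal_le_iff flip: ennreal_mult)
    have Kmono: "K s \<le> K t" if "s \<le> t" for s t
      using K_functional_mono[OF that, of A0 A1 f] unfolding K(1) using K(2) by (simp add: ennreal_le_iff)
    define x where "x = (\<lambda>i. w / C1 * (2 powr (real i * (1 - \<theta>) * d) * b i))"
    have x0: "0 \<le> x i" for i unfolding x_def using w C b by simp
    have xg: "x i \<le> t powr (- \<theta>) * K t" if t: "t \<in> {exp (real i * \<delta>)..exp (real i * \<delta> + \<bar>\<delta>\<bar> / 2)}" for i t
    proof -
      have t0: "0 < t" using t by (meson atLeastAtMost_iff exp_gt_zero less_le_trans)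
      have "ln t \<le> real i * \<delta> + \<bar>\<delta>\<bar> / 2" using t t0 exp_le_cancel_iff[of "ln t" "real i * \<delta> + \<bar>\<delta>\<bar> / 2"] by simp
      then have "\<theta> * ln t \<le> \<theta> * (real i * \<delta> + \<bar>\<delta>\<bar> / 2)" using \<theta> by (intro mult_left_mono) auto
      then have "exp (- (\<theta> * (real i * \<delta> + \<bar>\<delta>\<bar> / 2))) \<le> exp (- (\<theta> * ln t))" by (simp only: exp_le_cancel_iff neg_le_iff_le)
      also have "exp (- (\<theta> * ln t)) = t powr (- \<theta>)" using t0 by (simp add: powr_def)
      also have "exp (- (\<theta> * (real i * \<delta> + \<bar>\<delta>\<bar> / 2))) = w * exp (- (\<theta> * (real i * \<delta>)))"
        unfolding w_def by (simp add: algebra_simps flip: exp_add)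
      finally have tw: "w * exp (- (\<theta> * (real i * \<delta>))) \<le> t powr (- \<theta>)" .
      have "2 powr (real i * (1 - \<theta>) * d) * b i = exp (- (\<theta> * (real i * \<delta>))) * (2 powr (real i * d) * b i)"
        unfolding \<delta>_def by (simp add: powr_def algebra_simps flip: exp_add)
      also have "\<dots> \<le> exp (- (\<theta> * (real i * \<delta>))) * (C1 * K (2 powr (real i * d)))" by (intro mult_left_mono bK) auto
      also have "\<dots> \<le> exp (- (\<theta> * (real i * \<delta>))) * (C1 * K t)"
        using t C unfolding pid by (intro mult_left_mono Kmono) auto
      finally have "x i \<le> w / C1 * (exp (- (\<theta> * (real i * \<delta>))) * (C1 * K t))"
        unfolding x_def using w C by (intro mult_left_mono) auto
      also have "\<dots> = (w * exp (- (\<theta> * (real i * \<delta>)))) * K t" using C by simp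
      also have "\<dots> \<le> t powr (- \<theta>) * K t" by (intro mult_right_mono tw K)
      finally show ?thesis .
    qed
    have Nf: "N f = Lq_dt_t_norm q (\<lambda>t. t powr (- \<theta>) * K t)" unfolding N_def K_def ..
    have "ennreal (1 / G) * snd E f \<le> N f"
      unfolding Nf Lq_dt_t_norm_def
    proof (rule INF_greatest, safe)
      fix l :: real assume l: "0 < l" and int: "(\<integral>\<^sup>+t\<in>{0<..}. ennreal (\<bar>t powr (- \<theta>) * K t / l\<bar> powr q t / t) \<partial>lebesgue) \<le> 1"
      have S: "(\<Sum>i. ennreal ((x i / (D2 * l)) powr q 0)) \<le> 1" by (rule D2(2)[OF l x0 xg int])
      have xi: "x i / (D2 * l) = 2 powr (real i * (1 - \<theta>) * d) * enn2real (B f i) / (C1 * D2 / w * l)" for i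
        unfolding x_def b_def using C(1) D2(1) w l by (simp add: mult_ac)
      have pos: "0 < C1 * D2 / w * l" using C(1) D2(1) w l by simp
      have "snd E f \<le> ennreal (C3 * (C1 * D2 / w * l))"
        by (rule n1[OF fX pos Bfin S[unfolded xi]])
      moreover have "C3 * (C1 * D2 / w * l) = G * l" unfolding G_def by simp
      ultimately have "ennreal (1 / G) * snd E f \<le> ennreal (1 / G) * ennreal (G * l)" by (intro mult_left_mono) auto
      also have "\<dots> = ennreal l" using G l by (simp flip: ennreal_mult)
      finally show "ennreal (1 / G) * snd E f \<le> ennreal l" .
    qed
    then have "ennreal G * (ennreal (1 / G) * snd E f) \<le> ennreal G * N f" by (intro mult_left_mono) auto
    moreover have "ennreal G * (ennreal (1 / G) * snd E f) = snd E f"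
      using G by (simp add: mult.assoc[symmetric] flip: ennreal_mult)
    ultimately show ?thesis by simp
  qed
  define H where "H = D1 * (C2 * C3)"
  have H: "0 < H" unfolding H_def using C D1 by simp
  \<comment> \<open>Formulated with a number \<open>m\<close> strictly above the norm, the form in
    which \<open>n2\<close> yields the normalised sum; \<open>upper'\<close> then lets
    \<open>m\<close> approach the norm, which also covers norm 0.\<close>
  have upper: "f \<in> sum_carrier A0 A1 \<and> N f \<le> ennreal (H * m)" if fX: "f \<in> X" and m: "snd E f < ennreal m" for f m
  proof -
    have m0: "0 < m" using m by (metis ennreal_neg not_less_zero not_le)
    have Bfin: "B f i < top" for i using n2[OF fX m] by blast
    define b where "b = (\<lambda>i. enn2real (B f i))"
    have b: "B f i = ennreal (b i)" "0 \<le> b i" for i unfolding b_def using Bfin[of i] by auto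
    define x where "x = (\<lambda>i. 2 powr (real i * (1 - \<theta>) * d) * b i / (C3 * m))"
    have x0: "0 \<le> x i" for i unfolding x_def using C b m0 by simp
    have sx: "(\<Sum>i. ennreal (x i powr q 0)) \<le> 1" using n2[OF fX m] unfolding x_def b_def by blast
    \<comment> \<open>Boundedness of the \<open>x i\<close> makes the exponentially weighted sums
      finite for every \<open>t\<close>. This finiteness is the premise of \<open>up\<close>, and
      with it comes membership of \<open>f\<close> in the sum of the spaces.\<close>
    have x1: "x i \<le> 1" for i
    proof (rule ccontr)
      assume "\<not> x i \<le> 1"
      then have "1 < x i powr q 0" using q1[of 0] by (simp add: less_imp_neq gr_one_powr)
      moreover have "ennreal (x i powr q 0) \<le> 1" by (rule order_trans[OF ennreal_le_suminf sx])
      ultimately show False by simp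
    qed
    let ?e = "\<lambda>t i. exp (- (2 * e) * \<bar>ln t - real i * \<delta>\<bar>)"
    have bound: "(\<Sum>i. ennreal (min (2 powr (real i * d)) t) * B f i) \<le> ennreal (t powr \<theta> * (C3 * m)) * (\<Sum>i. ennreal (?e t i * x i))"
      if t: "0 < t" for t
    proof -
      have "(\<Sum>i. ennreal (min (2 powr (real i * d)) t) * B f i) \<le> (\<Sum>i. ennreal (t powr \<theta> * (C3 * m)) * ennreal (?e t i * x i))"
      proof (intro suminf_le)
        fix i
        have "min (2 powr (real i * d)) t * b i \<le> t powr \<theta> * (?e t i * 2 powr (real i * (1 - \<theta>) * d)) * b i"
          using min_weight_bound[OF t \<theta>, of i d] b unfolding e_def \<delta>_def by (intro mult_right_mono) auto
        also have "\<dots> = t powr \<theta> * (C3 * m) * (?e t i * x i)" unfolding x_def using C m0 by simp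
        finally show "ennreal (min (2 powr (real i * d)) t) * B f i \<le> ennreal (t powr \<theta> * (C3 * m)) * ennreal (?e t i * x i)"
          using b[of i] t C m0 x0[of i] by (simp add: ennreal_leI flip: ennreal_mult)
      qed auto
      then show ?thesis by simp
    qed
    have sfin: "(\<Sum>i. ennreal (?e t i * x i)) < top" for t
    proof -
      have "(\<Sum>i. ennreal (?e t i * x i)) \<le> (\<Sum>i. ennreal (exp (- (2 * e) * \<bar>ln t - real i * \<delta>\<bar>)))"
        using x0 x1 by (intro suminf_le ennreal_leI) (auto intro!: mult_right_le_one_le)
      also have "\<dots> \<le> ennreal (2 * exp ((2 * e) * \<bar>\<delta>\<bar>) / (1 - exp (- ((2 * e) * \<bar>\<delta>\<bar>))))"
        by (rule suminf_exp_abs_le) (use e \<delta> in linarith)+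
      also have "\<dots> < top" by (rule ennreal_less_top)
      finally show ?thesis .
    qed
    have upt: "f \<in> sum_carrier A0 A1 \<and> K_functional A0 A1 t f \<le> ennreal C2 * (ennreal (t powr \<theta> * (C3 * m)) * (\<Sum>i. ennreal (?e t i * x i)))"
      if t: "0 < t" for t
    proof -
      have "(\<Sum>i. ennreal (min (2 powr (real i * d)) t) * B f i) < top"
        by (rule le_less_trans[OF bound[OF t]]) (use sfin[of t] in \<open>simp add: ennreal_mult_less_top\<close>)
      from up[OF fX t this] show ?thesis using bound[OF t] by (meson mult_left_mono order_trans zero_le)
    qed
    have "N f \<le> ennreal (D1 * (C2 * (C3 * m)))"
      unfolding N_def
    proof (rule D1(2))
      show "0 < C2 * (C3 * m)" using C m0 by simp
      show "0 \<le> x i" for i by (rule x0)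
      show "(\<Sum>i. ennreal (x i powr q 0)) \<le> 1" by (rule sx)
      fix t :: real assume t: "0 < t"
      show "0 \<le> t powr - \<theta> * enn2real (K_functional A0 A1 t f)" by simp
      have "ennreal (t powr - \<theta> * enn2real (K_functional A0 A1 t f)) = ennreal (t powr - \<theta>) * K_functional A0 A1 t f"
        using Kfin[of f t] upt[OF t] by (simp add: ennreal_mult)
      also have "\<dots> \<le> ennreal (t powr - \<theta>) * (ennreal C2 * (ennreal (t powr \<theta> * (C3 * m)) * (\<Sum>i. ennreal (?e t i * x i))))"
        using upt[OF t] by (intro mult_left_mono) auto
      also have "\<dots> = ennreal (t powr - \<theta> * (C2 * (t powr \<theta> * (C3 * m)))) * (\<Sum>i. ennreal (?e t i * x i))"
        using C m0 by (simp add: ennreal_mult mult.assoc)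
      also have "t powr - \<theta> * (C2 * (t powr \<theta> * (C3 * m))) = C2 * (C3 * m)"
        using t by (simp add: powr_minus field_simps)
      finally show "ennreal (t powr - \<theta> * enn2real (K_functional A0 A1 t f)) \<le> ennreal (C2 * (C3 * m)) * (\<Sum>i. ennreal (?e t i * x i))" .
    qed
    then show ?thesis using upt[OF zero_less_one] unfolding H_def by (simp add: mult.assoc)
  qed
  have upper': "f \<in> sum_carrier A0 A1 \<and> N f \<le> ennreal H * snd E f" if fX: "f \<in> X" and s: "snd E f < top" for f
  proof -
    obtain s where s: "snd E f = ennreal s" "0 \<le> s" using s by (cases "snd E f") auto
    have "f \<in> sum_carrier A0 A1" using upper[OF fX, of "s + 1"] s by (simp add: ennreal_less_iff)
    moreover have "N f \<le> ennreal (H * s)"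
    proof (rule ennreal_le_if_le_greater)
      fix l assume l: "H * s < l"
      then have "s < l / H" using H by (simp add: field_simps)
      then have "N f \<le> ennreal (H * (l / H))" using upper[OF fX, of "l / H"] s by (simp add: ennreal_less_iff)
      then show "N f \<le> ennreal l" using H by simp
    qed
    ultimately show ?thesis using s H by (simp add: ennreal_mult)
  qed
  have eq: "{f \<in> sum_carrier A0 A1. N f < top} = fst E"
  proof (intro equalityI subsetI)
    fix f assume "f \<in> {f \<in> sum_carrier A0 A1. N f < top}"
    then have f: "f \<in> sum_carrier A0 A1" "N f < top" by auto
    have "snd E f < top" using lower[OF f(1)] f(2) by (meson ennreal_less_top ennreal_mult_less_top le_less_trans)
    then show "f \<in> fst E" unfolding E using f sub by auto
  next
    fix f assume "f \<in> fst E"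
    then have f: "f \<in> X" "snd E f < top" unfolding E by auto
    have "N f < top" using upper'[OF f] f(2) by (meson ennreal_less_top ennreal_mult_less_top le_less_trans)
    then show "f \<in> {f \<in> sum_carrier A0 A1. N f < top}" using upper'[OF f] by auto
  qed
  show ?thesis
    unfolding same_space_def I eq
  proof (intro conjI refl exI[of _ "max G H"] ballI)
    show "0 < max G H" using G by simp
    fix f assume f: "f \<in> fst E"
    then have fX: "f \<in> X" "snd E f < top" unfolding E by auto
    have fs: "f \<in> sum_carrier A0 A1" using upper'[OF fX] by auto
    show "N f \<le> ennreal (max G H) * snd E f"
      by (rule order_trans[OF conjunct2[OF upper'[OF fX]]]) (intro mult_right_mono ennreal_leI; simp)
    show "snd E f \<le> ennreal (max G H) * N f"
      using lower[OF fs] by (rule order_trans) (intro mult_right_mono ennreal_leI; simp)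
  qed
qed

section \<open>Constant sequence exponents and rearrangements\<close>

lemma ennreal_suminf_Suc_le: "(\<Sum>k. a (Suc k)) \<le> (\<Sum>k. a k :: ennreal)"
proof (rule suminf_le_const)
  fix n
  have "(\<Sum>k<n. a (Suc k)) \<le> (\<Sum>k<Suc n. a k)" by (subst sum.lessThan_Suc_shift) simp
  also have "\<dots> \<le> (\<Sum>k. a k)" by (rule sum_le_suminf) auto
  finally show "(\<Sum>k<n. a (Suc k)) \<le> (\<Sum>k. a k)" .
qed simp

lemma ennreal_suminf_pred_le: "(\<Sum>k. case k of 0 \<Rightarrow> 0 | Suc i \<Rightarrow> a i) \<le> (\<Sum>k. a k :: ennreal)"
proof (rule suminf_le_const)
  fix n
  have "(\<Sum>k<n. case k of 0 \<Rightarrow> 0 | Suc i \<Rightarrow> a i) \<le> (\<Sum>k<Suc n. case k of 0 \<Rightarrow> 0 | Suc i \<Rightarrow> a i)" by simp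
  also have "\<dots> = (\<Sum>k<n. a k)" by (subst sum.lessThan_Suc_shift) simp
  also have "\<dots> \<le> (\<Sum>k. a k)" by (rule sum_le_suminf) auto
  finally show "(\<Sum>k<n. case k of 0 \<Rightarrow> 0 | Suc i \<Rightarrow> a i) \<le> (\<Sum>k. a k)" .
qed simp

text \<open>Every index belongs to the neighbourhoods of at most three others, itself
  included.\<close>

lemma suminf_neighbours_le:
  fixes a :: "nat \<Rightarrow> ennreal"
  shows "(\<Sum>k. \<Sum>j\<in>{k - 1..Suc k}. a j) \<le> 3 * (\<Sum>k. a k)"
proof -
  have "(\<Sum>k. \<Sum>j\<in>{k - 1..Suc k}. a j) = (\<Sum>k. a k + a (Suc k) + (case k of 0 \<Rightarrow> 0 | Suc i \<Rightarrow> a i))"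
  proof (rule arg_cong[where f = suminf], rule ext)
    fix k
    show "(\<Sum>j\<in>{k - 1..Suc k}. a j) = a k + a (Suc k) + (case k of 0 \<Rightarrow> 0 | Suc i \<Rightarrow> a i)"
      by (cases k) (auto simp: add_ac)
  qed
  also have "\<dots> = (\<Sum>k. a k) + (\<Sum>k. a (Suc k)) + (\<Sum>k. case k of 0 \<Rightarrow> 0 | Suc i \<Rightarrow> a i)"
    by (simp add: suminf_add[symmetric])
  also have "\<dots> \<le> (\<Sum>k. a k) + (\<Sum>k. a k) + (\<Sum>k. a k)"
    by (intro add_mono order_refl ennreal_suminf_Suc_le ennreal_suminf_pred_le)
  also have "\<dots> = 3 * (\<Sum>k. a k)"
  proof -
    have "(3::ennreal) = 1 + 1 + 1" by simp
    then show ?thesis by (simp only: distrib_right mult_1)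
  qed
  finally show ?thesis .
qed

lemma powr_le_1_cancel:
  fixes x q :: real
  assumes "x powr q \<le> 1" "0 \<le> x" "1 \<le> q"
  shows "x \<le> 1"
proof (rule ccontr)
  assume "\<not> x \<le> 1"
  then have "1 < x powr q" using assms by (simp add: gr_one_powr)
  then show False using assms by simp
qed

lemma mixed_norm_const_ge:
  assumes p: "\<And>x. 0 \<le> p x" and r: "1 \<le> r"
  shows "Lp_norm p (f j) \<le> mixed_norm_const p r f"
proof (cases "r = top")
  case True then show ?thesis by (auto simp: mixed_norm_const_def intro: SUP_upper)
next
  case False
  have "1 \<le> enn2real r" using r False enn2real_mono[of 1 r] by (simp add: less_top)
  then show ?thesis using False p by (simp add: mixed_norm_const_def Lp_norm_le_mixed_norm)
qed

lemma mixed_norm_const_le: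
  assumes p: "\<And>x. 0 \<le> p x" and r: "1 \<le> r"
  shows "mixed_norm_const p r f \<le> (\<Sum>j. Lp_norm p (f j))"
proof (cases "r = top")
  case True then show ?thesis by (auto simp: mixed_norm_const_def intro!: SUP_least ennreal_le_suminf)
next
  case False
  have "1 \<le> enn2real r" using r False enn2real_mono[of 1 r] by (simp add: less_top)
  then show ?thesis using False p by (simp add: mixed_norm_const_def mixed_norm_le_suminf)
qed

lemma powr_sum3_le:
  fixes x :: "nat \<Rightarrow> real"
  assumes r: "1 \<le> r" and x: "\<And>j. 0 \<le> x j" and A: "finite A" "card A \<le> 3"
  shows "(\<Sum>j\<in>A. x j) powr r \<le> 3 powr r * (\<Sum>j\<in>A. x j powr r)"
proof (cases "A = {}")
  case False
  define m where "m = Max (x ` A)"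
  have m: "m \<in> x ` A" unfolding m_def using A False by (intro Max_in) auto
  have xm: "x j \<le> m" if "j \<in> A" for j unfolding m_def using A that by (intro Max_ge) auto
  obtain i where i: "i \<in> A" "m = x i" using m by auto
  have m0: "0 \<le> m" using i x by simp
  have "(\<Sum>j\<in>A. x j) \<le> real (card A) * m" using xm by (intro sum_bounded_above) auto
  also have "\<dots> \<le> 3 * m" using A m0 by (intro mult_right_mono) auto
  finally have "(\<Sum>j\<in>A. x j) powr r \<le> (3 * m) powr r" using r x by (intro powr_mono2) (auto intro: sum_nonneg)
  also have "\<dots> = 3 powr r * x i powr r" using i by (simp add: powr_mult)
  also have "\<dots> \<le> 3 powr r * (\<Sum>j\<in>A. x j powr r)"
    using i A by (intro mult_left_mono member_le_sum) auto
  finally show ?thesis .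
qed simp

text \<open>The value at \<open>2 ^ i\<close> of the decreasing rearrangement of \<open>b\<close>.\<close>

definition dyadic_rearrangement :: "(nat \<Rightarrow> ennreal) \<Rightarrow> nat \<Rightarrow> ennreal" where
  "dyadic_rearrangement b i = (INF c\<in>{c::real. 0 \<le> c \<and> finite {j. ennreal c < b j} \<and> card {j. ennreal c < b j} < 2 ^ i}. ennreal c)"

text \<open>A level below the infimum is not admissible, so its superlevel set is infinite or has at
  least \<open>2 ^ i\<close> elements; in both cases a subset of exactly that size exists.\<close>

lemma less_dyadic_rearrangement:
  assumes s: "0 \<le> s" "ennreal s < dyadic_rearrangement b i"
  obtains F where "finite F" "card F = 2 ^ i" "\<And>j. j \<in> F \<Longrightarrow> ennreal s < b j"
proof -
  have n: "\<not> (finite {j. ennreal s < b j} \<and> card {j. ennreal s < b j} < 2 ^ i)"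
  proof
    assume "finite {j. ennreal s < b j} \<and> card {j. ennreal s < b j} < 2 ^ i"
    then have "dyadic_rearrangement b i \<le> ennreal s" unfolding dyadic_rearrangement_def using s by (intro INF_lower) auto
    then show False using s by simp
  qed
  have "\<exists>F. finite F \<and> card F = 2 ^ i \<and> F \<subseteq> {j. ennreal s < b j}"
  proof (cases "finite {j. ennreal s < b j}")
    case True
    then have "2 ^ i \<le> card {j. ennreal s < b j}" using n by auto
    then show ?thesis using True obtain_subset_with_card_n by (metis finite_subset)
  next
    case False then show ?thesis using infinite_arbitrarily_large by blast
  qed
  then show ?thesis using that by auto
qed

text \<open>The infimum is admissible too: among \<open>2 ^ i\<close> values above it the least is
  still above it, and an admissible level in between would have to be exceeded by all of
  them.\<close>

lemma dyadic_rearrangement_level: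
  shows "finite {j. dyadic_rearrangement b i < b j}" and "card {j. dyadic_rearrangement b i < b j} < 2 ^ i"
proof -
  have no: False if F: "finite F" "card F = 2 ^ i" "F \<subseteq> {j. dyadic_rearrangement b i < b j}" for F
  proof -
    have ne: "F \<noteq> {}" using F(2) by auto
    define m where "m = Min (b ` F)"
    have "m \<in> b ` F" unfolding m_def using F ne by (intro Min_in) auto
    then have "dyadic_rearrangement b i < m" using F(3) by auto
    then obtain c where c: "0 \<le> c" "finite {j. ennreal c < b j}" "card {j. ennreal c < b j} < 2 ^ i" "ennreal c < m"
      unfolding dyadic_rearrangement_def by (auto simp: INF_less_iff)
    have "F \<subseteq> {j. ennreal c < b j}"
    proof
      fix j assume "j \<in> F"
      then have "m \<le> b j" unfolding m_def using F by (intro Min_le) auto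
      then show "j \<in> {j. ennreal c < b j}" using c(4) by simp
    qed
    then have "card F \<le> card {j. ennreal c < b j}" using c(2) by (rule card_mono[rotated])
    then show False using F(2) c(3) by simp
  qed
  show f: "finite {j. dyadic_rearrangement b i < b j}"
    using no infinite_arbitrarily_large by blast
  show "card {j. dyadic_rearrangement b i < b j} < 2 ^ i"
  proof (rule ccontr)
    assume "\<not> ?thesis"
    then have "2 ^ i \<le> card {j. dyadic_rearrangement b i < b j}" by simp
    then show False using no f obtain_subset_with_card_n by (metis finite_subset)
  qed
qed

lemma dyadic_rearrangement_le:
  assumes "0 \<le> m" "\<And>j. b j \<le> ennreal m"
  shows "dyadic_rearrangement b i \<le> ennreal m"
proof -
  have e: "{j. ennreal m < b j} = {}" using assms(2) by (auto simp: not_less)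
  show ?thesis unfolding dyadic_rearrangement_def using assms(1) by (intro INF_lower) (auto simp: e)
qed

text \<open>Take the least \<open>n\<close> at which the rearrangement falls below
  \<open>b j\<close>. It is not 0, because fewer than \<open>2 ^ 0 = 1\<close> values exceed the
  rearrangement at 0; so \<open>n\<close> has a predecessor, which is the block of
  \<open>j\<close>.\<close>

lemma dyadic_rearrangement_block:
  assumes j: "b j \<noteq> 0" and lim: "\<And>e. 0 < e \<Longrightarrow> \<exists>i. dyadic_rearrangement b i < e"
  shows "\<exists>i. dyadic_rearrangement b (Suc i) < b j \<and> b j \<le> dyadic_rearrangement b i"
proof -
  have "\<exists>i. dyadic_rearrangement b i < b j" using lim[of "b j"] j by (simp add: zero_less_iff_neq_zero)
  then obtain n where n: "dyadic_rearrangement b n < b j" "\<And>i. i < n \<Longrightarrow> \<not> dyadic_rearrangement b i < b j"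
    using exists_least_iff[of "\<lambda>i. dyadic_rearrangement b i < b j"] by auto
  have "n \<noteq> 0"
  proof
    assume "n = 0"
    then have "j \<in> {j. dyadic_rearrangement b 0 < b j}" using n by simp
    moreover have "card {j. dyadic_rearrangement b 0 < b j} = 0" using dyadic_rearrangement_level(2)[of b 0] by simp
    ultimately show False using dyadic_rearrangement_level(1)[of b 0] by auto
  qed
  then obtain i where "n = Suc i" by (cases n) auto
  then show ?thesis using n(1) n(2)[of i] by (auto simp: not_less)
qed

text \<open>Both sides are integrals over \<open>s\<close> of counting functions, and
  \<open>s < y i\<close> forces \<open>2 ^ i\<close> of the \<open>z j\<close> to exceed \<open>s\<close>.\<close>

lemma suminf_dyadic_le:
  fixes y z :: "nat \<Rightarrow> real"
  assumes y: "\<And>i. 0 \<le> y i" and z: "\<And>j. 0 \<le> z j"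
    and F: "\<And>i s. 0 \<le> s \<Longrightarrow> s < y i \<Longrightarrow> \<exists>F. finite F \<and> card F = 2 ^ i \<and> (\<forall>j\<in>F. s < z j)"
  shows "(\<Sum>i. ennreal (2 ^ i * y i)) \<le> 2 * (\<Sum>j. ennreal (z j))"
proof -
  have len: "ennreal a = (\<integral>\<^sup>+s. indicator {0..<a} s \<partial>lborel)" if "0 \<le> a" for a :: real
    using that by simp
  have "(\<Sum>i. ennreal (2 ^ i * y i)) = (\<Sum>i. \<integral>\<^sup>+s. 2 ^ i * indicator {0..<y i} s \<partial>lborel)"
  proof (rule arg_cong[where f = suminf], rule ext)
    fix i
    have "(\<integral>\<^sup>+s. 2 ^ i * indicator {0..<y i} s \<partial>lborel) = 2 ^ i * ennreal (y i)"
      using y[of i] by (subst nn_integral_cmult) auto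
    also have "\<dots> = ennreal (2 ^ i * y i)" using y[of i] by (simp add: ennreal_mult flip: ennreal_power)
    finally show "ennreal (2 ^ i * y i) = (\<integral>\<^sup>+s. 2 ^ i * indicator {0..<y i} s \<partial>lborel)" by simp
  qed
  also have "\<dots> = (\<integral>\<^sup>+s. (\<Sum>i. 2 ^ i * indicator {0..<y i} s) \<partial>lborel)"
    by (rule nn_integral_suminf[symmetric]) measurable
  also have "\<dots> \<le> (\<integral>\<^sup>+s. 2 * (\<Sum>j. indicator {0..<z j} s) \<partial>lborel)"
  proof (rule nn_integral_mono, rule suminf_le_const)
    fix s :: real and n
    show "(\<Sum>i<n. 2 ^ i * indicator {0..<y i} s) \<le> 2 * (\<Sum>j. indicator {0..<z j} s :: ennreal)"
    proof (cases "\<exists>i<n. s \<in> {0..<y i}")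
      case True
      \<comment> \<open>At a fixed level the left-hand sum is governed by the largest index
        \<open>k\<close> occurring in it: the powers up to \<open>k\<close> add up to at most
        \<open>2 * 2 ^ k\<close>, and \<open>2 ^ k\<close> of the \<open>z j\<close> exceed the
        level. This is the origin of the factor 2.\<close>
      define k where "k = Max {i. i < n \<and> s \<in> {0..<y i}}"
      have k: "k \<in> {i. i < n \<and> s \<in> {0..<y i}}" unfolding k_def using True by (intro Max_in) auto
      have le: "i \<le> k" if "i < n" "s \<in> {0..<y i}" for i unfolding k_def using that by (intro Max_ge) auto
      obtain F where F': "finite F" "card F = 2 ^ k" "\<And>j. j \<in> F \<Longrightarrow> s < z j" using F[of s k] k by auto
      have "(\<Sum>i<n. 2 ^ i * indicator {0..<y i} s :: ennreal) \<le> (\<Sum>i<n. if i \<le> k then 2 ^ i else 0)"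
        using le by (intro sum_mono) (auto simp: indicator_def)
      also have "\<dots> = (\<Sum>i\<in>{i\<in>{..<n}. i \<le> k}. 2 ^ i)" by (rule sum.inter_filter[symmetric]) simp
      also have "\<dots> \<le> (\<Sum>i<Suc k. 2 ^ i)" by (rule sum_mono2) auto
      also have "\<dots> = ennreal (\<Sum>i<Suc k. 2 ^ i)" by (subst sum_ennreal[symmetric]) (auto simp flip: ennreal_power)
      also have "(\<Sum>i<Suc k. 2 ^ i :: real) \<le> 2 * 2 ^ k"
        by (subst geometric_sum) auto
      finally have 1: "(\<Sum>i<n. 2 ^ i * indicator {0..<y i} s) \<le> ennreal (2 * 2 ^ k)" by (simp add: ennreal_leI)
      have "ennreal (2 ^ k) = (\<Sum>j\<in>F. indicator {0..<z j} s)"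
        using F' k by (simp add: indicator_def flip: ennreal_power)
      also have "\<dots> \<le> (\<Sum>j. indicator {0..<z j} s)" using F' by (intro sum_le_suminf) auto
      finally have "ennreal 2 * ennreal (2 ^ k) \<le> ennreal 2 * (\<Sum>j. indicator {0..<z j} s)" by (rule mult_left_mono) simp
      then show ?thesis using 1 by (simp add: ennreal_mult)
    next
      case False
      then have "(\<Sum>i<n. 2 ^ i * indicator {0..<y i} s :: ennreal) = 0" by (intro sum.neutral) (auto simp: indicator_def)
      then show ?thesis by simp
    qed
  qed simp
  also have "\<dots> = 2 * (\<Sum>j. \<integral>\<^sup>+s. indicator {0..<z j} s \<partial>lborel)"
    by (subst nn_integral_cmult, measurable, subst nn_integral_suminf) auto
  also have "\<dots> = 2 * (\<Sum>j. ennreal (z j))" using z by simp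
  finally show ?thesis .
qed

text \<open>Every relevant \<open>b j\<close> is charged to a block \<open>i\<close> containing it
  with \<open>b j \<le> y i\<close>. After interchange of the summations block \<open>i\<close> pays
  at most \<open>card (G i)\<close> times \<open>y i powr r\<close>; overlapping blocks only enlarge
  the right-hand side.\<close>

lemma suminf_blocks_le:
  fixes b :: "nat \<Rightarrow> real" and y :: "nat \<Rightarrow> real" and G :: "nat \<Rightarrow> nat set"
  assumes b: "\<And>j. 0 \<le> b j" and r: "0 < r"
    and G: "\<And>i. finite (G i)" "\<And>i. card (G i) \<le> 2 ^ Suc i"
    and cover: "\<And>j. j \<in> S \<Longrightarrow> b j \<noteq> 0 \<Longrightarrow> \<exists>i\<in>J. j \<in> G i \<and> b j \<le> y i"
  shows "(\<Sum>j. ennreal (if j \<in> S then b j powr r else 0)) \<le> (\<Sum>i. ennreal (if i \<in> J then 2 ^ Suc i * y i powr r else 0))"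
proof -
  have "(\<Sum>j. ennreal (if j \<in> S then b j powr r else 0))
    \<le> (\<Sum>j. \<Sum>i. ennreal (if i \<in> J \<and> j \<in> G i then y i powr r else 0))"
  proof (intro suminf_le)
    fix j
    show "ennreal (if j \<in> S then b j powr r else 0) \<le> (\<Sum>i. ennreal (if i \<in> J \<and> j \<in> G i then y i powr r else 0))"
    proof (cases "j \<in> S \<and> b j \<noteq> 0")
      case True
      then obtain i where i: "i \<in> J" "j \<in> G i" "b j \<le> y i" using cover by blast
      have "ennreal (b j powr r) \<le> ennreal (if i \<in> J \<and> j \<in> G i then y i powr r else 0)"
        using i b r by (auto intro!: ennreal_leI powr_mono2)
      also have "\<dots> \<le> (\<Sum>i. ennreal (if i \<in> J \<and> j \<in> G i then y i powr r else 0))" by (rule ennreal_le_suminf)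
      finally show ?thesis using True by simp
    qed auto
  qed auto
  also have "\<dots> = (\<Sum>i. \<Sum>j. ennreal (if i \<in> J \<and> j \<in> G i then y i powr r else 0))"
  proof -
    have "(\<integral>\<^sup>+j. (\<Sum>i. ennreal (if i \<in> J \<and> j \<in> G i then y i powr r else 0)) \<partial>count_space UNIV)
      = (\<Sum>i. \<integral>\<^sup>+j. ennreal (if i \<in> J \<and> j \<in> G i then y i powr r else 0) \<partial>count_space UNIV)"
      by (rule nn_integral_suminf) simp
    then show ?thesis by (simp only: nn_integral_count_space_nat)
  qed
  also have "\<dots> \<le> (\<Sum>i. ennreal (if i \<in> J then 2 ^ Suc i * y i powr r else 0))"
  proof (intro suminf_le)
    fix i
    have "(\<Sum>j. ennreal (if i \<in> J \<and> j \<in> G i then y i powr r else 0)) = (\<Sum>j\<in>G i. ennreal (if i \<in> J \<and> j \<in> G i then y i powr r else 0))"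
      by (rule suminf_finite[OF G(1)]) auto
    also have "\<dots> = of_nat (card (G i)) * ennreal (if i \<in> J then y i powr r else 0)" by simp
    also have "\<dots> \<le> of_nat (2 ^ Suc i) * ennreal (if i \<in> J then y i powr r else 0)"
      by (intro mult_right_mono of_nat_mono G) auto
    also have "\<dots> = ennreal (if i \<in> J then 2 ^ Suc i * y i powr r else 0)"
      by (auto simp: ennreal_mult ennreal_of_nat_eq_real_of_nat)
    finally show "(\<Sum>j. ennreal (if i \<in> J \<and> j \<in> G i then y i powr r else 0)) \<le> ennreal (if i \<in> J then 2 ^ Suc i * y i powr r else 0)" .
  qed auto
  finally show ?thesis .
qed

section \<open>Size estimates for norms with a constant, possibly infinite sequence exponent\<close>

lemma enn2real_inverse_exponent:
  fixes r :: ennreal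
  assumes "1 \<le> r" "r \<noteq> top"
  shows "1 \<le> enn2real r" and "enn2real (1 / r) = 1 / enn2real r"
proof -
  obtain R where R: "r = ennreal R" "0 \<le> R" using assms(2) by (cases r) auto
  then have "1 \<le> R" using assms(1) by simp
  then show "1 \<le> enn2real r" "enn2real (1 / r) = 1 / enn2real r"
    using R divide_ennreal[of 1 R] by auto
qed

text \<open>A sequence with \<open>N\<close> entries of size at least \<open>a\<close> has norm at
  least \<open>N powr (1 / r) * a\<close>. For \<open>r = top\<close> the exponent
  \<open>enn2real (1 / r)\<close> is 0 and the estimate is the one for the supremum, so both cases
  share one formula.\<close>

lemma mixed_norm_const_lower:
  assumes p: "\<And>x. 0 \<le> p x" and r: "1 \<le> r" and F: "finite F" "F \<noteq> {}" and a: "0 \<le> a"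
    and aF: "\<And>j. j \<in> F \<Longrightarrow> ennreal a \<le> Lp_norm p (f j)"
  shows "ennreal (real (card F) powr enn2real (1 / r) * a) \<le> mixed_norm_const p r f"
proof (cases "r = top")
  case True
  obtain j where "j \<in> F" using F by auto
  then have "ennreal a \<le> (SUP j. Lp_norm p (f j))" using aF by (auto intro: SUP_upper2)
  then show ?thesis using True F by (simp add: mixed_norm_const_def)
next
  case False
  define R where "R = enn2real r"
  have R: "1 \<le> R" "enn2real (1 / r) = 1 / R" unfolding R_def using enn2real_inverse_exponent[OF r False] by auto
  have N: "mixed_norm_const p r f = mixed_norm p (\<lambda>_. R) f" using False by (simp add: mixed_norm_const_def R_def)
  show ?thesis
  proof (cases "mixed_norm p (\<lambda>_. R) f")
    case (real n)
    have "ennreal (real (card F) powr (1 / R) * a) \<le> ennreal n"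
    proof (rule ennreal_le_if_le_greater)
      fix m assume m: "n < m"
      have m0: "0 < m" using real m by simp
      have S: "(\<Sum>j. ennreal ((enn2real (Lp_norm p (f j)) / m) powr R)) \<le> 1"
        by (rule suminf_le_of_mixed_norm_less[OF p R(1)]) (use real m in \<open>simp add: ennreal_less_iff\<close>)
      have fin: "Lp_norm p (f j) < top" for j
        using Lp_norm_le_mixed_norm[of p "\<lambda>_. R" f j] p R(1) real by (metis ennreal_less_top le_less_trans)
      have "ennreal (real (card F) * (a / m) powr R) = (\<Sum>j\<in>F. ennreal ((a / m) powr R))"
        by (simp add: ennreal_mult ennreal_of_nat_eq_real_of_nat)
      also have "\<dots> \<le> (\<Sum>j\<in>F. ennreal ((enn2real (Lp_norm p (f j)) / m) powr R))"
      proof (intro sum_mono ennreal_leI powr_mono2 divide_right_mono)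
        fix j assume "j \<in> F"
        then have "enn2real (ennreal a) \<le> enn2real (Lp_norm p (f j))" using aF fin[of j] by (intro enn2real_mono) auto
        then show "a \<le> enn2real (Lp_norm p (f j))" using a by simp
      qed (use a m0 R in auto)
      also have "\<dots> \<le> (\<Sum>j. ennreal ((enn2real (Lp_norm p (f j)) / m) powr R))" using F by (intro sum_le_suminf) auto
      also have "\<dots> \<le> 1" by (rule S)
      finally have "real (card F) * (a / m) powr R \<le> 1" by simp
      also have "real (card F) * (a / m) powr R = (real (card F) powr (1 / R) * (a / m)) powr R"
        unfolding powr_mult powr_powr using R(1) F by simp
      finally have "real (card F) powr (1 / R) * (a / m) \<le> 1" by (rule powr_le_1_cancel) (use a m0 R(1) in auto)
      then have "real (card F) powr (1 / R) * a \<le> m" using m0 by (simp add: field_simps)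
      then show "ennreal (real (card F) powr (1 / R) * a) \<le> ennreal m" by (rule ennreal_leI)
    qed
    then show ?thesis unfolding N R(2) real .
  qed (simp add: N)
qed

text \<open>At most \<open>2 ^ (i + 1)\<close> coefficients of size up to \<open>y i\<close>
  contribute about \<open>2 powr (i / r) * y i\<close> to the norm of exponent \<open>r\<close>, and
  the contributions of the blocks are simply added. For finite \<open>r\<close> this holds because
  normalised contributions are at most 1 and hence dominate their powers of order \<open>r\<close>;
  for \<open>r = top\<close> each single one is a bound.\<close>

lemma mixed_norm_const_blocks:
  fixes b y :: "nat \<Rightarrow> real" and G :: "nat \<Rightarrow> nat set"
  assumes p: "\<And>x. 0 \<le> p x" and r: "1 \<le> r" and C: "0 < C" and M: "0 \<le> M"
    and b: "\<And>j. 0 \<le> b j" and y: "\<And>i. 0 \<le> y i"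
    and f: "\<And>k. Lp_norm p (f k) \<le> ennreal (C * (\<Sum>j\<in>{k - 1..Suc k}. if j \<in> S then b j else 0))"
    and G: "\<And>i. finite (G i)" "\<And>i. card (G i) \<le> 2 ^ Suc i"
    and cover: "\<And>j. j \<in> S \<Longrightarrow> b j \<noteq> 0 \<Longrightarrow> \<exists>i\<in>J. j \<in> G i \<and> b j \<le> y i"
    and S: "(\<Sum>i. ennreal (if i \<in> J then 2 powr (real i * enn2real (1 / r)) * y i else 0)) \<le> ennreal M"
  shows "mixed_norm_const p r f \<le> ennreal (18 * C * M)"
proof (cases "r = top")
  case True
  have yM: "y i \<le> M" if "i \<in> J" for i
  proof -
    have "ennreal (if i \<in> J then 2 powr (real i * enn2real (1 / r)) * y i else 0) \<le> ennreal M"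
      by (rule order_trans[OF ennreal_le_suminf S])
    then show ?thesis using that True M by simp
  qed
  have bM: "(if j \<in> S then b j else 0) \<le> M" for j
    using cover[of j] yM M by (cases "j \<in> S \<and> b j \<noteq> 0") (auto intro: order_trans)
  have "Lp_norm p (f k) \<le> ennreal (18 * C * M)" for k
  proof -
    have "(\<Sum>j\<in>{k - 1..Suc k}. if j \<in> S then b j else 0) \<le> real (card {k - 1..Suc k}) * M"
      by (rule sum_bounded_above) (rule bM)
    also have "\<dots> \<le> 18 * M" using M by (intro mult_right_mono) auto
    finally have "C * (\<Sum>j\<in>{k - 1..Suc k}. if j \<in> S then b j else 0) \<le> C * (18 * M)" using C by (intro mult_left_mono) auto
    then have "ennreal (C * (\<Sum>j\<in>{k - 1..Suc k}. if j \<in> S then b j else 0)) \<le> ennreal (C * (18 * M))" by (rule ennreal_leI)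
    also have "C * (18 * M) = 18 * C * M" by simp
    finally show ?thesis using f[of k] by (rule order_trans[rotated])
  qed
  then show ?thesis using True by (auto simp: mixed_norm_const_def intro: SUP_least)
next
  case False
  define R where "R = enn2real r"
  have R: "1 \<le> R" "enn2real (1 / r) = 1 / R" unfolding R_def using enn2real_inverse_exponent[OF r False] by auto
  have N: "mixed_norm_const p r f = mixed_norm p (\<lambda>_. R) f" using False by (simp add: mixed_norm_const_def R_def)
  define \<beta> where "\<beta> = (\<lambda>j. if j \<in> S then b j else 0)"
  have \<beta>0: "0 \<le> \<beta> j" for j unfolding \<beta>_def using b by simp
  have "mixed_norm p (\<lambda>_. R) f \<le> ennreal (18 * C * M)"
  proof (rule ennreal_le_if_le_greater)
    fix l assume l: "18 * C * M < l"
    \<comment> \<open>Here 18 is 3 times 6. The factor \<open>3 powr R\<close> for sums of three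
      neighbours turns \<open>(1 / 18) powr R\<close> into
      \<open>(1 / 6) powr R \<le> 1 / 6\<close>. This cancels the 6 made up of 3 for counting
      neighbours and 2 for the block sizes \<open>2 ^ Suc i\<close>.\<close>
    define m where "m = l / (18 * C)"
    have "0 \<le> 18 * C * M" using C M by simp
    then have "0 < l" using l by linarith
    then have m: "M < m" "l = 18 * C * m" "0 < m" unfolding m_def using l C by (simp_all add: pos_less_divide_eq mult_ac)
    have l0: "0 < l" using m C by simp
    define X where "X = (\<lambda>i. if i \<in> J then 2 powr (real i * (1 / R)) * y i else 0)"
    have X0: "0 \<le> X i" for i unfolding X_def using y by simp
    have SX: "(\<Sum>i. ennreal (X i)) \<le> ennreal M" using S unfolding X_def R(2) .
    have Xm: "X i / m \<le> 1" for i
    proof -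
      have "ennreal (X i) \<le> ennreal M" by (rule order_trans[OF ennreal_le_suminf SX])
      then have "X i \<le> M" using M by simp
      then show ?thesis using m by simp
    qed
    have "(\<Sum>k. ennreal ((C * (\<Sum>j\<in>{k - 1..Suc k}. \<beta> j) / l) powr R))
      \<le> (\<Sum>k. ennreal (3 powr R) * (\<Sum>j\<in>{k - 1..Suc k}. ennreal ((\<beta> j / (18 * m)) powr R)))"
    proof (intro suminf_le)
      fix k
      have "C * (\<Sum>j\<in>{k - 1..Suc k}. \<beta> j) / l = (\<Sum>j\<in>{k - 1..Suc k}. \<beta> j / (18 * m))"
        unfolding m(2) sum_divide_distrib[symmetric] using C by simp
      also have "\<dots> powr R \<le> 3 powr R * (\<Sum>j\<in>{k - 1..Suc k}. (\<beta> j / (18 * m)) powr R)"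
        using \<beta>0 m by (intro powr_sum3_le R) auto
      finally have "ennreal ((C * (\<Sum>j\<in>{k - 1..Suc k}. \<beta> j) / l) powr R) \<le> ennreal (3 powr R * (\<Sum>j\<in>{k - 1..Suc k}. (\<beta> j / (18 * m)) powr R))"
        by (rule ennreal_leI)
      also have "\<dots> = ennreal (3 powr R) * (\<Sum>j\<in>{k - 1..Suc k}. ennreal ((\<beta> j / (18 * m)) powr R))"
        by (subst ennreal_mult) (auto intro!: sum_nonneg simp: sum_ennreal simp del: sum.cl_ivl_Suc)
      finally show "ennreal ((C * (\<Sum>j\<in>{k - 1..Suc k}. \<beta> j) / l) powr R) \<le> ennreal (3 powr R) * (\<Sum>j\<in>{k - 1..Suc k}. ennreal ((\<beta> j / (18 * m)) powr R))" .
    qed auto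
    also have "\<dots> = ennreal (3 powr R) * (\<Sum>k. \<Sum>j\<in>{k - 1..Suc k}. ennreal ((\<beta> j / (18 * m)) powr R))" by simp
    also have "\<dots> \<le> ennreal (3 powr R) * (3 * (\<Sum>j. ennreal ((\<beta> j / (18 * m)) powr R)))"
      by (intro mult_left_mono suminf_neighbours_le) auto
    also have "\<dots> \<le> ennreal (3 powr R) * (3 * ennreal (2 * (1 / 18) powr R))"
    proof (intro mult_left_mono)
      have "(\<Sum>j. ennreal ((\<beta> j / (18 * m)) powr R)) = (\<Sum>j. ennreal (if j \<in> S then (b j / (18 * m)) powr R else 0))"
        by (rule arg_cong[where f = suminf]) (auto simp: \<beta>_def)
      also have "\<dots> \<le> (\<Sum>i. ennreal (if i \<in> J then 2 ^ Suc i * (y i / (18 * m)) powr R else 0))"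
      proof (rule suminf_blocks_le[where G = G, OF _ _ G])
        fix j assume "j \<in> S" "b j / (18 * m) \<noteq> 0"
        then obtain i where "i \<in> J" "j \<in> G i" "b j \<le> y i" using cover[of j] by auto
        then show "\<exists>i\<in>J. j \<in> G i \<and> b j / (18 * m) \<le> y i / (18 * m)"
          using m by (intro bexI[of _ i]) (auto intro: divide_right_mono)
      qed (use b m R(1) in auto)
      also have "\<dots> \<le> (\<Sum>i. ennreal (2 * (1 / 18) powr R / m) * ennreal (X i))"
      proof (intro suminf_le)
        fix i
        have "(if i \<in> J then 2 ^ Suc i * (y i / (18 * m)) powr R else 0) = 2 * (1 / 18) powr R * (X i / m) powr R"
        proof (cases "i \<in> J")
          case True
          have e: "(2 powr (real i * (1 / R))) powr R = 2 ^ i" using R(1) by (simp add: powr_powr powr_realpow)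
          have "(X i / m) powr R = ((2 powr (real i * (1 / R))) * (y i / m)) powr R" using True unfolding X_def by simp
          also have "\<dots> = 2 ^ i * (y i / m) powr R" unfolding powr_mult e ..
          finally have 1: "(X i / m) powr R = 2 ^ i * (y i / m) powr R" .
          have "(y i / (18 * m)) powr R = ((1 / 18) * (y i / m)) powr R" by simp
          also have "\<dots> = (1 / 18) powr R * (y i / m) powr R" by (rule powr_mult)
          finally show ?thesis using True 1 by simp
        next
          case False then show ?thesis unfolding X_def by simp
        qed
        also have "\<dots> \<le> 2 * (1 / 18) powr R * (X i / m)"
        proof (intro mult_left_mono)
          have "(X i / m) powr R \<le> (X i / m) powr 1"
            using Xm[of i] X0[of i] m R(1) by (intro powr_mono') auto
          then show "(X i / m) powr R \<le> X i / m" using X0[of i] m by simp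
        qed auto
        finally show "ennreal (if i \<in> J then 2 ^ Suc i * (y i / (18 * m)) powr R else 0) \<le> ennreal (2 * (1 / 18) powr R / m) * ennreal (X i)"
          using X0[of i] m by (simp add: ennreal_leI flip: ennreal_mult)
      qed auto
      also have "\<dots> = ennreal (2 * (1 / 18) powr R / m) * (\<Sum>i. ennreal (X i))" by simp
      also have "\<dots> \<le> ennreal (2 * (1 / 18) powr R / m) * ennreal m"
        using m by (intro mult_left_mono order_trans[OF SX] ennreal_leI) auto
      also have "\<dots> = ennreal (2 * (1 / 18) powr R)" using m by (simp flip: ennreal_mult)
      finally show "(\<Sum>j. ennreal ((\<beta> j / (18 * m)) powr R)) \<le> ennreal (2 * (1 / 18) powr R)" .
    qed auto
    also have "\<dots> = ennreal (6 * (3 powr R * (1 / 18) powr R))"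
    proof -
      have "(3::ennreal) = ennreal 3" by simp
      then show ?thesis by (simp only: ennreal_mult[symmetric] mult_ac powr_ge_zero mult_nonneg_nonneg zero_le_numeral) (simp add: mult_ac)
    qed
    also have "3 powr R * (1 / 18) powr R = (1 / 6 :: real) powr R" by (simp flip: powr_mult)
    also have "ennreal (6 * (1 / 6) powr R) \<le> 1"
      using powr_mono'[of 1 R "1 / 6"] R(1) by simp
    finally have fin: "(\<Sum>k. ennreal ((C * (\<Sum>j\<in>{k - 1..Suc k}. \<beta> j) / l) powr R)) \<le> 1" .
    show "mixed_norm p (\<lambda>_. R) f \<le> ennreal l"
      by (rule mixed_norm_const_exponent_le[OF p R(1) l0 f[folded \<beta>_def] _ fin])
        (use C \<beta>0 in \<open>auto intro!: mult_nonneg_nonneg sum_nonneg simp del: sum.cl_ivl_Suc\<close>)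
  qed
  then show ?thesis unfolding N .
qed

section \<open>Interpolation of Besov spaces\<close>

context
  fixes \<Psi> :: "real^'n::finite \<Rightarrow> complex" and \<phi> :: "nat \<Rightarrow> real^'n \<Rightarrow> complex"
    and p \<alpha>0 \<alpha>1 :: "real^'n \<Rightarrow> real" and \<theta> d :: real and q :: "real \<Rightarrow> real"
  assumes D: "dyadic_resolution \<Psi> \<phi>" and p: "p \<in> log_exponents"
    and \<alpha>0: "\<alpha>0 \<in> C_log_loc" and \<alpha>1: "\<alpha>1 \<in> C_log_loc" and d: "\<And>x. \<alpha>0 x - \<alpha>1 x = d"
    and \<theta>: "0 < \<theta>" "\<theta> < 1"
    and q: "q \<in> exponents" "log_hoelder_at_origin q" "log_hoelder_at_infinity q (q 0)"
begin

abbreviation (input) coeff :: "(real^'n \<Rightarrow> real) \<Rightarrow> ((real^'n \<Rightarrow> complex) \<Rightarrow> complex) \<Rightarrow> nat \<Rightarrow> ennreal" where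
  "coeff \<equiv> besov_coeff \<phi> p"

abbreviation (input) target :: "((real^'n \<Rightarrow> complex) \<Rightarrow> complex) qn_space" where
  "target \<equiv> besov \<phi> (\<lambda>x. (1 - \<theta>) * \<alpha>0 x + \<theta> * \<alpha>1 x) p (\<lambda>_. q 0)"

lemma p_ge_0: "0 \<le> p x"
  using exponent_ge_0[OF D p] by auto

lemma q0_ge_1: "1 \<le> q 0" using q(1) unfolding exponents_def by auto

lemma coeff_shift_le:
  assumes "\<And>x. s' x = s x + c"
  shows "coeff s' T j \<le> ennreal (2 powr (real j * c)) * coeff s T j"
  unfolding besov_coeff_def[OF D p]
  using p_ge_0 by (intro Lp_norm_cmult_le) (auto simp: assms norm_mult powr_add algebra_simps)

text \<open>A constant change of smoothness is a factor independent of \<open>x\<close>. Here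
  constancy of \<open>\<alpha>0 - \<alpha>1\<close> enters: the coefficients for
  \<open>\<alpha>0\<close>, \<open>\<alpha>1\<close> and the target
  \<open>\<alpha>1 + (1 - \<theta>) * d\<close> differ by geometric weights only.\<close>

lemma coeff_shift:
  assumes "\<And>x. s' x = s x + c"
  shows "coeff s' T j = ennreal (2 powr (real j * c)) * coeff s T j"
proof (rule antisym[OF coeff_shift_le[OF assms]])
  have "coeff s T j \<le> ennreal (2 powr (real j * - c)) * coeff s' T j" by (rule coeff_shift_le) (simp add: assms)
  then have "ennreal (2 powr (real j * c)) * coeff s T j \<le> ennreal (2 powr (real j * c)) * (ennreal (2 powr (real j * - c)) * coeff s' T j)"
    by (rule mult_left_mono) simp
  also have "\<dots> = coeff s' T j" by (simp add: mult.assoc[symmetric] flip: ennreal_mult powr_add)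
  finally show "ennreal (2 powr (real j * c)) * coeff s T j \<le> coeff s' T j" .
qed

lemma coeff_\<alpha>0: "coeff \<alpha>0 T j = ennreal (2 powr (real j * d)) * coeff \<alpha>1 T j"
  by (rule coeff_shift) (use d in \<open>simp add: algebra_simps\<close>)

lemma coeff_target:
  "coeff (\<lambda>x. (1 - \<theta>) * \<alpha>0 x + \<theta> * \<alpha>1 x) T j = ennreal (2 powr (real j * (1 - \<theta>) * d)) * coeff \<alpha>1 T j"
proof -
  have "(1 - \<theta>) * \<alpha>0 x + \<theta> * \<alpha>1 x = \<alpha>1 x + (1 - \<theta>) * d" for x using d[of x] by (simp add: algebra_simps flip: d[of x])
  from coeff_shift[OF this] show ?thesis by (simp add: mult.assoc)
qed

lemma fst_besov_from: "fst (besov_from \<phi> s N) = {f \<in> tempered_distributions. snd (besov_from \<phi> s N) f < top}"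
  and snd_besov_from: "snd (besov_from \<phi> s N) f = N (\<lambda>j x. of_real (2 powr (real j * s x)) * convolution (\<phi> j) f x)"
  unfolding besov_from_def Let_def by simp_all

lemma fst_target: "fst target = {f \<in> tempered_distributions. snd target f < top}"
  unfolding besov_def by (rule fst_besov_from)

lemma target_upper:
  assumes m: "0 < m" and b: "\<And>j. coeff (\<lambda>x. (1 - \<theta>) * \<alpha>0 x + \<theta> * \<alpha>1 x) f j \<le> ennreal (b j)" "\<And>j. 0 \<le> b j"
    and S: "(\<Sum>j. ennreal ((b j / m) powr q 0)) \<le> 1"
  shows "snd target f \<le> ennreal m"
  unfolding besov_def snd_besov_from
  by (rule mixed_norm_const_exponent_le[OF p_ge_0 q0_ge_1 m b(1)[unfolded besov_coeff_def[OF D p]] b(2) S])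

lemma target_lower:
  assumes m: "snd target f < ennreal m"
  shows "coeff (\<lambda>x. (1 - \<theta>) * \<alpha>0 x + \<theta> * \<alpha>1 x) f j < top"
    and "(\<Sum>j. ennreal ((enn2real (coeff (\<lambda>x. (1 - \<theta>) * \<alpha>0 x + \<theta> * \<alpha>1 x) f j) / m) powr q 0)) \<le> 1"
proof -
  note m' = m[unfolded besov_def snd_besov_from]
  have "coeff (\<lambda>x. (1 - \<theta>) * \<alpha>0 x + \<theta> * \<alpha>1 x) f j \<le> snd target f"
    unfolding besov_def snd_besov_from besov_coeff_def[OF D p]
    by (rule Lp_norm_le_mixed_norm[OF p_ge_0 q0_ge_1,
      where f = "\<lambda>j x. of_real (2 powr (real j * ((1 - \<theta>) * \<alpha>0 x + \<theta> * \<alpha>1 x))) * convolution (\<phi> j) f x"])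
  then show "coeff (\<lambda>x. (1 - \<theta>) * \<alpha>0 x + \<theta> * \<alpha>1 x) f j < top" using m by (meson ennreal_less_top le_less_trans less_trans)
  show "(\<Sum>j. ennreal ((enn2real (coeff (\<lambda>x. (1 - \<theta>) * \<alpha>0 x + \<theta> * \<alpha>1 x) f j) / m) powr q 0)) \<le> 1"
    unfolding besov_coeff_def[OF D p] by (rule suminf_le_of_mixed_norm_less[OF p_ge_0 q0_ge_1 m'])
qed

lemma sum_carrier_tempered:
  "sum_carrier (besov_from \<phi> \<alpha>0 N0) (besov_from \<phi> \<alpha>1 N1) \<subseteq> tempered_distributions"
  unfolding sum_carrier_def by (auto simp: fst_besov_from intro: tempered_distributions_add)

text \<open>\<open>N0\<close> and \<open>N1\<close> may be any functionals between supremum and sum,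
  so variable exponents \<open>q0\<close>, \<open>q1\<close> and constants \<open>r0\<close>,
  \<open>r1\<close> including \<open>top\<close> are treated at once.\<close>

lemma interpolation_besov_distinct_smoothness:
  fixes N0 N1 :: "(nat \<Rightarrow> real^'n \<Rightarrow> complex) \<Rightarrow> ennreal"
  assumes dnz: "d \<noteq> 0"
    and N0: "\<And>F j. Lp_norm p (F j) \<le> N0 F" "\<And>F. N0 F \<le> (\<Sum>j. Lp_norm p (F j))"
    and N1: "\<And>F j. Lp_norm p (F j) \<le> N1 F" "\<And>F. N1 F \<le> (\<Sum>j. Lp_norm p (F j))"
  shows "same_space (interpolation_space (besov_from \<phi> \<alpha>0 N0) (besov_from \<phi> \<alpha>1 N1) \<theta> q) target"
proof -
  let ?A0 = "besov_from \<phi> \<alpha>0 N0" and ?A1 = "besov_from \<phi> \<alpha>1 N1"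
  have ge: "coeff \<alpha>0 f j \<le> snd ?A0 f" "coeff \<alpha>1 f j \<le> snd ?A1 f" for f j
    unfolding snd_besov_from besov_coeff_def[OF D p]
    using N0(1)[of "\<lambda>j x. of_real (2 powr (real j * \<alpha>0 x)) * convolution (\<phi> j) f x" j]
      N1(1)[of "\<lambda>j x. of_real (2 powr (real j * \<alpha>1 x)) * convolution (\<phi> j) f x" j] by auto
  have le: "snd ?A0 f \<le> (\<Sum>j. coeff \<alpha>0 f j)" "snd ?A1 f \<le> (\<Sum>j. coeff \<alpha>1 f j)" for f
    unfolding snd_besov_from besov_coeff_def[OF D p] by (rule N0(2), rule N1(2))
  obtain C where C: "0 < C" "\<And>T S. \<lbrakk>T \<in> tempered_distributions; finite S \<or> finite (- S)\<rbrakk> \<Longrightarrow>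
    \<exists>T0\<in>tempered_distributions. \<exists>T1\<in>tempered_distributions. T = T0 + T1 \<and>
      (\<forall>k. coeff \<alpha>0 T0 k \<le> ennreal C * (\<Sum>j\<in>{k - 1..Suc k} \<inter> S. coeff \<alpha>0 T j)) \<and>
      (\<forall>k. coeff \<alpha>1 T1 k \<le> ennreal C * (\<Sum>j\<in>{k - 1..Suc k} - S. coeff \<alpha>1 T j))"
    using dyadic_splitting[OF D p \<alpha>0 \<alpha>1] by blast
  have nb: "(\<Sum>k. ennreal C * (\<Sum>j\<in>{k - 1..Suc k} \<inter> S. a j)) \<le> ennreal (3 * C) * (\<Sum>j. if j \<in> S then a j else 0)"
    for a :: "nat \<Rightarrow> ennreal" and S
  proof -
    have "(\<Sum>k. ennreal C * (\<Sum>j\<in>{k - 1..Suc k} \<inter> S. a j)) = ennreal C * (\<Sum>k. \<Sum>j\<in>{k - 1..Suc k}. if j \<in> S then a j else 0)"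
      by (simp add: sum.inter_restrict del: sum.cl_ivl_Suc)
    also have "\<dots> \<le> ennreal C * (3 * (\<Sum>j. if j \<in> S then a j else 0))" by (intro mult_left_mono suminf_neighbours_le) auto
    also have "\<dots> = ennreal (3 * C) * (\<Sum>j. if j \<in> S then a j else 0)"
      using C(1) by (simp add: ennreal_mult mult_ac)
    finally show ?thesis .
  qed
  show ?thesis
  proof (rule interpolation_space_eqI[where X = tempered_distributions and B = "coeff \<alpha>1" and d = d and ?C1.0 = 1 and ?C2.0 = "3 * C" and ?C3.0 = 1, OF \<theta> q dnz])
    show "sum_carrier ?A0 ?A1 \<subseteq> tempered_distributions" by (rule sum_carrier_tempered)
    show "snd ?A0 f < top" if "f \<in> fst ?A0" for f using that by (simp add: fst_besov_from)
    show "snd ?A1 f < top" if "f \<in> fst ?A1" for f using that by (simp add: fst_besov_from)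
    show "fst target = {f \<in> tempered_distributions. snd target f < top}" by (rule fst_target)
    show "ennreal (2 powr (real i * d)) * coeff \<alpha>1 f i \<le> ennreal 1 * K_functional ?A0 ?A1 (2 powr (real i * d)) f" for f i
      unfolding K_functional_def ennreal_1 mult_1
    proof (rule INF_greatest, safe)
      fix f0 f1 assume f: "f0 \<in> fst ?A0" "f1 \<in> fst ?A1"
      then have t: "f0 \<in> tempered_distributions" "f1 \<in> tempered_distributions" by (auto simp: fst_besov_from)
      have "ennreal (2 powr (real i * d)) * coeff \<alpha>1 (f0 + f1) i = coeff \<alpha>0 (f0 + f1) i" by (simp add: coeff_\<alpha>0)
      also have "\<dots> \<le> coeff \<alpha>0 f0 i + coeff \<alpha>0 f1 i" by (rule besov_coeff_add[OF D p \<alpha>0 t])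
      also have "\<dots> \<le> snd ?A0 f0 + ennreal (2 powr (real i * d)) * snd ?A1 f1"
        by (intro add_mono ge) (auto simp: coeff_\<alpha>0 intro!: mult_left_mono ge)
      finally show "ennreal (2 powr (real i * d)) * coeff \<alpha>1 (f0 + f1) i \<le> snd ?A0 f0 + ennreal (2 powr (real i * d)) * snd ?A1 f1" .
    qed
    show "f \<in> sum_carrier ?A0 ?A1 \<and> K_functional ?A0 ?A1 t f \<le> ennreal (3 * C) * (\<Sum>i. ennreal (min (2 powr (real i * d)) t) * coeff \<alpha>1 f i)"
      if f: "f \<in> tempered_distributions" and t: "0 < t" and fin: "(\<Sum>i. ennreal (min (2 powr (real i * d)) t) * coeff \<alpha>1 f i) < top" for f t
    proof -
      define S where "S = {i::nat. 2 powr (real i * d) \<le> t}"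
      have S: "i \<in> S \<longleftrightarrow> real i * (d * ln 2) \<le> ln t" for i
      proof -
        have "2 powr (real i * d) = exp (real i * (d * ln 2))" by (simp add: powr_def mult_ac)
        then show ?thesis unfolding S_def using t by (simp add: ln_ge_iff)
      qed
      \<comment> \<open>\<open>S\<close> is an initial segment of the indices for positive
        \<open>d\<close> and a final one for negative \<open>d\<close>.\<close>
      have fS: "finite S \<or> finite (- S)"
      proof (cases "0 < d")
        case True
        have "S \<subseteq> {..nat \<lceil>ln t / (d * ln 2)\<rceil>}"
        proof
          fix i assume "i \<in> S"
          then have "real i \<le> ln t / (d * ln 2)" using True by (simp add: S pos_le_divide_eq)
          then show "i \<in> {..nat \<lceil>ln t / (d * ln 2)\<rceil>}" by simp linarith
        qed
        then show ?thesis using finite_subset by blast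
      next
        case False
        then have neg: "d * ln 2 < 0" using dnz by (simp add: mult_neg_pos)
        have "- S \<subseteq> {..nat \<lceil>ln t / (d * ln 2)\<rceil>}"
        proof
          fix i assume "i \<in> - S"
          then have "ln t < real i * (d * ln 2)" by (simp add: S)
          then have "real i < ln t / (d * ln 2)" using neg by (simp add: neg_less_divide_eq)
          then show "i \<in> {..nat \<lceil>ln t / (d * ln 2)\<rceil>}" by simp linarith
        qed
        then show ?thesis using finite_subset by blast
      qed
      obtain f0 f1 where f01: "f0 \<in> tempered_distributions" "f1 \<in> tempered_distributions" "f = f0 + f1"
        "\<And>k. coeff \<alpha>0 f0 k \<le> ennreal C * (\<Sum>j\<in>{k - 1..Suc k} \<inter> S. coeff \<alpha>0 f j)"
        "\<And>k. coeff \<alpha>1 f1 k \<le> ennreal C * (\<Sum>j\<in>{k - 1..Suc k} - S. coeff \<alpha>1 f j)"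
        using C(2)[OF f fS] by blast
      have diff: "A - S = A \<inter> - S" for A by auto
      have b0: "snd ?A0 f0 \<le> ennreal (3 * C) * (\<Sum>j. if j \<in> S then coeff \<alpha>0 f j else 0)"
        by (rule order_trans[OF le(1) order_trans[OF suminf_le[OF f01(4)] nb]]) auto
      have b1: "snd ?A1 f1 \<le> ennreal (3 * C) * (\<Sum>j. if j \<in> - S then coeff \<alpha>1 f j else 0)"
        by (rule order_trans[OF le(2) order_trans[OF suminf_le[OF f01(5)[unfolded diff]] nb]]) auto
      have "snd ?A0 f0 + ennreal t * snd ?A1 f1
        \<le> ennreal (3 * C) * (\<Sum>j. if j \<in> S then coeff \<alpha>0 f j else 0) + ennreal t * (ennreal (3 * C) * (\<Sum>j. if j \<in> - S then coeff \<alpha>1 f j else 0))"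
        by (intro add_mono mult_left_mono b0 b1) auto
      also have "\<dots> = ennreal (3 * C) * ((\<Sum>j. if j \<in> S then coeff \<alpha>0 f j else 0) + (\<Sum>j. ennreal t * (if j \<in> - S then coeff \<alpha>1 f j else 0)))"
        by (simp add: distrib_left mult_ac)
      also have "(\<Sum>j. if j \<in> S then coeff \<alpha>0 f j else 0) + (\<Sum>j. ennreal t * (if j \<in> - S then coeff \<alpha>1 f j else 0))
        = (\<Sum>j. (if j \<in> S then coeff \<alpha>0 f j else 0) + ennreal t * (if j \<in> - S then coeff \<alpha>1 f j else 0))"
        by (rule suminf_add) auto
      \<comment> \<open>On \<open>S\<close> the coefficient for \<open>\<alpha>0\<close> brings the
        factor \<open>2 powr (j * d) \<le> t\<close>, and off \<open>S\<close> the factor is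
        \<open>t < 2 powr (j * d)\<close>: in both cases the minimum.\<close>
      also have "\<dots> = (\<Sum>i. ennreal (min (2 powr (real i * d)) t) * coeff \<alpha>1 f i)"
        by (rule arg_cong[where f = suminf]) (auto simp: S_def coeff_\<alpha>0 min_def)
      finally have sum: "snd ?A0 f0 + ennreal t * snd ?A1 f1 \<le> ennreal (3 * C) * (\<Sum>i. ennreal (min (2 powr (real i * d)) t) * coeff \<alpha>1 f i)" .
      also have "\<dots> < top" using fin by (simp add: ennreal_mult_less_top)
      finally have "snd ?A0 f0 < top" "snd ?A1 f1 < top" using t by (auto simp: ennreal_mult_less_top)
      then have m: "f0 \<in> fst ?A0" "f1 \<in> fst ?A1" using f01 by (auto simp: fst_besov_from)
      show ?thesis unfolding f01(3)
        using m K_functional_lower[OF m, of t] sum[unfolded f01(3)] by (auto simp: sum_carrier_def intro: order_trans)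
    qed
    show "snd target f \<le> ennreal (1 * m)"
      if "0 < m" "\<And>i. coeff \<alpha>1 f i < top"
        "(\<Sum>i. ennreal ((2 powr (real i * (1 - \<theta>) * d) * enn2real (coeff \<alpha>1 f i) / m) powr q 0)) \<le> 1" for f m
      unfolding mult_1 using that by (intro target_upper[OF that(1) _ _ that(3)]) (auto simp: coeff_target ennreal_mult)
    show "(\<forall>i. coeff \<alpha>1 f i < top) \<and>
      (\<Sum>i. ennreal ((2 powr (real i * (1 - \<theta>) * d) * enn2real (coeff \<alpha>1 f i) / (1 * m)) powr q 0)) \<le> 1"
      if "snd target f < ennreal m" for f m
    proof -
      have "coeff \<alpha>1 f i < top" for i
        using target_lower(1)[OF that, of i] unfolding coeff_target by (auto simp: ennreal_mult_less_top)
      then show ?thesis using target_lower(2)[OF that] unfolding coeff_target by (simp add: enn2real_mult)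
    qed
  qed (use C in auto)
qed

section \<open>Equal smoothness: coinciding spaces and rearranged block norms\<close>

lemma sum_carrier_self_le:
  assumes A: "snd A (\<lambda>_. 0) < top" "fst A = {f \<in> X. snd A f < top}" "(\<lambda>_. 0) \<in> X" and f: "f \<in> fst A"
  shows "f \<in> sum_carrier A A" and "K_functional A A t f \<le> snd A f + ennreal t * snd A (\<lambda>_. 0)"
    and "K_functional A A t f \<le> snd A (\<lambda>_. 0) + ennreal t * snd A f"
proof -
  have z: "(\<lambda>_. 0) \<in> fst A" using A by simp
  have e: "f = f + (\<lambda>_. 0)" "f = (\<lambda>_. 0) + f" by (rule ext; simp)+
  show "f \<in> sum_carrier A A" unfolding sum_carrier_def using e(1) f z by blast
  show "K_functional A A t f \<le> snd A f + ennreal t * snd A (\<lambda>_. 0)"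
    using K_functional_lower[OF f z, of t] e(1) by simp
  show "K_functional A A t f \<le> snd A (\<lambda>_. 0) + ennreal t * snd A f"
    using K_functional_lower[OF z f, of t] e(2) by simp
qed

text \<open>For a couple of two equal spaces K is comparable with \<open>min 1 t\<close> times the
  norm. This is the pattern of \<open>interpolation_space_eqI\<close> for a sequence with a single
  nonzero entry; the step \<open>d = 1\<close> used there is an arbitrary nonzero number, unrelated
  to the vanishing difference of the smoothness functions.\<close>

lemma interpolation_besov_trivial:
  assumes d0: "d = 0"
  shows "same_space (interpolation_space target target \<theta> q) target"
proof -
  let ?s = "\<lambda>x. (1 - \<theta>) * \<alpha>0 x + \<theta> * \<alpha>1 x"
  have s1: "?s = \<alpha>1"
  proof
    fix x show "?s x = \<alpha>1 x" using d[of x] d0 by (simp add: algebra_simps)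
  qed
  have sC: "?s \<in> C_log_loc" unfolding s1 by (rule \<alpha>1)
  \<comment> \<open>The constant 2 comes from convexity with weights \<open>1/2\<close>: if
    \<open>m0\<close> and \<open>m1\<close> exceed the two norms and
    \<open>l = 2 * (m0 + m1)\<close>, then \<open>(x + y) / l\<close> is at most half the sum of
    \<open>x / m0\<close> and \<open>y / m1\<close>. Up to equivalence this is as good as the
    triangle inequality.\<close>
  have quasi: "snd target (f0 + f1) \<le> ennreal 2 * (snd target f0 + snd target f1)"
    if f: "f0 \<in> fst target" "f1 \<in> fst target" for f0 f1
  proof -
    have t: "f0 \<in> tempered_distributions" "f1 \<in> tempered_distributions" "snd target f0 < top" "snd target f1 < top"
      using f by (auto simp: fst_target)
    obtain a where a: "snd target f0 = ennreal a" "0 \<le> a" using t(3) by (cases "snd target f0") auto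
    obtain b where b: "snd target f1 = ennreal b" "0 \<le> b" using t(4) by (cases "snd target f1") auto
    have "snd target (f0 + f1) \<le> ennreal (2 * (a + b))"
    proof (rule ennreal_le_if_le_greater)
      fix l assume l: "2 * (a + b) < l"
      define e where "e = (l / 2 - a - b) / 2"
      have e: "0 < e" unfolding e_def using l by simp
      define m0 m1 where "m0 = a + e" and "m1 = b + e"
      have m: "0 < m0" "0 < m1" "m0 + m1 = l / 2" unfolding m0_def m1_def e_def using a b e l by (auto simp: field_simps)
      have lt: "snd target f0 < ennreal m0" "snd target f1 < ennreal m1"
        unfolding m0_def m1_def a b using a b e by (auto simp: ennreal_less_iff)
      define x where "x = (\<lambda>j. enn2real (coeff ?s f0 j))"
      define y where "y = (\<lambda>j. enn2real (coeff ?s f1 j))"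
      have x: "coeff ?s f0 j = ennreal (x j)" "0 \<le> x j" for j unfolding x_def using target_lower(1)[OF lt(1), of j] by auto
      have y: "coeff ?s f1 j = ennreal (y j)" "0 \<le> y j" for j unfolding y_def using target_lower(1)[OF lt(2), of j] by auto
      have sx: "(\<Sum>j. ennreal ((x j / m0) powr q 0)) \<le> 1" unfolding x_def by (rule target_lower(2)[OF lt(1)])
      have sy: "(\<Sum>j. ennreal ((y j / m1) powr q 0)) \<le> 1" unfolding y_def by (rule target_lower(2)[OF lt(2)])
      have "(\<Sum>j. ennreal (((x j + y j) / l) powr q 0)) \<le> (\<Sum>j. ennreal (1/2) * ennreal ((x j / m0) powr q 0) + ennreal (1/2) * ennreal ((y j / m1) powr q 0))"
      proof (intro suminf_le)
        fix j
        have l0: "0 < l" using l a b by simp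
        have "x j / l \<le> (1/2) * (x j / m0)" "y j / l \<le> (1/2) * (y j / m1)"
          using m l0 x(2)[of j] y(2)[of j] frac_le[of "x j" "x j" "2 * m0" l] frac_le[of "y j" "y j" "2 * m1" l] by simp_all
        then have "(x j + y j) / l \<le> (1/2) * (x j / m0) + (1/2) * (y j / m1)" unfolding add_divide_distrib by (rule add_mono)
        then have "((x j + y j) / l) powr q 0 \<le> ((1/2) * (x j / m0) + (1/2) * (y j / m1)) powr q 0"
          using x(2)[of j] y(2)[of j] l0 q0_ge_1 by (intro powr_mono2) auto
        also have "\<dots> \<le> (1/2) * (x j / m0) powr q 0 + (1/2) * (y j / m1) powr q 0"
          using x(2)[of j] y(2)[of j] m by (intro powr_convex_combination q0_ge_1) auto
        finally have "ennreal (((x j + y j) / l) powr q 0) \<le> ennreal ((1/2) * (x j / m0) powr q 0 + (1/2) * (y j / m1) powr q 0)"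
          by (rule ennreal_leI)
        also have "\<dots> = ennreal ((1/2) * (x j / m0) powr q 0) + ennreal ((1/2) * (y j / m1) powr q 0)"
          by (rule ennreal_plus) auto
        also have "\<dots> = ennreal (1/2) * ennreal ((x j / m0) powr q 0) + ennreal (1/2) * ennreal ((y j / m1) powr q 0)"
          by (simp only: ennreal_mult powr_ge_zero zero_le_divide_1_iff zero_le_numeral)
        finally show "ennreal (((x j + y j) / l) powr q 0) \<le> ennreal (1/2) * ennreal ((x j / m0) powr q 0) + ennreal (1/2) * ennreal ((y j / m1) powr q 0)" .
      qed auto
      also have "\<dots> = ennreal (1/2) * (\<Sum>j. ennreal ((x j / m0) powr q 0)) + ennreal (1/2) * (\<Sum>j. ennreal ((y j / m1) powr q 0))"
        by (subst suminf_add[symmetric]) auto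
      also have "\<dots> \<le> ennreal (1/2) * 1 + ennreal (1/2) * 1" by (intro add_mono mult_left_mono sx sy) auto
      also have "\<dots> = ennreal (1/2 + 1/2)" unfolding mult_1_right by (rule ennreal_plus[symmetric]) auto
      also have "\<dots> = 1" by simp
      finally have S: "(\<Sum>j. ennreal (((x j + y j) / l) powr q 0)) \<le> 1" .
      show "snd target (f0 + f1) \<le> ennreal l"
      proof (rule target_upper[OF _ _ _ S])
        show "0 < l" using l a b by simp
        show "coeff ?s (f0 + f1) j \<le> ennreal (x j + y j)" for j
          using besov_coeff_add[OF D p sC t(1,2), of j] x[of j] y[of j] by simp
        show "0 \<le> x j + y j" for j using x(2) y(2) by simp
      qed
    qed
    then show ?thesis using a b by (simp add: ennreal_mult)
  qed
  have z0: "snd target (\<lambda>_. 0) = 0"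
  proof -
    have "snd target (\<lambda>_. 0) \<le> (\<Sum>j. Lp_norm p (\<lambda>x. 0))"
      unfolding besov_def snd_besov_from
      using mixed_norm_le_suminf[OF p_ge_0 q0_ge_1, where f = "\<lambda>j x. of_real (2 powr (real j * ?s x)) * convolution (\<phi> j) (\<lambda>_. 0) x"]
      by (simp add: convolution_def)
    then show ?thesis by simp
  qed
  have zt: "(\<lambda>_. 0) \<in> tempered_distributions"
    unfolding tempered_distributions_def by (auto intro: exI[of _ "1::real"])
  note self = sum_carrier_self_le[of target, unfolded z0, OF _ fst_target zt]
  \<comment> \<open>With all weight at index 0 the sums in \<open>interpolation_space_eqI\<close>
    collapse to \<open>min 1 t\<close> times the norm, and the normalised sum says just that the
    norm is at most the scale.\<close>
  define B where "B = (\<lambda>f (i::nat). if i = 0 then snd target f else 0)"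
  have Bs: "(\<Sum>i. c i * B f i) = c 0 * snd target f" for f and c :: "nat \<Rightarrow> ennreal"
    using suminf_finite[of "{0}" "\<lambda>i. c i * B f i"] by (simp add: B_def)
  show ?thesis
  proof (rule interpolation_space_eqI[where X = tempered_distributions and B = B and d = 1 and ?C1.0 = 2 and ?C2.0 = 1 and ?C3.0 = 1, OF \<theta> q])
    show "fst target = {f \<in> tempered_distributions. snd target f < top}" by (rule fst_target)
    show "sum_carrier target target \<subseteq> tempered_distributions" unfolding besov_def
      unfolding sum_carrier_def by (auto simp: fst_besov_from intro: tempered_distributions_add)
    show "snd target f < top" if "f \<in> fst target" for f using that by (simp add: fst_target)
    then show "snd target f < top" if "f \<in> fst target" for f using that .
    show "ennreal (2 powr (real i * 1)) * B f i \<le> ennreal 2 * K_functional target target (2 powr (real i * 1)) f" for f i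
    proof (cases "i = 0")
      case True
      have half: "ennreal (1/2) * (ennreal 2 * X) = X" for X
      proof -
        have "ennreal (1/2) * ennreal 2 = 1" by (subst ennreal_mult[symmetric]) auto
        then show ?thesis by (simp only: mult.assoc[symmetric] mult_1)
      qed
      have "ennreal (1/2) * snd target f \<le> K_functional target target 1 f"
        unfolding K_functional_def
      proof (rule INF_greatest, safe)
        fix f0 f1 assume "f0 \<in> fst target" "f1 \<in> fst target"
        then have "ennreal (1/2) * snd target (f0 + f1) \<le> ennreal (1/2) * (ennreal 2 * (snd target f0 + snd target f1))"
          by (intro mult_left_mono quasi) auto
        also have "\<dots> = snd target f0 + ennreal 1 * snd target f1"
          unfolding half by simp
        finally show "ennreal (1/2) * snd target (f0 + f1) \<le> snd target f0 + ennreal 1 * snd target f1" .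
      qed
      then have "ennreal 2 * (ennreal (1/2) * snd target f) \<le> ennreal 2 * K_functional target target 1 f" by (rule mult_left_mono) simp
      moreover have "ennreal 2 * (ennreal (1/2) * snd target f) = snd target f"
        using half[of "snd target f"] by (simp only: mult.left_commute)
      ultimately show ?thesis using True by (simp add: B_def)
    qed (simp add: B_def)
    show "f \<in> sum_carrier target target \<and> K_functional target target t f \<le> ennreal 1 * (\<Sum>i. ennreal (min (2 powr (real i * 1)) t) * B f i)"
      if f: "f \<in> tempered_distributions" and t: "0 < t" and fin: "(\<Sum>i. ennreal (min (2 powr (real i * 1)) t) * B f i) < top" for f t
    proof -
      have "ennreal (min 1 t) * snd target f < top" using fin unfolding Bs by simp
      then have "snd target f < top" using t by (auto simp: ennreal_mult_less_top)
      then have "f \<in> fst target" using f by (simp add: fst_target)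
      from self[OF _ this] show ?thesis unfolding Bs using t by (auto simp: min_def)
    qed
    show "snd target f \<le> ennreal (1 * m)"
      if m: "0 < m" and fin: "\<And>i. B f i < top" and S: "(\<Sum>i. ennreal ((2 powr (real i * (1 - \<theta>) * 1) * enn2real (B f i) / m) powr q 0)) \<le> 1" for f m
    proof -
      have "ennreal ((2 powr (real 0 * (1 - \<theta>) * 1) * enn2real (B f 0) / m) powr q 0) \<le> 1"
        by (rule order_trans[OF ennreal_le_suminf S])
      then have "(enn2real (snd target f) / m) powr q 0 \<le> 1" by (simp add: B_def)
      then have "enn2real (snd target f) / m \<le> 1" by (rule powr_le_1_cancel) (use m q0_ge_1 in auto)
      then have "enn2real (snd target f) \<le> m" using m by simp
      then have le: "ennreal (enn2real (snd target f)) \<le> ennreal (1 * m)" by (intro ennreal_leI) simp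
      have "snd target f < top" using fin[of 0] by (simp add: B_def)
      then have "ennreal (enn2real (snd target f)) = snd target f" by (rule ennreal_enn2real)
      then show ?thesis using le by (simp only:)
    qed
    show "(\<forall>i. B f i < top) \<and> (\<Sum>i. ennreal ((2 powr (real i * (1 - \<theta>) * 1) * enn2real (B f i) / (1 * m)) powr q 0)) \<le> 1"
      if s: "snd target f < ennreal m" for f m
    proof -
      obtain a where a: "snd target f = ennreal a" "0 \<le> a" using s by (cases "snd target f") auto
      have am: "a < m" using s a by (simp add: ennreal_less_iff)
      have term_eq: "ennreal ((2 powr (real i * (1 - \<theta>) * 1) * enn2real (B f i) / (1 * m)) powr q 0)
        = (if i = 0 then ennreal ((a / m) powr q 0) else 0)" for i
      proof (cases "i = 0")
        case True
        have "B f i = ennreal a" unfolding B_def using True a(1) by simp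
        then show ?thesis using True a(2) by simp
      next
        case False
        then have "B f i = 0" unfolding B_def by simp
        then show ?thesis using False by simp
      qed
      have "(\<Sum>i. if i = 0 then ennreal ((a / m) powr q 0) else 0) = (\<Sum>i\<in>{0::nat}. if i = 0 then ennreal ((a / m) powr q 0) else 0)"
        by (rule suminf_finite) auto
      also have "\<dots> \<le> ennreal 1"
      proof -
        have "(a / m) powr q 0 \<le> 1" using am a(2) q0_ge_1 by (intro powr_le1) auto
        then show ?thesis by (simp add: ennreal_leI)
      qed
      finally have S: "(\<Sum>i. ennreal ((2 powr (real i * (1 - \<theta>) * 1) * enn2real (B f i) / (1 * m)) powr q 0)) \<le> 1"
        unfolding term_eq by simp
      have "B f i < top" for i
        unfolding B_def using a(1) by simp
      then show ?thesis using S by blast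
    qed
  qed auto
qed

text \<open>With equal smoothness the two norms are those of exponents \<open>r0\<close> and
  \<open>r1\<close> of one sequence of block norms. Up to constants the target norm, raised to the
  power \<open>q 0\<close>, is the sum of \<open>2 ^ i * c i powr q 0\<close> over the rearrangement
  values \<open>c i\<close>: \<open>suminf_dyadic_le\<close> and \<open>suminf_blocks_le\<close>
  give the two directions. The relation between the exponents makes the weights of the interpolation
  space match \<open>2 powr (i / q 0)\<close>.\<close>

lemma interpolation_besov_equal_smoothness:
  fixes r0 r1 :: ennreal
  assumes d0: "d = 0" and r: "1 \<le> r0" "1 \<le> r1"
    and ne: "enn2real (1 / r0) \<noteq> enn2real (1 / r1)"
    and qr: "1 / q 0 = (1 - \<theta>) * enn2real (1 / r0) + \<theta> * enn2real (1 / r1)"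
  shows "same_space (interpolation_space (besov_const \<phi> \<alpha>0 p r0) (besov_const \<phi> \<alpha>1 p r1) \<theta> q) target"
proof -
  let ?A0 = "besov_const \<phi> \<alpha>0 p r0" and ?A1 = "besov_const \<phi> \<alpha>1 p r1"
  define \<rho>0 where "\<rho>0 = enn2real (1 / r0)"
  define \<rho>1 where "\<rho>1 = enn2real (1 / r1)"
  define \<delta> where "\<delta> = \<rho>0 - \<rho>1"
  have \<delta>: "\<delta> \<noteq> 0" unfolding \<delta>_def \<rho>0_def \<rho>1_def using ne by simp
  have \<rho>: "0 \<le> \<rho>0" "0 \<le> \<rho>1" "\<rho>0 \<le> 1" "\<rho>1 \<le> 1"
  proof -
    have "enn2real (1 / x) \<le> 1" if "1 \<le> x" for x :: ennreal
    proof (cases "x = top")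
      case False
      then show ?thesis using enn2real_inverse_exponent[OF that False] by simp
    qed simp
    then show "0 \<le> \<rho>0" "0 \<le> \<rho>1" "\<rho>0 \<le> 1" "\<rho>1 \<le> 1" unfolding \<rho>0_def \<rho>1_def using r by auto
  qed
  have q0: "1 \<le> q 0" by (rule q0_ge_1)
  have \<alpha>eq: "\<alpha>0 = \<alpha>1" using d d0 by (auto simp: fun_eq_iff)
  have s1: "(\<lambda>x. (1 - \<theta>) * \<alpha>0 x + \<theta> * \<alpha>1 x) = \<alpha>1" unfolding \<alpha>eq by (simp add: algebra_simps)
  define b where "b = coeff \<alpha>1"
  have tu: "snd target f \<le> ennreal m"
    if "0 < m" "\<And>j. b f j \<le> ennreal (v j)" "\<And>j. 0 \<le> v j" "(\<Sum>j. ennreal ((v j / m) powr q 0)) \<le> 1" for f m v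
    using that unfolding b_def by (intro target_upper[of m f v]) (auto simp: s1)
  have tl: "b f j < top" "(\<Sum>j. ennreal ((enn2real (b f j) / m) powr q 0)) \<le> 1"
    if "snd target f < ennreal m" for f m j
    using target_lower[OF that] unfolding b_def s1 by auto
  have A: "fst ?A0 = {f \<in> tempered_distributions. snd ?A0 f < top}" "fst ?A1 = {f \<in> tempered_distributions. snd ?A1 f < top}"
    unfolding besov_const_def by (rule fst_besov_from)+
  define W where "W = (\<lambda>f j x. of_real (2 powr (real j * \<alpha>1 x)) * convolution (\<phi> j) f x)"
  have sndA: "snd ?A0 f = mixed_norm_const p r0 (W f)" "snd ?A1 f = mixed_norm_const p r1 (W f)" for f
    unfolding besov_const_def snd_besov_from W_def \<alpha>eq by auto
  have bW: "b f j = Lp_norm p (W f j)" for f j unfolding b_def besov_coeff_def[OF D p] W_def by simp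
  define c where "c = (\<lambda>f. dyadic_rearrangement (b f))"
  \<comment> \<open>The weight is chosen so that \<open>2 powr (i * \<delta>) * B f i\<close> is the
    \<open>r0\<close>-size \<open>2 powr (i * \<rho>0) * c f i\<close> of block \<open>i\<close>,
    \<open>B f i\<close> its \<open>r1\<close>-size, and
    \<open>2 powr (i * (1 - \<theta>) * \<delta>) * B f i\<close> its size for the exponent
    \<open>q 0\<close>.\<close>
  define B where "B = (\<lambda>f i. ennreal (2 powr (real i * \<rho>1)) * c f i)"
  have expo: "2 powr (real i * (1 - \<theta>) * \<delta>) * 2 powr (real i * \<rho>1) = 2 powr (real i / q 0)" for i :: nat
  proof -
    have "real i * (1 - \<theta>) * \<delta> + real i * \<rho>1 = real i * (1 / q 0)"
      unfolding qr \<delta>_def \<rho>0_def \<rho>1_def by (simp add: algebra_simps)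
    then show ?thesis by (simp flip: powr_add)
  qed
  have expo2: "2 powr (real i * \<delta>) * 2 powr (real i * \<rho>1) = 2 powr (real i * \<rho>0)" for i :: nat
    unfolding \<delta>_def by (simp add: algebra_simps flip: powr_add)
  obtain C where C: "0 < C" "\<And>T S. \<lbrakk>T \<in> tempered_distributions; finite S \<or> finite (- S)\<rbrakk> \<Longrightarrow>
    \<exists>T0\<in>tempered_distributions. \<exists>T1\<in>tempered_distributions. T = T0 + T1 \<and>
      (\<forall>k. b T0 k \<le> ennreal C * (\<Sum>j\<in>{k - 1..Suc k} \<inter> S. b T j)) \<and>
      (\<forall>k. b T1 k \<le> ennreal C * (\<Sum>j\<in>{k - 1..Suc k} - S. b T j))"
    using dyadic_splitting[OF D p \<alpha>1 \<alpha>1] unfolding b_def by blast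
  \<comment> \<open>Cut at index \<open>i + 1\<close>, so that coefficients between
    \<open>c f (i + 1)\<close> and \<open>c f i\<close> lie in \<open>G f i\<close>; hence the bound
    \<open>2 ^ Suc i\<close> for its size.\<close>
  define G where "G = (\<lambda>f i. {j. c f (Suc i) < b f j})"
  have G: "finite (G f i)" "card (G f i) \<le> 2 ^ Suc i" for f i
    unfolding G_def c_def using dyadic_rearrangement_level[of "b f" "Suc i"] by auto
  \<comment> \<open>The quarter is a product of two halves: one from having only half of the
    \<open>2 ^ i\<close> indices, as \<open>(1 / 2) powr \<rho> \<ge> 1 / 2\<close> for
    \<open>\<rho> \<le> 1\<close>, the other from the level \<open>s / 2\<close>.\<close>
  have half: "ennreal (2 powr (real i * \<rho>) * (s / 4)) \<le> mixed_norm_const p r (W g)"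
    if "1 \<le> r" "\<rho> = enn2real (1 / r)" "\<rho> \<le> 1" "finite F" "2 ^ i \<le> 2 * card F" "0 \<le> s" "\<And>j. j \<in> F \<Longrightarrow> ennreal (s / 2) \<le> b g j"
    for i \<rho> s r F g
  proof -
    have F: "F \<noteq> {}" using that(5) by auto
    have \<rho>0: "0 \<le> \<rho>" using that(2) by simp
    have "real (2 ^ i) \<le> real (2 * card F)" using that(5) by (rule of_nat_mono)
    then have cF: "2 ^ i / 2 \<le> real (card F)" by simp
    have "2 powr (real i * \<rho>) / 2 \<le> 2 powr (real i * \<rho>) * (1 / 2) powr \<rho>"
    proof -
      have "(1 / 2) powr 1 \<le> (1 / 2 :: real) powr \<rho>" using that(3) by (intro powr_mono') auto
      then show ?thesis by simp
    qed
    also have "2 powr (real i * \<rho>) * (1 / 2) powr \<rho> = (2 ^ i / 2) powr \<rho>"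
      by (simp add: powr_divide powr_powr flip: powr_realpow)
    also have "\<dots> \<le> real (card F) powr \<rho>" using cF \<rho>0 by (intro powr_mono2) auto
    finally have "2 powr (real i * \<rho>) / 2 * (s / 2) \<le> real (card F) powr \<rho> * (s / 2)"
      using that(6) by (intro mult_right_mono) auto
    then have "ennreal (2 powr (real i * \<rho>) * (s / 4)) \<le> ennreal (real (card F) powr \<rho> * (s / 2))"
      by (intro ennreal_leI) simp
    also have "\<dots> \<le> mixed_norm_const p r (W g)"
      unfolding that(2) using that by (intro mixed_norm_const_lower[OF p_ge_0 that(1,4) F]) (auto simp: bW)
    finally show ?thesis .
  qed
  have low: "ennreal (2 powr (real i * \<delta>)) * B f i \<le> ennreal 4 * K_functional ?A0 ?A1 (2 powr (real i * \<delta>)) f" for f i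
  proof -
    have "ennreal (1 / 4) * (ennreal (2 powr (real i * \<delta>)) * B f i) \<le> K_functional ?A0 ?A1 (2 powr (real i * \<delta>)) f"
      unfolding K_functional_def
    proof (rule INF_greatest, safe)
      fix f0 f1 assume "f0 \<in> fst ?A0" "f1 \<in> fst ?A1"
      then have t: "f0 \<in> tempered_distributions" "f1 \<in> tempered_distributions" by (auto simp: A)
      define Z where "Z = snd ?A0 f0 + ennreal (2 powr (real i * \<delta>)) * snd ?A1 f1"
      \<comment> \<open>Pigeonhole: at each of \<open>2 ^ i\<close> indices where the coefficient of
        \<open>f0 + f1\<close> exceeds \<open>s\<close>, that of \<open>f0\<close> or of
        \<open>f1\<close> is at least \<open>s / 2\<close>, so one of the two has this at half of
        the indices at least.\<close>
      have key: "ennreal (2 powr (real i * \<rho>0) * (s / 4)) \<le> Z" if s: "0 \<le> s" "ennreal s < c (f0 + f1) i" for s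
      proof -
        obtain F where F: "finite F" "card F = 2 ^ i" "\<And>j. j \<in> F \<Longrightarrow> ennreal s < b (f0 + f1) j"
          using less_dyadic_rearrangement[OF s[unfolded c_def]] by blast
        define F0 where "F0 = {j \<in> F. ennreal (s / 2) \<le> b f0 j}"
        define F1 where "F1 = {j \<in> F. ennreal (s / 2) \<le> b f1 j}"
        have sub: "F \<subseteq> F0 \<union> F1"
        proof
          fix j assume j: "j \<in> F"
          show "j \<in> F0 \<union> F1"
          proof (rule ccontr)
            assume "j \<notin> F0 \<union> F1"
            then have lt: "b f0 j < ennreal (s / 2)" "b f1 j < ennreal (s / 2)" using j unfolding F0_def F1_def by auto
            have "b (f0 + f1) j \<le> b f0 j + b f1 j" unfolding b_def by (rule besov_coeff_add[OF D p \<alpha>1 t])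
            also have "\<dots> \<le> ennreal (s / 2) + ennreal (s / 2)" using lt by (intro add_mono) auto
            also have "\<dots> = ennreal (s / 2 + s / 2)" using s by (intro ennreal_plus[symmetric]) auto
            finally show False using F(3)[OF j] by simp
          qed
        qed
        have F01: "finite F0" "finite F1" unfolding F0_def F1_def using F(1) by auto
        then have "finite (F0 \<union> F1)" by simp
        from card_mono[OF this sub] have "card F \<le> card F0 + card F1" using card_Un_le[of F0 F1] by linarith
        then have "2 ^ i \<le> 2 * card F0 \<or> 2 ^ i \<le> 2 * card F1" using F(2) by linarith
        then show ?thesis
        proof
          assume "2 ^ i \<le> 2 * card F0"
          then have "ennreal (2 powr (real i * \<rho>0) * (s / 4)) \<le> snd ?A0 f0"
            unfolding sndA(1) by (intro half[OF r(1) \<rho>0_def \<rho>(3) F01(1) _ s(1)]) (auto simp: F0_def)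
          also have "\<dots> \<le> Z" unfolding Z_def by simp
          finally show ?thesis .
        next
          assume "2 ^ i \<le> 2 * card F1"
          then have "ennreal (2 powr (real i * \<rho>1) * (s / 4)) \<le> snd ?A1 f1"
            unfolding sndA(2) by (intro half[OF r(2) \<rho>1_def \<rho>(4) F01(2) _ s(1)]) (auto simp: F1_def)
          then have "ennreal (2 powr (real i * \<delta>)) * ennreal (2 powr (real i * \<rho>1) * (s / 4)) \<le> ennreal (2 powr (real i * \<delta>)) * snd ?A1 f1"
            by (rule mult_left_mono) simp
          also have "\<dots> \<le> Z" unfolding Z_def by simp
          finally show ?thesis using s by (simp add: mult.assoc[symmetric] expo2 flip: ennreal_mult)
        qed
      qed
      define w where "w = 2 powr (real i * \<rho>0) / 4"
      have w: "0 < w" unfolding w_def by simp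
      have "c (f0 + f1) i \<le> ennreal (1 / w) * Z"
      proof (rule dense_le)
        fix y assume y: "y < c (f0 + f1) i"
        then obtain s where s: "y = ennreal s" "0 \<le> s" by (cases y) auto
        have "ennreal (w * s) \<le> Z" using key[of s] y s unfolding w_def by simp
        then have "ennreal (1 / w) * ennreal (w * s) \<le> ennreal (1 / w) * Z" by (rule mult_left_mono) simp
        moreover have "ennreal (1 / w) * ennreal (w * s) = y" using w s by (simp flip: ennreal_mult)
        ultimately show "y \<le> ennreal (1 / w) * Z" by simp
      qed
      then have "ennreal w * c (f0 + f1) i \<le> ennreal w * (ennreal (1 / w) * Z)" by (rule mult_left_mono) simp
      moreover have "ennreal w * (ennreal (1 / w) * Z) = Z"
      proof -
        have "ennreal w * ennreal (1 / w) = 1" using w by (subst ennreal_mult[symmetric]) auto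
        then show ?thesis by (simp only: mult.assoc[symmetric] mult_1)
      qed
      moreover have "ennreal (1 / 4) * (ennreal (2 powr (real i * \<delta>)) * B (f0 + f1) i) = ennreal w * c (f0 + f1) i"
      proof -
        have "ennreal w = ennreal (1 / 4) * (ennreal (2 powr (real i * \<delta>)) * ennreal (2 powr (real i * \<rho>1)))"
          unfolding w_def expo2[symmetric] by (subst ennreal_mult[symmetric], simp, simp, subst ennreal_mult[symmetric], simp, simp) simp
        then show ?thesis unfolding B_def by (simp only: mult.assoc)
      qed
      ultimately show "ennreal (1 / 4) * (ennreal (2 powr (real i * \<delta>)) * B (f0 + f1) i)
        \<le> snd ?A0 f0 + ennreal (2 powr (real i * \<delta>)) * snd ?A1 f1" unfolding Z_def by simp
    qed
    then have "ennreal 4 * (ennreal (1 / 4) * (ennreal (2 powr (real i * \<delta>)) * B f i)) \<le> ennreal 4 * K_functional ?A0 ?A1 (2 powr (real i * \<delta>)) f"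
      by (rule mult_left_mono) simp
    moreover have "ennreal 4 * (ennreal (1 / 4) * Y) = Y" for Y
    proof -
      have "ennreal 4 * ennreal (1 / 4) = 1" by (subst ennreal_mult[symmetric]) auto
      then show ?thesis by (simp only: mult.assoc[symmetric] mult_1)
    qed
    ultimately show ?thesis by simp
  qed
  have up: "f \<in> sum_carrier ?A0 ?A1 \<and> K_functional ?A0 ?A1 t f \<le> ennreal (18 * C) * (\<Sum>i. ennreal (min (2 powr (real i * \<delta>)) t) * B f i)"
    if f: "f \<in> tempered_distributions" and t: "0 < t" and fin: "(\<Sum>i. ennreal (min (2 powr (real i * \<delta>)) t) * B f i) < top" for f t
  proof -
    \<comment> \<open>Since \<open>\<rho>0\<close> and \<open>\<rho>1\<close> are nonnegative, the
      finite sum dominates a multiple of the sum of the \<open>c f i\<close>. Hence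
      \<open>c f\<close> tends to 0, and every nonzero coefficient lies in some block.\<close>
    have term_ge: "ennreal (min 1 t) * c f i \<le> ennreal (min (2 powr (real i * \<delta>)) t) * B f i" for i
    proof -
      have "1 \<le> 2 powr (real i * \<rho>0)" "1 \<le> 2 powr (real i * \<rho>1)" using \<rho> by (auto intro: ge_one_powr_ge_zero)
      moreover have "min (2 powr (real i * \<delta>)) t * 2 powr (real i * \<rho>1) = min (2 powr (real i * \<rho>0)) (t * 2 powr (real i * \<rho>1))"
        by (simp add: min_mult_distrib_right expo2)
      moreover have "t * 1 \<le> t * 2 powr (real i * \<rho>1)" using calculation(2) t by (intro mult_left_mono) auto
      ultimately have "min 1 t \<le> min (2 powr (real i * \<delta>)) t * 2 powr (real i * \<rho>1)" by (simp add: min_def split: if_splits)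
      then have "ennreal (min 1 t) * c f i \<le> ennreal (min (2 powr (real i * \<delta>)) t * 2 powr (real i * \<rho>1)) * c f i"
        by (intro mult_right_mono ennreal_leI) auto
      then show ?thesis unfolding B_def using t by (simp add: ennreal_mult mult.assoc)
    qed
    have "ennreal (min 1 t) * (\<Sum>i. c f i) = (\<Sum>i. ennreal (min 1 t) * c f i)" by simp
    also have "\<dots> \<le> (\<Sum>i. ennreal (min (2 powr (real i * \<delta>)) t) * B f i)" by (intro suminf_le term_ge) auto
    also have "\<dots> < top" by (rule fin)
    finally have cs: "(\<Sum>i. c f i) < top" using t by (auto simp: ennreal_mult_less_top)
    define y where "y = (\<lambda>i. enn2real (c f i))"
    have cfin: "c f i < top" for i by (rule le_less_trans[OF ennreal_le_suminf cs])
    have y: "c f i = ennreal (y i)" "0 \<le> y i" for i unfolding y_def using cfin[of i] by auto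
    have "summable y" using cs y by (intro summable_suminf_not_top) auto
    then have ylim: "y \<longlonglongrightarrow> 0" by (rule summable_LIMSEQ_zero)
    have clim: "\<exists>i. c f i < e" if "0 < e" for e
    proof (cases e)
      case (real e')
      then have "0 < e'" using that by simp
      then have "eventually (\<lambda>i. y i < e') sequentially" using order_tendstoD(2)[OF ylim] by blast
      then obtain i where "y i < e'" by (auto simp: eventually_sequentially)
      then have "c f i < e" using y[of i] real by (simp add: ennreal_less_iff)
        then show ?thesis by blast
    next
      case top then show ?thesis using cfin by blast
    qed
    have block: "\<exists>i. j \<in> G f i \<and> b f j \<le> c f i" if "b f j \<noteq> 0" for j
      using dyadic_rearrangement_block[OF that clim[unfolded c_def]] unfolding G_def c_def by auto
    define \<beta> where "\<beta> = (\<lambda>j. enn2real (b f j))"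
    have bfin: "b f j < top" for j
    proof (cases "b f j = 0")
      case False
      then show ?thesis using block[of j] cfin le_less_trans by blast
    qed simp
    have \<beta>: "b f j = ennreal (\<beta> j)" "0 \<le> \<beta> j" for j unfolding \<beta>_def using bfin[of j] by auto
    define J0 where "J0 = {i::nat. 2 powr (real i * \<delta>) \<le> t}"
    have J0: "i \<in> J0 \<longleftrightarrow> real i * (\<delta> * ln 2) \<le> ln t" for i
    proof -
      have "2 powr (real i * \<delta>) = exp (real i * (\<delta> * ln 2))" by (simp add: powr_def mult_ac)
      then show ?thesis unfolding J0_def using t by (simp add: ln_ge_iff)
    qed
    have fJ: "finite J0 \<or> finite (- J0)"
    proof (cases "0 < \<delta>")
      case True
      have "J0 \<subseteq> {..nat \<lceil>ln t / (\<delta> * ln 2)\<rceil>}"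
      proof
        fix i assume "i \<in> J0"
        then have "real i \<le> ln t / (\<delta> * ln 2)" using True by (simp add: J0 pos_le_divide_eq)
        then show "i \<in> {..nat \<lceil>ln t / (\<delta> * ln 2)\<rceil>}" by simp linarith
      qed
      then show ?thesis using finite_subset by blast
    next
      case False
      then have neg: "\<delta> * ln 2 < 0" using \<delta> by (simp add: mult_neg_pos)
      have "- J0 \<subseteq> {..nat \<lceil>ln t / (\<delta> * ln 2)\<rceil>}"
      proof
        fix i assume "i \<in> - J0"
        then have "ln t < real i * (\<delta> * ln 2)" by (simp add: J0)
        then have "real i < ln t / (\<delta> * ln 2)" using neg by (simp add: neg_less_divide_eq)
        then show "i \<in> {..nat \<lceil>ln t / (\<delta> * ln 2)\<rceil>}" by simp linarith
      qed
      then show ?thesis using finite_subset by blast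
    qed
    define Bl where "Bl = (\<lambda>J. {j. \<exists>i\<in>J. j \<in> G f i \<and> b f j \<le> c f i})"
    have Blfin: "finite (Bl J)" if "finite J" for J
    proof (rule finite_subset)
      show "Bl J \<subseteq> (\<Union>i\<in>J. G f i)" unfolding Bl_def by auto
      show "finite (\<Union>i\<in>J. G f i)" using that G by auto
    qed
    \<comment> \<open>The blocks on the finite side of \<open>J0\<close> and \<open>- J0\<close>
      form one part and everything else the other. Vanishing coefficients belong to no block and so
      fall to the infinite part, which keeps the split finite against cofinite.\<close>
    obtain S where S: "finite S \<or> finite (- S)"
      "\<And>j. j \<in> S \<Longrightarrow> b f j \<noteq> 0 \<Longrightarrow> j \<in> Bl J0" "\<And>j. j \<in> - S \<Longrightarrow> b f j \<noteq> 0 \<Longrightarrow> j \<in> Bl (- J0)"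
    proof (cases "finite J0")
      case True
      have "j \<in> Bl (- J0)" if "j \<in> - Bl J0" "b f j \<noteq> 0" for j
        using block[OF that(2)] that(1) unfolding Bl_def by blast
      then show thesis using Blfin[OF True] by (intro that[of "Bl J0"]) auto
    next
      case False
      then have fin': "finite (- J0)" using fJ by simp
      have "j \<in> Bl J0" if "j \<in> - Bl (- J0)" "b f j \<noteq> 0" for j
        using block[OF that(2)] that(1) unfolding Bl_def by blast
      then show thesis using Blfin[OF fin'] by (intro that[of "- Bl (- J0)"]) auto
    qed
    obtain f0 f1 where f01: "f0 \<in> tempered_distributions" "f1 \<in> tempered_distributions" "f = f0 + f1"
      "\<And>k. b f0 k \<le> ennreal C * (\<Sum>j\<in>{k - 1..Suc k} \<inter> S. b f j)"
      "\<And>k. b f1 k \<le> ennreal C * (\<Sum>j\<in>{k - 1..Suc k} - S. b f j)"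
      using C(2)[OF f S(1)] by blast
    have diff: "X - S = X \<inter> - S" for X by auto
    have conv: "ennreal C * (\<Sum>j\<in>{k - 1..Suc k} \<inter> S'. b f j) = ennreal (C * (\<Sum>j\<in>{k - 1..Suc k}. if j \<in> S' then \<beta> j else 0))" for k S'
    proof -
      have "(\<Sum>j\<in>{k - 1..Suc k} \<inter> S'. b f j) = (\<Sum>j\<in>{k - 1..Suc k}. if j \<in> S' then b f j else 0)"
        by (rule sum.inter_restrict) simp
      also have "\<dots> = (\<Sum>j\<in>{k - 1..Suc k}. ennreal (if j \<in> S' then \<beta> j else 0))"
        by (rule sum.cong) (auto simp: \<beta>(1))
      also have "\<dots> = ennreal (\<Sum>j\<in>{k - 1..Suc k}. if j \<in> S' then \<beta> j else 0)"
        by (rule sum_ennreal) (auto simp: \<beta>(2))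
      finally show ?thesis using C(1) \<beta>(2) by (simp add: ennreal_mult sum_nonneg del: sum.cl_ivl_Suc)
    qed
    \<comment> \<open>Used twice, for \<open>r0\<close> with the blocks in \<open>J0\<close> and for
      \<open>r1\<close> with the remaining ones. The sum on the right may be infinite at this stage,
      in which case nothing is claimed.\<close>
    have part: "mixed_norm_const p r (W g) \<le> ennreal (18 * C) * (\<Sum>i. if i \<in> J then ennreal (2 powr (real i * enn2real (1 / r))) * c f i else 0)"
      if r: "1 \<le> r" and g: "\<And>k. b g k \<le> ennreal C * (\<Sum>j\<in>{k - 1..Suc k} \<inter> S'. b f j)"
        and S': "\<And>j. j \<in> S' \<Longrightarrow> b f j \<noteq> 0 \<Longrightarrow> j \<in> Bl J" for r g S' J
    proof -
      define X where "X = (\<Sum>i. if i \<in> J then ennreal (2 powr (real i * enn2real (1 / r))) * c f i else 0)"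
      have Xe: "X = (\<Sum>i. ennreal (if i \<in> J then 2 powr (real i * enn2real (1 / r)) * y i else 0))"
        unfolding X_def by (rule arg_cong[where f = suminf]) (auto simp: y ennreal_mult)
      show ?thesis
      proof (cases X)
        case (real M)
        have "mixed_norm_const p r (W g) \<le> ennreal (18 * C * M)"
        proof (rule mixed_norm_const_blocks[OF p_ge_0 r C(1) real(1) \<beta>(2) y(2) _ G])
          show "Lp_norm p (W g k) \<le> ennreal (C * (\<Sum>j\<in>{k - 1..Suc k}. if j \<in> S' then \<beta> j else 0))" for k
            using g[of k] unfolding conv bW[symmetric] .
          show "\<exists>i\<in>J. j \<in> G f i \<and> \<beta> j \<le> y i" if jS: "j \<in> S'" and jb: "\<beta> j \<noteq> 0" for j
          proof -
            have "b f j \<noteq> 0" using jb \<beta>[of j] by simp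
            from S'[OF jS this] obtain i where "i \<in> J" "j \<in> G f i" "b f j \<le> c f i" unfolding Bl_def by blast
            then show ?thesis using \<beta>[of j] y[of i] by auto
          qed
          show "(\<Sum>i. ennreal (if i \<in> J then 2 powr (real i * enn2real (1 / r)) * y i else 0)) \<le> ennreal M"
            using real(2) unfolding Xe by simp
        qed
        then show ?thesis unfolding X_def[symmetric] real(2) using C(1) real(1) by (simp add: ennreal_mult)
      next
        case top
        then show ?thesis unfolding X_def[symmetric] using C(1) by (simp add: ennreal_mult_top)
      qed
    qed
    have p0: "snd ?A0 f0 \<le> ennreal (18 * C) * (\<Sum>i. if i \<in> J0 then ennreal (2 powr (real i * \<rho>0)) * c f i else 0)"
      unfolding sndA \<rho>0_def by (rule part[OF r(1) f01(4) S(2)])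
    have p1: "snd ?A1 f1 \<le> ennreal (18 * C) * (\<Sum>i. if i \<in> - J0 then ennreal (2 powr (real i * \<rho>1)) * c f i else 0)"
      unfolding sndA \<rho>1_def by (rule part[OF r(2) f01(5)[unfolded diff] S(3)])
    have "snd ?A0 f0 + ennreal t * snd ?A1 f1
      \<le> ennreal (18 * C) * (\<Sum>i. if i \<in> J0 then ennreal (2 powr (real i * \<rho>0)) * c f i else 0)
        + ennreal t * (ennreal (18 * C) * (\<Sum>i. if i \<in> - J0 then ennreal (2 powr (real i * \<rho>1)) * c f i else 0))"
      by (intro add_mono mult_left_mono p0 p1) auto
    also have "\<dots> = ennreal (18 * C) * ((\<Sum>i. if i \<in> J0 then ennreal (2 powr (real i * \<rho>0)) * c f i else 0)
        + (\<Sum>i. ennreal t * (if i \<in> - J0 then ennreal (2 powr (real i * \<rho>1)) * c f i else 0)))"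
      unfolding ennreal_suminf_cmult by (simp only: distrib_left mult.left_commute)
    also have "(\<Sum>i. if i \<in> J0 then ennreal (2 powr (real i * \<rho>0)) * c f i else 0)
        + (\<Sum>i. ennreal t * (if i \<in> - J0 then ennreal (2 powr (real i * \<rho>1)) * c f i else 0))
      = (\<Sum>i. (if i \<in> J0 then ennreal (2 powr (real i * \<rho>0)) * c f i else 0)
        + ennreal t * (if i \<in> - J0 then ennreal (2 powr (real i * \<rho>1)) * c f i else 0))"
      by (rule suminf_add) auto
    also have "\<dots> = (\<Sum>i. ennreal (min (2 powr (real i * \<delta>)) t) * B f i)"
    proof (rule arg_cong[where f = suminf], rule ext)
      fix i
      have "ennreal (2 powr (real i * \<rho>0)) = ennreal (2 powr (real i * \<delta>)) * ennreal (2 powr (real i * \<rho>1))"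
        unfolding expo2[symmetric] by (rule ennreal_mult) auto
      then show "(if i \<in> J0 then ennreal (2 powr (real i * \<rho>0)) * c f i else 0)
        + ennreal t * (if i \<in> - J0 then ennreal (2 powr (real i * \<rho>1)) * c f i else 0) = ennreal (min (2 powr (real i * \<delta>)) t) * B f i"
        unfolding B_def J0_def by (auto simp: min_def mult.assoc)
    qed
    finally have sum: "snd ?A0 f0 + ennreal t * snd ?A1 f1 \<le> ennreal (18 * C) * (\<Sum>i. ennreal (min (2 powr (real i * \<delta>)) t) * B f i)" .
    also have "\<dots> < top" using fin by (simp add: ennreal_mult_less_top)
    finally have "snd ?A0 f0 < top" "snd ?A1 f1 < top" using t by (auto simp: ennreal_mult_less_top)
    then have m: "f0 \<in> fst ?A0" "f1 \<in> fst ?A1" using f01 by (auto simp: A)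
    have "f \<in> sum_carrier ?A0 ?A1" unfolding sum_carrier_def using m f01(3) by blast
    moreover have "K_functional ?A0 ?A1 t f \<le> snd ?A0 f0 + ennreal t * snd ?A1 f1"
      unfolding f01(3) by (rule K_functional_lower[OF m])
    ultimately show ?thesis using order_trans[OF _ sum] by blast
  qed
  have Breal: "2 powr (real i * (1 - \<theta>) * \<delta>) * enn2real (B f i) = 2 powr (real i / q 0) * enn2real (c f i)" for f i
    unfolding B_def enn2real_mult expo[symmetric] by simp
  have powi: "(2 powr (real i / q 0) * v) powr q 0 = 2 ^ i * v powr q 0" for i :: nat and v
    using q0 unfolding powr_mult powr_powr by (simp add: powr_realpow)
  show ?thesis
  \<comment> \<open>The constants: 4 from the pigeonhole bound, \<open>18 * C\<close> from
    \<open>mixed_norm_const_blocks\<close>, and 2 because each comparison of the sequence with its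
    rearrangement doubles a sum, while doubling the scale gains
    \<open>(1 / 2) powr q 0 \<le> 1 / 2\<close>.\<close>
  proof (rule interpolation_space_eqI[where X = tempered_distributions and B = B and d = \<delta> and ?C1.0 = 4 and ?C2.0 = "18 * C" and ?C3.0 = 2, OF \<theta> q \<delta>])
    show "sum_carrier ?A0 ?A1 \<subseteq> tempered_distributions" unfolding besov_const_def by (rule sum_carrier_tempered)
    show "snd ?A0 f < top" if "f \<in> fst ?A0" for f using that by (simp add: A)
    show "snd ?A1 f < top" if "f \<in> fst ?A1" for f using that by (simp add: A)
    show "fst target = {f \<in> tempered_distributions. snd target f < top}" by (rule fst_target)
    show "ennreal (2 powr (real i * \<delta>)) * B f i \<le> ennreal 4 * K_functional ?A0 ?A1 (2 powr (real i * \<delta>)) f" for f i by (rule low)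
    show "f \<in> sum_carrier ?A0 ?A1 \<and> K_functional ?A0 ?A1 t f \<le> ennreal (18 * C) * (\<Sum>i. ennreal (min (2 powr (real i * \<delta>)) t) * B f i)"
      if "f \<in> tempered_distributions" "0 < t" "(\<Sum>i. ennreal (min (2 powr (real i * \<delta>)) t) * B f i) < top" for f t
      by (rule up[OF that])
    show "snd target f \<le> ennreal (2 * m)"
      if m: "0 < m" and fin: "\<And>i. B f i < top"
        and S: "(\<Sum>i. ennreal ((2 powr (real i * (1 - \<theta>) * \<delta>) * enn2real (B f i) / m) powr q 0)) \<le> 1" for f m
    proof -
      define y where "y = (\<lambda>i. enn2real (c f i))"
      have cfin: "c f i < top" for i using fin[of i] unfolding B_def by (auto simp: ennreal_mult_less_top)
      have y: "c f i = ennreal (y i)" "0 \<le> y i" for i unfolding y_def using cfin[of i] by auto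
      have S': "(\<Sum>i. ennreal (2 ^ i * (y i / m) powr q 0)) \<le> 1"
      proof -
        have "(2 powr (real i * (1 - \<theta>) * \<delta>) * enn2real (B f i) / m) powr q 0 = 2 ^ i * (y i / m) powr q 0" for i
          unfolding Breal y_def using powi[of i "enn2real (c f i) / m"] by simp
        then show ?thesis using S by simp
      qed
      have ylim: "(\<lambda>i. (y i / m) powr q 0) \<longlonglongrightarrow> 0"
      proof -
        have "summable (\<lambda>i. 2 ^ i * (y i / m) powr q 0)"
          using S' by (intro summable_suminf_not_top) (auto simp: top_unique)
        then have "(\<lambda>i. 2 ^ i * (y i / m) powr q 0) \<longlonglongrightarrow> 0" by (rule summable_LIMSEQ_zero)
        then show ?thesis
        proof (rule Lim_null_comparison[rotated])
          show "\<forall>\<^sub>F i in sequentially. norm ((y i / m) powr q 0) \<le> 2 ^ i * (y i / m) powr q 0"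
          proof (rule always_eventually, rule allI)
            fix i
            have "1 * (y i / m) powr q 0 \<le> 2 ^ i * (y i / m) powr q 0" by (intro mult_right_mono) auto
            then show "norm ((y i / m) powr q 0) \<le> 2 ^ i * (y i / m) powr q 0" by simp
          qed
        qed
      qed
      have clim: "\<exists>i. c f i < e" if "0 < e" for e
      proof (cases e)
        case (real e')
        then have "0 < (e' / m) powr q 0" using that m by simp
        then have "eventually (\<lambda>i. (y i / m) powr q 0 < (e' / m) powr q 0) sequentially" using order_tendstoD(2)[OF ylim] by blast
        then obtain i where i: "(y i / m) powr q 0 < (e' / m) powr q 0" by (auto simp: eventually_sequentially)
        have "y i < e'"
        proof (rule ccontr)
          assume "\<not> y i < e'"
          then have "(e' / m) powr q 0 \<le> (y i / m) powr q 0"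
            using real m q0 by (intro powr_mono2) (auto simp: divide_right_mono)
          then show False using i by simp
        qed
        then have "c f i < e" using y[of i] real by (simp add: ennreal_less_iff)
        then show ?thesis by blast
      next
        case top then show ?thesis using cfin by blast
      qed
      have block: "\<exists>i. j \<in> G f i \<and> b f j \<le> c f i" if "b f j \<noteq> 0" for j
        using dyadic_rearrangement_block[OF that clim[unfolded c_def]] unfolding G_def c_def by auto
      define \<beta> where "\<beta> = (\<lambda>j. enn2real (b f j))"
      have bfin: "b f j < top" for j
      proof (cases "b f j = 0")
        case False
        then show ?thesis using block[of j] cfin le_less_trans by blast
      qed simp
      have \<beta>: "b f j = ennreal (\<beta> j)" "0 \<le> \<beta> j" for j unfolding \<beta>_def using bfin[of j] by auto
      \<comment> \<open>From the rearrangement back to the sequence: all indices and all blocks take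
        part, whence the index sets \<open>UNIV\<close>.\<close>
      have "(\<Sum>j. ennreal (if j \<in> UNIV then (\<beta> j / (2 * m)) powr q 0 else 0))
        \<le> (\<Sum>i. ennreal (if i \<in> UNIV then 2 ^ Suc i * (y i / (2 * m)) powr q 0 else 0))"
      proof (rule suminf_blocks_le[where G = "G f", OF _ _ G])
        show "\<exists>i\<in>UNIV. j \<in> G f i \<and> \<beta> j / (2 * m) \<le> y i / (2 * m)" if "\<beta> j / (2 * m) \<noteq> 0" for j
        proof -
          have "b f j \<noteq> 0" using that \<beta>[of j] by auto
          then obtain i where "j \<in> G f i" "b f j \<le> c f i" using block by blast
          then show ?thesis using \<beta>[of j] y[of i] m by (intro bexI[of _ i]) (auto intro!: divide_right_mono)
        qed
      qed (use \<beta>(2) m q0 in auto)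
      also have "\<dots> \<le> (\<Sum>i. ennreal (2 ^ i * (y i / m) powr q 0))"
      proof (intro suminf_le ennreal_leI)
        fix i
        have "(y i / (2 * m)) powr q 0 = ((1/2) * (y i / m)) powr q 0" by simp
        also have "\<dots> = (1/2) powr q 0 * (y i / m) powr q 0" by (rule powr_mult)
        also have "\<dots> \<le> (1/2) * (y i / m) powr q 0"
          using powr_mono'[of 1 "q 0" "1/2"] q0 by (intro mult_right_mono) auto
        finally have "2 ^ Suc i * (y i / (2 * m)) powr q 0 \<le> 2 ^ Suc i * ((1/2) * (y i / m) powr q 0)" by (intro mult_left_mono) auto
        then show "(if i \<in> UNIV then 2 ^ Suc i * (y i / (2 * m)) powr q 0 else 0) \<le> 2 ^ i * (y i / m) powr q 0" by simp
      qed auto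
      also have "\<dots> \<le> 1" by (rule S')
      finally have "(\<Sum>j. ennreal ((\<beta> j / (2 * m)) powr q 0)) \<le> 1" by simp
      then show ?thesis using m \<beta> by (intro tu[of "2 * m" f \<beta>]) auto
    qed
    show "(\<forall>i. B f i < top) \<and> (\<Sum>i. ennreal ((2 powr (real i * (1 - \<theta>) * \<delta>) * enn2real (B f i) / (2 * m)) powr q 0)) \<le> 1"
      if s: "snd target f < ennreal m" for f m
    proof -
      have m: "0 < m" using s by (metis ennreal_neg not_less_zero not_le)
      define \<beta> where "\<beta> = (\<lambda>j. enn2real (b f j))"
      have \<beta>: "b f j = ennreal (\<beta> j)" "0 \<le> \<beta> j" for j unfolding \<beta>_def using tl(1)[OF s, of j] by auto
      have S: "(\<Sum>j. ennreal ((\<beta> j / m) powr q 0)) \<le> 1" unfolding \<beta>_def by (rule tl(2)[OF s])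
      have \<beta>m: "b f j \<le> ennreal m" for j
      proof -
        have "ennreal ((\<beta> j / m) powr q 0) \<le> 1" by (rule order_trans[OF ennreal_le_suminf S])
        then have "(\<beta> j / m) powr q 0 \<le> 1" by simp
        then have "\<beta> j / m \<le> 1" by (rule powr_le_1_cancel) (use \<beta>(2) m q0 in auto)
        then show ?thesis unfolding \<beta>(1) using m by (intro ennreal_leI) simp
      qed
      have cm: "c f i \<le> ennreal m" for i unfolding c_def using m \<beta>m by (intro dyadic_rearrangement_le) auto
      have cfin: "c f i < top" for i using cm[of i] ennreal_less_top by (rule le_less_trans)
      define y where "y = (\<lambda>i. enn2real (c f i))"
      have y: "c f i = ennreal (y i)" "0 \<le> y i" for i unfolding y_def using cfin[of i] by auto
      have "(\<Sum>i. ennreal (2 ^ i * (y i / m) powr q 0)) \<le> 2 * (\<Sum>j. ennreal ((\<beta> j / m) powr q 0))"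
      proof (rule suminf_dyadic_le)
        fix i s assume s: "0 \<le> s" "s < (y i / m) powr q 0"
        \<comment> \<open>The level for the coefficients that corresponds to the level
          \<open>s\<close> for their normalised powers of order \<open>q 0\<close>.\<close>
        define s' where "s' = m * s powr (1 / q 0)"
        have s'0: "0 \<le> s'" unfolding s'_def using m by simp
        have "s powr (1 / q 0) < ((y i / m) powr q 0) powr (1 / q 0)" using s q0 by (intro powr_less_mono2) auto
        also have "\<dots> = y i / m" using y(2)[of i] m q0 by (simp add: powr_powr)
        finally have "s' < y i" unfolding s'_def using m by (simp add: field_simps)
        then have "ennreal s' < dyadic_rearrangement (b f) i" using y[of i] s'0 unfolding c_def by (simp add: ennreal_less_iff)
        then obtain F where F: "finite F" "card F = 2 ^ i" "\<And>j. j \<in> F \<Longrightarrow> ennreal s' < b f j"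
          using less_dyadic_rearrangement[OF s'0] by blast
        have "s < (\<beta> j / m) powr q 0" if "j \<in> F" for j
        proof -
          have "s' < \<beta> j" using F(3)[OF that] \<beta>[of j] s'0 by (simp add: ennreal_less_iff)
          then have "s powr (1 / q 0) < \<beta> j / m" unfolding s'_def using m by (simp add: field_simps)
          then have "(s powr (1 / q 0)) powr q 0 < (\<beta> j / m) powr q 0" using q0 by (intro powr_less_mono2) auto
          then show ?thesis using s q0 by (simp add: powr_powr)
        qed
        then show "\<exists>F. finite F \<and> card F = 2 ^ i \<and> (\<forall>j\<in>F. s < (\<beta> j / m) powr q 0)" using F by blast
      qed auto
      also have "\<dots> \<le> 2 * 1" by (intro mult_left_mono S) auto
      finally have S2: "(\<Sum>i. ennreal (2 ^ i * (y i / m) powr q 0)) \<le> 2" by simp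
      have "(\<Sum>i. ennreal ((2 powr (real i * (1 - \<theta>) * \<delta>) * enn2real (B f i) / (2 * m)) powr q 0))
        \<le> (\<Sum>i. ennreal (1/2) * ennreal (2 ^ i * (y i / m) powr q 0))"
      proof (intro suminf_le)
        fix i
        have "(2 powr (real i * (1 - \<theta>) * \<delta>) * enn2real (B f i) / (2 * m)) powr q 0 = 2 ^ i * ((1/2) * (y i / m)) powr q 0"
          unfolding Breal y_def using powi[of i "(1/2) * (enn2real (c f i) / m)"] by simp
        also have "((1/2) * (y i / m)) powr q 0 = (1/2) powr q 0 * (y i / m) powr q 0" by (rule powr_mult)
        also have "\<dots> \<le> (1/2) * (y i / m) powr q 0"
          using powr_mono'[of 1 "q 0" "1/2"] q0 by (intro mult_right_mono) auto
        finally have "(2 powr (real i * (1 - \<theta>) * \<delta>) * enn2real (B f i) / (2 * m)) powr q 0 \<le> (1/2) * (2 ^ i * (y i / m) powr q 0)" by simp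
        then have "ennreal ((2 powr (real i * (1 - \<theta>) * \<delta>) * enn2real (B f i) / (2 * m)) powr q 0) \<le> ennreal ((1/2) * (2 ^ i * (y i / m) powr q 0))"
          by (rule ennreal_leI)
        also have "\<dots> = ennreal (1/2) * ennreal (2 ^ i * (y i / m) powr q 0)" by (rule ennreal_mult) auto
        finally show "ennreal ((2 powr (real i * (1 - \<theta>) * \<delta>) * enn2real (B f i) / (2 * m)) powr q 0) \<le> ennreal (1/2) * ennreal (2 ^ i * (y i / m) powr q 0)" .
      qed auto
      also have "\<dots> = ennreal (1/2) * (\<Sum>i. ennreal (2 ^ i * (y i / m) powr q 0))" by (rule ennreal_suminf_cmult)
      also have "\<dots> \<le> ennreal (1/2) * 2" by (intro mult_left_mono S2) auto
      also have "\<dots> = ennreal (1/2) * ennreal 2" by simp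
      also have "\<dots> = 1" by (subst ennreal_mult[symmetric]) auto
      finally have fin: "(\<Sum>i. ennreal ((2 powr (real i * (1 - \<theta>) * \<delta>) * enn2real (B f i) / (2 * m)) powr q 0)) \<le> 1" .
      have "B f i < top" for i unfolding B_def using cfin[of i] by (simp add: ennreal_mult_less_top)
      then show ?thesis using fin by blast
    qed
  qed (use C in auto)
qed

end

section \<open>From extended to real exponents, and the assembly of all cases\<close>

text \<open>For an infinite exponent both readings of its reciprocal are 0: a finite number divided
  by \<open>top\<close> vanishes in the extended reals, and so does
  \<open>enn2real (1 / top)\<close>. All other terms are honest real quotients.\<close>

lemma enn2real_interpolation_exponents:
  fixes r0 r1 :: ennreal
  assumes r: "1 \<le> r0" "1 \<le> r1" and \<theta>: "0 < \<theta>" "\<theta> < 1" and q: "1 \<le> q"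
    and eq: "1 / ennreal q = ennreal (1 - \<theta>) / r0 + ennreal \<theta> / r1"
  shows "1 / q = (1 - \<theta>) * enn2real (1 / r0) + \<theta> * enn2real (1 / r1)"
proof -
  have inv: "ennreal a / r = ennreal (a * enn2real (1 / r))" if "1 \<le> r" "0 \<le> a" for a and r :: ennreal
  proof (cases "r = top")
    case False
    then obtain R where R: "r = ennreal R" "0 \<le> R" by (cases r) auto
    then have "1 \<le> R" using enn2real_inverse_exponent(1)[OF that(1) False] by simp
    then show ?thesis
      using enn2real_inverse_exponent(2)[OF that(1) False] that(2) R by (simp add: divide_ennreal)
  qed simp
  have "1 / ennreal q = ennreal (1 / q)" using q divide_ennreal[of 1 q] by simp
  then have "ennreal (1 / q) = ennreal ((1 - \<theta>) * enn2real (1 / r0) + \<theta> * enn2real (1 / r1))"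
    using eq \<theta> by (simp add: inv[OF r(1)] inv[OF r(2)])
  then show ?thesis using \<theta> q by (subst (asm) ennreal_inj) auto
qed

lemma interpolation_besov_const:
  assumes D: "dyadic_resolution \<Psi> \<phi>" and p: "p \<in> log_exponents"
    and \<alpha>: "\<alpha>0 \<in> C_log_loc" "\<alpha>1 \<in> C_log_loc" and d: "\<And>x. \<alpha>0 x - \<alpha>1 x = d"
    and \<theta>: "0 < \<theta>" "\<theta> < 1"
    and q: "q \<in> exponents" "log_hoelder_at_origin q" "log_hoelder_at_infinity q (q 0)"
    and r: "1 \<le> r0" "1 \<le> r1" and qr: "1 / ennreal (q 0) = ennreal (1 - \<theta>) / r0 + ennreal \<theta> / r1"
  shows "same_space (interpolation_space (besov_const \<phi> \<alpha>0 p r0) (besov_const \<phi> \<alpha>1 p r1) \<theta> q)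
    (besov \<phi> (\<lambda>x. (1 - \<theta>) * \<alpha>0 x + \<theta> * \<alpha>1 x) p (\<lambda>_. q 0))"
proof (cases "d = 0")
  case False
  have p0: "0 \<le> p x" for x by (rule p_ge_0[OF D p \<alpha> d \<theta> q])
  show ?thesis unfolding besov_const_def
    by (rule interpolation_besov_distinct_smoothness[OF D p \<alpha> d \<theta> q False
      mixed_norm_const_ge[OF p0 r(1)] mixed_norm_const_le[OF p0 r(1)]
      mixed_norm_const_ge[OF p0 r(2)] mixed_norm_const_le[OF p0 r(2)]])
next
  case True
  have q0: "1 \<le> q 0" by (rule q0_ge_1[OF D p \<alpha> d \<theta> q])
  have qr': "1 / q 0 = (1 - \<theta>) * enn2real (1 / r0) + \<theta> * enn2real (1 / r1)"
    by (rule enn2real_interpolation_exponents[OF r \<theta> q0 qr])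
  show ?thesis
  proof (cases "enn2real (1 / r0) = enn2real (1 / r1)")
    case False
    show ?thesis by (rule interpolation_besov_equal_smoothness[OF D p \<alpha> d \<theta> q True r False qr'])
  next
    case eq: True
    \<comment> \<open>Equal reciprocals make the right-hand side of the exponent relation a single
      reciprocal, so \<open>r0\<close> and \<open>r1\<close> are both \<open>q 0\<close> and each
      space of the couple is the target itself.\<close>
    have req: "r = ennreal (q 0)" if "1 \<le> r" "1 / q 0 = enn2real (1 / r)" for r
    proof -
      have nt: "r \<noteq> top" using that(2) q0 by auto
      then have "q 0 = enn2real r" using enn2real_inverse_exponent[OF that(1) nt] that(2) q0 by simp
      then show ?thesis using nt by (simp add: less_top)
    qed
    have "1 / q 0 = enn2real (1 / r0)" and "1 / q 0 = enn2real (1 / r1)"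
      using qr' unfolding eq by (simp_all add: algebra_simps)
    then have rr: "r0 = ennreal (q 0)" "r1 = ennreal (q 0)" by (blast intro: req r)+
    have \<alpha>eq: "\<alpha>0 = \<alpha>1" using d True by (auto simp: fun_eq_iff)
    have s: "(\<lambda>x. (1 - \<theta>) * \<alpha>1 x + \<theta> * \<alpha>1 x) = \<alpha>1" by (rule ext) (simp add: algebra_simps)
    have "besov_const \<phi> \<alpha>1 p (ennreal (q 0)) = besov \<phi> \<alpha>1 p (\<lambda>_. q 0)"
      using q0 by (simp add: besov_const_def besov_def mixed_norm_const_def[abs_def])
    then show ?thesis
      using interpolation_besov_trivial[OF D p \<alpha> d \<theta> q True] unfolding rr \<alpha>eq s by simp
  qed
qed

theorem theorem6:
  fixes \<Psi> :: "real^'n::finite \<Rightarrow> complex"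
    and \<phi> :: "nat \<Rightarrow> real^'n \<Rightarrow> complex"
    and \<theta> q_inf d :: real
    and q :: "real \<Rightarrow> real"
    and p q0 q1 \<alpha>0 \<alpha>1 :: "real^'n \<Rightarrow> real"
  assumes "dyadic_resolution \<Psi> \<phi>"
    and "0 < \<theta>" and "\<theta> < 1"
    and "q \<in> exponents"
    and "log_hoelder_at_origin q" and "log_hoelder_at_infinity q q_inf" and "q 0 = q_inf"
    and "p \<in> log_exponents" and "q0 \<in> log_exponents" and "q1 \<in> log_exponents"
    and "\<alpha>0 \<in> C_log_loc" and "\<alpha>1 \<in> C_log_loc"
    and "\<And>x. \<alpha>0 x - \<alpha>1 x = d"
  shows "(d \<noteq> 0 \<longrightarrow>
            same_space
              (interpolation_space (besov \<phi> \<alpha>0 p q0) (besov \<phi> \<alpha>1 p q1) \<theta> q)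
              (besov \<phi> (\<lambda>x. (1 - \<theta>) * \<alpha>0 x + \<theta> * \<alpha>1 x) p (\<lambda>_. q 0)))
       \<and> (\<forall>r0 r1 :: ennreal.
            1 \<le> r0 \<longrightarrow> 1 \<le> r1 \<longrightarrow>
            1 / ennreal (q 0) = ennreal (1 - \<theta>) / r0 + ennreal \<theta> / r1 \<longrightarrow>
            same_space
              (interpolation_space (besov_const \<phi> \<alpha>0 p r0) (besov_const \<phi> \<alpha>1 p r1) \<theta> q)
              (besov \<phi> (\<lambda>x. (1 - \<theta>) * \<alpha>0 x + \<theta> * \<alpha>1 x) p (\<lambda>_. q 0)))"
proof (intro conjI impI allI)
  have q': "log_hoelder_at_infinity q (q 0)" using assms(6,7) by simp
  have ge: "0 \<le> p x" "1 \<le> q0 x" "1 \<le> q1 x" for x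
    using assms(8-10) by (auto simp: log_exponents_def exponents_def intro: order_trans[of 0 1])
  show "same_space (interpolation_space (besov \<phi> \<alpha>0 p q0) (besov \<phi> \<alpha>1 p q1) \<theta> q)
      (besov \<phi> (\<lambda>x. (1 - \<theta>) * \<alpha>0 x + \<theta> * \<alpha>1 x) p (\<lambda>_. q 0))" if "d \<noteq> 0"
    unfolding besov_def[of \<phi> \<alpha>0] besov_def[of \<phi> \<alpha>1]
    by (rule interpolation_besov_distinct_smoothness[OF assms(1,8,11-13,2-5) q' that
      Lp_norm_le_mixed_norm[OF ge(1,2)] mixed_norm_le_suminf[OF ge(1,2)]
      Lp_norm_le_mixed_norm[OF ge(1,3)] mixed_norm_le_suminf[OF ge(1,3)]])
  show "same_space (interpolation_space (besov_const \<phi> \<alpha>0 p r0) (besov_const \<phi> \<alpha>1 p r1) \<theta> q)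
      (besov \<phi> (\<lambda>x. (1 - \<theta>) * \<alpha>0 x + \<theta> * \<alpha>1 x) p (\<lambda>_. q 0))"
    if "1 \<le> r0" "1 \<le> r1" "1 / ennreal (q 0) = ennreal (1 - \<theta>) / r0 + ennreal \<theta> / r1" for r0 r1
    by (rule interpolation_besov_const[OF assms(1,8,11-13,2-5) q' that])
qed

end
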